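(* Let $i_1\ge1$, $k_1\ge0$, $k_2\ge0$, $i_1+k_1+1<i_2$ and $i_2+k_2\le n-3$. Let $\tau$ be the face of the cone $\sigma$ of $X_{2,n}$ with $$D_\tau=[(1,2),(i_1,i_1+1)]\cup[(i_1+k_1+2,i_1+k_1+3),(i_2,i_2+1)]\cup[(i_2+k_2+2,i_2+k_2+3),(n-1,n)],$$ and for $l=1,2$ let $\tau_l$ be the face of $\sigma$ with $$D_{\tau_l}=[(1,2),(i_l,i_l+1)]\cup[(i_l+k_l+2,i_l+k_l+3),(n-1,n)]$$ (so $\tau$ is the union of the two non-intersecting, non-consecutive $J$-blocks $\tau_1,\tau_2$). Then: (1) The tangent cone $TC_{P_\tau}X_\sigma$ is identified with (is isomorphic to) $Z_{2,k_1+4}\times Z_{2,k_2+4}\times K^m$, where $m=\mathrm{codim}_\sigma\tau=2(n-k_1-k_2)-9$; in particular, $TC_{P_\tau}X_\sigma$ is a toric variety. (2) $\mathrm{mult}_{P_\tau}X_{2,n}=\left(\mathrm{mult}_{P_{\tau_1}}X_{2,n}\right)\cdot\left(\mathrm{mult}_{P_{\tau_2}}X_{2,n}\right)$.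
   Context: $K$ is an algebraically closed field of arbitrary characteristic. $I_{2,n}=\{(i_1,i_2)\in\mathbb{Z}^2: 1\le i_1<i_2\le n\}$ with the componentwise order, a finite distributive lattice (join and meet are componentwise max and min). For a finite distributive lattice $\mathcal{L}$, the Hibi toric variety $X(\mathcal{L})\subset\mathbb{A}^{\#\mathcal{L}}$ is the affine variety whose vanishing ideal in $K[X_\alpha,\alpha\in\mathcal{L}]$ is generated by the binomials $X_\alpha X_\beta-X_{\alpha\vee\beta}X_{\alpha\wedge\beta}$. Write $X_{2,n}=X(I_{2,n})$, and for $r\ge3$ let $Z_{2,r}=X(\widetilde{I_{2,r}})$, where $\widetilde{I_{2,r}}=I_{2,r}\setminus\{(1,2),(r-1,r)\}$. Let $J=J(\mathcal{L})$ be the poset of join-irreducible elements of $\mathcal{L}$ ($z$ such that $z=x\vee y$ implies $z=x$ or $z=y$; the minimal element is included), and for $\alpha\in\mathcal{L}$ put $I_\alpha=\{z\in J: z\le\alpha\}$. Let $M$ be the free abelian group with basis $\{f_z\}_{z\in J}$, $N$ its dual with dual basis $\{e_z\}_{z\in J}$, and $f_{I_\alpha}=\sum_{z\in I_\alpha}f_z$. Let $\sigma\subset N_{\mathbb{R}}$ be the cone generated by the $e_z$ with $z$ maximal in $J$ and the $e_{y'}-e_y$ with $y$ covering $y'$ in $J$. The semigroup $\sigma^\vee\cap M$ is generated by the $f_{I_\alpha}$, and $X(\mathcal{L})=X_\sigma=\mathrm{Spec}\,K[\sigma^\vee\cap M]$, the coordinate $X_\alpha$ corresponding to $f_{I_\alpha}$.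 For a face $\tau$ of $\sigma$, $P_\tau\in X_\sigma$ is the point whose $\alpha$-th coordinate is $1$ if $f_{I_\alpha}\in\tau^\perp$ and $0$ otherwise, and $D_\tau=\{\alpha\in\mathcal{L}: P_\tau(\alpha)\ne0\}$. A sublattice $\mathcal{L}'\subset\mathcal{L}$ is embedded if $\alpha\vee\beta,\alpha\wedge\beta\in\mathcal{L}'$ implies $\alpha,\beta\in\mathcal{L}'$; $\tau\mapsto D_\tau$ is a bijection between faces of $\sigma$ and embedded sublattices of $\mathcal{L}$. Here this is applied with $\mathcal{L}=I_{2,n}$; intervals $[\cdot,\cdot]$ are taken in $I_{2,n}$. $\mathrm{codim}_\sigma\tau=\dim\sigma-\dim\tau$. The tangent cone at a closed point $P$ is $TC_PX=\mathrm{Spec}\,\mathrm{gr}(\mathcal{O}_{X,P},\mathfrak{m}_P)$, and $\mathrm{mult}_PX$ is the degree of the graded ring $\mathrm{gr}(\mathcal{O}_{X,P},\mathfrak{m}_P)$ (for a graded ring of dimension $r+1$, its degree $e$ is defined by the leading coefficient $e/r!$ of the Hilbert polynomial). *)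

theory Defs
  imports
    "HOL-Algebra.QuotRing"
    "HOL-Algebra.Ideal_Product"
    "HOL-Algebra.Embedded_Algebras"
    "HOL-Analysis.Finite_Function_Topology"
    "HOL-Analysis.Convex"
    "HOL-Library.Product_Order"
    "HOL-Library.Extended_Nat"
    "HOL-Computational_Algebra.Polynomial"
begin

section \<open>Commutative algebras\<close>

text \<open>
  An algebra over the field \<open>'k\<close> is a record of type \<open>('k, 'a) module\<close>: a ring together with a
  scalar multiplication.
\<close>

definition algebra_isomorphic :: "('k, 'a) module \<Rightarrow> ('k, 'b) module \<Rightarrow> bool" where
  "algebra_isomorphic A B \<longleftrightarrow>
     (\<exists>h \<in> ring_iso A B. \<forall>c. \<forall>x \<in> carrier A. h (c \<odot>\<^bsub>A\<^esub> x) = c \<odot>\<^bsub>B\<^esub> h x)"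

definition quotient_algebra :: "('k, 'a) module \<Rightarrow> 'a set \<Rightarrow> ('k, 'a set) module" where
  "quotient_algebra A I =
     \<lparr> carrier = carrier (A Quot I), monoid.mult = monoid.mult (A Quot I), one = one (A Quot I),
       zero = zero (A Quot I), add = add (A Quot I),
       module.smult = (\<lambda>c X. \<Union>x\<in>X. I +>\<^bsub>A\<^esub> (c \<odot>\<^bsub>A\<^esub> x)) \<rparr>"

text \<open>
  The fraction \<open>a/s\<close> is the class of all pairs \<open>(b,t)\<close> with \<open>u (t a - s b) = 0\<close> for some
  \<open>u \<in> S\<close>. The operations on fractions are evaluated on all representatives at once; for
  classes, all sets in these unions coincide.
\<close>

definition fraction :: "('k, 'a) module \<Rightarrow> 'a set \<Rightarrow> 'a \<Rightarrow> 'a \<Rightarrow> ('a \<times> 'a) set" where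
  "fraction A S a s =
     {(b, t). b \<in> carrier A \<and> t \<in> S \<and>
        (\<exists>u\<in>S. u \<otimes>\<^bsub>A\<^esub> ((t \<otimes>\<^bsub>A\<^esub> a) \<ominus>\<^bsub>A\<^esub> (s \<otimes>\<^bsub>A\<^esub> b)) = \<zero>\<^bsub>A\<^esub>)}"

definition localization :: "('k, 'a) module \<Rightarrow> 'a set \<Rightarrow> ('k, ('a \<times> 'a) set) module" where
  "localization A S =
     \<lparr> carrier = {fraction A S a s | a s. a \<in> carrier A \<and> s \<in> S},
       monoid.mult = (\<lambda>X Y. \<Union>(a, s)\<in>X. \<Union>(b, t)\<in>Y. fraction A S (a \<otimes>\<^bsub>A\<^esub> b) (s \<otimes>\<^bsub>A\<^esub> t)),
       one = fraction A S \<one>\<^bsub>A\<^esub> \<one>\<^bsub>A\<^esub>,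
       zero = fraction A S \<zero>\<^bsub>A\<^esub> \<one>\<^bsub>A\<^esub>,
       add = (\<lambda>X Y. \<Union>(a, s)\<in>X. \<Union>(b, t)\<in>Y.
                fraction A S ((t \<otimes>\<^bsub>A\<^esub> a) \<oplus>\<^bsub>A\<^esub> (s \<otimes>\<^bsub>A\<^esub> b)) (s \<otimes>\<^bsub>A\<^esub> t)),
       module.smult = (\<lambda>c X. \<Union>(a, s)\<in>X. fraction A S (c \<odot>\<^bsub>A\<^esub> a) s) \<rparr>"

primrec ideal_power :: "('k, 'a) module \<Rightarrow> 'a set \<Rightarrow> nat \<Rightarrow> 'a set" where
  "ideal_power R I 0 = carrier R"
| "ideal_power R I (Suc q) = ideal_prod R I (ideal_power R I q)"

text \<open>
  The associated graded ring, the direct sum of the \<open>I^q / I^(q+1)\<close>. Its elements are the finitely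
  supported sequences of homogeneous components, the component in degree \<open>q\<close> being a coset of
  \<open>I^(q+1)\<close>.
\<close>

definition gr_component :: "('k, 'a) module \<Rightarrow> 'a set \<Rightarrow> nat \<Rightarrow> 'a set set" where
  "gr_component R I q = {ideal_power R I (Suc q) +>\<^bsub>R\<^esub> x | x. x \<in> ideal_power R I q}"

definition gr_mult ::
  "('k, 'a) module \<Rightarrow> 'a set \<Rightarrow> nat \<Rightarrow> nat \<Rightarrow> 'a set \<Rightarrow> 'a set \<Rightarrow> 'a set" where
  "gr_mult R I i j X Y = (\<Union>x\<in>X. \<Union>y\<in>Y. ideal_power R I (Suc (i + j)) +>\<^bsub>R\<^esub> (x \<otimes>\<^bsub>R\<^esub> y))"

definition associated_graded :: "('k, 'a) module \<Rightarrow> 'a set \<Rightarrow> ('k, nat \<Rightarrow> 'a set) module" where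
  "associated_graded R I =
     \<lparr> carrier = {f. (\<forall>q. f q \<in> gr_component R I q) \<and>
                     finite {q. f q \<noteq> ideal_power R I (Suc q)}},
       monoid.mult = (\<lambda>f g q. finsum (R Quot ideal_power R I (Suc q))
                 (\<lambda>i. gr_mult R I i (q - i) (f i) (g (q - i))) {..q}),
       one = (\<lambda>q. ideal_power R I (Suc q) +>\<^bsub>R\<^esub> (if q = 0 then \<one>\<^bsub>R\<^esub> else \<zero>\<^bsub>R\<^esub>)),
       zero = (\<lambda>q. ideal_power R I (Suc q)),
       add = (\<lambda>f g q. f q <+>\<^bsub>R\<^esub> g q),
       module.smult = (\<lambda>c f q. \<Union>x\<in>f q. ideal_power R I (Suc q) +>\<^bsub>R\<^esub> (c \<odot>\<^bsub>R\<^esub> x)) \<rparr>"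

definition gr_homogeneous :: "('k, 'a) module \<Rightarrow> 'a set \<Rightarrow> nat \<Rightarrow> (nat \<Rightarrow> 'a set) set" where
  "gr_homogeneous R I q =
     {f \<in> carrier (associated_graded R I). \<forall>p. p \<noteq> q \<longrightarrow> f p = \<zero>\<^bsub>associated_graded R I\<^esub> p}"

definition krull_dimension :: "('k, 'a) module \<Rightarrow> enat" where
  "krull_dimension R =
     Sup {enat l | l. \<exists>\<pp>. (\<forall>i\<le>l. primeideal (\<pp> i) R) \<and> (\<forall>i<l. \<pp> i \<subset> \<pp> (Suc i))}"

text \<open>
  For a graded algebra \<open>G\<close> of Krull dimension \<open>r + 1\<close> with homogeneous components \<open>H q\<close>, the
  degree is the \<open>e\<close> for which the Hilbert polynomial \<open>p\<close> has leading coefficient \<open>e / r!\<close>.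
  Vector space dimensions are taken over the copy of the ground field inside \<open>G\<close>.
\<close>

definition graded_degree :: "('k, 'a) module \<Rightarrow> (nat \<Rightarrow> 'a set) \<Rightarrow> rat" where
  "graded_degree G H =
     (THE e. \<exists>r p. krull_dimension G = enat (r + 1) \<and>
        (\<forall>\<^sub>F q in sequentially. \<exists>d. ring.dimension G d (range (\<lambda>c. c \<odot>\<^bsub>G\<^esub> \<one>\<^bsub>G\<^esub>)) (H q) \<and>
            poly p (of_nat q) = of_nat d) \<and>
        lead_coeff p = e / fact r)"

section \<open>Closed subschemes of affine spaces\<close>

type_synonym ('v, 'k) mpolynomial = "('v \<Rightarrow>\<^sub>0 nat) \<Rightarrow>\<^sub>0 'k"

definition polynomial_algebra :: "'v set \<Rightarrow> ('k::field, ('v, 'k) mpolynomial) module" where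
  "polynomial_algebra V =
     \<lparr> carrier = {p. \<forall>m \<in> Poly_Mapping.keys p. Poly_Mapping.keys m \<subseteq> V},
       monoid.mult = (*), one = 1, zero = 0, add = (+),
       module.smult = (\<lambda>c p. Poly_Mapping.single 0 c * p) \<rparr>"

definition variable :: "'v \<Rightarrow> ('v, 'k::field) mpolynomial" where
  "variable v = Poly_Mapping.single (Poly_Mapping.single v 1) 1"

definition mpolynomial_eval :: "('v \<Rightarrow> 'k) \<Rightarrow> ('v, 'k::field) mpolynomial \<Rightarrow> 'k" where
  "mpolynomial_eval P p =
     (\<Sum>m \<in> Poly_Mapping.keys p.
        Poly_Mapping.lookup p m * (\<Prod>v \<in> Poly_Mapping.keys m. P v ^ Poly_Mapping.lookup m v))"

definition mpolynomial_rename :: "('v \<Rightarrow> 'w) \<Rightarrow> ('v, 'k::field) mpolynomial \<Rightarrow> ('w, 'k) mpolynomial" where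
  "mpolynomial_rename g p =
     (\<Sum>m \<in> Poly_Mapping.keys p.
        Poly_Mapping.single
          (\<Sum>v \<in> Poly_Mapping.keys m. Poly_Mapping.single (g v) (Poly_Mapping.lookup m v))
          (Poly_Mapping.lookup p m))"

text \<open>
  A closed subscheme of an affine space is given by the set \<open>V\<close> of coordinates of the
  ambient space and its ideal \<open>I\<close> in \<open>K[V]\<close>; its coordinate algebra is \<open>K[V]/I\<close>. A
  \<open>K\<close>-rational point is an assignment of values to the coordinates at which \<open>I\<close> vanishes.
\<close>

type_synonym ('v, 'k) affine_subscheme = "'v set \<times> ('v, 'k) mpolynomial set"

definition coordinate_algebra ::
  "('v, 'k::field) affine_subscheme \<Rightarrow> ('k, ('v, 'k) mpolynomial set) module" where
  "coordinate_algebra X = quotient_algebra (polynomial_algebra (fst X)) (snd X)"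

definition affine_space :: "nat \<Rightarrow> (nat, 'k::field) affine_subscheme" where
  "affine_space m = ({..<m}, {0})"

text \<open>
  The coordinates of a product are the disjoint union of the coordinates of the factors, so that
  \<open>K[V]/I\<close> and \<open>K[W]/J\<close> give \<open>K[V, W]/(I + J)\<close>, the tensor product of the two coordinate algebras.
\<close>

definition affine_product ::
  "('v, 'k::field) affine_subscheme \<Rightarrow> ('w, 'k) affine_subscheme \<Rightarrow> ('v + 'w, 'k) affine_subscheme"
  where
  "affine_product X Y =
     (fst X <+> fst Y,
      genideal (polynomial_algebra (fst X <+> fst Y))
        (mpolynomial_rename Inl ` snd X \<union> mpolynomial_rename Inr ` snd Y))"

definition point_ideal ::
  "('v, 'k::field) affine_subscheme \<Rightarrow> ('v \<Rightarrow> 'k) \<Rightarrow> ('v, 'k) mpolynomial set set" where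
  "point_ideal X P =
     {snd X +>\<^bsub>polynomial_algebra (fst X)\<^esub> p | p.
        p \<in> carrier (polynomial_algebra (fst X)) \<and> mpolynomial_eval P p = 0}"

type_synonym ('v, 'k) germ = "(('v, 'k) mpolynomial set \<times> ('v, 'k) mpolynomial set) set"

definition non_vanishing ::
  "('v, 'k::field) affine_subscheme \<Rightarrow> ('v \<Rightarrow> 'k) \<Rightarrow> ('v, 'k) mpolynomial set set" where
  "non_vanishing X P = carrier (coordinate_algebra X) - point_ideal X P"

definition local_ring ::
  "('v, 'k::field) affine_subscheme \<Rightarrow> ('v \<Rightarrow> 'k) \<Rightarrow> ('k, ('v, 'k) germ) module" where
  "local_ring X P = localization (coordinate_algebra X) (non_vanishing X P)"

definition local_max_ideal ::
  "('v, 'k::field) affine_subscheme \<Rightarrow> ('v \<Rightarrow> 'k) \<Rightarrow> ('v, 'k) germ set" where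
  "local_max_ideal X P =
     {fraction (coordinate_algebra X) (non_vanishing X P) a s | a s.
        a \<in> point_ideal X P \<and> s \<in> non_vanishing X P}"

text \<open>
  The tangent cone is an affine scheme, represented by its coordinate algebra.
\<close>

definition tangent_cone ::
  "('v, 'k::field) affine_subscheme \<Rightarrow> ('v \<Rightarrow> 'k) \<Rightarrow> ('k, nat \<Rightarrow> ('v, 'k) germ set) module" where
  "tangent_cone X P = associated_graded (local_ring X P) (local_max_ideal X P)"

definition multiplicity_at :: "('v, 'k::field) affine_subscheme \<Rightarrow> ('v \<Rightarrow> 'k) \<Rightarrow> rat" where
  "multiplicity_at X P =
     graded_degree (tangent_cone X P) (gr_homogeneous (local_ring X P) (local_max_ideal X P))"

section \<open>Cones and affine toric varieties\<close>

text \<open>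
  For a finite set \<open>B\<close>, both \<open>N\<^sub>\<real>\<close> and \<open>M\<^sub>\<real>\<close> are the space of real vectors supported in \<open>B\<close>,
  paired by the standard pairing, and \<open>N\<close> and \<open>M\<close> are the integral vectors.
\<close>

definition pairing :: "('b \<Rightarrow>\<^sub>0 real) \<Rightarrow> ('b \<Rightarrow>\<^sub>0 real) \<Rightarrow> real" where
  "pairing u v = (\<Sum>z \<in> Poly_Mapping.keys u. Poly_Mapping.lookup u z * Poly_Mapping.lookup v z)"

definition vectors :: "'b set \<Rightarrow> ('b \<Rightarrow>\<^sub>0 real) set" where
  "vectors B = {u. Poly_Mapping.keys u \<subseteq> B}"

definition lattice_points :: "'b set \<Rightarrow> ('b \<Rightarrow>\<^sub>0 real) set" where
  "lattice_points B = {u \<in> vectors B. \<forall>z. Poly_Mapping.lookup u z \<in> \<int>}"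

definition dual_cone :: "'b set \<Rightarrow> ('b \<Rightarrow>\<^sub>0 real) set \<Rightarrow> ('b \<Rightarrow>\<^sub>0 real) set" where
  "dual_cone B \<sigma> = {u \<in> vectors B. \<forall>v\<in>\<sigma>. pairing u v \<ge> 0}"

definition perp :: "'b set \<Rightarrow> ('b \<Rightarrow>\<^sub>0 real) set \<Rightarrow> ('b \<Rightarrow>\<^sub>0 real) set" where
  "perp B \<tau> = {u \<in> vectors B. \<forall>v\<in>\<tau>. pairing u v = 0}"

text \<open>
  Faces in the sense of toric geometry: intersections of the cone with supporting hyperplanes.
\<close>

definition cone_face :: "'b set \<Rightarrow> ('b \<Rightarrow>\<^sub>0 real) set \<Rightarrow> ('b \<Rightarrow>\<^sub>0 real) set \<Rightarrow> bool" where
  "cone_face B \<tau> \<sigma> \<longleftrightarrow> (\<exists>u \<in> dual_cone B \<sigma>. \<tau> = {v \<in> \<sigma>. pairing u v = 0})"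

definition cone_codim :: "('b \<Rightarrow>\<^sub>0 real) set \<Rightarrow> ('b \<Rightarrow>\<^sub>0 real) set \<Rightarrow> nat" where
  "cone_codim \<sigma> \<tau> = real_vector.dim \<sigma> - real_vector.dim \<tau>"

definition semigroup_algebra ::
  "('b \<Rightarrow>\<^sub>0 real) set \<Rightarrow> ('k::field, ('b \<Rightarrow>\<^sub>0 real) \<Rightarrow>\<^sub>0 'k) module" where
  "semigroup_algebra S =
     \<lparr> carrier = {p. Poly_Mapping.keys p \<subseteq> S},
       monoid.mult = (*), one = 1, zero = 0, add = (+),
       module.smult = (\<lambda>c p. Poly_Mapping.single 0 c * p) \<rparr>"

text \<open>
  An affine scheme over \<open>K\<close> is an affine toric variety if its coordinate algebra is
  \<open>K[\<sigma>\<^sup>\<or> \<inter> M]\<close> for a strongly convex rational polyhedral cone \<open>\<sigma>\<close>.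
\<close>

definition affine_toric :: "('k::field, 'a) module \<Rightarrow> bool" where
  "affine_toric A \<longleftrightarrow>
     (\<exists>(d::nat) G. finite G \<and> G \<subseteq> lattice_points {..<d} \<and>
        (convex_cone hull G) \<inter> uminus ` (convex_cone hull G) = {0} \<and>
        algebra_isomorphic A
          (semigroup_algebra (dual_cone {..<d} (convex_cone hull G) \<inter> lattice_points {..<d})))"

section \<open>Hibi toric varieties\<close>

text \<open>
  A finite distributive lattice is a finite subset of a distributive lattice type that is
  closed under \<open>sup\<close> and \<open>inf\<close>.
\<close>

definition hibi_variety :: "'v::distrib_lattice set \<Rightarrow> ('v, 'k::field) affine_subscheme" where
  "hibi_variety L =
     (L, genideal (polynomial_algebra L)
           {variable \<alpha> * variable \<beta> - variable (sup \<alpha> \<beta>) * variable (inf \<alpha> \<beta>) | \<alpha> \<beta>.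
              \<alpha> \<in> L \<and> \<beta> \<in> L})"

definition join_irreducibles :: "'v::distrib_lattice set \<Rightarrow> 'v set" where
  "join_irreducibles L = {z \<in> L. \<forall>x\<in>L. \<forall>y\<in>L. z = sup x y \<longrightarrow> z = x \<or> z = y}"

definition covers :: "'v::order set \<Rightarrow> 'v \<Rightarrow> 'v \<Rightarrow> bool" where
  "covers J y y' \<longleftrightarrow> y \<in> J \<and> y' \<in> J \<and> y' < y \<and> \<not> (\<exists>z\<in>J. y' < z \<and> z < y)"

definition hibi_cone :: "'v::distrib_lattice set \<Rightarrow> ('v \<Rightarrow>\<^sub>0 real) set" where
  "hibi_cone L =
     convex_cone hull
       ({Poly_Mapping.single z 1 | z.
           z \<in> join_irreducibles L \<and> \<not> (\<exists>w \<in> join_irreducibles L. z < w)} \<union>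
        {Poly_Mapping.single y' 1 - Poly_Mapping.single y 1 | y y'.
           covers (join_irreducibles L) y y'})"

definition ideal_vector :: "'v::distrib_lattice set \<Rightarrow> 'v \<Rightarrow> ('v \<Rightarrow>\<^sub>0 real)" where
  "ideal_vector L \<alpha> = (\<Sum>z \<in> {z \<in> join_irreducibles L. z \<le> \<alpha>}. Poly_Mapping.single z 1)"

definition hibi_face :: "'v::distrib_lattice set \<Rightarrow> ('v \<Rightarrow>\<^sub>0 real) set \<Rightarrow> bool" where
  "hibi_face L \<tau> \<longleftrightarrow> cone_face (join_irreducibles L) \<tau> (hibi_cone L)"

definition face_point :: "'v::distrib_lattice set \<Rightarrow> ('v \<Rightarrow>\<^sub>0 real) set \<Rightarrow> 'v \<Rightarrow> 'k::field" where
  "face_point L \<tau> \<alpha> = (if ideal_vector L \<alpha> \<in> perp (join_irreducibles L) \<tau> then 1 else 0)"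

definition point_support :: "'v set \<Rightarrow> ('v \<Rightarrow> 'k::field) \<Rightarrow> 'v set" where
  "point_support L P = {\<alpha> \<in> L. P \<alpha> \<noteq> 0}"

section \<open>The lattices\<close>

definition I2 :: "nat \<Rightarrow> (nat \<times> nat) set" where
  "I2 n = {(a, b). 1 \<le> a \<and> a < b \<and> b \<le> n}"

definition I2_interval :: "nat \<Rightarrow> nat \<times> nat \<Rightarrow> nat \<times> nat \<Rightarrow> (nat \<times> nat) set" where
  "I2_interval n x y = {z \<in> I2 n. x \<le> z \<and> z \<le> y}"

definition X2 :: "nat \<Rightarrow> (nat \<times> nat, 'k::field) affine_subscheme" where
  "X2 n = hibi_variety (I2 n)"

definition Z2 :: "nat \<Rightarrow> (nat \<times> nat, 'k::field) affine_subscheme" where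
  "Z2 r = hibi_variety (I2 r - {(1, 2), (r - 1, r)})"

end

theory Submission
  imports Defs
begin

text \<open>
  In a neighbourhood of \<open>P\<^sub>\<tau>\<close> the coordinates on the blocks of \<open>D\<^sub>\<tau>\<close> are units, and every coordinate
  \<open>X\<^sub>a\<^sub>b\<close> is a product of a factor of its row, a factor of its column and one factor for each gap
  between the block of \<open>a\<close> and the block of \<open>b\<close>. Giving the gap factors and the differences \<open>X\<^sub>a\<^sub>b - 1\<close> at
  the borders of the blocks weight one yields a substitution into \<open>K[S][t]\<close> whose \<open>t\<close>-order is the order
  with respect to the maximal ideal; hence the associated graded ring is the monoid algebra \<open>K[S]\<close>.
  Here \<open>S\<close> is generated by one ladder for each gap, whose cells are those of \<open>I\<^sub>2\<^sub>,\<^sub>k\<^sub>+\<^sub>4\<close> without its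
  minimum and its maximum, and by the border cells, which are free. The Hibi relations of the ladders
  straighten every monomial of \<open>K[S]\<close> to a standard one, which gives the presentation of the product of the
  \<open>Z\<close>'s, the saturation of \<open>S\<close>, and the Hilbert function: its leading coefficient counts the
  facets of a product of complexes of chains, so the multiplicity is the product over the gaps of the
  numbers of maximal chains.
\<close>

text \<open>The tangent cone involves all powers of the maximal ideal, and these cannot be read off
  the Hibi relations directly. They are trapped between two bounds. A substitution that kills the
  relations and has evaluation at the point as constant coefficient sends \<mm>^q to elements of
  order at least q. Conversely, every coordinate minus its value agrees modulo \<mm>^2 with a
  combination of chosen elements, one for each generator of S. So an element of \<mm>^q is, modulo
  \<mm>^(q+1), a combination of products of these; their leading coefficients are distinct
  monomials, and order at least q+1 forces the combination to vanish. The number of gaps is a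
  parameter throughout: one gap gives \<tau>_1 and \<tau>_2, two gaps give \<tau>, and
  multiplicativity is read off a formula with one factor per gap. The border cells are counted from
  the blocks and the codimension from the span of the face; only their equality turns the free
  generators into K^m.\<close>

lemma poly_mapping_sum_single: "p = (\<Sum>m\<in>Poly_Mapping.keys p. Poly_Mapping.single m (Poly_Mapping.lookup p m))"
proof (rule poly_mapping_eqI)
  fix k
  have "(\<Sum>m\<in>Poly_Mapping.keys p. Poly_Mapping.lookup p m when m = k) =
    (\<Sum>m\<in>Poly_Mapping.keys p. if m = k then Poly_Mapping.lookup p m else 0)"
    by (simp add: when_def)
  also have "\<dots> = Poly_Mapping.lookup p k"
    by (subst sum.delta) (auto simp: in_keys_iff)
  finally show "Poly_Mapping.lookup p k = Poly_Mapping.lookup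
     (\<Sum>m\<in>Poly_Mapping.keys p. Poly_Mapping.single m (Poly_Mapping.lookup p m)) k"
    by (simp add: lookup_sum lookup_single)
qed

lemma mult_sum_single:
  "p * q = (\<Sum>m\<in>Poly_Mapping.keys p. \<Sum>m'\<in>Poly_Mapping.keys q.
     Poly_Mapping.single (m + m') (Poly_Mapping.lookup p m * Poly_Mapping.lookup q m'))"
proof -
  have "p * q = (\<Sum>m\<in>Poly_Mapping.keys p. Poly_Mapping.single m (Poly_Mapping.lookup p m)) *
    (\<Sum>m\<in>Poly_Mapping.keys q. Poly_Mapping.single m (Poly_Mapping.lookup q m))"
    using poly_mapping_sum_single by metis
  then show ?thesis by (simp add: sum_product mult_single)
qed

text \<open>Nothing is asked of \<open>\<mu>\<close>, not even compatibility with addition of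
  exponents. So the same linear extension serves for substitutions, for projections to one degree,
  and for the sections \<open>Xi\<close> and \<open>Z\<close>, which are multiplicative only modulo
  an ideal.\<close>

definition lift :: "('k::field \<Rightarrow> 'r::comm_ring_1) \<Rightarrow> ('m \<Rightarrow> 'r) \<Rightarrow> ('m \<Rightarrow>\<^sub>0 'k) \<Rightarrow> 'r" where
  "lift h \<mu> p = (\<Sum>m\<in>Poly_Mapping.keys p. h (Poly_Mapping.lookup p m) * \<mu> m)"

text \<open>In spite of the name this is the notion of a unital homomorphism between whole ring
  types; it applies to coefficient embeddings, evaluations and substitutions alike.\<close>

definition coefficient_hom :: "('k::comm_ring_1 \<Rightarrow> 'r::comm_ring_1) \<Rightarrow> bool" where
  "coefficient_hom h \<longleftrightarrow> (\<forall>a b. h (a + b) = h a + h b) \<and> (\<forall>a b. h (a * b) = h a * h b) \<and> h 1 = 1"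

lemma coefficient_homD:
  assumes "coefficient_hom h"
  shows "h (a + b) = h a + h b" "h (a * b) = h a * h b" "h 1 = 1" "h 0 = 0"
    "h (- a) = - h a" "h (a - b) = h a - h b"
proof -
  have add: "h (a + b) = h a + h b" for a b
    using assms by (auto simp: coefficient_hom_def)
  show "h (a + b) = h a + h b" "h (a * b) = h a * h b" "h 1 = 1"
    using assms by (auto simp: coefficient_hom_def)
  show z: "h 0 = 0" using add[of 0 0] by simp
  show m: "h (- a) = - h a" for a using add[of a "- a"] z by (simp add: eq_neg_iff_add_eq_0 add.commute)
  show "h (a - b) = h a - h b" using add[of a "- b"] m[of b] by simp
qed

lemma coefficient_hom_sum: "coefficient_hom h \<Longrightarrow> h (sum f A) = (\<Sum>a\<in>A. h (f a))"
  by (induction A rule: infinite_finite_induct) (auto simp: coefficient_homD)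

lemma coefficient_hom_id [simp]: "coefficient_hom (\<lambda>x. x)"
  by (simp add: coefficient_hom_def)

lemma coefficient_hom_single [simp]:
  "coefficient_hom (Poly_Mapping.single (0::'m::comm_monoid_add) :: 'k::field \<Rightarrow> _)"
  by (simp add: coefficient_hom_def single_add mult_single)

lemma coefficient_hom_pCons [simp]: "coefficient_hom (\<lambda>x. [:x:])"
  by (simp add: coefficient_hom_def pCons_one)

lemma coefficient_hom_comp:
  "coefficient_hom h \<Longrightarrow> coefficient_hom h' \<Longrightarrow> coefficient_hom (\<lambda>x. h (h' x))"
  by (simp add: coefficient_hom_def)

lemma lift_superset:
  assumes "coefficient_hom h" "finite A" "Poly_Mapping.keys p \<subseteq> A"
  shows "lift h \<mu> p = (\<Sum>m\<in>A. h (Poly_Mapping.lookup p m) * \<mu> m)"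
  unfolding lift_def using assms
  by (intro sum.mono_neutral_left) (auto simp: in_keys_iff coefficient_homD)

lemma lift_zero [simp]: "lift h \<mu> 0 = 0"
  by (simp add: lift_def)

lemma lift_single: "coefficient_hom h \<Longrightarrow> lift h \<mu> (Poly_Mapping.single m c) = h c * \<mu> m"
  by (cases "c = 0") (auto simp: lift_def coefficient_homD)

lemma lift_add:
  assumes "coefficient_hom h"
  shows "lift h \<mu> (p + q) = lift h \<mu> p + lift h \<mu> q"
proof -
  let ?A = "Poly_Mapping.keys p \<union> Poly_Mapping.keys q"
  have "lift h \<mu> (p + q) = (\<Sum>m\<in>?A. h (Poly_Mapping.lookup (p + q) m) * \<mu> m)"
    by (rule lift_superset[OF assms]) (auto simp: Poly_Mapping.keys_add)
  also have "\<dots> = lift h \<mu> p + lift h \<mu> q"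
    using lift_superset[OF assms, of ?A p \<mu>] lift_superset[OF assms, of ?A q \<mu>]
    by (simp add: lookup_add coefficient_homD[OF assms] distrib_right sum.distrib)
  finally show ?thesis .
qed

lemma lift_sum: "coefficient_hom h \<Longrightarrow> lift h \<mu> (sum f A) = (\<Sum>a\<in>A. lift h \<mu> (f a))"
  by (induction A rule: infinite_finite_induct) (auto simp: lift_add)

lemma lift_uminus: "coefficient_hom h \<Longrightarrow> lift h \<mu> (- p) = - lift h \<mu> p"
  using lift_add[of h \<mu> p "- p"] by (simp add: eq_neg_iff_add_eq_0 add.commute)

lemma lift_diff: "coefficient_hom h \<Longrightarrow> lift h \<mu> (p - q) = lift h \<mu> p - lift h \<mu> q"
  using lift_add[of h \<mu> p "- q"] by (simp add: lift_uminus)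

lemma lift_mult_expand:
  assumes "coefficient_hom h"
  shows "lift h \<mu> (p * q) = (\<Sum>m\<in>Poly_Mapping.keys p. \<Sum>m'\<in>Poly_Mapping.keys q.
     h (Poly_Mapping.lookup p m) * h (Poly_Mapping.lookup q m') * \<mu> (m + m'))"
  by (subst mult_sum_single) (simp add: lift_sum lift_single assms coefficient_homD)

lemma lift_mult:
  assumes "coefficient_hom h"
    and "\<And>m m'. m \<in> Poly_Mapping.keys p \<Longrightarrow> m' \<in> Poly_Mapping.keys q \<Longrightarrow> \<mu> (m + m') = \<mu> m * \<mu> m'"
  shows "lift h \<mu> (p * q) = lift h \<mu> p * lift h \<mu> q"
  by (subst lift_mult_expand[OF assms(1)])
     (auto simp: lift_def sum_product assms(2) mult_ac intro!: sum.cong)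

lemma lift_scale:
  assumes "coefficient_hom h"
  shows "lift h \<mu> (Poly_Mapping.single 0 c * p) = h c * lift h \<mu> p"
proof (cases "c = 0")
  case False
  then show ?thesis
    by (subst lift_mult_expand[OF assms])
       (simp add: lift_def sum_distrib_left mult.assoc)
qed (simp add: coefficient_homD[OF assms])

section \<open>Monomials as multisets of variables, and substitution homomorphisms\<close>

definition monomial_value :: "('v \<Rightarrow> 'r::comm_monoid_mult) \<Rightarrow> ('v \<Rightarrow>\<^sub>0 nat) \<Rightarrow> 'r" where
  "monomial_value f m = (\<Prod>v\<in>Poly_Mapping.keys m. f v ^ Poly_Mapping.lookup m v)"

lemma monomial_value_superset:
  assumes "finite A" "Poly_Mapping.keys m \<subseteq> A"
  shows "monomial_value f m = (\<Prod>v\<in>A. f v ^ Poly_Mapping.lookup m v)"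
  unfolding monomial_value_def using assms
  by (intro prod.mono_neutral_left) (auto simp: in_keys_iff)

lemma monomial_value_zero [simp]: "monomial_value f 0 = 1"
  by (simp add: monomial_value_def)

lemma monomial_value_add: "monomial_value f (m + m') = monomial_value f m * monomial_value f m'"
proof -
  let ?A = "Poly_Mapping.keys m \<union> Poly_Mapping.keys m'"
  have "monomial_value f (m + m') = (\<Prod>v\<in>?A. f v ^ Poly_Mapping.lookup (m + m') v)"
    by (rule monomial_value_superset) (auto simp: Poly_Mapping.keys_add)
  then show ?thesis
    using monomial_value_superset[of ?A m f] monomial_value_superset[of ?A m' f]
    by (simp add: lookup_add power_add prod.distrib)
qed

lemma monomial_value_single [simp]: "monomial_value f (Poly_Mapping.single v k) = f v ^ k"
  by (cases "k = 0") (auto simp: monomial_value_def)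

text \<open>Monomials are entered as multisets so that one factor can be added or removed at a time;
  by \<open>ex_exponent\<close> every exponent vector arises in this way.\<close>

definition exponent :: "'v multiset \<Rightarrow> ('v \<Rightarrow>\<^sub>0 nat)" where
  "exponent M = (\<Sum>v\<in>#M. Poly_Mapping.single v 1)"

lemma exponent_simps [simp]:
  "exponent {#} = 0" "exponent (add_mset v M) = Poly_Mapping.single v 1 + exponent M"
  "exponent (M + N) = exponent M + exponent N"
  by (simp_all add: exponent_def)

lemma lookup_exponent: "Poly_Mapping.lookup (exponent M) v = count M v"
  by (induction M) (auto simp: lookup_add lookup_single)

lemma keys_exponent [simp]: "Poly_Mapping.keys (exponent M) = set_mset M"
  by (auto simp: in_keys_iff lookup_exponent)

lemma ex_exponent: "\<exists>M. m = exponent M"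
proof
  show "m = exponent (Abs_multiset (Poly_Mapping.lookup m))"
    by (rule poly_mapping_eqI) (simp add: lookup_exponent)
qed

lemma monomial_value_exponent: "monomial_value f (exponent M) = (\<Prod>v\<in>#M. f v)"
  by (induction M) (auto simp: monomial_value_add)

definition substitute :: "('k::field \<Rightarrow> 'r::comm_ring_1) \<Rightarrow> ('v \<Rightarrow> 'r) \<Rightarrow> (('v \<Rightarrow>\<^sub>0 nat) \<Rightarrow>\<^sub>0 'k) \<Rightarrow> 'r" where
  "substitute h f = lift h (monomial_value f)"

lemma substitute_hom:
  assumes "coefficient_hom h"
  shows "coefficient_hom (substitute h f)"
proof -
  have "substitute h f 1 = 1"
    using assms lift_single[OF assms, of "monomial_value f" 0 1]
    by (simp add: substitute_def coefficient_homD)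
  then show ?thesis
    unfolding coefficient_hom_def substitute_def
    using assms by (auto simp: lift_add lift_mult monomial_value_add)
qed

lemma substitute_variable: "coefficient_hom h \<Longrightarrow> substitute h f (variable v) = f v"
  by (simp add: substitute_def variable_def lift_single coefficient_homD)

lemma substitute_const: "coefficient_hom h \<Longrightarrow> substitute h f (Poly_Mapping.single 0 c) = h c"
  by (simp add: substitute_def lift_single)

text \<open>Uniqueness of homomorphisms out of a polynomial ring. Agreement is required only at
  variables that occur in \<open>p\<close>, because the values of a point are known only at the
  coordinates of its ambient space.\<close>

lemma substitute_eqI:
  fixes h :: "'k::field \<Rightarrow> 'r::comm_ring_1" and \<psi> :: "('v, 'k) mpolynomial \<Rightarrow> 'r"
  assumes "coefficient_hom h" "coefficient_hom \<psi>"
    and "\<And>c. \<psi> (Poly_Mapping.single 0 c) = h c" "\<And>m v. m \<in> Poly_Mapping.keys p \<Longrightarrow> v \<in> Poly_Mapping.keys m \<Longrightarrow> \<psi> (variable v) = f v"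
  shows "\<psi> p = substitute h f p"
proof -
  have mon: "\<psi> (Poly_Mapping.single (exponent M) 1) = (\<Prod>v\<in>#M. f v)"
    if "\<And>v. v \<in># M \<Longrightarrow> \<psi> (variable v) = f v" for M
    using that
  proof (induction M)
    case (add v M)
    have "Poly_Mapping.single (exponent (add_mset v M)) (1::'k) = variable v * Poly_Mapping.single (exponent M) 1"
      by (simp add: variable_def mult_single)
    then show ?case using add by (simp add: coefficient_homD[OF assms(2)])
  qed (use assms(3)[of 1] assms(1) in \<open>simp add: coefficient_homD\<close>)
  have "\<psi> p = (\<Sum>m\<in>Poly_Mapping.keys p. \<psi> (Poly_Mapping.single m (Poly_Mapping.lookup p m)))"
    by (subst poly_mapping_sum_single[of p]) (simp add: coefficient_hom_sum[OF assms(2)])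
  also have "\<dots> = (\<Sum>m\<in>Poly_Mapping.keys p. h (Poly_Mapping.lookup p m) * monomial_value f m)"
  proof (rule sum.cong[OF refl])
    fix m assume m: "m \<in> Poly_Mapping.keys p"
    obtain M where M: "m = exponent M" using ex_exponent by blast
    have "Poly_Mapping.single m c = Poly_Mapping.single 0 c * Poly_Mapping.single m 1" for c :: 'k
      by (simp add: mult_single)
    then have "\<psi> (Poly_Mapping.single m (Poly_Mapping.lookup p m)) =
       \<psi> (Poly_Mapping.single 0 (Poly_Mapping.lookup p m)) * \<psi> (Poly_Mapping.single m 1)"
      by (metis coefficient_homD(2)[OF assms(2)])
    also have "\<psi> (Poly_Mapping.single m 1) = (\<Prod>v\<in>#M. f v)"
      unfolding M by (rule mon) (use assms(4) m M in auto)
    finally show "\<psi> (Poly_Mapping.single m (Poly_Mapping.lookup p m)) =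
      h (Poly_Mapping.lookup p m) * monomial_value f m"
      by (simp add: assms M monomial_value_exponent)
  qed
  finally show ?thesis by (simp add: substitute_def lift_def)
qed

lemma mpolynomial_eval_substitute: "mpolynomial_eval P = substitute (\<lambda>c. c) P"
  by (auto simp: mpolynomial_eval_def substitute_def lift_def monomial_value_def)

lemma mpolynomial_rename_substitute:
  "mpolynomial_rename g = substitute (Poly_Mapping.single 0) (\<lambda>v. variable (g v))"
proof
  fix p :: "('a, 'b) mpolynomial"
  have pow: "variable v ^ k = Poly_Mapping.single (Poly_Mapping.single v k) (1::'b)" for v :: 'c and k
    by (induction k) (auto simp: variable_def mult_single single_add[symmetric])
  have *: "(\<Prod>v\<in>A. Poly_Mapping.single (f v) (1::'b)) = Poly_Mapping.single (\<Sum>v\<in>A. f v) 1" for A :: "'a set" and f :: "'a \<Rightarrow> 'c \<Rightarrow>\<^sub>0 nat"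
    by (induction A rule: infinite_finite_induct) (auto simp: mult_single)
  show "mpolynomial_rename g p = substitute (Poly_Mapping.single 0) (\<lambda>v. variable (g v)) p"
    by (simp add: mpolynomial_rename_def substitute_def lift_def monomial_value_def pow * mult_single)
qed

section \<open>Monoid algebras and their quotients\<close>

definition additive_submonoid :: "'m::comm_monoid_add set \<Rightarrow> bool" where
  "additive_submonoid M \<longleftrightarrow> 0 \<in> M \<and> (\<forall>a\<in>M. \<forall>b\<in>M. a + b \<in> M)"

definition supported :: "'m set \<Rightarrow> ('m \<Rightarrow>\<^sub>0 'k::zero) set" where
  "supported M = {p. Poly_Mapping.keys p \<subseteq> M}"

text \<open>Polynomial rings (monomials as exponents) and semigroup rings of lattice points (real
  vectors as exponents) are both of this form and can be treated in one setting.\<close>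

definition monoid_algebra :: "'m::comm_monoid_add set \<Rightarrow> ('k::field, 'm \<Rightarrow>\<^sub>0 'k) module" where
  "monoid_algebra M =
     \<lparr> carrier = supported M, monoid.mult = (*), one = 1, zero = 0, add = (+),
       module.smult = (\<lambda>c p. Poly_Mapping.single 0 c * p) \<rparr>"

lemma monoid_algebra_simps [simp]:
  "carrier (monoid_algebra M) = supported M" "x \<otimes>\<^bsub>monoid_algebra M\<^esub> y = x * y"
  "\<one>\<^bsub>monoid_algebra M\<^esub> = 1" "\<zero>\<^bsub>monoid_algebra M\<^esub> = 0" "x \<oplus>\<^bsub>monoid_algebra M\<^esub> y = x + y"
  "c \<odot>\<^bsub>monoid_algebra M\<^esub> x = Poly_Mapping.single 0 c * x"
  by (simp_all add: monoid_algebra_def)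

lemma semigroup_algebra_eq: "semigroup_algebra S = monoid_algebra S"
  by (simp add: semigroup_algebra_def monoid_algebra_def supported_def)

definition monomials :: "'v set \<Rightarrow> ('v \<Rightarrow>\<^sub>0 nat) set" where
  "monomials V = {m. Poly_Mapping.keys m \<subseteq> V}"

lemma polynomial_algebra_eq: "polynomial_algebra V = monoid_algebra (monomials V)"
  by (simp add: polynomial_algebra_def monoid_algebra_def supported_def monomials_def subset_eq)

lemma submonoid_monomials [simp]: "additive_submonoid (monomials V)"
  unfolding additive_submonoid_def monomials_def
proof (intro conjI ballI CollectI)
  fix a b :: "'a \<Rightarrow>\<^sub>0 nat" assume "a \<in> {m. Poly_Mapping.keys m \<subseteq> V}" "b \<in> {m. Poly_Mapping.keys m \<subseteq> V}"
  then show "Poly_Mapping.keys (a + b) \<subseteq> V"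
    using Poly_Mapping.keys_add[of a b] by blast
qed simp

lemma supported_zero [simp]: "0 \<in> supported M"
  by (simp add: supported_def)

lemma supported_add [simp]: "p \<in> supported M \<Longrightarrow> q \<in> supported M \<Longrightarrow> p + q \<in> supported M"
  using Poly_Mapping.keys_add[of p q] by (auto simp: supported_def)

lemma supported_uminus [simp]: "- p \<in> supported M \<longleftrightarrow> p \<in> supported M"
  by (auto simp: supported_def in_keys_iff subset_eq)

lemma supported_diff [simp]: "p \<in> supported M \<Longrightarrow> q \<in> supported M \<Longrightarrow> p - q \<in> supported M"
  for p q :: "'m \<Rightarrow>\<^sub>0 'k::comm_ring_1"
  using supported_add[of p M "- q"] by simp

lemma supported_sum: "(\<And>a. a \<in> A \<Longrightarrow> f a \<in> supported M) \<Longrightarrow> sum f A \<in> supported M"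
  by (induction A rule: infinite_finite_induct) auto

lemma supported_mult [simp]:
  "additive_submonoid M \<Longrightarrow> p \<in> supported M \<Longrightarrow> q \<in> supported M \<Longrightarrow> p * q \<in> supported M"
proof -
  assume M: "additive_submonoid M" and pq: "p \<in> supported M" "q \<in> supported M"
  have "m \<in> M" if m: "m \<in> Poly_Mapping.keys (p * q)" for m
  proof -
    obtain a b where "m = a + b" "a \<in> Poly_Mapping.keys p" "b \<in> Poly_Mapping.keys q"
      using m Poly_Mapping.keys_mult[of p q] by blast
    then show ?thesis using M pq by (auto simp: supported_def additive_submonoid_def)
  qed
  then show ?thesis by (auto simp: supported_def)
qed

lemma supported_single [simp]:
  "m \<in> M \<Longrightarrow> Poly_Mapping.single m c \<in> supported M"
  by (cases "c = 0") (auto simp: supported_def)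

lemma supported_const [simp]: "additive_submonoid M \<Longrightarrow> Poly_Mapping.single 0 c \<in> supported M"
  by (simp add: additive_submonoid_def)

lemma supported_one [simp]:
  "additive_submonoid M \<Longrightarrow> (1 :: 'm::comm_monoid_add \<Rightarrow>\<^sub>0 'k::comm_ring_1) \<in> supported M"
  by (auto simp: supported_def additive_submonoid_def)

lemma supported_prod_mset:
  assumes "additive_submonoid M" "\<And>v. v \<in># A \<Longrightarrow> f v \<in> supported M"
  shows "(\<Prod>v\<in>#A. f v :: _ \<Rightarrow>\<^sub>0 'k::comm_ring_1) \<in> supported M"
  using assms(2) by (induction A) (auto simp: assms(1))

lemma supported_variable [simp]: "v \<in> V \<Longrightarrow> variable v \<in> supported (monomials V)"
  by (auto simp: variable_def monomials_def)

lemma cring_monoid_algebra: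
  assumes M: "additive_submonoid M"
  shows "cring (monoid_algebra M :: ('k::field, _) module)"
proof (rule cringI)
  show "abelian_group (monoid_algebra M :: ('k, _) module)"
    by (rule abelian_groupI) (auto simp: add_ac intro: bexI[of _ "- x" for x])
  show "comm_monoid (monoid_algebra M :: ('k, _) module)"
    by (rule comm_monoidI) (auto simp: M mult_ac)
qed (auto simp: distrib_right)

lemma monoid_algebra_a_inv:
  fixes x :: "_ \<Rightarrow>\<^sub>0 'k::field"
  assumes M: "additive_submonoid M" and x: "x \<in> supported M"
  shows "\<ominus>\<^bsub>monoid_algebra M\<^esub> x = - x"
proof -
  interpret cring "monoid_algebra M :: ('k, _) module" by (rule cring_monoid_algebra[OF M])
  show ?thesis using x by (intro minus_equality) auto
qed

lemma monoid_algebra_coset: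
  "I +>\<^bsub>monoid_algebra M\<^esub> p = (\<lambda>i. i + p) ` I"
  by (auto simp: a_r_coset_def')

text \<open>Working with differences instead of cosets keeps all computations in the ring type.\<close>

locale monoid_algebra_ideal =
  fixes M :: "'m::comm_monoid_add set" and I :: "('m \<Rightarrow>\<^sub>0 'k::field) set"
  assumes M: "additive_submonoid M" and ideal_I: "ideal I (monoid_algebra M)"
begin

sublocale ideal I "monoid_algebra M :: ('k, 'm \<Rightarrow>\<^sub>0 'k) module"
  by (rule ideal_I)

lemma I_supported: "x \<in> I \<Longrightarrow> x \<in> supported M"
  using Icarr by simp

lemma I_zero [simp]: "0 \<in> I"
  using additive_subgroup.zero_closed[OF is_additive_subgroup] by simp

lemma I_add: "x \<in> I \<Longrightarrow> y \<in> I \<Longrightarrow> x + y \<in> I"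
  using additive_subgroup.a_closed[OF is_additive_subgroup, of x y] by simp

lemma I_uminus: "x \<in> I \<Longrightarrow> - x \<in> I"
  using additive_subgroup.a_inv_closed[OF is_additive_subgroup, of x] I_supported[of x] by (simp add: monoid_algebra_a_inv M)

lemma I_diff: "x \<in> I \<Longrightarrow> y \<in> I \<Longrightarrow> x - y \<in> I"
  using I_add[of x "- y"] I_uminus by simp

lemma I_mult_left: "x \<in> I \<Longrightarrow> y \<in> supported M \<Longrightarrow> y * x \<in> I"
  using I_l_closed[of x y] by simp

lemma I_mult_right: "x \<in> I \<Longrightarrow> y \<in> supported M \<Longrightarrow> x * y \<in> I"
  using I_r_closed[of x y] by simp

lemma I_sum: "(\<And>a. a \<in> A \<Longrightarrow> f a \<in> I) \<Longrightarrow> sum f A \<in> I"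
  by (induction A rule: infinite_finite_induct) (auto simp: I_add)

lemma I_sym: "x - y \<in> I \<Longrightarrow> y - x \<in> I"
  using I_uminus[of "x - y"] by simp

lemma I_trans: "x - y \<in> I \<Longrightarrow> y - z \<in> I \<Longrightarrow> x - z \<in> I"
  using I_add[of "x - y" "y - z"] by simp

lemma coset_mem_iff:
  "q \<in> I +>\<^bsub>monoid_algebra M\<^esub> p \<longleftrightarrow> q - p \<in> I"
proof
  assume "q - p \<in> I"
  then show "q \<in> I +>\<^bsub>monoid_algebra M\<^esub> p"
    unfolding monoid_algebra_coset by (intro image_eqI[of _ _ "q - p"]) auto
qed (auto simp: monoid_algebra_coset)

lemma coset_eq_iff:
  "I +>\<^bsub>monoid_algebra M\<^esub> p = I +>\<^bsub>monoid_algebra M\<^esub> q \<longleftrightarrow> p - q \<in> I"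
proof
  assume *: "I +>\<^bsub>monoid_algebra M\<^esub> p = I +>\<^bsub>monoid_algebra M\<^esub> q"
  have "p \<in> I +>\<^bsub>monoid_algebra M\<^esub> q" unfolding *[symmetric] by (simp add: coset_mem_iff)
  then show "p - q \<in> I" by (simp add: coset_mem_iff)
next
  assume "p - q \<in> I"
  then show "I +>\<^bsub>monoid_algebra M\<^esub> p = I +>\<^bsub>monoid_algebra M\<^esub> q"
    unfolding set_eq_iff coset_mem_iff using I_trans I_sym by blast
qed

definition Q :: "('k, ('m \<Rightarrow>\<^sub>0 'k) set) module" where
  "Q = quotient_algebra (monoid_algebra M) I"

definition cos :: "('m \<Rightarrow>\<^sub>0 'k) \<Rightarrow> ('m \<Rightarrow>\<^sub>0 'k) set" where
  "cos p = I +>\<^bsub>monoid_algebra M\<^esub> p"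

lemma cos_eq_iff: "cos p = cos q \<longleftrightarrow> p - q \<in> I"
  by (simp add: cos_def coset_eq_iff)

lemma mem_cos_iff: "q \<in> cos p \<longleftrightarrow> q - p \<in> I"
  by (simp add: cos_def coset_mem_iff)

lemma carrier_Q: "carrier Q = cos ` supported M"
  by (auto simp: Q_def quotient_algebra_def FactRing_def A_RCOSETS_def' cos_def)

lemma one_Q: "\<one>\<^bsub>Q\<^esub> = cos 1"
  by (simp add: Q_def quotient_algebra_def FactRing_def cos_def)

lemma zero_Q: "\<zero>\<^bsub>Q\<^esub> = cos 0"
  by (simp add: Q_def quotient_algebra_def FactRing_def cos_def monoid_algebra_coset)

lemma add_Q:
  assumes "p \<in> supported M" "q \<in> supported M"
  shows "cos p \<oplus>\<^bsub>Q\<^esub> cos q = cos (p + q)"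
  using a_rcos_sum[of p q] assms
  by (simp add: Q_def quotient_algebra_def FactRing_def cos_def)

lemma mult_Q:
  assumes "p \<in> supported M" "q \<in> supported M"
  shows "cos p \<otimes>\<^bsub>Q\<^esub> cos q = cos (p * q)"
  using rcoset_mult_add[of p q] assms
  by (simp add: Q_def quotient_algebra_def FactRing_def cos_def)

lemma smult_Q: "c \<odot>\<^bsub>Q\<^esub> cos p = cos (Poly_Mapping.single 0 c * p)"
proof -
  let ?c = "Poly_Mapping.single 0 c :: 'm \<Rightarrow>\<^sub>0 'k"
  have "cos (?c * x) = cos (?c * p)" if "x \<in> cos p" for x
    using I_mult_left[of "x - p" ?c] that M
    by (auto simp: cos_eq_iff mem_cos_iff right_diff_distrib)
  then have "(\<Union>x\<in>cos p. cos (?c * x)) = (\<Union>x\<in>cos p. cos (?c * p))"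
    by (rule SUP_cong[OF refl])
  moreover have "p \<in> cos p" by (simp add: mem_cos_iff)
  moreover have "c \<odot>\<^bsub>Q\<^esub> cos p = (\<Union>x\<in>cos p. cos (?c * x))"
    by (simp add: Q_def quotient_algebra_def cos_def)
  ultimately show ?thesis by auto
qed

lemma carrier_QE:
  assumes "x \<in> carrier Q" obtains p where "p \<in> supported M" "x = cos p"
  using assms by (auto simp: carrier_Q)

lemma cos_carrier [simp]: "p \<in> supported M \<Longrightarrow> cos p \<in> carrier Q"
  by (simp add: carrier_Q)

lemma cring_Q: "cring Q"
proof (rule cringI)
  show "abelian_group Q"
  proof (rule abelian_groupI)
    fix x assume "x \<in> carrier Q"
    then obtain p where p: "p \<in> supported M" "x = cos p" by (rule carrier_QE)
    then have "cos (- p) \<in> carrier Q" "cos (- p) \<oplus>\<^bsub>Q\<^esub> x = \<zero>\<^bsub>Q\<^esub>"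
      by (simp_all add: add_Q zero_Q)
    then show "\<exists>y\<in>carrier Q. y \<oplus>\<^bsub>Q\<^esub> x = \<zero>\<^bsub>Q\<^esub>" by blast
    show "\<zero>\<^bsub>Q\<^esub> \<oplus>\<^bsub>Q\<^esub> x = x" using p by (simp add: add_Q zero_Q)
  next
    fix x y assume "x \<in> carrier Q" "y \<in> carrier Q"
    then obtain p q where "p \<in> supported M" "x = cos p" "q \<in> supported M" "y = cos q" by (metis carrier_QE)
    then show "x \<oplus>\<^bsub>Q\<^esub> y \<in> carrier Q" "x \<oplus>\<^bsub>Q\<^esub> y = y \<oplus>\<^bsub>Q\<^esub> x"
      by (simp_all add: add_Q add.commute)
  next
    fix x y z assume "x \<in> carrier Q" "y \<in> carrier Q" "z \<in> carrier Q"
    then obtain p q r where "p \<in> supported M" "x = cos p" "q \<in> supported M" "y = cos q"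
      "r \<in> supported M" "z = cos r" by (metis carrier_QE)
    then show "x \<oplus>\<^bsub>Q\<^esub> y \<oplus>\<^bsub>Q\<^esub> z = x \<oplus>\<^bsub>Q\<^esub> (y \<oplus>\<^bsub>Q\<^esub> z)"
      by (simp add: add_Q add.assoc)
  qed (simp add: zero_Q)
  show "comm_monoid Q"
  proof (rule comm_monoidI)
    fix x assume "x \<in> carrier Q"
    then obtain p where "p \<in> supported M" "x = cos p" by (rule carrier_QE)
    then show "\<one>\<^bsub>Q\<^esub> \<otimes>\<^bsub>Q\<^esub> x = x" by (simp add: mult_Q one_Q M)
  next
    fix x y assume "x \<in> carrier Q" "y \<in> carrier Q"
    then obtain p q where "p \<in> supported M" "x = cos p" "q \<in> supported M" "y = cos q" by (metis carrier_QE)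
    then show "x \<otimes>\<^bsub>Q\<^esub> y \<in> carrier Q" "x \<otimes>\<^bsub>Q\<^esub> y = y \<otimes>\<^bsub>Q\<^esub> x"
      by (simp_all add: mult_Q mult.commute M)
  next
    fix x y z assume "x \<in> carrier Q" "y \<in> carrier Q" "z \<in> carrier Q"
    then obtain p q r where "p \<in> supported M" "x = cos p" "q \<in> supported M" "y = cos q"
      "r \<in> supported M" "z = cos r" by (metis carrier_QE)
    then show "x \<otimes>\<^bsub>Q\<^esub> y \<otimes>\<^bsub>Q\<^esub> z = x \<otimes>\<^bsub>Q\<^esub> (y \<otimes>\<^bsub>Q\<^esub> z)"
      by (simp add: mult_Q mult.assoc M)
  qed (simp add: one_Q M)
  fix x y z assume "x \<in> carrier Q" "y \<in> carrier Q" "z \<in> carrier Q"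
  then obtain p q r where "p \<in> supported M" "x = cos p" "q \<in> supported M" "y = cos q"
    "r \<in> supported M" "z = cos r" by (metis carrier_QE)
  then show "(x \<oplus>\<^bsub>Q\<^esub> y) \<otimes>\<^bsub>Q\<^esub> z = x \<otimes>\<^bsub>Q\<^esub> z \<oplus>\<^bsub>Q\<^esub> y \<otimes>\<^bsub>Q\<^esub> z"
    by (simp add: mult_Q add_Q M distrib_right)
qed

lemma minus_Q:
  assumes "p \<in> supported M" "q \<in> supported M"
  shows "cos p \<ominus>\<^bsub>Q\<^esub> cos q = cos (p - q)"
proof -
  interpret Q: cring Q by (rule cring_Q)
  have "\<ominus>\<^bsub>Q\<^esub> cos q = cos (- q)"
    using assms by (intro Q.minus_equality) (auto simp: add_Q zero_Q carrier_Q)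
  then show ?thesis
    using assms by (simp add: a_minus_def add_Q)
qed

end

section \<open>The local ring of a point\<close>

locale affine_point =
  fixes V :: "'v set" and I :: "('v, 'k::field) mpolynomial set" and P :: "'v \<Rightarrow> 'k"
  assumes ideal_polynomials: "ideal I (polynomial_algebra V)"
    and vanish: "\<And>p. p \<in> I \<Longrightarrow> mpolynomial_eval P p = 0"
begin

sublocale monoid_algebra_ideal "monomials V" I
  by (rule monoid_algebra_ideal.intro) (use ideal_polynomials in \<open>simp_all add: polynomial_algebra_eq\<close>)

abbreviation "C \<equiv> supported (monomials V) :: ('v, 'k) mpolynomial set"
abbreviation "ev \<equiv> mpolynomial_eval P"
abbreviation "X \<equiv> (V, I)"

lemma I_comb: "x \<in> I \<Longrightarrow> y \<in> I \<Longrightarrow> a \<in> C \<Longrightarrow> b \<in> C \<Longrightarrow> a * x + b * y \<in> I"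
  by (intro I_add I_mult_left)

lemma ev_hom: "coefficient_hom ev"
  by (simp add: mpolynomial_eval_substitute substitute_hom)

lemmas ev_simps = coefficient_homD[OF ev_hom]

lemma ev_const [simp]: "ev (Poly_Mapping.single 0 c) = c"
  by (simp add: mpolynomial_eval_substitute substitute_const)

lemma ev_variable [simp]: "ev (variable v) = P v"
  by (simp add: mpolynomial_eval_substitute substitute_variable)

definition U :: "('v, 'k) mpolynomial set" where
  "U = {r \<in> C. ev r \<noteq> 0}"

lemma U_C: "r \<in> U \<Longrightarrow> r \<in> C" by (simp add: U_def)

lemma U_one [simp]: "1 \<in> U" by (simp add: U_def ev_simps)

lemma U_mult [simp]: "r \<in> U \<Longrightarrow> s \<in> U \<Longrightarrow> r * s \<in> U" by (simp add: U_def ev_simps)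

lemma coordinate_algebra_eq: "coordinate_algebra X = Q"
  by (simp add: coordinate_algebra_def Q_def polynomial_algebra_eq)

lemma ev_cong: "p - q \<in> I \<Longrightarrow> ev p = ev q"
  using vanish[of "p - q"] by (simp add: ev_simps)

lemma point_ideal_eq: "point_ideal X P = cos ` {p \<in> C. ev p = 0}"
  by (auto simp: point_ideal_def cos_def polynomial_algebra_eq)

lemma non_vanishing_eq: "non_vanishing X P = cos ` U"
  by (auto simp: non_vanishing_def point_ideal_eq coordinate_algebra_eq carrier_Q U_def cos_eq_iff
      dest!: ev_cong)

text \<open>Germs are represented by pairs of polynomials, so that their equality becomes membership
  in \<open>I\<close> (\<open>frac_eq_iff\<close>) and no arithmetic of cosets remains.\<close>

definition frac :: "('v, 'k) mpolynomial \<Rightarrow> ('v, 'k) mpolynomial \<Rightarrow> ('v, 'k) germ" where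
  "frac p r = fraction Q (cos ` U) (cos p) (cos r)"

lemma mem_frac_iff:
  assumes "p \<in> C" "r \<in> U"
  shows "x \<in> frac p r \<longleftrightarrow>
    (\<exists>p'\<in>C. \<exists>r'\<in>U. x = (cos p', cos r') \<and> (\<exists>u\<in>U. u * (r' * p - r * p') \<in> I))"
proof -
  have *: "(cos u \<otimes>\<^bsub>Q\<^esub> ((cos r' \<otimes>\<^bsub>Q\<^esub> cos p) \<ominus>\<^bsub>Q\<^esub> (cos r \<otimes>\<^bsub>Q\<^esub> cos p')) = \<zero>\<^bsub>Q\<^esub>) \<longleftrightarrow>
      u * (r' * p - r * p') \<in> I" if "u \<in> U" "r' \<in> U" "p' \<in> C" for u r' p'
    using that assms by (simp add: mult_Q minus_Q U_C zero_Q cos_eq_iff)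
  show ?thesis
    using * assms by (auto simp: frac_def fraction_def carrier_Q) blast+
qed

lemma mem_fracI:
  assumes "p \<in> C" "r \<in> U" "p' \<in> C" "r' \<in> U" "u \<in> U" "u * (r' * p - r * p') \<in> I"
  shows "(cos p', cos r') \<in> frac p r"
  unfolding mem_frac_iff[OF assms(1,2)] using assms by blast

lemma frac_self:
  assumes "p \<in> C" "r \<in> U"
  shows "(cos p, cos r) \<in> frac p r"
proof -
  have "1 * (r * p - r * p) \<in> I" by simp
  then show ?thesis
    unfolding mem_frac_iff[OF assms] using assms U_one by blast
qed

lemma frac_sym_aux: "u * (r' * p - r * p') \<in> I \<Longrightarrow> u * (r * p' - r' * p) \<in> I"
  using I_uminus[of "u * (r' * p - r * p')"] by (simp add: algebra_simps)

text \<open>Transitivity of the relation between fractions in a ring that may have zero divisors: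
  the middle denominator \<open>r'\<close> cannot be cancelled and is absorbed in the
  multiplier.\<close>

lemma frac_trans_aux:
  assumes "p \<in> C" "r \<in> U" "p' \<in> C" "r' \<in> U" "p'' \<in> C" "r'' \<in> U"
    and u: "u \<in> U" "u * (r' * p - r * p') \<in> I" and w: "w \<in> U" "w * (r'' * p' - r' * p'') \<in> I"
  shows "(u * w * r') * (r'' * p - r * p'') \<in> I"
proof -
  have "(w * r'') * (u * (r' * p - r * p')) + (u * r) * (w * (r'' * p' - r' * p'')) \<in> I"
    using assms by (intro I_comb) (auto simp: U_C)
  also have "(w * r'') * (u * (r' * p - r * p')) + (u * r) * (w * (r'' * p' - r' * p'')) =
    (u * w * r') * (r'' * p - r * p'')" by (simp add: algebra_simps)
  finally show ?thesis .
qed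

lemma frac_eq_iff:
  assumes "p \<in> C" "r \<in> U" "p' \<in> C" "r' \<in> U"
  shows "frac p r = frac p' r' \<longleftrightarrow> (\<exists>u\<in>U. u * (r' * p - r * p') \<in> I)"
proof
  assume *: "frac p r = frac p' r'"
  have "(cos p', cos r') \<in> frac p' r'"
    using assms by (simp add: frac_self)
  then have "(cos p', cos r') \<in> frac p r" by (simp add: *)
  then obtain p1 r1 u where 1: "p1 \<in> C" "r1 \<in> U" "p' - p1 \<in> I" "r' - r1 \<in> I" "u \<in> U" "u * (r1 * p - r * p1) \<in> I"
    using assms by (auto simp: mem_frac_iff cos_eq_iff)
  have "u * (r1 * p - r * p1) + ((r' - r1) * (u * p) - (p' - p1) * (u * r)) \<in> I"
    using 1 assms by (intro I_add[OF _ I_diff] I_mult_right[of "r' - r1"] I_mult_right[of "p' - p1"]) (auto simp: U_C)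
  also have "u * (r1 * p - r * p1) + ((r' - r1) * (u * p) - (p' - p1) * (u * r)) = u * (r' * p - r * p')"
    by (simp add: algebra_simps)
  finally show "\<exists>u\<in>U. u * (r' * p - r * p') \<in> I" using 1 by blast
next
  assume "\<exists>u\<in>U. u * (r' * p - r * p') \<in> I"
  then obtain u where u: "u \<in> U" "u * (r' * p - r * p') \<in> I" by blast
  have "frac p r \<subseteq> frac p' r'"
  proof
    fix x assume "x \<in> frac p r"
    then obtain p1 r1 w where 1: "p1 \<in> C" "r1 \<in> U" "x = (cos p1, cos r1)" "w \<in> U" "w * (r1 * p - r * p1) \<in> I"
      using assms by (auto simp: mem_frac_iff)
    have "(u * w * r) * (r1 * p' - r' * p1) \<in> I"
      using frac_trans_aux[OF _ _ _ _ _ _ u(1) frac_sym_aux[OF u(2)] 1(4,5)] assms 1 by simp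
    then show "x \<in> frac p' r'"
      using mem_fracI[OF assms(3,4) 1(1,2), of "u * w * r"] 1 u assms by simp
  qed
  moreover have "frac p' r' \<subseteq> frac p r"
  proof
    fix x assume "x \<in> frac p' r'"
    then obtain p1 r1 w where 1: "p1 \<in> C" "r1 \<in> U" "x = (cos p1, cos r1)" "w \<in> U" "w * (r1 * p' - r' * p1) \<in> I"
      using assms by (auto simp: mem_frac_iff)
    have "(u * w * r') * (r1 * p - r * p1) \<in> I"
      using frac_trans_aux[OF _ _ _ _ _ _ u 1(4,5)] assms 1 by simp
    then show "x \<in> frac p r"
      using mem_fracI[OF assms(1,2) 1(1,2), of "u * w * r'"] 1 u assms by simp
  qed
  ultimately show "frac p r = frac p' r'" by blast
qed

lemma frac_eqI:
  assumes "p \<in> C" "r \<in> U" "p' \<in> C" "r' \<in> U" "r' * p - r * p' \<in> I"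
  shows "frac p r = frac p' r'"
proof -
  have "1 * (r' * p - r * p') \<in> I" using assms by simp
  then show ?thesis
    unfolding frac_eq_iff[OF assms(1-4)] using U_one by blast
qed

abbreviation "LR \<equiv> local_ring X P"

lemma LR_def: "LR = localization Q (cos ` U)"
  by (simp add: local_ring_def coordinate_algebra_eq non_vanishing_eq)

lemma carrier_LR: "carrier LR = {frac p r | p r. p \<in> C \<and> r \<in> U}"
  by (fastforce simp: LR_def localization_def carrier_Q frac_def)

lemma frac_carrier [simp]: "p \<in> C \<Longrightarrow> r \<in> U \<Longrightarrow> frac p r \<in> carrier LR"
  by (auto simp: carrier_LR)

lemma one_LR: "\<one>\<^bsub>LR\<^esub> = frac 1 1" and zero_LR: "\<zero>\<^bsub>LR\<^esub> = frac 0 1"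
  by (simp_all add: LR_def localization_def frac_def one_Q zero_Q)

text \<open>The operations of a localization are unions over all representatives; once the sets are
  known not to depend on the representative, the union collapses to any one of them.\<close>

lemma frac_UN:
  assumes "p \<in> C" "r \<in> U"
    and "\<And>p' r'. p' \<in> C \<Longrightarrow> r' \<in> U \<Longrightarrow> frac p r = frac p' r' \<Longrightarrow> f (cos p') (cos r') = Z"
  shows "(\<Union>(a, s)\<in>frac p r. f a s) = Z"
proof -
  have "f a s = Z" if "(a, s) \<in> frac p r" for a s
  proof -
    obtain p' r' where "p' \<in> C" "r' \<in> U" "a = cos p'" "s = cos r'" "\<exists>u\<in>U. u * (r' * p - r * p') \<in> I"
      using \<open>(a, s) \<in> frac p r\<close> assms(1,2) by (auto simp: mem_frac_iff)
    then show ?thesis using assms frac_eq_iff by metis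
  qed
  then show ?thesis using frac_self[OF assms(1,2)] by fastforce
qed

lemma mult_LR:
  assumes "p \<in> C" "r \<in> U" "p' \<in> C" "r' \<in> U"
  shows "frac p r \<otimes>\<^bsub>LR\<^esub> frac p' r' = frac (p * p') (r * r')"
proof -
  have *: "fraction Q (cos ` U) (cos q \<otimes>\<^bsub>Q\<^esub> cos q') (cos s \<otimes>\<^bsub>Q\<^esub> cos s') = frac (p * p') (r * r')"
    if q: "q \<in> C" "s \<in> U" "frac p r = frac q s" "q' \<in> C" "s' \<in> U" "frac p' r' = frac q' s'" for q s q' s'
  proof -
    have "frac (q * q') (s * s') = frac (p * p') (r * r')"
    proof -
      obtain u where u: "u \<in> U" "u * (s * p - r * q) \<in> I"
        using q(3) frac_eq_iff assms q by metis
      obtain w where w: "w \<in> U" "w * (s' * p' - r' * q') \<in> I"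
        using q(6) frac_eq_iff assms q by metis
      have "(w * s' * p') * (u * (s * p - r * q)) + (u * r * q) * (w * (s' * p' - r' * q')) \<in> I"
        using assms u w q by (intro I_comb) (auto simp: U_C)
      also have "(w * s' * p') * (u * (s * p - r * q)) + (u * r * q) * (w * (s' * p' - r' * q')) =
        (u * w) * ((s * s') * (p * p') - (r * r') * (q * q'))" by (simp add: algebra_simps)
      finally have "frac (p * p') (r * r') = frac (q * q') (s * s')"
        using assms q u(1) w(1) frac_eq_iff[of "p * p'" "r * r'" "q * q'" "s * s'"] M U_mult[OF u(1) w(1)]
        by auto
      then show ?thesis by simp
    qed
    then show ?thesis using q by (simp add: mult_Q U_C frac_def)
  qed
  show ?thesis
    unfolding LR_def localization_def monoid.simps
    by (rule frac_UN[OF assms(1,2)], rule frac_UN[OF assms(3,4)]) (rule *)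
qed

lemma add_LR:
  assumes "p \<in> C" "r \<in> U" "p' \<in> C" "r' \<in> U"
  shows "frac p r \<oplus>\<^bsub>LR\<^esub> frac p' r' = frac (r' * p + r * p') (r * r')"
proof -
  have *: "fraction Q (cos ` U) ((cos s' \<otimes>\<^bsub>Q\<^esub> cos q) \<oplus>\<^bsub>Q\<^esub> (cos s \<otimes>\<^bsub>Q\<^esub> cos q')) (cos s \<otimes>\<^bsub>Q\<^esub> cos s') =
      frac (r' * p + r * p') (r * r')"
    if q: "q \<in> C" "s \<in> U" "frac p r = frac q s" "q' \<in> C" "s' \<in> U" "frac p' r' = frac q' s'" for q s q' s'
  proof -
    obtain u where u: "u \<in> U" "u * (s * p - r * q) \<in> I"
      using q(3) frac_eq_iff assms q by metis
    obtain w where w: "w \<in> U" "w * (s' * p' - r' * q') \<in> I"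
      using q(6) frac_eq_iff assms q by metis
    have "(w * r' * s') * (u * (s * p - r * q)) + (u * r * s) * (w * (s' * p' - r' * q')) \<in> I"
      using assms u w q by (intro I_comb) (auto simp: U_C)
    also have "(w * r' * s') * (u * (s * p - r * q)) + (u * r * s) * (w * (s' * p' - r' * q')) =
      (u * w) * ((s * s') * (r' * p + r * p') - (r * r') * (s' * q + s * q'))" by (simp add: algebra_simps)
    finally have "frac (r' * p + r * p') (r * r') = frac (s' * q + s * q') (s * s')"
      using assms q u(1) w(1) frac_eq_iff[of "r' * p + r * p'" "r * r'" "s' * q + s * q'" "s * s'"] M
        U_mult[OF u(1) w(1)] by (auto simp: U_C)
    then show ?thesis using q by (simp add: mult_Q add_Q U_C frac_def)
  qed
  show ?thesis
    unfolding LR_def localization_def ring_record_simps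
    by (rule frac_UN[OF assms(1,2)], rule frac_UN[OF assms(3,4)]) (rule *)
qed

lemma smult_LR:
  assumes "p \<in> C" "r \<in> U"
  shows "c \<odot>\<^bsub>LR\<^esub> frac p r = frac (Poly_Mapping.single 0 c * p) r"
proof -
  have *: "fraction Q (cos ` U) (c \<odot>\<^bsub>Q\<^esub> cos q) (cos s) = frac (Poly_Mapping.single 0 c * p) r"
    if q: "q \<in> C" "s \<in> U" "frac p r = frac q s" for q s
  proof -
    obtain u where u: "u \<in> U" "u * (s * p - r * q) \<in> I"
      using q(3) frac_eq_iff assms q by metis
    have "Poly_Mapping.single 0 c * (u * (s * p - r * q)) \<in> I"
      by (rule I_mult_left[OF u(2)]) simp
    also have "Poly_Mapping.single 0 c * (u * (s * p - r * q)) =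
      u * (s * (Poly_Mapping.single 0 c * p) - r * (Poly_Mapping.single 0 c * q))" by (simp add: algebra_simps)
    finally have "frac (Poly_Mapping.single 0 c * p) r = frac (Poly_Mapping.single 0 c * q) s"
      using assms q u(1) M
        frac_eq_iff[of "Poly_Mapping.single 0 c * p" r "Poly_Mapping.single 0 c * q" s] by auto
    then show ?thesis by (simp add: smult_Q frac_def)
  qed
  show ?thesis
    unfolding LR_def localization_def module.simps
    by (rule frac_UN[OF assms(1,2)]) (rule *)
qed

lemma carrier_LRE:
  assumes "x \<in> carrier LR" obtains p r where "p \<in> C" "r \<in> U" "x = frac p r"
  using assms by (auto simp: carrier_LR)

lemma add_frac_uminus: "p \<in> C \<Longrightarrow> r \<in> U \<Longrightarrow> frac (- p) r \<oplus>\<^bsub>LR\<^esub> frac p r = \<zero>\<^bsub>LR\<^esub>"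
  by (simp add: add_LR zero_LR U_C) (rule frac_eqI; simp)

lemma cring_LR: "cring LR"
proof (rule cringI)
  show "abelian_group LR"
  proof (rule abelian_groupI)
    fix x assume "x \<in> carrier LR"
    then obtain p r where p: "p \<in> C" "r \<in> U" "x = frac p r" by (rule carrier_LRE)
    then show "\<exists>y\<in>carrier LR. y \<oplus>\<^bsub>LR\<^esub> x = \<zero>\<^bsub>LR\<^esub>"
      using add_frac_uminus by (intro bexI[of _ "frac (- p) r"]) auto
    show "\<zero>\<^bsub>LR\<^esub> \<oplus>\<^bsub>LR\<^esub> x = x" using p by (simp add: add_LR zero_LR)
  next
    fix x y assume "x \<in> carrier LR" "y \<in> carrier LR"
    then obtain p r q s where "p \<in> C" "r \<in> U" "x = frac p r" "q \<in> C" "s \<in> U" "y = frac q s"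
      by (metis carrier_LRE)
    then show "x \<oplus>\<^bsub>LR\<^esub> y \<in> carrier LR" "x \<oplus>\<^bsub>LR\<^esub> y = y \<oplus>\<^bsub>LR\<^esub> x"
      by (simp_all add: add_LR U_C add.commute mult.commute)
  next
    fix x y z assume "x \<in> carrier LR" "y \<in> carrier LR" "z \<in> carrier LR"
    then obtain p r q s t u where "p \<in> C" "r \<in> U" "x = frac p r" "q \<in> C" "s \<in> U" "y = frac q s"
        "t \<in> C" "u \<in> U" "z = frac t u"
      by (metis carrier_LRE)
    then show "x \<oplus>\<^bsub>LR\<^esub> y \<oplus>\<^bsub>LR\<^esub> z = x \<oplus>\<^bsub>LR\<^esub> (y \<oplus>\<^bsub>LR\<^esub> z)"
      by (simp add: add_LR U_C algebra_simps)
  qed (simp add: zero_LR)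
  show "comm_monoid LR"
  proof (rule comm_monoidI)
    fix x assume "x \<in> carrier LR"
    then obtain p r where "p \<in> C" "r \<in> U" "x = frac p r" by (rule carrier_LRE)
    then show "\<one>\<^bsub>LR\<^esub> \<otimes>\<^bsub>LR\<^esub> x = x" by (simp add: mult_LR one_LR)
  next
    fix x y assume "x \<in> carrier LR" "y \<in> carrier LR"
    then obtain p r q s where "p \<in> C" "r \<in> U" "x = frac p r" "q \<in> C" "s \<in> U" "y = frac q s"
      by (metis carrier_LRE)
    then show "x \<otimes>\<^bsub>LR\<^esub> y \<in> carrier LR" "x \<otimes>\<^bsub>LR\<^esub> y = y \<otimes>\<^bsub>LR\<^esub> x"
      by (simp_all add: mult_LR mult.commute)
  next
    fix x y z assume "x \<in> carrier LR" "y \<in> carrier LR" "z \<in> carrier LR"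
    then obtain p r q s t u where "p \<in> C" "r \<in> U" "x = frac p r" "q \<in> C" "s \<in> U" "y = frac q s"
        "t \<in> C" "u \<in> U" "z = frac t u"
      by (metis carrier_LRE)
    then show "x \<otimes>\<^bsub>LR\<^esub> y \<otimes>\<^bsub>LR\<^esub> z = x \<otimes>\<^bsub>LR\<^esub> (y \<otimes>\<^bsub>LR\<^esub> z)"
      by (simp add: mult_LR mult.assoc)
  qed (simp add: one_LR)
  fix x y z assume "x \<in> carrier LR" "y \<in> carrier LR" "z \<in> carrier LR"
  then obtain p r q s t u where "p \<in> C" "r \<in> U" "x = frac p r" "q \<in> C" "s \<in> U" "y = frac q s"
      "t \<in> C" "u \<in> U" "z = frac t u"
    by (metis carrier_LRE)
  then show "(x \<oplus>\<^bsub>LR\<^esub> y) \<otimes>\<^bsub>LR\<^esub> z = x \<otimes>\<^bsub>LR\<^esub> z \<oplus>\<^bsub>LR\<^esub> y \<otimes>\<^bsub>LR\<^esub> z"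
    by (simp add: add_LR mult_LR U_C) (rule frac_eqI; simp add: U_C algebra_simps)
qed

lemma a_inv_LR: "p \<in> C \<Longrightarrow> r \<in> U \<Longrightarrow> \<ominus>\<^bsub>LR\<^esub> frac p r = frac (- p) r"
proof -
  assume *: "p \<in> C" "r \<in> U"
  interpret LR: cring LR by (rule cring_LR)
  show ?thesis using * by (intro LR.minus_equality) (auto simp: add_frac_uminus)
qed

lemma local_max_ideal_eq: "local_max_ideal X P = {frac p r | p r. p \<in> C \<and> ev p = 0 \<and> r \<in> U}"
  by (fastforce simp: local_max_ideal_def coordinate_algebra_eq non_vanishing_eq point_ideal_eq frac_def)

end

section \<open>The associated graded ring of a local ring with a monomial order function\<close>

context affine_point
begin

text \<open>\<open>ideal_pow q p\<close> says that \<open>p\<close> lies in \<open>\<mm>\<^sup>q + I\<close>, where \<open>\<mm>\<close> is the ideal of \<open>P\<close> in the polynomial ring.\<close>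

inductive ideal_pow :: "nat \<Rightarrow> ('v, 'k) mpolynomial \<Rightarrow> bool" where
  ideal_powI: "p \<in> I \<Longrightarrow> ideal_pow q p"
| ideal_pow0: "p \<in> C \<Longrightarrow> ideal_pow 0 p"
| ideal_pow_Suc: "a \<in> C \<Longrightarrow> ev a = 0 \<Longrightarrow> ideal_pow q b \<Longrightarrow> ideal_pow (Suc q) (a * b)"
| ideal_pow_add: "ideal_pow q a \<Longrightarrow> ideal_pow q b \<Longrightarrow> ideal_pow q (a + b)"

lemma ideal_pow_C: "ideal_pow q p \<Longrightarrow> p \<in> C"
  by (induction rule: ideal_pow.induct) (auto simp: I_supported)

lemma ideal_pow_mult_left: "ideal_pow q p \<Longrightarrow> c \<in> C \<Longrightarrow> ideal_pow q (c * p)"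
proof (induction rule: ideal_pow.induct)
  case (ideal_pow_Suc a q b)
  then show ?case using ideal_pow.ideal_pow_Suc[of a q "c * b"] by (simp add: mult_ac)
next
  case (ideal_pow_add q a b)
  then show ?case by (simp add: distrib_left ideal_pow.ideal_pow_add)
qed (auto intro: ideal_powI ideal_pow0 I_mult_left)

lemma ideal_pow_mult:
  "ideal_pow i p \<Longrightarrow> ideal_pow j r \<Longrightarrow> ideal_pow (i + j) (p * r)"
proof (induction rule: ideal_pow.induct)
  case (ideal_powI p q)
  then show ?case using ideal_pow_C[OF ideal_powI(2)] by (intro ideal_pow.ideal_powI I_mult_right)
next
  case (ideal_pow0 p)
  then show ?case by (simp add: ideal_pow_mult_left)
next
  case (ideal_pow_Suc a q b)
  then show ?case using ideal_pow.ideal_pow_Suc[of a "q + j" "b * r"] by (simp add: mult_ac)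
next
  case (ideal_pow_add q a b)
  then show ?case by (simp add: distrib_right ideal_pow.ideal_pow_add)
qed

lemma ideal_pow_uminus: "ideal_pow q p \<Longrightarrow> ideal_pow q (- p)"
  using ideal_pow_mult_left[of q p "- 1"] by simp

lemma ideal_pow_diff: "ideal_pow q p \<Longrightarrow> ideal_pow q r \<Longrightarrow> ideal_pow q (p - r)"
  using ideal_pow_add[of q p "- r"] ideal_pow_uminus by simp

lemma ideal_pow_1: "a \<in> C \<Longrightarrow> ev a = 0 \<Longrightarrow> ideal_pow (Suc 0) a"
  using ideal_pow_Suc[of a 0 1] by (simp add: ideal_pow0)

end

text \<open>An abstract criterion for gr to be K[S]. By \<open>phi_I\<close> and
  \<open>phi_0\<close> the t-order of \<open>\<phi>\<close> bounds the order at the point from one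
  side; \<open>xi_low\<close> and \<open>xi_lead\<close> give independent initial forms;
  \<open>generators\<close> says that the elements \<open>\<xi> s\<close> of degree one span the
  cotangent space. It is enough that \<open>\<xi>\<close> be multiplicative modulo
  \<open>I\<close>.\<close>

locale graded_model = affine_point V I P
  for V :: "'v set" and I :: "('v, 'k::field) mpolynomial set" and P :: "'v \<Rightarrow> 'k" +
  fixes \<phi> :: "('v, 'k) mpolynomial \<Rightarrow> ('m::comm_monoid_add \<Rightarrow>\<^sub>0 'k) poly"
    and S :: "'m set" and deg :: "'m \<Rightarrow> nat" and \<xi> :: "'m \<Rightarrow> ('v, 'k) mpolynomial"
  assumes phi_hom: "coefficient_hom \<phi>"
    and phi_I: "\<And>p. p \<in> I \<Longrightarrow> \<phi> p = 0"
    and phi_0: "\<And>p. p \<in> C \<Longrightarrow> coeff (\<phi> p) 0 = Poly_Mapping.single 0 (ev p)"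
    and S: "additive_submonoid S"
    and deg_add: "\<And>s t. s \<in> S \<Longrightarrow> t \<in> S \<Longrightarrow> deg (s + t) = deg s + deg t"
    and phi_const: "\<And>c. \<phi> (Poly_Mapping.single 0 c) = [:Poly_Mapping.single 0 c:]"
    and xi_C: "\<And>s. s \<in> S \<Longrightarrow> \<xi> s \<in> C"
    and xi_0: "\<xi> 0 - 1 \<in> I"
    and xi_add: "\<And>s t. s \<in> S \<Longrightarrow> t \<in> S \<Longrightarrow> \<xi> (s + t) - \<xi> s * \<xi> t \<in> I"
    and xi_low: "\<And>s i. s \<in> S \<Longrightarrow> i < deg s \<Longrightarrow> coeff (\<phi> (\<xi> s)) i = 0"
    and xi_lead: "\<And>s. s \<in> S \<Longrightarrow> coeff (\<phi> (\<xi> s)) (deg s) = Poly_Mapping.single s 1"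
    and generators: "\<And>v. v \<in> V \<Longrightarrow> \<exists>b. Poly_Mapping.keys b \<subseteq> {s \<in> S. deg s = 1} \<and>
      ideal_pow 2 (variable v - Poly_Mapping.single 0 (P v) - lift (Poly_Mapping.single 0) \<xi> b)"
begin

section \<open>The order filtration and the powers of the ideal of the point\<close>

lemmas phi_simps = coefficient_homD[OF phi_hom]

definition Xi :: "('m \<Rightarrow>\<^sub>0 'k) \<Rightarrow> ('v, 'k) mpolynomial" where
  "Xi b = lift (Poly_Mapping.single 0) \<xi> b"

definition Sd :: "nat \<Rightarrow> 'm set" where
  "Sd q = {s \<in> S. deg s = q}"

lemma zero_S [simp]: "0 \<in> S" and add_S: "s \<in> S \<Longrightarrow> t \<in> S \<Longrightarrow> s + t \<in> S"
  using S by (auto simp: additive_submonoid_def)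

lemma deg_0 [simp]: "deg 0 = 0"
  using deg_add[of 0 0] by simp

lemma Xi_add: "Xi (a + b) = Xi a + Xi b"
  by (simp add: Xi_def lift_add)

lemma Xi_0 [simp]: "Xi 0 = 0"
  by (simp add: Xi_def)

lemma Xi_diff: "Xi (a - b) = Xi a - Xi b"
  by (simp add: Xi_def lift_diff)

lemma Xi_sum: "Xi (sum f A) = (\<Sum>a\<in>A. Xi (f a))"
  by (simp add: Xi_def lift_sum)

lemma Xi_scale: "Xi (Poly_Mapping.single 0 c * b) = Poly_Mapping.single 0 c * Xi b"
  by (simp add: Xi_def lift_scale)

lemma Xi_C: "b \<in> supported S \<Longrightarrow> Xi b \<in> C"
  unfolding Xi_def lift_def by (rule supported_sum) (auto simp: supported_def[of S] xi_C)

lemma Xi_mult: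
  assumes "a \<in> supported S" "b \<in> supported S"
  shows "Xi (a * b) - Xi a * Xi b \<in> I"
proof -
  let ?c = "Poly_Mapping.single 0 :: 'k \<Rightarrow> ('v, 'k) mpolynomial"
  have "Xi (a * b) - Xi a * Xi b = (\<Sum>s\<in>Poly_Mapping.keys a. \<Sum>t\<in>Poly_Mapping.keys b.
     (?c (Poly_Mapping.lookup a s) * ?c (Poly_Mapping.lookup b t)) * (\<xi> (s + t) - \<xi> s * \<xi> t))"
    unfolding Xi_def lift_mult_expand[OF coefficient_hom_single]
    by (simp add: lift_def sum_product sum_subtractf right_diff_distrib mult_ac)
  also have "\<dots> \<in> I"
    using assms by (intro I_sum I_mult_left) (auto simp: xi_add supported_def[of S] subset_iff)
  finally show ?thesis .
qed

text \<open>The elements of order at least \<open>q\<close>: the candidate for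
  \<open>\<mm>^q + I\<close>, confirmed in \<open>ideal_pow_iff\<close>.\<close>

definition N :: "nat \<Rightarrow> ('v, 'k) mpolynomial set" where
  "N q = {p \<in> C. \<forall>i<q. coeff (\<phi> p) i = 0}"

lemma N_C: "p \<in> N q \<Longrightarrow> p \<in> C" by (simp add: N_def)

lemma N_mono: "p \<in> N q \<Longrightarrow> q' \<le> q \<Longrightarrow> p \<in> N q'" by (auto simp: N_def)

lemma N_add: "p \<in> N q \<Longrightarrow> r \<in> N q \<Longrightarrow> p + r \<in> N q" by (simp add: N_def phi_simps)

lemma N_I: "p \<in> I \<Longrightarrow> p \<in> N q" by (simp add: N_def phi_I I_supported)

lemma N_mult:
  assumes "p \<in> N i" "r \<in> N j"
  shows "p * r \<in> N (i + j)"
proof -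
  have "coeff (\<phi> p) k * coeff (\<phi> r) (n - k) = 0" if "n < i + j" "k \<le> n" for n k
  proof (cases "k < i")
    case False
    then have "n - k < j" using that by simp
    then show ?thesis using assms by (simp add: N_def)
  qed (use assms in \<open>simp add: N_def\<close>)
  then show ?thesis
    using assms M by (simp add: N_def phi_simps coeff_mult)
qed

lemma N_ev: "p \<in> C \<Longrightarrow> ev p = 0 \<Longrightarrow> p \<in> N 1"
  by (simp add: N_def phi_0)

lemma ideal_pow_N: "ideal_pow q p \<Longrightarrow> p \<in> N q"
proof (induction rule: ideal_pow.induct)
  case (ideal_pow_Suc a q b)
  then show ?case using N_mult[OF N_ev[of a], of b q] by simp
qed (auto simp: N_I N_add, simp add: N_def)

text \<open>A homogeneous combination is its own initial form, so it can be recovered from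
  \<open>Xi b\<close> even when terms of higher order are ignored.\<close>

lemma coeff_Xi:
  assumes "Poly_Mapping.keys b \<subseteq> Sd q"
  shows "i < q \<Longrightarrow> coeff (\<phi> (Xi b)) i = 0" "coeff (\<phi> (Xi b)) q = b"
proof -
  have *: "\<phi> (Xi b) = (\<Sum>s\<in>Poly_Mapping.keys b. [:Poly_Mapping.single 0 (Poly_Mapping.lookup b s):] * \<phi> (\<xi> s))"
    by (simp add: Xi_def lift_def coefficient_hom_sum[OF phi_hom] phi_simps phi_const)
  have mem: "s \<in> S" "deg s = q" if "s \<in> Poly_Mapping.keys b" for s
    using assms that by (auto simp: Sd_def)
  show "coeff (\<phi> (Xi b)) i = 0" if "i < q" 
    unfolding * using that mem by (simp add: coeff_sum xi_low)
  have "coeff (\<phi> (Xi b)) q = (\<Sum>s\<in>Poly_Mapping.keys b. Poly_Mapping.single 0 (Poly_Mapping.lookup b s) * Poly_Mapping.single s 1)"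
    unfolding * coeff_sum
  proof (rule sum.cong[OF refl])
    fix s assume "s \<in> Poly_Mapping.keys b"
    then show "coeff ([:Poly_Mapping.single 0 (Poly_Mapping.lookup b s):] * \<phi> (\<xi> s)) q =
      Poly_Mapping.single 0 (Poly_Mapping.lookup b s) * Poly_Mapping.single s 1"
      using xi_lead[of s] mem[of s] by simp
  qed
  also have "\<dots> = b"
    by (subst (5) poly_mapping_sum_single) (simp add: mult_single)
  finally show "coeff (\<phi> (Xi b)) q = b" .
qed

lemma Sd_supported: "Poly_Mapping.keys b \<subseteq> Sd q \<Longrightarrow> b \<in> supported S"
  by (auto simp: supported_def Sd_def)

lemma Xi_N: "Poly_Mapping.keys b \<subseteq> Sd q \<Longrightarrow> Xi b \<in> N q"
  by (simp add: N_def Xi_C coeff_Xi Sd_supported)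

lemma Sd_mult: "Poly_Mapping.keys a \<subseteq> Sd i \<Longrightarrow> Poly_Mapping.keys b \<subseteq> Sd j \<Longrightarrow> Poly_Mapping.keys (a * b) \<subseteq> Sd (i + j)"
  using Poly_Mapping.keys_mult[of a b] by (fastforce simp: Sd_def add_S deg_add)

lemma Sd_add: "Poly_Mapping.keys a \<subseteq> Sd i \<Longrightarrow> Poly_Mapping.keys b \<subseteq> Sd i \<Longrightarrow> Poly_Mapping.keys (a + b) \<subseteq> Sd i"
  using Poly_Mapping.keys_add[of a b] by blast

lemma Sd_scale: "Poly_Mapping.keys a \<subseteq> Sd i \<Longrightarrow> Poly_Mapping.keys (Poly_Mapping.single 0 c * a) \<subseteq> Sd i"
  using Sd_mult[of "Poly_Mapping.single 0 c" 0 a i] by (simp add: Sd_def)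

lemma ideal_pow_Xi_1: "Poly_Mapping.keys b \<subseteq> Sd 1 \<Longrightarrow> ideal_pow 1 (Xi b)"
proof -
  assume b: "Poly_Mapping.keys b \<subseteq> Sd 1"
  have "coeff (\<phi> (Xi b)) 0 = 0" using coeff_Xi(1)[OF b] by simp
  then have "ev (Xi b) = 0"
    using phi_0[OF Xi_C[OF Sd_supported[OF b]]] by (metis lookup_single_eq lookup_zero)
  then show ?thesis using ideal_pow_1[OF Xi_C[OF Sd_supported[OF b]]] by simp
qed

text \<open>First-order expansion at the point. The polynomials that have one form a class closed
  under sums and, by the Leibniz rule, under products; so the case of the coordinates, given by
  \<open>generators\<close>, is enough.\<close>

lemma linear_part:
  assumes "p \<in> C"
  shows "\<exists>b. Poly_Mapping.keys b \<subseteq> Sd 1 \<and> ideal_pow 2 (p - Poly_Mapping.single 0 (ev p) - Xi b)"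
proof -
  let ?c = "Poly_Mapping.single 0 :: 'k \<Rightarrow> ('v, 'k) mpolynomial"
  define good where "good p \<longleftrightarrow> p \<in> C \<and>
    (\<exists>b. Poly_Mapping.keys b \<subseteq> Sd 1 \<and> ideal_pow 2 (p - ?c (ev p) - Xi b))" for p
  have add: "good (p + r)" if pr: "good p" "good r" for p r
  proof -
    obtain a b where "Poly_Mapping.keys a \<subseteq> Sd 1" "ideal_pow 2 (p - ?c (ev p) - Xi a)"
      "Poly_Mapping.keys b \<subseteq> Sd 1" "ideal_pow 2 (r - ?c (ev r) - Xi b)"
      using pr unfolding good_def by blast
    moreover have "(p + r) - ?c (ev (p + r)) - Xi (a + b) = (p - ?c (ev p) - Xi a) + (r - ?c (ev r) - Xi b)"
      by (simp add: ev_simps single_add Xi_add)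
    ultimately show ?thesis
      using pr unfolding good_def by (metis Sd_add ideal_pow_add supported_add)
  qed
  have const: "good (?c c)" for c
    unfolding good_def by (auto intro!: exI[of _ 0] ideal_powI)
  have mult: "good (p * r)" if pr: "good p" "good r" for p r
  proof -
    obtain a b where ab: "Poly_Mapping.keys a \<subseteq> Sd 1" "ideal_pow 2 (p - ?c (ev p) - Xi a)"
      "Poly_Mapping.keys b \<subseteq> Sd 1" "ideal_pow 2 (r - ?c (ev r) - Xi b)"
      using pr unfolding good_def by blast
    have C: "p \<in> C" "r \<in> C" using pr by (auto simp: good_def)
    \<comment> \<open>Both factors vanish at the point, so their product is of second order; the
      Leibniz terms are collected in \<open>?d\<close>.\<close>
    have 1: "ideal_pow (1 + 1) ((p - ?c (ev p)) * (r - ?c (ev r)))"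
      using C by (intro ideal_pow_mult) (auto intro!: ideal_pow_1 simp: ev_simps)
    let ?d = "?c (ev r) * (p - ?c (ev p) - Xi a) + ?c (ev p) * (r - ?c (ev r) - Xi b)"
    have 2: "ideal_pow 2 ?d"
      using ab by (intro ideal_pow_add ideal_pow_mult_left) auto
    have "p * r - ?c (ev (p * r)) - Xi (Poly_Mapping.single 0 (ev r) * a + Poly_Mapping.single 0 (ev p) * b) =
      (p - ?c (ev p)) * (r - ?c (ev r)) + ?d"
    proof -
      have "?c (ev (p * r)) = ?c (ev p) * ?c (ev r)" by (simp add: ev_simps mult_single)
      then show ?thesis by (simp add: Xi_add Xi_scale) (simp add: algebra_simps)
    qed
    also have "ideal_pow 2 \<dots>" using ideal_pow_add[OF _ 2] 1 by (simp add: numeral_2_eq_2)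
    finally have "ideal_pow 2 (p * r - ?c (ev (p * r)) -
      Xi (Poly_Mapping.single 0 (ev r) * a + Poly_Mapping.single 0 (ev p) * b))" .
    moreover have "Poly_Mapping.keys (Poly_Mapping.single 0 (ev r) * a + Poly_Mapping.single 0 (ev p) * b) \<subseteq> Sd 1"
      using ab by (intro Sd_add Sd_scale)
    ultimately show ?thesis
      using C M unfolding good_def by (intro conjI supported_mult exI)
  qed
  have var: "good (variable v)" if "v \<in> V" for v
    using generators[OF that] that unfolding good_def Sd_def Xi_def by auto
  have mon: "good (Poly_Mapping.single (exponent A) 1)" if "set_mset A \<subseteq> V" for A
    using that
  proof (induction A)
    case empty
    then show ?case using const[of 1] by simp
  next
    case (add v A)
    have "Poly_Mapping.single (exponent (add_mset v A)) (1::'k) = variable v * Poly_Mapping.single (exponent A) 1"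
      by (simp add: variable_def mult_single)
    then show ?case using mult[OF var[of v] add.IH] add.prems by simp
  qed
  have "good (\<Sum>m\<in>A. Poly_Mapping.single m (Poly_Mapping.lookup p m))" if "A \<subseteq> Poly_Mapping.keys p" for A
    using finite_subset[OF that finite_keys] that
  proof (induction A)
    case empty
    then show ?case using const[of 0] by simp
  next
    case (insert m A)
    obtain B where B: "m = exponent B" using ex_exponent by blast
    have "set_mset B \<subseteq> V"
      using insert.prems assms B keys_exponent[of B] by (fastforce simp: supported_def monomials_def)
    moreover have "Poly_Mapping.single m (Poly_Mapping.lookup p m) = ?c (Poly_Mapping.lookup p m) * Poly_Mapping.single m 1"
      by (simp add: mult_single)
    ultimately have "good (Poly_Mapping.single m (Poly_Mapping.lookup p m))"
      using mult[OF const mon[of B]] B by simp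
    then show ?case using insert add by simp
  qed
  from this[OF order.refl] have "good p" by (simp flip: poly_mapping_sum_single)
  then show ?thesis by (simp add: good_def)
qed

text \<open>Induction along the generation of \<mm>^q. In a product \<open>a * b\<close> the factor
  \<open>a\<close> is replaced by its linear part and \<open>b\<close> by its part of degree
  \<open>q\<close>; each replacement costs an element of \<mm>^(q+2), and so does the defect of
  multiplicativity, which lies in \<open>I\<close>. In degree 0 the constant is reached through
  \<open>\<xi> 0\<close>, which is 1 modulo \<open>I\<close>.\<close>

lemma homogeneous_part_exists:
  "ideal_pow q p \<Longrightarrow> \<exists>b. Poly_Mapping.keys b \<subseteq> Sd q \<and> ideal_pow (Suc q) (p - Xi b)"
proof (induction rule: ideal_pow.induct)
  case (ideal_powI p q)
  then show ?case by (auto intro!: exI[of _ 0] ideal_pow.ideal_powI)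
next
  case (ideal_pow0 p)
  let ?c = "Poly_Mapping.single 0 (ev p) :: ('v, 'k) mpolynomial"
  have "p - Xi (Poly_Mapping.single 0 (ev p)) = (p - ?c) - ?c * (\<xi> 0 - 1)"
    by (simp add: Xi_def lift_single algebra_simps)
  moreover have "ideal_pow (Suc 0) ((p - ?c) - ?c * (\<xi> 0 - 1))"
    using ideal_pow0 xi_0 by (intro ideal_pow_diff ideal_pow_1 ideal_powI I_mult_left) (auto simp: ev_simps)
  ultimately have "ideal_pow (Suc 0) (p - Xi (Poly_Mapping.single 0 (ev p)))" by metis
  moreover have "Poly_Mapping.keys (Poly_Mapping.single 0 (ev p)) \<subseteq> Sd 0"
    by (simp add: Sd_def)
  ultimately show ?case by blast
next
  case (ideal_pow_Suc a q b)
  then obtain d where d: "Poly_Mapping.keys d \<subseteq> Sd q" "ideal_pow (Suc q) (b - Xi d)" by blast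
  obtain c where c: "Poly_Mapping.keys c \<subseteq> Sd 1" "ideal_pow 2 (a - Xi c)"
    using linear_part[of a] ideal_pow_Suc by auto
  have "ideal_pow (2 + q) ((a - Xi c) * b)"
    using c ideal_pow_Suc by (intro ideal_pow_mult)
  moreover have "ideal_pow (1 + Suc q) (Xi c * (b - Xi d))"
    using c d by (intro ideal_pow_mult ideal_pow_Xi_1)
  moreover have "ideal_pow (Suc (Suc q)) (Xi (c * d) - Xi c * Xi d)"
    using c d by (intro ideal_powI Xi_mult) (auto intro: Sd_supported)
  ultimately have "ideal_pow (Suc (Suc q)) ((a - Xi c) * b + Xi c * (b - Xi d) - (Xi (c * d) - Xi c * Xi d))"
    using ideal_pow_diff[OF ideal_pow.ideal_pow_add] by simp
  moreover have "(a - Xi c) * b + Xi c * (b - Xi d) - (Xi (c * d) - Xi c * Xi d) = a * b - Xi (c * d)"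
    by (simp add: algebra_simps)
  ultimately show ?case
    using Sd_mult[OF c(1) d(1)] by auto
next
  case (ideal_pow_add q a b)
  then obtain c d where "Poly_Mapping.keys c \<subseteq> Sd q" "ideal_pow (Suc q) (a - Xi c)"
    "Poly_Mapping.keys d \<subseteq> Sd q" "ideal_pow (Suc q) (b - Xi d)" by blast
  moreover have "a + b - Xi (c + d) = (a - Xi c) + (b - Xi d)" by (simp add: Xi_add)
  ultimately show ?case by (metis Sd_add ideal_pow.ideal_pow_add)
qed

text \<open>An element of order at least q+1 lies in \<mm>^q by induction and so has a homogeneous
  part of degree q. That part is the coefficient of t^q, hence zero, and what remains is in
  \<mm>^(q+1).\<close>

lemma N_imp_ideal_pow: "p \<in> N q \<Longrightarrow> ideal_pow q p"
proof (induction q)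
  case 0
  then show ?case by (intro ideal_pow0 N_C)
next
  case (Suc q)
  then obtain b where b: "Poly_Mapping.keys b \<subseteq> Sd q" "ideal_pow (Suc q) (p - Xi b)"
    using homogeneous_part_exists[OF Suc.IH[OF N_mono[OF Suc.prems]]] by auto
  have "coeff (\<phi> (p - Xi b)) q = 0" using ideal_pow_N[OF b(2)] by (simp add: N_def)
  then have "b = 0" using Suc.prems coeff_Xi(2)[OF b(1)] by (simp add: N_def phi_simps)
  then show ?case using b(2) by simp
qed

lemma ideal_pow_iff: "ideal_pow q p \<longleftrightarrow> p \<in> N q"
  using ideal_pow_N N_imp_ideal_pow by blast

subsection \<open>Powers of the maximal ideal\<close>

abbreviation "mm \<equiv> local_max_ideal X P"
abbreviation "mpow \<equiv> ideal_power LR mm"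

lemma frac_mm: "p \<in> C \<Longrightarrow> ev p = 0 \<Longrightarrow> r \<in> U \<Longrightarrow> frac p r \<in> mm"
  unfolding local_max_ideal_eq by blast

lemma mmE:
  assumes "x \<in> mm" obtains p r where "p \<in> C" "ev p = 0" "r \<in> U" "x = frac p r"
  using assms unfolding local_max_ideal_eq by blast

text \<open>The constant coefficient of \<open>f\<close> is a nonzero scalar, so multiplication by
  \<open>f\<close> cannot raise the order. This removes denominators and multipliers from an
  equality of fractions, although K[S][t] is not assumed to be a domain.\<close>

lemma order_cancel:
  fixes f g :: "('m \<Rightarrow>\<^sub>0 'k) poly"
  assumes "coeff f 0 = Poly_Mapping.single 0 c" "c \<noteq> 0" "\<forall>i<q. coeff (f * g) i = 0"
  shows "\<forall>i<q. coeff g i = 0"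
proof (intro allI impI)
  fix i assume "i < q"
  then show "coeff g i = 0"
  proof (induction i rule: less_induct)
    case (less i)
    have "0 = coeff (f * g) i" using assms(3) less by simp
    also have "\<dots> = coeff f 0 * coeff g i"
      unfolding coeff_mult by (rule sum.remove[of _ 0, THEN trans]) (use less in \<open>auto intro!: sum.neutral\<close>)
    finally have "Poly_Mapping.single 0 (inverse c) * (Poly_Mapping.single 0 c * coeff g i) = 0"
      using assms(1) by simp
    then show ?case using assms(2) by (simp flip: mult.assoc add: mult_single)
  qed
qed

lemma frac_order:
  assumes "p \<in> C" "r \<in> U" "p' \<in> N q" "r' \<in> U" "frac p r = frac p' r'"
  shows "p \<in> N q"
proof -
  obtain u where u: "u \<in> U" "u * (r' * p - r * p') \<in> I"
    using assms frac_eq_iff[of p r p' r'] N_C by blast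
  then have "\<phi> (u * r') * \<phi> p = \<phi> (u * r * p')"
    using phi_I[OF u(2)] by (simp add: phi_simps algebra_simps)
  moreover have "u * r * p' \<in> N (0 + q)"
    using assms u M by (intro N_mult) (auto simp: N_def U_C)
  ultimately have "\<forall>i<q. coeff (\<phi> (u * r') * \<phi> p) i = 0"
    by (simp add: N_def)
  moreover have "u * r' \<in> U" using u assms by simp
  ultimately have "\<forall>i<q. coeff (\<phi> p) i = 0"
    using order_cancel[of "\<phi> (u * r')" "ev (u * r')" q "\<phi> p"] phi_0[of "u * r'"] by (simp add: U_def)
  then show ?thesis using assms by (simp add: N_def)
qed

lemma ideal_pow_in_pow: "ideal_pow q p \<Longrightarrow> frac p 1 \<in> mpow q"
proof (induction rule: ideal_pow.induct)
  case (ideal_powI p q)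
  have 0: "frac 0 1 \<in> mpow q" for q
  proof (induction q)
    case (Suc q)
    have "frac 0 1 \<otimes>\<^bsub>LR\<^esub> frac 0 1 \<in> mpow (Suc q)"
      unfolding ideal_power.simps using Suc by (intro ideal_prod.prod frac_mm) (auto simp: ev_simps)
    then show ?case by (simp add: mult_LR)
  qed simp
  moreover have "frac p 1 = frac 0 1" using ideal_powI by (intro frac_eqI) (auto simp: I_supported)
  ultimately show ?case by simp
next
  case (ideal_pow_Suc a q b)
  then have "frac a 1 \<otimes>\<^bsub>LR\<^esub> frac b 1 \<in> mpow (Suc q)"
    unfolding ideal_power.simps by (intro ideal_prod.prod frac_mm) auto
  then show ?case using ideal_pow_Suc by (simp add: mult_LR ideal_pow_C)
next
  case (ideal_pow_add q a b)
  have "frac a 1 \<oplus>\<^bsub>LR\<^esub> frac b 1 \<in> mpow q"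
  proof (cases q)
    case (Suc q')
    then show ?thesis using ideal_pow_add by (simp add: ideal_prod.sum)
  qed (use ideal_pow_add in \<open>simp add: add_LR ideal_pow_C\<close>)
  then show ?case using ideal_pow_add by (simp add: add_LR ideal_pow_C)
qed simp

lemma pow_subset: "x \<in> mpow q \<Longrightarrow> \<exists>p\<in>N q. \<exists>r\<in>U. x = frac p r"
proof (induction q arbitrary: x)
  case 0
  then show ?case by (auto simp: carrier_LR N_def)
next
  case (Suc q)
  from Suc.prems have "x \<in> ideal_prod LR mm (mpow q)" by simp
  then show ?case
  proof (induction rule: ideal_prod.induct)
    case (prod i j)
    obtain p r where 1: "p \<in> C" "ev p = 0" "r \<in> U" "i = frac p r" using prod mmE by blast
    obtain p' r' where 2: "p' \<in> N q" "r' \<in> U" "j = frac p' r'" using prod Suc.IH by blast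
    have "p * p' \<in> N (Suc q)" using 1 2 N_mult[OF N_ev[of p], of p' q] by simp
    moreover have "i \<otimes>\<^bsub>LR\<^esub> j = frac (p * p') (r * r')" using 1 2 by (simp add: mult_LR N_C)
    ultimately show ?case using U_mult[OF 1(3) 2(2)] by blast
  next
    case (sum s1 s2)
    then obtain p r p' r' where pr: "p \<in> N (Suc q)" "r \<in> U" "s1 = frac p r" "p' \<in> N (Suc q)" "r' \<in> U" "s2 = frac p' r'"
      by blast
    have "r' \<in> N 0" "r \<in> N 0" using pr by (simp_all add: N_def U_C)
    then have "r' * p + r * p' \<in> N (Suc q)"
      using pr N_mult[of r' 0 p "Suc q"] N_mult[of r 0 p' "Suc q"] by (intro N_add) auto
    moreover have "s1 \<oplus>\<^bsub>LR\<^esub> s2 = frac (r' * p + r * p') (r * r')" using pr by (simp add: add_LR N_C)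
    ultimately show ?case using U_mult[OF pr(2,5)] by blast
  qed
qed

lemma ideal_mm: "ideal mm LR"
proof -
  interpret LR: cring LR by (rule cring_LR)
  show ?thesis
  proof (rule idealI)
    show "ring LR" by (rule LR.ring_axioms)
    show "subgroup mm (add_monoid LR)"
    proof (rule LR.add.subgroupI)
      show "mm \<subseteq> carrier LR" using frac_carrier by (auto elim!: mmE)
      have "frac 0 1 \<in> mm" by (rule frac_mm) (auto simp: ev_simps)
      then show "mm \<noteq> {}" by blast
      fix x assume "x \<in> mm"
      then obtain p r where "p \<in> C" "ev p = 0" "r \<in> U" "x = frac p r" by (rule mmE)
      then show "\<ominus>\<^bsub>LR\<^esub> x \<in> mm"
        using frac_mm[of "- p" r] by (simp add: a_inv_LR ev_simps)
    next
      fix x y assume "x \<in> mm" "y \<in> mm"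
      then obtain p r p' r' where "p \<in> C" "ev p = 0" "r \<in> U" "x = frac p r" "p' \<in> C" "ev p' = 0" "r' \<in> U" "y = frac p' r'"
        by (metis mmE)
      then show "x \<oplus>\<^bsub>LR\<^esub> y \<in> mm"
        using frac_mm[of "r' * p + r * p'" "r * r'"] by (simp add: add_LR ev_simps U_C)
    qed
    fix a x assume "a \<in> mm" "x \<in> carrier LR"
    then obtain p r p' r' where "p \<in> C" "ev p = 0" "r \<in> U" "a = frac p r" "p' \<in> C" "r' \<in> U" "x = frac p' r'"
      by (metis mmE carrier_LRE)
    then show "x \<otimes>\<^bsub>LR\<^esub> a \<in> mm" "a \<otimes>\<^bsub>LR\<^esub> x \<in> mm"
      using frac_mm[of "p * p'" "r * r'"] by (simp_all add: mult_LR ev_simps U_C mult.commute)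
  qed
qed

lemma ideal_pow_ideal: "ideal (mpow q) LR"
proof -
  interpret LR: cring LR by (rule cring_LR)
  show ?thesis
    by (induction q) (auto intro: LR.ideal_prod_is_ideal ideal_mm LR.oneideal)
qed

text \<open>Denominators are units of the local ring, so the power of the maximal ideal containing a
  fraction is decided by the order of its numerator alone.\<close>

lemma pow_iff:
  assumes "p \<in> C" "r \<in> U"
  shows "frac p r \<in> mpow q \<longleftrightarrow> p \<in> N q"
proof
  assume "frac p r \<in> mpow q"
  then obtain p' r' where "p' \<in> N q" "r' \<in> U" "frac p r = frac p' r'" using pow_subset by blast
  then show "p \<in> N q" using frac_order assms by blast
next
  assume "p \<in> N q"
  then have "frac p 1 \<in> mpow q" by (simp add: ideal_pow_in_pow ideal_pow_iff)
  moreover have "frac 1 r \<in> carrier LR" using assms by simp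
  ultimately have "frac p 1 \<otimes>\<^bsub>LR\<^esub> frac 1 r \<in> mpow q"
    using ideal.I_r_closed[OF ideal_pow_ideal] by blast
  then show "frac p r \<in> mpow q" using assms by (simp add: mult_LR)
qed

end

declare ideal_power.simps [simp del]

section \<open>The isomorphism from the monoid algebra to the tangent cone\<close>

context graded_model
begin

abbreviation "TC \<equiv> tangent_cone X P"

definition coset :: "nat \<Rightarrow> ('v, 'k) mpolynomial \<Rightarrow> ('v, 'k) mpolynomial \<Rightarrow> ('v, 'k) germ set" where
  "coset q p r = mpow (Suc q) +>\<^bsub>LR\<^esub> frac p r"

lemma coset_eq_iff:
  assumes "p \<in> C" "r \<in> U" "p' \<in> C" "r' \<in> U"
  shows "coset q p r = coset q p' r' \<longleftrightarrow> r' * p - r * p' \<in> N (Suc q)"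
proof -
  interpret LR: cring LR by (rule cring_LR)
  have "frac p r \<ominus>\<^bsub>LR\<^esub> frac p' r' = frac (r' * p - r * p') (r * r')"
    using assms by (simp add: a_minus_def a_inv_LR add_LR)
  then show ?thesis
    using LR.quotient_eq_iff_same_a_r_cos[OF ideal_pow_ideal, of "frac p r" "frac p' r'" "Suc q"] assms
      pow_iff[of "r' * p - r * p'" "r * r'" "Suc q"]
    by (simp add: coset_def U_C)
qed

lemma coset_zero: "coset q 0 1 = mpow (Suc q)"
proof -
  interpret LR: cring LR by (rule cring_LR)
  show ?thesis
    unfolding coset_def by (rule LR.a_rcos_zero[OF ideal_pow_ideal]) (simp add: pow_iff N_def phi_simps)
qed

lemma coset_eq_zero_iff: "p \<in> C \<Longrightarrow> coset q p 1 = mpow (Suc q) \<longleftrightarrow> p \<in> N (Suc q)"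
  using coset_eq_iff[of p 1 0 1 q] by (simp add: coset_zero)

lemma coset_add:
  assumes "p \<in> C" "r \<in> U" "p' \<in> C" "r' \<in> U"
  shows "coset q p r <+>\<^bsub>LR\<^esub> coset q p' r' = coset q (r' * p + r * p') (r * r')"
  using ideal.a_rcos_sum[OF ideal_pow_ideal, of "frac p r" "frac p' r'" "Suc q"] assms
  by (simp add: coset_def add_LR)

lemma mem_cosetE:
  assumes "x \<in> coset q p r" "p \<in> C" "r \<in> U"
  obtains p' r' where "p' \<in> C" "r' \<in> U" "x = frac p' r'" "r * p' - r' * p \<in> N (Suc q)"
proof -
  interpret LR: cring LR by (rule cring_LR)
  interpret I: ideal "mpow (Suc q)" LR by (rule ideal_pow_ideal)
  have x: "x \<in> carrier LR"
    using assms I.a_Hcarr I.a_subset by (auto simp: coset_def a_r_coset_def')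
  then obtain p' r' where pr: "p' \<in> C" "r' \<in> U" "x = frac p' r'" by (rule carrier_LRE)
  have "mpow (Suc q) +>\<^bsub>LR\<^esub> frac p r = mpow (Suc q) +>\<^bsub>LR\<^esub> x"
    using assms by (intro LR.a_repr_independence I.a_subgroup) (auto simp: coset_def)
  then have "coset q p' r' = coset q p r" using pr by (simp add: coset_def)
  then show thesis using that pr assms by (simp add: coset_eq_iff)
qed

lemma coset_self: "p \<in> C \<Longrightarrow> r \<in> U \<Longrightarrow> frac p r \<in> coset q p r"
proof -
  assume "p \<in> C" "r \<in> U"
  interpret I: ideal "mpow (Suc q)" LR by (rule ideal_pow_ideal)
  show ?thesis
    using \<open>p \<in> C\<close> \<open>r \<in> U\<close> I.a_rcos_self by (simp add: coset_def)
qed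

lemma coset_UN:
  assumes "p \<in> C" "r \<in> U"
    and "\<And>p' r'. p' \<in> C \<Longrightarrow> r' \<in> U \<Longrightarrow> r * p' - r' * p \<in> N (Suc q) \<Longrightarrow> f (frac p' r') = Z"
  shows "(\<Union>x\<in>coset q p r. f x) = Z"
proof -
  have "f x = Z" if "x \<in> coset q p r" for x
    using mem_cosetE[OF that assms(1,2)] assms(3) by metis
  then show ?thesis using coset_self[OF assms(1,2)] by blast
qed

lemma gr_mult_coset:
  assumes "p \<in> N i" "p' \<in> N j"
  shows "gr_mult LR mm i j (coset i p 1) (coset j p' 1) = coset (i + j) (p * p') 1"
  unfolding gr_mult_def
proof (rule coset_UN, goal_cases)
  case (3 a r)
  show ?case
  proof (rule coset_UN, goal_cases)
    case (3 b s)
    have ar: "a - r * p \<in> N (Suc i)" "r \<in> N 0" "b - s * p' \<in> N (Suc j)" "s \<in> N 0"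
      using \<open>1 * a - r * p \<in> _\<close> \<open>r \<in> U\<close> 3 by (auto simp: N_def U_C)
    have "b \<in> N j"
      using N_add[of "b - s * p'" j "s * p'"] N_mono[OF ar(3)] N_mult[OF ar(4) assms(2)] by simp
    then have "(a - r * p) * b + (r * p) * (b - s * p') \<in> N (Suc (i + j))"
      using N_mult[OF ar(1), of b j] N_mult[OF N_mult[OF ar(2) assms(1)] ar(3)] by (intro N_add) auto
    then have "1 * (a * b) - (r * s) * (p * p') \<in> N (Suc (i + j))"
      by (simp add: algebra_simps)
    then have "coset (i + j) (a * b) (r * s) = coset (i + j) (p * p') 1"
      using \<open>a \<in> C\<close> \<open>r \<in> U\<close> 3 assms M by (subst coset_eq_iff) (auto simp: N_C)
    then show ?case
      using \<open>a \<in> C\<close> \<open>r \<in> U\<close> 3 by (simp add: coset_def mult_LR)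
  qed (use assms in \<open>auto simp: N_C\<close>)
qed (use assms in \<open>auto simp: N_C\<close>)

lemma smult_coset:
  assumes "p \<in> C"
  shows "(\<Union>x\<in>coset q p 1. mpow (Suc q) +>\<^bsub>LR\<^esub> (c \<odot>\<^bsub>LR\<^esub> x)) = coset q (Poly_Mapping.single 0 c * p) 1"
proof (rule coset_UN, goal_cases)
  case (3 a r)
  have "Poly_Mapping.single 0 c * (1 * a - r * p) \<in> N (0 + Suc q)"
    using 3 by (intro N_mult) (auto simp: N_def)
  then have "1 * (Poly_Mapping.single 0 c * a) - r * (Poly_Mapping.single 0 c * p) \<in> N (Suc q)"
    by (simp add: algebra_simps)
  then have "coset q (Poly_Mapping.single 0 c * a) r = coset q (Poly_Mapping.single 0 c * p) 1"
    using 3 assms M by (subst coset_eq_iff) auto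
  then show ?case using 3 by (simp add: coset_def smult_LR)
qed (use assms in auto)

text \<open>A denominator is congruent to its value modulo \<mm>; on \<mm>^q / \<mm>^(q+1) dividing
  by it is therefore multiplication by a scalar, and polynomial representatives suffice.\<close>

lemma gr_component_eq: "gr_component LR mm q = {coset q p 1 | p. p \<in> N q}"
proof (intro equalityI subsetI)
  fix Y assume "Y \<in> gr_component LR mm q"
  then obtain x where x: "x \<in> mpow q" "Y = mpow (Suc q) +>\<^bsub>LR\<^esub> x" by (auto simp: gr_component_def)
  then obtain p r where pr: "p \<in> N q" "r \<in> U" "x = frac p r" using pow_subset by blast
  let ?c = "Poly_Mapping.single 0 (1 / ev r) :: ('v, 'k) mpolynomial"
  have "1 - r * ?c \<in> N 1" using pr M by (intro N_ev) (auto simp: ev_simps U_def)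
  then have "(1 - r * ?c) * p \<in> N (1 + q)" using pr by (intro N_mult)
  then have "1 * p - r * (?c * p) \<in> N (Suc q)" by (simp add: algebra_simps)
  then have "coset q p r = coset q (?c * p) 1" using pr M by (subst coset_eq_iff) (auto simp: N_C)
  moreover have "?c * p \<in> N (0 + q)" using pr by (intro N_mult) (auto simp: N_def)
  ultimately show "Y \<in> {coset q p 1 | p. p \<in> N q}" using x pr by (auto simp: coset_def)
next
  fix Y assume "Y \<in> {coset q p 1 | p. p \<in> N q}"
  then obtain p where p: "p \<in> N q" "Y = coset q p 1" by blast
  then have "frac p 1 \<in> mpow q" by (simp add: pow_iff N_C)
  then show "Y \<in> gr_component LR mm q" using p by (auto simp: gr_component_def coset_def)
qed

lemma finsum_coset:
  assumes "finite A" "\<And>a. a \<in> A \<Longrightarrow> f a \<in> C"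
  shows "finsum (LR Quot mpow (Suc q)) (\<lambda>a. coset q (f a) 1) A = coset q (sum f A) 1"
proof -
  interpret LR: cring LR by (rule cring_LR)
  interpret I: ideal "mpow (Suc q)" LR by (rule ideal_pow_ideal)
  interpret Quot: ring "LR Quot mpow (Suc q)" by (rule I.quotient_is_ring)
  have car: "coset q p 1 \<in> carrier (LR Quot mpow (Suc q))" if "p \<in> C" for p
    using that by (auto simp: FactRing_def A_RCOSETS_def' coset_def)
  show ?thesis using assms
  proof (induction A)
    case empty
    then show ?case by (simp add: coset_zero) (simp add: FactRing_def)
  next
    case (insert a A)
    have "finsum (LR Quot mpow (Suc q)) (\<lambda>a. coset q (f a) 1) (insert a A) =
      coset q (f a) 1 \<oplus>\<^bsub>LR Quot mpow (Suc q)\<^esub> coset q (sum f A) 1"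
      using insert car by (subst Quot.finsum_insert) auto
    also have "\<dots> = coset q (f a) 1 <+>\<^bsub>LR\<^esub> coset q (sum f A) 1"
      by (simp add: FactRing_def)
    also have "\<dots> = coset q (f a + sum f A) 1"
      using insert.prems by (subst coset_add) (auto intro: supported_sum)
    finally show ?case using insert by simp
  qed
qed

definition part :: "nat \<Rightarrow> ('m \<Rightarrow>\<^sub>0 'k) \<Rightarrow> ('m \<Rightarrow>\<^sub>0 'k)" where
  "part q = lift (Poly_Mapping.single 0) (\<lambda>s. if deg s = q then Poly_Mapping.single s 1 else 0)"

lemma part_add: "part q (a + b) = part q a + part q b"
  by (simp add: part_def lift_add)

lemma part_scale: "part q (Poly_Mapping.single 0 c * b) = Poly_Mapping.single 0 c * part q b"
  by (simp add: part_def lift_scale)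

lemma part_sum: "part q (sum f A) = (\<Sum>a\<in>A. part q (f a))"
  by (simp add: part_def lift_sum)

lemma lookup_part: "Poly_Mapping.lookup (part q b) s = (if deg s = q then Poly_Mapping.lookup b s else 0)"
proof -
  have "part q b = (\<Sum>t\<in>Poly_Mapping.keys b. if deg t = q then Poly_Mapping.single t (Poly_Mapping.lookup b t) else 0)"
    unfolding part_def lift_def by (intro sum.cong) (auto simp: mult_single)
  then have "Poly_Mapping.lookup (part q b) s = (\<Sum>t\<in>Poly_Mapping.keys b. Poly_Mapping.lookup
      (if deg t = q then Poly_Mapping.single t (Poly_Mapping.lookup b t) else 0) s)"
    by (simp only: lookup_sum)
  also have "\<dots> = (\<Sum>t\<in>Poly_Mapping.keys b. if t = s then (if deg s = q then Poly_Mapping.lookup b s else 0) else 0)"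
    by (intro sum.cong) (auto simp: lookup_single)
  also have "\<dots> = (if deg s = q then Poly_Mapping.lookup b s else 0)"
    by (subst sum.delta) (auto simp: in_keys_iff)
  finally show ?thesis .
qed

lemma keys_part: "b \<in> supported S \<Longrightarrow> Poly_Mapping.keys (part q b) \<subseteq> Sd q"
  by (auto simp: in_keys_iff lookup_part Sd_def supported_def subset_iff split: if_splits)

lemma part_homogeneous:
  assumes "Poly_Mapping.keys b \<subseteq> Sd q"
  shows "part q' b = (if q' = q then b else 0)"
proof (rule poly_mapping_eqI)
  fix s
  show "Poly_Mapping.lookup (part q' b) s = Poly_Mapping.lookup (if q' = q then b else 0) s"
  proof (cases "s \<in> Poly_Mapping.keys b")
    case True
    then show ?thesis using assms by (auto simp: lookup_part Sd_def)
  qed (auto simp: lookup_part in_keys_iff)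
qed

lemma part_mult:
  assumes "a \<in> supported S" "b \<in> supported S"
  shows "part q (a * b) = (\<Sum>i\<le>q. part i a * part (q - i) b)"
proof -
  let ?c = "Poly_Mapping.single 0 :: 'k \<Rightarrow> 'm \<Rightarrow>\<^sub>0 'k"
  let ?\<mu> = "\<lambda>q s. if deg s = q then Poly_Mapping.single s 1 else 0 :: 'm \<Rightarrow>\<^sub>0 'k"
  have "(\<Sum>i\<le>q. part i a * part (q - i) b) =
    (\<Sum>i\<le>q. \<Sum>s\<in>Poly_Mapping.keys a. \<Sum>t\<in>Poly_Mapping.keys b.
      ?c (Poly_Mapping.lookup a s) * ?c (Poly_Mapping.lookup b t) * (?\<mu> i s * ?\<mu> (q - i) t))"
    unfolding part_def lift_def sum_product by (intro sum.cong refl) (simp only: mult_ac)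
  also have "\<dots> = (\<Sum>s\<in>Poly_Mapping.keys a. \<Sum>i\<le>q. \<Sum>t\<in>Poly_Mapping.keys b.
      ?c (Poly_Mapping.lookup a s) * ?c (Poly_Mapping.lookup b t) * (?\<mu> i s * ?\<mu> (q - i) t))"
    by (rule sum.swap)
  also have "\<dots> = (\<Sum>s\<in>Poly_Mapping.keys a. \<Sum>t\<in>Poly_Mapping.keys b. \<Sum>i\<le>q.
      ?c (Poly_Mapping.lookup a s) * ?c (Poly_Mapping.lookup b t) * (?\<mu> i s * ?\<mu> (q - i) t))"
    by (intro sum.cong refl sum.swap)
  also have "\<dots> = (\<Sum>s\<in>Poly_Mapping.keys a. \<Sum>t\<in>Poly_Mapping.keys b.
      ?c (Poly_Mapping.lookup a s) * ?c (Poly_Mapping.lookup b t) * ?\<mu> q (s + t))"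
  proof (intro sum.cong refl)
    fix s t assume "s \<in> Poly_Mapping.keys a" "t \<in> Poly_Mapping.keys b"
    then have st: "deg (s + t) = deg s + deg t" using assms by (intro deg_add) (auto simp: supported_def)
    have "(\<Sum>i\<le>q. ?\<mu> i s * ?\<mu> (q - i) t) = (\<Sum>i\<le>q. if i = deg s then ?\<mu> q (s + t) else 0)"
      by (intro sum.cong refl) (auto simp: mult_single st)
    also have "\<dots> = ?\<mu> q (s + t)"
      by (auto simp: st)
    finally show "(\<Sum>i\<le>q. ?c (Poly_Mapping.lookup a s) * ?c (Poly_Mapping.lookup b t) * (?\<mu> i s * ?\<mu> (q - i) t)) =
      ?c (Poly_Mapping.lookup a s) * ?c (Poly_Mapping.lookup b t) * ?\<mu> q (s + t)"
      by (simp only: sum_distrib_left[symmetric])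
  qed
  also have "\<dots> = part q (a * b)"
    unfolding part_def lift_mult_expand[OF coefficient_hom_single] by simp
  finally show ?thesis by simp
qed

lemma part_supported: "b \<in> supported S \<Longrightarrow> part q b \<in> supported S"
  by (rule Sd_supported[OF keys_part])

definition graded_map :: "('m \<Rightarrow>\<^sub>0 'k) \<Rightarrow> nat \<Rightarrow> ('v, 'k) germ set" where
  "graded_map b = (\<lambda>q. coset q (Xi (part q b)) 1)"

lemma Xi_part_N: "b \<in> supported S \<Longrightarrow> Xi (part q b) \<in> N q"
  by (intro Xi_N keys_part)

lemma Xi_part_C [simp]: "b \<in> supported S \<Longrightarrow> Xi (part q b) \<in> C"
  using Xi_part_N N_C by blast

lemma TC_simps:
  "carrier TC = {f. (\<forall>q. f q \<in> gr_component LR mm q) \<and> finite {q. f q \<noteq> mpow (Suc q)}}"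
  "\<zero>\<^bsub>TC\<^esub> = (\<lambda>q. mpow (Suc q))"
  "f \<oplus>\<^bsub>TC\<^esub> g = (\<lambda>q. f q <+>\<^bsub>LR\<^esub> g q)"
  "f \<otimes>\<^bsub>TC\<^esub> g = (\<lambda>q. finsum (LR Quot mpow (Suc q)) (\<lambda>i. gr_mult LR mm i (q - i) (f i) (g (q - i))) {..q})"
  "\<one>\<^bsub>TC\<^esub> = (\<lambda>q. mpow (Suc q) +>\<^bsub>LR\<^esub> (if q = 0 then \<one>\<^bsub>LR\<^esub> else \<zero>\<^bsub>LR\<^esub>))"
  "c \<odot>\<^bsub>TC\<^esub> f = (\<lambda>q. \<Union>x\<in>f q. mpow (Suc q) +>\<^bsub>LR\<^esub> (c \<odot>\<^bsub>LR\<^esub> x))"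
  by (simp_all add: tangent_cone_def associated_graded_def)

lemma homogeneous_zero: "Poly_Mapping.keys b \<subseteq> Sd q \<Longrightarrow> Xi b \<in> N (Suc q) \<Longrightarrow> b = 0"
  using coeff_Xi(2)[of b q] by (simp add: N_def)

lemma graded_map_eq_zero: "b \<in> supported S \<Longrightarrow> graded_map b q = mpow (Suc q) \<longleftrightarrow> part q b = 0"
  using homogeneous_zero[OF keys_part, of b q]
  by (auto simp: graded_map_def coset_eq_zero_iff) (simp add: N_def phi_simps)

lemma graded_map_carrier:
  assumes "b \<in> supported S"
  shows "graded_map b \<in> carrier TC"
proof -
  have "{q. graded_map b q \<noteq> mpow (Suc q)} \<subseteq> deg ` Poly_Mapping.keys b"
  proof
    fix q assume "q \<in> {q. graded_map b q \<noteq> mpow (Suc q)}"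
    then have "part q b \<noteq> 0" using graded_map_eq_zero[OF assms] by simp
    then obtain s where "Poly_Mapping.lookup (part q b) s \<noteq> 0" by (metis poly_mapping_eqI lookup_zero)
    then show "q \<in> deg ` Poly_Mapping.keys b" by (auto simp: lookup_part in_keys_iff split: if_splits)
  qed
  then have "finite {q. graded_map b q \<noteq> mpow (Suc q)}" by (rule finite_subset) simp
  moreover have "graded_map b q \<in> gr_component LR mm q" for q
    using Xi_part_N[OF assms] by (auto simp: gr_component_eq graded_map_def)
  ultimately show ?thesis unfolding TC_simps by blast
qed

lemma graded_map_inj: "inj_on graded_map (supported S)"
proof (rule inj_onI)
  fix a b assume ab: "a \<in> supported S" "b \<in> supported S" "graded_map a = graded_map b"
  have "part q a = part q b" for q
  proof -
    have "Xi (part q a) - Xi (part q b) \<in> N (Suc q)"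
    proof -
      have "coset q (Xi (part q a)) 1 = coset q (Xi (part q b)) 1"
        using fun_cong[OF ab(3), of q] unfolding graded_map_def .
      then show ?thesis using ab by (simp add: coset_eq_iff)
    qed
    then have "Xi (part q (a - b)) \<in> N (Suc q)"
      by (simp add: part_def lift_diff Xi_diff)
    then have "part q (a - b) = 0" by (rule homogeneous_zero[OF keys_part[OF supported_diff[OF ab(1,2)]]])
    then show ?thesis by (simp add: part_def lift_diff)
  qed
  then show "a = b" using lookup_part by (metis poly_mapping_eqI)
qed

lemma graded_map_surj:
  assumes "f \<in> carrier TC"
  shows "\<exists>b\<in>supported S. f = graded_map b"
proof -
  have "\<exists>b. Poly_Mapping.keys b \<subseteq> Sd q \<and> f q = coset q (Xi b) 1" for q
  proof -
    obtain p where p: "p \<in> N q" "f q = coset q p 1"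
      using assms unfolding TC_simps gr_component_eq by blast
    obtain b where b: "Poly_Mapping.keys b \<subseteq> Sd q" "p - Xi b \<in> N (Suc q)"
      using homogeneous_part_exists p ideal_pow_iff by blast
    then have "coset q p 1 = coset q (Xi b) 1"
      using p by (subst coset_eq_iff) (auto simp: N_C Xi_C Sd_supported)
    then show ?thesis using b p by auto
  qed
  then obtain B where B: "\<And>q. Poly_Mapping.keys (B q) \<subseteq> Sd q" "\<And>q. f q = coset q (Xi (B q)) 1" by metis
  define F where "F = {q. f q \<noteq> mpow (Suc q)}"
  have F: "finite F" using assms unfolding TC_simps F_def by blast
  define b where "b = (\<Sum>q\<in>F. B q)"
  have "b \<in> supported S" unfolding b_def using B(1) by (intro supported_sum Sd_supported)
  moreover have "f q = graded_map b q" for q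
  proof -
    have "part q b = (\<Sum>q'\<in>F. if q = q' then B q' else 0)"
      unfolding b_def part_sum by (intro sum.cong refl) (simp add: part_homogeneous[OF B(1)])
    then have *: "part q b = (if q \<in> F then B q else 0)" using F by simp
    show ?thesis
    proof (cases "q \<in> F")
      case False
      then show ?thesis using * by (simp add: graded_map_def F_def coset_zero)
    qed (use * B(2) in \<open>simp add: graded_map_def\<close>)
  qed
  ultimately show ?thesis by blast
qed

text \<open>The defect of multiplicativity of \<open>Xi\<close> lies in \<open>I\<close>, hence in
  every step of the filtration, and disappears in the graded ring.\<close>

theorem graded_map_iso: "graded_map \<in> ring_iso (monoid_algebra S) TC"
proof (rule ring_iso_memI)
  fix a b assume "a \<in> carrier (monoid_algebra S :: ('k, _) module)" "b \<in> carrier (monoid_algebra S :: ('k, _) module)"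
  then have ab: "a \<in> supported S" "b \<in> supported S" by simp_all
  show "graded_map (a \<oplus>\<^bsub>monoid_algebra S\<^esub> b) = graded_map a \<oplus>\<^bsub>TC\<^esub> graded_map b"
    unfolding TC_simps using ab by (simp add: graded_map_def part_add Xi_add coset_add)
  show "graded_map (a \<otimes>\<^bsub>monoid_algebra S\<^esub> b) = graded_map a \<otimes>\<^bsub>TC\<^esub> graded_map b"
    unfolding TC_simps
  proof
    fix q
    have "finsum (LR Quot mpow (Suc q)) (\<lambda>i. gr_mult LR mm i (q - i) (graded_map a i) (graded_map b (q - i))) {..q} =
      finsum (LR Quot mpow (Suc q)) (\<lambda>i. coset q (Xi (part i a) * Xi (part (q - i) b)) 1) {..q}"
    proof -
      interpret I: ideal "mpow (Suc q)" LR by (rule ideal_pow_ideal)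
      interpret Quot: ring "LR Quot mpow (Suc q)" by (rule I.quotient_is_ring)
      have car: "coset q p 1 \<in> carrier (LR Quot mpow (Suc q))" if "p \<in> C" for p
        using that by (auto simp: FactRing_def A_RCOSETS_def' coset_def)
      show ?thesis
        using ab gr_mult_coset[OF Xi_part_N Xi_part_N] M car
        by (intro Quot.finsum_cong') (auto simp: graded_map_def)
    qed
    also have "\<dots> = coset q (\<Sum>i\<le>q. Xi (part i a) * Xi (part (q - i) b)) 1"
      using ab M by (intro finsum_coset) auto
    also have "\<dots> = graded_map (a * b) q"
    proof -
      have "Xi (part q (a * b)) - (\<Sum>i\<le>q. Xi (part i a) * Xi (part (q - i) b)) =
        (\<Sum>i\<le>q. Xi (part i a * part (q - i) b) - Xi (part i a) * Xi (part (q - i) b))"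
        by (simp add: part_mult ab Xi_sum sum_subtractf)
      also have "\<dots> \<in> I"
        using ab by (intro I_sum Xi_mult part_supported)
      finally have "1 * (\<Sum>i\<le>q. Xi (part i a) * Xi (part (q - i) b)) - 1 * Xi (part q (a * b)) \<in> N (Suc q)"
        using I_sym N_I by simp
      then show ?thesis
        unfolding graded_map_def using ab M S by (subst coset_eq_iff) (auto intro!: supported_sum)
    qed
    finally show "graded_map (a \<otimes>\<^bsub>monoid_algebra S\<^esub> b) q =
      finsum (LR Quot mpow (Suc q)) (\<lambda>i. gr_mult LR mm i (q - i) (graded_map a i) (graded_map b (q - i))) {..q}"
      by simp
  qed
next
  have "Poly_Mapping.keys (1 :: 'm \<Rightarrow>\<^sub>0 'k) \<subseteq> Sd 0" by (simp add: Sd_def)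
  note * = part_homogeneous[OF this]
  have "Xi 1 = \<xi> 0"
    unfolding Xi_def using lift_single[OF coefficient_hom_single, of \<xi> 0 1] by simp
  then show "graded_map \<one>\<^bsub>monoid_algebra S\<^esub> = \<one>\<^bsub>TC\<^esub>"
    unfolding TC_simps using N_I[OF xi_0]
    by (auto simp: graded_map_def * coset_zero one_LR zero_LR coset_def[symmetric] coset_eq_iff xi_C fun_eq_iff)
qed (use graded_map_carrier graded_map_inj graded_map_surj in \<open>auto simp: bij_betw_def\<close>)

lemma graded_map_smult:
  "b \<in> supported S \<Longrightarrow> graded_map (c \<odot>\<^bsub>monoid_algebra S\<^esub> b) = c \<odot>\<^bsub>TC\<^esub> graded_map b"
  unfolding TC_simps by (simp add: graded_map_def smult_coset part_scale Xi_scale)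

lemma graded_map_zero: "graded_map 0 = \<zero>\<^bsub>TC\<^esub>"
  unfolding TC_simps by (simp add: graded_map_def part_def coset_zero)

text \<open>The degree is defined from the homogeneous components of the tangent cone; this turns
  their dimensions into numbers of elements of \<open>S\<close> of a given degree.\<close>

lemma graded_map_homogeneous:
  "graded_map ` {b. Poly_Mapping.keys b \<subseteq> Sd q} = gr_homogeneous LR mm q"
proof -
  have hom: "gr_homogeneous LR mm q = {f \<in> carrier TC. \<forall>p. p \<noteq> q \<longrightarrow> f p = mpow (Suc p)}"
    using TC_simps(2) by (simp add: gr_homogeneous_def tangent_cone_def)
  show ?thesis
  proof (intro equalityI subsetI)
    fix f assume "f \<in> graded_map ` {b. Poly_Mapping.keys b \<subseteq> Sd q}"
    then obtain b where b: "f = graded_map b" "Poly_Mapping.keys b \<subseteq> Sd q" by blast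
    then show "f \<in> gr_homogeneous LR mm q"
      unfolding hom using graded_map_carrier graded_map_eq_zero[OF Sd_supported]
      by (auto simp: Sd_supported part_homogeneous)
  next
    fix f assume f: "f \<in> gr_homogeneous LR mm q"
    then obtain b where b: "b \<in> supported S" "f = graded_map b"
      unfolding hom using graded_map_surj by blast
    have "Poly_Mapping.keys b \<subseteq> Sd q"
    proof
      fix s assume s: "s \<in> Poly_Mapping.keys b"
      have "deg s = q"
      proof (rule ccontr)
        assume "deg s \<noteq> q"
        then have "part (deg s) b = 0" using f b unfolding hom by (simp add: graded_map_eq_zero)
        then show False using s lookup_part[of "deg s" b s] by (simp add: in_keys_iff)
      qed
      then show "s \<in> Sd q" using s b by (auto simp: Sd_def supported_def)
    qed
    then show "f \<in> graded_map ` {b. Poly_Mapping.keys b \<subseteq> Sd q}" using b by blast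
  qed
qed

end

section \<open>Krull dimension and degree of graded monoid algebras\<close>

lemma algebra_isomorphic_sym:
  assumes "algebra_isomorphic A B" "ring A" "\<And>c x. x \<in> carrier A \<Longrightarrow> c \<odot>\<^bsub>A\<^esub> x \<in> carrier A"
  shows "algebra_isomorphic B A"
proof -
  obtain h where h: "h \<in> ring_iso A B" "\<And>c x. x \<in> carrier A \<Longrightarrow> h (c \<odot>\<^bsub>A\<^esub> x) = c \<odot>\<^bsub>B\<^esub> h x"
    using assms by (auto simp: algebra_isomorphic_def)
  let ?g = "inv_into (carrier A) h"
  have bij: "bij_betw h (carrier A) (carrier B)" using h by (simp add: ring_iso_def)
  have "?g (c \<odot>\<^bsub>B\<^esub> y) = c \<odot>\<^bsub>A\<^esub> ?g y" if y: "y \<in> carrier B" for c y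
  proof -
    have "?g y \<in> carrier A" "h (?g y) = y"
      using bij y by (metis bij_betw_def inv_into_into, metis bij_betw_inv_into_right)
    then have "h (c \<odot>\<^bsub>A\<^esub> ?g y) = c \<odot>\<^bsub>B\<^esub> y" "c \<odot>\<^bsub>A\<^esub> ?g y \<in> carrier A"
      using h assms by auto
    then show ?thesis using bij by (metis bij_betw_inv_into_left)
  qed
  then show ?thesis
    using ring_iso_set_sym[OF assms(2) h(1)] by (auto simp: algebra_isomorphic_def)
qed

lemma algebra_isomorphic_trans:
  assumes "algebra_isomorphic A B" "algebra_isomorphic B D"
  shows "algebra_isomorphic A D"
proof -
  obtain h where h: "h \<in> ring_iso A B" "\<And>c x. x \<in> carrier A \<Longrightarrow> h (c \<odot>\<^bsub>A\<^esub> x) = c \<odot>\<^bsub>B\<^esub> h x"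
    using assms by (auto simp: algebra_isomorphic_def)
  obtain g where g: "g \<in> ring_iso B D" "\<And>c x. x \<in> carrier B \<Longrightarrow> g (c \<odot>\<^bsub>B\<^esub> x) = c \<odot>\<^bsub>D\<^esub> g x"
    using assms by (auto simp: algebra_isomorphic_def)
  have "h x \<in> carrier B" if "x \<in> carrier A" for x
    using h that by (auto simp: ring_iso_def ring_hom_def)
  then show ?thesis
    unfolding algebra_isomorphic_def
    using ring_iso_set_trans[OF h(1) g(1)] h g by (intro bexI[of _ "g \<circ> h"]) auto
qed

lemma primeideal_iso_vimage:
  assumes R: "cring R" and T: "cring T" and h: "h \<in> ring_iso R T" and p: "primeideal p T"
  shows "primeideal {r \<in> carrier R. h r \<in> p} R"
proof -
  interpret R: cring R by fact
  interpret T: cring T by fact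
  interpret p: primeideal p T by fact
  have hom: "h \<in> ring_hom R T" and bij: "bij_betw h (carrier R) (carrier T)"
    using h by (auto simp: ring_iso_def)
  interpret h: ring_hom_cring R T h by unfold_locales (rule hom)
  show ?thesis
  proof (rule primeidealI2)
    show "additive_subgroup {r \<in> carrier R. h r \<in> p} R"
    proof (rule additive_subgroup.intro, rule R.add.subgroupI)
      have "\<zero>\<^bsub>R\<^esub> \<in> {r \<in> carrier R. h r \<in> p}" by simp
      then show "{r \<in> carrier R. h r \<in> p} \<noteq> {}" by blast
    qed (simp_all add: subset_iff)
    obtain t where t: "t \<in> carrier T" "t \<notin> p" using p.I_notcarr p.a_subset by blast
    then obtain r where "r \<in> carrier R" "t = h r" using bij unfolding bij_betw_def by blast
    then show "carrier R \<noteq> {r \<in> carrier R. h r \<in> p}" using t by blast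
    show "cring R" by (rule R)
    fix a b
    show "a \<in> {r \<in> carrier R. h r \<in> p} \<Longrightarrow> b \<in> carrier R \<Longrightarrow> b \<otimes>\<^bsub>R\<^esub> a \<in> {r \<in> carrier R. h r \<in> p}"
      "a \<in> {r \<in> carrier R. h r \<in> p} \<Longrightarrow> b \<in> carrier R \<Longrightarrow> a \<otimes>\<^bsub>R\<^esub> b \<in> {r \<in> carrier R. h r \<in> p}"
      by (simp_all add: p.I_l_closed p.I_r_closed)
    assume "a \<in> carrier R" "b \<in> carrier R" "a \<otimes>\<^bsub>R\<^esub> b \<in> {r \<in> carrier R. h r \<in> p}"
    then show "a \<in> {r \<in> carrier R. h r \<in> p} \<or> b \<in> {r \<in> carrier R. h r \<in> p}"
      using p.I_prime[of "h a" "h b"] by simp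
  qed
qed

lemma krull_dimension_iso_le:
  assumes R: "cring R" and T: "cring T" and h: "h \<in> ring_iso R T"
  shows "krull_dimension T \<le> krull_dimension R"
  unfolding krull_dimension_def
proof (rule Sup_subset_mono, safe)
  fix l and p :: "nat \<Rightarrow> _ set"
  assume p: "\<forall>i\<le>l. primeideal (p i) T" "\<forall>i<l. p i \<subset> p (Suc i)"
  define q where "q i = {r \<in> carrier R. h r \<in> p i}" for i
  have bij: "bij_betw h (carrier R) (carrier T)" using h by (auto simp: ring_iso_def)
  have "\<forall>i\<le>l. primeideal (q i) R"
    using p primeideal_iso_vimage[OF R T h] by (simp add: q_def)
  moreover have "q i \<subset> q (Suc i)" if i: "i < l" for i
  proof -
    obtain t where t: "t \<in> p (Suc i)" "t \<notin> p i" using p i by blast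
    have "p (Suc i) \<subseteq> carrier T"
      using p i additive_subgroup.a_subset[OF ideal.axioms(1)[OF primeideal.axioms(1)]] by (meson Suc_leI)
    then obtain r where "r \<in> carrier R" "t = h r" using t bij by (auto simp: bij_betw_def)
    then show ?thesis using t p i by (auto simp: q_def)
  qed
  ultimately show "\<exists>l'. enat l = enat l' \<and> (\<exists>p. (\<forall>i\<le>l'. primeideal (p i) R) \<and> (\<forall>i<l'. p i \<subset> p (Suc i)))"
    by blast
qed

lemma krull_dimension_iso:
  assumes R: "cring R" and T: "cring T" and h: "h \<in> ring_iso R T"
  shows "krull_dimension T = krull_dimension R"
  using krull_dimension_iso_le[OF assms] krull_dimension_iso_le[OF T R ring_iso_set_sym[OF cring.axioms(1)[OF R] h]]
  by simp

section \<open>The ground field inside a monoid algebra, and spans of monomials\<close>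

definition constants :: "('m::comm_monoid_add \<Rightarrow>\<^sub>0 'k::field) set" where
  "constants = range (Poly_Mapping.single 0)"

lemma subfield_constants:
  assumes M: "additive_submonoid M"
  shows "subfield (constants :: (_ \<Rightarrow>\<^sub>0 'k::field) set) (monoid_algebra M)"
proof -
  interpret R: cring "monoid_algebra M :: ('k, _) module" by (rule cring_monoid_algebra[OF M])
  show ?thesis
  proof (rule R.subfieldI)
    show "subcring (constants :: (_ \<Rightarrow>\<^sub>0 'k) set) (monoid_algebra M)"
    proof (rule R.subcringI)
      show "subring (constants :: (_ \<Rightarrow>\<^sub>0 'k) set) (monoid_algebra M)"
      proof (rule R.subringI)
        show "\<one>\<^bsub>monoid_algebra M\<^esub> \<in> (constants :: (_ \<Rightarrow>\<^sub>0 'k) set)"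
          unfolding constants_def monoid_algebra_simps by (metis rangeI single_one)
      qed (auto simp: constants_def M mult_single monoid_algebra_a_inv simp flip: single_add single_uminus)
    qed (auto simp: mult.commute)
    show "Units (monoid_algebra M \<lparr>carrier := constants\<rparr>) = (constants :: (_ \<Rightarrow>\<^sub>0 'k) set) - {\<zero>\<^bsub>monoid_algebra M\<^esub>}"
    proof (intro equalityI subsetI)
      fix x :: "_ \<Rightarrow>\<^sub>0 'k" assume "x \<in> Units (monoid_algebra M \<lparr>carrier := constants\<rparr>)"
      then show "x \<in> constants - {\<zero>\<^bsub>monoid_algebra M\<^esub>}" by (auto simp: Units_def)
    next
      fix x :: "_ \<Rightarrow>\<^sub>0 'k" assume x: "x \<in> constants - {\<zero>\<^bsub>monoid_algebra M\<^esub>}"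
      then obtain c where c: "x = Poly_Mapping.single 0 c" by (auto simp: constants_def)
      with x have "c \<noteq> 0" by auto
      then have "Poly_Mapping.single 0 (inverse c) * x = 1" "x * Poly_Mapping.single 0 (inverse c) = 1"
        using c by (simp_all add: mult_single)
      then show "x \<in> Units (monoid_algebra M \<lparr>carrier := constants\<rparr>)"
        using c unfolding Units_def by (auto simp: constants_def)
    qed
  qed
qed

lemma dimension_supported:
  assumes M: "additive_submonoid M" and F: "finite F" "F \<subseteq> M"
  shows "ring.dimension (monoid_algebra M :: ('k::field, _) module) (card F) constants (supported F)"
  using F
proof (induction F)
  case empty
  interpret R: cring "monoid_algebra M :: ('k, _) module" by (rule cring_monoid_algebra[OF M])
  have "supported {} = {\<zero>\<^bsub>monoid_algebra M\<^esub> :: _ \<Rightarrow>\<^sub>0 'k}" by (auto simp: supported_def)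
  then show ?case using R.zero_dim[of constants] by simp
next
  case (insert s F)
  interpret R: cring "monoid_algebra M :: ('k, _) module" by (rule cring_monoid_algebra[OF M])
  let ?v = "Poly_Mapping.single s 1 :: _ \<Rightarrow>\<^sub>0 'k"
  have line: "R.line_extension constants ?v (supported F) =
    {Poly_Mapping.single 0 c * ?v + e | c e. e \<in> supported F}"
    unfolding R.line_extension_def set_add_def set_mult_def r_coset_def constants_def by auto
  have "supported (insert s F) = R.line_extension constants ?v (supported F)"
    unfolding line
  proof (intro equalityI subsetI)
    fix b :: "_ \<Rightarrow>\<^sub>0 'k" assume b: "b \<in> supported (insert s F)"
    let ?c = "Poly_Mapping.single 0 (Poly_Mapping.lookup b s)"
    have "Poly_Mapping.lookup (b - ?c * ?v) t = (if t = s then 0 else Poly_Mapping.lookup b t)" for t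
      by (simp add: lookup_minus mult_single lookup_single)
    then have "b - ?c * ?v \<in> supported F"
      using b by (auto simp: supported_def in_keys_iff split: if_splits)
    moreover have "b = ?c * ?v + (b - ?c * ?v)" by simp
    ultimately show "b \<in> {Poly_Mapping.single 0 c * ?v + e | c e. e \<in> supported F}" by blast
  next
    fix b :: "_ \<Rightarrow>\<^sub>0 'k" assume "b \<in> {Poly_Mapping.single 0 c * ?v + e | c e. e \<in> supported F}"
    then obtain c e where "b = Poly_Mapping.single 0 c * ?v + e" "e \<in> supported F"
      by blast
    moreover have "supported F \<subseteq> supported (insert s F)" by (auto simp: supported_def)
    ultimately show "b \<in> supported (insert s F)" by (auto simp: mult_single)
  qed
  moreover have "R.dimension (Suc (card F)) constants (R.line_extension constants ?v (supported F))"
    using insert by (intro R.Suc_dim) (auto simp: supported_def)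
  ultimately show ?case using insert by simp
qed

subsection \<open>Prime ideals from faces\<close>

definition restriction :: "'m set \<Rightarrow> ('m \<Rightarrow>\<^sub>0 'k::field) \<Rightarrow> ('m::comm_monoid_add \<Rightarrow>\<^sub>0 'k)" where
  "restriction T b = (\<Sum>s\<in>Poly_Mapping.keys b \<inter> T. Poly_Mapping.single s (Poly_Mapping.lookup b s))"

lemma lookup_restriction: "Poly_Mapping.lookup (restriction T b) s = (if s \<in> T then Poly_Mapping.lookup b s else 0)"
proof -
  have "Poly_Mapping.lookup (restriction T b) s =
    (\<Sum>t\<in>Poly_Mapping.keys b \<inter> T. if t = s then Poly_Mapping.lookup b s else 0)"
    unfolding restriction_def lookup_sum by (intro sum.cong) (auto simp: lookup_single)
  also have "\<dots> = (if s \<in> T then Poly_Mapping.lookup b s else 0)"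
    by (subst sum.delta) (auto simp: in_keys_iff)
  finally show ?thesis .
qed

text \<open>The quotient by the monomials outside a face \<open>T\<close> is K[T], reached by
  \<open>restriction T\<close>. It is a domain because the exponents lie in a linearly ordered
  cancellative monoid, where products of nonzero elements do not vanish; hence the sort of
  \<open>'m\<close>.\<close>

lemma primeideal_face:
  fixes M T :: "'m::{ordered_cancel_comm_monoid_add, linorder} set"
  assumes M: "additive_submonoid M" and T: "T \<subseteq> M" "0 \<in> T"
    and face: "\<And>s t. s \<in> M \<Longrightarrow> t \<in> M \<Longrightarrow> s + t \<in> T \<longleftrightarrow> s \<in> T \<and> t \<in> T"
  shows "primeideal (supported (M - T) :: ('m \<Rightarrow>\<^sub>0 'k::field) set) (monoid_algebra M)"
proof (rule primeidealI2)
  interpret R: cring "monoid_algebra M :: ('k, _) module" by (rule cring_monoid_algebra[OF M])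
  have sub: "supported (M - T) \<subseteq> (supported M :: ('m \<Rightarrow>\<^sub>0 'k) set)" by (auto simp: supported_def)
  show "additive_subgroup (supported (M - T) :: ('m \<Rightarrow>\<^sub>0 'k) set) (monoid_algebra M)"
  proof (rule additive_subgroup.intro, rule R.add.subgroupI)
    have "(0 :: 'm \<Rightarrow>\<^sub>0 'k) \<in> supported (M - T)" by simp
    then show "supported (M - T) \<noteq> ({} :: ('m \<Rightarrow>\<^sub>0 'k) set)" by blast
  qed (use sub in \<open>auto simp: monoid_algebra_a_inv M subset_iff\<close>)
  show "cring (monoid_algebra M :: ('k, _) module)" by (rule R.is_cring)
  have mult: "x * a \<in> supported (M - T)" if a: "a \<in> supported (M - T)" and x: "x \<in> supported M" for a x :: "'m \<Rightarrow>\<^sub>0 'k"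
    unfolding supported_def
  proof (intro CollectI subsetI)
    fix u assume "u \<in> Poly_Mapping.keys (x * a)"
    then obtain s t where "u = s + t" "s \<in> Poly_Mapping.keys x" "t \<in> Poly_Mapping.keys a"
      using Poly_Mapping.keys_mult by blast
    then show "u \<in> M - T" using a x M face[of s t] by (auto simp: supported_def additive_submonoid_def)
  qed
  fix a b :: "'m \<Rightarrow>\<^sub>0 'k"
  show "a \<in> supported (M - T) \<Longrightarrow> b \<in> carrier (monoid_algebra M) \<Longrightarrow> b \<otimes>\<^bsub>monoid_algebra M\<^esub> a \<in> supported (M - T)"
    "a \<in> supported (M - T) \<Longrightarrow> b \<in> carrier (monoid_algebra M) \<Longrightarrow> a \<otimes>\<^bsub>monoid_algebra M\<^esub> b \<in> supported (M - T)"
    using mult[of a b] by (simp_all add: mult.commute)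
  have "(1 :: 'm \<Rightarrow>\<^sub>0 'k) \<in> supported M - supported (M - T)"
    using M T by (auto simp: supported_def additive_submonoid_def)
  then show "carrier (monoid_algebra M) \<noteq> (supported (M - T) :: ('m \<Rightarrow>\<^sub>0 'k) set)" by auto
  assume ab: "a \<in> carrier (monoid_algebra M)" "b \<in> carrier (monoid_algebra M)"
    "a \<otimes>\<^bsub>monoid_algebra M\<^esub> b \<in> supported (M - T)"
  show "a \<in> supported (M - T) \<or> b \<in> supported (M - T)"
  proof (rule ccontr)
    assume *: "\<not> ?thesis"
    let ?r = "restriction T"
    have rest: "c - ?r c \<in> supported (M - T)" "?r c \<in> supported T" if "c \<in> supported M" for c :: "'m \<Rightarrow>\<^sub>0 'k"
      using that by (auto simp: supported_def in_keys_iff lookup_minus lookup_restriction split: if_splits)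
    have nz: "?r c \<noteq> 0" if "c \<in> supported M" "c \<notin> supported (M - T)" for c :: "'m \<Rightarrow>\<^sub>0 'k"
      using rest(1)[OF that(1)] that(2) by auto
    have sup: "supported T \<subseteq> (supported M :: ('m \<Rightarrow>\<^sub>0 'k) set)" using T by (auto simp: supported_def)
    have "?r a * ?r b \<noteq> 0" using nz[of a] nz[of b] ab * by simp
    then obtain u where "Poly_Mapping.lookup (?r a * ?r b) u \<noteq> 0" by (metis poly_mapping_eqI lookup_zero)
    then have u: "u \<in> Poly_Mapping.keys (?r a * ?r b)" by (simp add: in_keys_iff)
    have "additive_submonoid T"
      unfolding additive_submonoid_def using T face by blast
    then have "?r a * ?r b \<in> supported T" using rest(2)[of a] rest(2)[of b] ab by simp
    then have uT: "u \<in> T" using u by (auto simp: supported_def)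
    have "a * b - ?r a * ?r b = (a - ?r a) * b + ?r a * (b - ?r b)" by (simp add: algebra_simps)
    also have "\<dots> \<in> supported (M - T)"
    proof (rule supported_add)
      show "(a - ?r a) * b \<in> supported (M - T)"
        using mult[of "a - ?r a" b] rest(1)[of a] ab by (simp add: mult.commute)
      have "?r a \<in> supported M" using rest(2)[of a] ab sup by auto
      then show "?r a * (b - ?r b) \<in> supported (M - T)"
        using mult[of "b - ?r b" "?r a"] rest(1)[of b] ab by simp
    qed
    finally have *: "a * b - ?r a * ?r b \<in> supported (M - T)" .
    have "a * b - (a * b - ?r a * ?r b) \<in> supported (M - T)"
      by (rule supported_diff[OF _ *]) (use ab in simp)
    then show False using u uT by (auto simp: supported_def)
  qed
qed

text \<open>Smaller faces have larger complements, so a descending chain of faces becomes an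
  ascending chain of primes.\<close>

lemma krull_dimension_lower:
  fixes T :: "nat \<Rightarrow> 'm::{ordered_cancel_comm_monoid_add, linorder} set"
  assumes M: "additive_submonoid M" and T: "\<And>i. i \<le> d \<Longrightarrow> T i \<subseteq> M" "\<And>i. i \<le> d \<Longrightarrow> 0 \<in> T i"
    and face: "\<And>i s t. i \<le> d \<Longrightarrow> s \<in> M \<Longrightarrow> t \<in> M \<Longrightarrow> s + t \<in> T i \<longleftrightarrow> s \<in> T i \<and> t \<in> T i"
    and strict: "\<And>i. i < d \<Longrightarrow> T (Suc i) \<subset> T i"
  shows "enat d \<le> krull_dimension (monoid_algebra M :: ('k::field, _) module)"
  unfolding krull_dimension_def
proof (rule Sup_upper, intro CollectI exI[of _ d] exI[of _ "\<lambda>i. supported (M - T i)"] conjI refl allI impI)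
  fix i
  show "primeideal (supported (M - T i)) (monoid_algebra M :: ('k, _) module)" if "i \<le> d"
    using that by (intro primeideal_face M T face) auto
  assume i: "i < d"
  then obtain s where s: "s \<in> T i" "s \<notin> T (Suc i)" using strict by blast
  have "Poly_Mapping.single s (1::'k) \<in> supported (M - T (Suc i)) - supported (M - T i)"
    using s T(1)[of i] i by (auto simp: supported_def)
  moreover have "supported (M - T i) \<subseteq> (supported (M - T (Suc i)) :: ('m \<Rightarrow>\<^sub>0 'k) set)"
    using strict[OF i] by (auto simp: supported_def)
  ultimately show "supported (M - T i) \<subset> (supported (M - T (Suc i)) :: ('m \<Rightarrow>\<^sub>0 'k) set)" by blast
qed

subsection \<open>Chains of primes and growth\<close>

lemma card_le_of_independent:
  fixes v :: "'i \<Rightarrow> 'm::comm_monoid_add \<Rightarrow>\<^sub>0 'k::field"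
  assumes fin: "finite A" "finite T" and sup: "\<And>a. a \<in> A \<Longrightarrow> v a \<in> supported T"
    and ind: "\<And>c. (\<Sum>a\<in>A. Poly_Mapping.single 0 (c a) * v a) = 0 \<Longrightarrow> \<forall>a\<in>A. c a = 0"
  shows "card A \<le> card T"
proof -
  interpret vs: vector_space "\<lambda>c (p :: 'm \<Rightarrow>\<^sub>0 'k). Poly_Mapping.single 0 c * p"
    by unfold_locales (simp_all add: algebra_simps single_add mult_single flip: mult.assoc)
  have inj: "inj_on v A"
  proof (rule inj_onI, rule ccontr)
    fix a b assume ab: "a \<in> A" "b \<in> A" "v a = v b" "a \<noteq> b"
    let ?c = "\<lambda>x. if x = a then 1 else if x = b then - 1 else 0 :: 'k"
    have "(\<Sum>x\<in>A. Poly_Mapping.single 0 (?c x) * v x) = (\<Sum>x\<in>{a, b}. Poly_Mapping.single 0 (?c x) * v x)"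
      using fin ab by (intro sum.mono_neutral_right) auto
    also have "\<dots> = 0" using ab by (simp add: single_uminus)
    finally show False using ind[of ?c] ab by auto
  qed
  have "vs.independent (v ` A)"
  proof (rule vs.independent_if_scalars_zero)
    fix f x assume f: "(\<Sum>x\<in>v ` A. Poly_Mapping.single 0 (f x) * x) = 0" "x \<in> v ` A"
    then have "(\<Sum>a\<in>A. Poly_Mapping.single 0 (f (v a)) * v a) = 0"
      by (simp add: sum.reindex[OF inj])
    then show "f x = 0" using ind[of "\<lambda>a. f (v a)"] f by blast
  qed (use fin in simp)
  moreover have "v ` A \<subseteq> vs.span ((\<lambda>t. Poly_Mapping.single t 1) ` T)"
  proof
    fix y assume "y \<in> v ` A"
    then have y: "y \<in> supported T" using sup by blast
    have "(\<Sum>m\<in>Poly_Mapping.keys y. Poly_Mapping.single 0 (Poly_Mapping.lookup y m) * Poly_Mapping.single m 1) \<in>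
      vs.span ((\<lambda>t. Poly_Mapping.single t 1) ` T)"
      using y by (intro vs.span_sum vs.span_scale vs.span_base) (auto simp: supported_def)
    then show "y \<in> vs.span ((\<lambda>t. Poly_Mapping.single t 1) ` T)"
      by (simp add: mult_single flip: poly_mapping_sum_single)
  qed
  ultimately have "card (v ` A) \<le> card ((\<lambda>t. Poly_Mapping.single t (1::'k)) ` T)"
    using vs.independent_span_bound fin by blast
  also have "\<dots> \<le> card T" using card_image_le[OF fin(2)] .
  finally show ?thesis by (simp add: card_image inj)
qed

text \<open>Modulo \<open>p'\<close> only the term \<open>g 0\<close> survives, and by
  \<open>zero\<close> it is 0. The rest is divisible by \<open>f\<close>, which can be cancelled
  because \<open>p\<close> is prime and does not contain it; then the argument repeats with one
  power less.\<close>

lemma prime_power_combination: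
  fixes f :: "'m::comm_monoid_add \<Rightarrow>\<^sub>0 'k::field"
  assumes p: "primeideal p (monoid_algebra M)" and p': "ideal p' (monoid_algebra M)" and M: "additive_submonoid M"
    and sub: "p \<subseteq> p'" and f: "f \<in> p'" "f \<notin> p" and g: "\<And>x. g x \<in> supported M"
    and zero: "\<And>x. g x \<in> p' \<Longrightarrow> g x = 0"
    and sum: "(\<Sum>x\<le>n. f ^ x * g x) \<in> p"
  shows "\<forall>x\<le>n. g x = 0"
  using g zero sum
proof (induction n arbitrary: g)
  interpret p: primeideal p "monoid_algebra M" by (rule p)
  interpret P: monoid_algebra_ideal M p
    by (rule monoid_algebra_ideal.intro[OF M p.ideal_axioms])
  interpret P': monoid_algebra_ideal M p'
    by (rule monoid_algebra_ideal.intro[OF M p'])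
  {
    case 0
    then have "g 0 \<in> p'" using sub by auto
    then show ?case using 0 by simp
  next
    case (Suc n)
    have fM: "f \<in> supported M" using f P'.I_supported by blast
    let ?r = "\<Sum>x\<le>n. f ^ x * g (Suc x)"
    have fpow: "f ^ x \<in> supported M" for x using fM M by (induction x) auto
    have r: "?r \<in> supported M" using Suc.prems(1) M fpow by (intro supported_sum supported_mult) auto
    have eq: "(\<Sum>x\<le>Suc n. f ^ x * g x) = g 0 + f * ?r"
      by (subst sum.atMost_Suc_shift) (simp add: sum_distrib_left mult_ac)
    have "g 0 + f * ?r \<in> p'" using Suc.prems(3) sub unfolding eq by blast
    moreover have "f * ?r \<in> p'" using f r by (intro P'.I_mult_right)
    ultimately have "g 0 + f * ?r - f * ?r \<in> p'" by (rule P'.I_diff)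
    then have g0: "g 0 = 0" using Suc.prems(2) by simp
    then have "f * ?r \<in> p" using Suc.prems(3) unfolding eq by simp
    then have "?r \<in> p" using p.I_prime[of f ?r] f fM r by auto
    then have "\<forall>x\<le>n. g (Suc x) = 0" by (intro Suc.IH) (use Suc.prems in auto)
    then show ?case using g0 by (metis Suc_le_mono not0_implies_Suc)
  }
qed

fun power_product :: "(nat \<Rightarrow> 'r::comm_monoid_mult) \<Rightarrow> nat \<Rightarrow> nat list \<Rightarrow> 'r" where
  "power_product f i [] = 1"
| "power_product f i (x # xs) = f i ^ x * power_product f (Suc i) xs"

text \<open>Elements taken from the successive differences of a chain of primes have linearly
  independent monomials, even modulo the prime where one starts. The induction is on the number
  \<open>m\<close> of factors left; at the top of the chain a single constant remains, and a prime
  contains no nonzero constant.\<close>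

lemma chain_independent:
  fixes p :: "nat \<Rightarrow> ('m::comm_monoid_add \<Rightarrow>\<^sub>0 'k::field) set"
  assumes M: "additive_submonoid M" and p: "\<And>i. i \<le> l \<Longrightarrow> primeideal (p i) (monoid_algebra M)"
    and sub: "\<And>i. i < l \<Longrightarrow> p i \<subseteq> p (Suc i)" and f: "\<And>i. i < l \<Longrightarrow> f i \<in> p (Suc i) - p i"
  shows "i + m = l \<Longrightarrow> (\<Sum>xs\<in>{xs. set xs \<subseteq> {..n} \<and> length xs = m}. Poly_Mapping.single 0 (c xs) * power_product f i xs) \<in> p i
    \<Longrightarrow> \<forall>xs\<in>{xs. set xs \<subseteq> {..n} \<and> length xs = m}. c xs = 0"
proof (induction m arbitrary: i c)
  case 0
  interpret p: primeideal "p i" "monoid_algebra M" using 0 by (intro p) simp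
  interpret P: monoid_algebra_ideal M "p i"
    by (rule monoid_algebra_ideal.intro[OF M p.ideal_axioms])
  have *: "{xs. set xs \<subseteq> {..n} \<and> length xs = 0} = {[]}" by auto
  have "c [] = 0"
  proof (rule ccontr)
    assume "c [] \<noteq> 0"
    have "Poly_Mapping.single 0 (inverse (c [])) * Poly_Mapping.single 0 (c []) \<in> p i"
      using 0 unfolding * by (intro P.I_mult_left) (auto simp: M)
    then have "\<one>\<^bsub>monoid_algebra M\<^esub> \<in> p i" using \<open>c [] \<noteq> 0\<close> by (simp add: mult_single)
    then show False using p.one_imp_carrier p.I_notcarr by blast
  qed
  then show ?case by auto
next
  case (Suc m)
  let ?L = "\<lambda>m. {xs. set xs \<subseteq> {..n} \<and> length xs = m}"
  have i: "i < l" using Suc by simp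
  interpret p: primeideal "p i" "monoid_algebra M" using i by (intro p) simp
  interpret p': primeideal "p (Suc i)" "monoid_algebra M" using i by (intro p) simp
  interpret P': monoid_algebra_ideal M "p (Suc i)"
    by (rule monoid_algebra_ideal.intro[OF M p'.ideal_axioms])
  have fM: "f j \<in> supported M" if "j < l" for j
    using f[OF that] primeideal.axioms(1)[OF p[of "Suc j"]] that
    by (auto dest!: ideal.Icarr)
  have pp: "power_product f j xs \<in> supported M" if "j + length xs \<le> l" for j xs
    using that
  proof (induction xs arbitrary: j)
    case (Cons x xs)
    have "f j ^ x \<in> supported M" using fM[of j] M Cons.prems by (induction x) auto
    then show ?case using Cons M by simp
  qed (simp add: M)
  define g where "g x = (\<Sum>xs\<in>?L m. Poly_Mapping.single 0 (c (x # xs)) * power_product f (Suc i) xs)" for x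
  have split: "?L (Suc m) = (\<lambda>(x, xs). x # xs) ` ({..n} \<times> ?L m)"
    by (auto simp: length_Suc_conv image_iff)
  have inj: "inj_on (\<lambda>(x, xs). x # xs) ({..n} \<times> ?L m)" by (auto simp: inj_on_def)
  have fin: "finite (?L m)" by (rule finite_lists_length_eq) simp
  have "(\<Sum>xs\<in>?L (Suc m). Poly_Mapping.single 0 (c xs) * power_product f i xs) =
    (\<Sum>x\<le>n. f i ^ x * g x)"
    unfolding split sum.reindex[OF inj] sum_distrib_left g_def
    by (simp add: sum.cartesian_product mult_ac case_prod_unfold)
  then have sum: "(\<Sum>x\<le>n. f i ^ x * g x) \<in> p i" using Suc.prems by simp
  have zero: "g x = 0 \<and> (\<forall>xs\<in>?L m. c (x # xs) = 0)" if "g x \<in> p (Suc i)" for x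
    using Suc.IH[of "Suc i" "\<lambda>xs. c (x # xs)"] that Suc.prems by (simp add: g_def)
  have "\<forall>x\<le>n. g x = 0"
  proof (rule prime_power_combination[OF p.primeideal_axioms p'.ideal_axioms M _ _ _ _ _ sum])
    show "g x \<in> supported M" for x
      unfolding g_def using Suc.prems M by (intro supported_sum supported_mult pp) auto
  qed (use zero sub f i in auto)
  then have "c (x # xs) = 0" if "x \<le> n" "xs \<in> ?L m" for x xs
    using zero[of x] that by simp
  then show ?case by (auto simp: split)
qed

text \<open>A chain of length l yields (n + 1)^l independent products with exponents at most n, all
  of degree at most s n l. At most B (s n l + 1)^d monomials are available in these degrees, so
  growing n forces l \<le> d.\<close>

lemma krull_dimension_upper:
  fixes deg :: "'m::comm_monoid_add \<Rightarrow> nat"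
  assumes M: "additive_submonoid M"
    and deg: "\<And>s t. s \<in> M \<Longrightarrow> t \<in> M \<Longrightarrow> deg (s + t) = deg s + deg t"
    and fin: "\<And>n. finite {s \<in> M. deg s \<le> n}"
    and growth: "\<And>n. card {s \<in> M. deg s \<le> n} \<le> B * (n + 1) ^ d"
  shows "krull_dimension (monoid_algebra M :: ('k::field, _) module) \<le> enat d"
  unfolding krull_dimension_def
proof (rule Sup_least, safe)
  fix l and p :: "nat \<Rightarrow> ('m \<Rightarrow>\<^sub>0 'k) set"
  assume p: "\<forall>i\<le>l. primeideal (p i) (monoid_algebra M)" "\<forall>i<l. p i \<subset> p (Suc i)"
  then have "\<forall>i. \<exists>x. i < l \<longrightarrow> x \<in> p (Suc i) - p i" by blast
  then obtain f where f: "\<And>i. i < l \<Longrightarrow> f i \<in> p (Suc i) - p i" by metis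
  have fM: "f i \<in> supported M" if "i < l" for i
    using f[OF that] p(1) that ideal.Icarr[OF primeideal.axioms(1), of "p (Suc i)" "monoid_algebra M" "f i"] by auto
  \<comment> \<open>\<open>s\<close> bounds the degrees occurring in all chosen elements; the
    inserted 0 keeps the maximum defined when there are none.\<close>
  define s where "s = Max (insert 0 (deg ` (\<Union>i<l. Poly_Mapping.keys (f i))))"
  have s: "deg t \<le> s" if "t \<in> Poly_Mapping.keys (f i)" "i < l" for t i
    unfolding s_def using that by (intro Max_ge) auto
  have deg0: "deg 0 = 0" using deg[of 0 0] M by (simp add: additive_submonoid_def)
  let ?D = "\<lambda>n. {s \<in> M. deg s \<le> n}"
  have mult: "a * b \<in> supported (?D (i + j))" if "a \<in> supported (?D i)" "b \<in> supported (?D j)" for a b :: "'m \<Rightarrow>\<^sub>0 'k" and i j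
    unfolding supported_def
  proof (rule CollectI, rule subsetI)
    fix u assume "u \<in> Poly_Mapping.keys (a * b)"
    then obtain x y where "u = x + y" "x \<in> Poly_Mapping.keys a" "y \<in> Poly_Mapping.keys b"
      using Poly_Mapping.keys_mult by blast
    moreover have "x \<in> ?D i" "y \<in> ?D j" using calculation that by (auto simp: supported_def)
    ultimately show "u \<in> ?D (i + j)" using deg[of x y] M by (auto simp: additive_submonoid_def)
  qed
  have one: "1 \<in> supported (?D n)" for n using M deg0 by (auto simp: supported_def additive_submonoid_def)
  have fD: "f i \<in> supported (?D s)" if "i < l" for i
    using fM[OF that] s that by (auto simp: supported_def)
  have pow: "f i ^ x \<in> supported (?D (s * x))" if "i < l" for i x
  proof (induction x)
    case 0
    show ?case using one[of 0] by simp
  next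
    case (Suc x)
    then show ?case using mult[OF fD[OF that] Suc] by (simp add: add.commute)
  qed
  have pp: "power_product f i xs \<in> supported (?D (s * n * length xs))"
    if "i + length xs \<le> l" "set xs \<subseteq> {..n}" for i xs n
    using that
  proof (induction xs arbitrary: i)
    case (Cons x xs)
    have "f i ^ x \<in> supported (?D (s * n))"
    proof -
      have "x \<le> n" using Cons.prems by simp
      then have "?D (s * x) \<subseteq> ?D (s * n)"
        using order_trans[OF _ mult_le_mono2[of x n s]] by blast
      then show ?thesis using pow[of i x] Cons.prems unfolding supported_def by auto
    qed
    from mult[OF this Cons.IH[of "Suc i"]] Cons.prems show ?case by simp
  next
    case Nil
    then show ?case using one[of 0] by simp
  qed
  have main: "(n + 1) ^ l \<le> B * (s * n * l + 1) ^ d" for n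
  proof -
    let ?L = "{xs. set xs \<subseteq> {..n} \<and> length xs = l}"
    have "card ?L \<le> card (?D (s * n * l))"
    proof (rule card_le_of_independent[where v = "power_product f 0"])
      show "finite ?L" by (rule finite_lists_length_eq) simp
      show "finite (?D (s * n * l))" by (rule fin)
      show "power_product f 0 xs \<in> supported (?D (s * n * l))" if "xs \<in> ?L" for xs
        using pp[of 0 xs n] that by simp
      fix c assume "(\<Sum>xs\<in>?L. Poly_Mapping.single 0 (c xs) * power_product f 0 xs) = 0"
      moreover have "0 \<in> p 0"
        using p(1) additive_subgroup.zero_closed[OF ideal.axioms(1)[OF primeideal.axioms(1), of "p 0" "monoid_algebra M"]] by simp
      ultimately show "\<forall>xs\<in>?L. c xs = 0"
        using p f by (intro chain_independent[OF M, where l = l and p = p and f = f and i = 0 and m = l and n = n and c = c]) auto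
    qed
    also have "\<dots> \<le> B * (s * n * l + 1) ^ d" by (rule growth)
    also have "card ?L = (n + 1) ^ l" by (subst card_lists_length_eq) auto
    finally show ?thesis .
  qed
  show "enat l \<le> enat d"
  proof (rule ccontr)
    assume "\<not> enat l \<le> enat d"
    then have ld: "d < l" by simp
    \<comment> \<open>Since \<open>s * n * l + 1 \<le> (s * l + 1) * (n + 1)\<close>, with this
      \<open>n\<close> the growth bound would read
      \<open>(n + 1) ^ (d + 1) \<le> n * (n + 1) ^ d\<close>.\<close>
    define n where "n = B * (s * l + 1) ^ d"
    have "(n + 1) ^ (d + 1) \<le> (n + 1) ^ l" using ld by (intro power_increasing) auto
    also have "\<dots> \<le> B * (s * n * l + 1) ^ d" by (rule main)
    also have "\<dots> \<le> B * ((s * l + 1) * (n + 1)) ^ d"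
      by (intro mult_left_mono power_mono) (auto simp: algebra_simps)
    also have "\<dots> = (B * (s * l + 1) ^ d) * (n + 1) ^ d" by (simp only: power_mult_distrib mult.assoc)
    also have "\<dots> = n * (n + 1) ^ d" by (simp only: n_def[symmetric])
    finally have "(n + 1) * (n + 1) ^ d \<le> n * (n + 1) ^ d" by simp
    then show False by simp
  qed
qed

subsection \<open>Degree from a Hilbert function\<close>

text \<open>The polynomial in q with value (q - 1) choose k at every q \<ge> 1; the shift is the one
  that occurs when monomials with a prescribed support are counted.\<close>

definition binomial_poly :: "nat \<Rightarrow> rat poly" where
  "binomial_poly k = smult (1 / fact k) (\<Prod>i<k. [:- (1 + of_nat i), 1:])"

lemma poly_binomial_poly: "q \<ge> 1 \<Longrightarrow> poly (binomial_poly k) (of_nat q) = of_nat ((q - 1) choose k)"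
proof -
  assume "q \<ge> 1"
  then obtain n where n: "q = Suc n" by (cases q) auto
  have "poly (\<Prod>i<k. [:- (1 + of_nat i), 1:]) (of_nat q) = (\<Prod>i<k. of_nat n - of_nat i :: rat)"
    by (simp add: poly_prod n algebra_simps)
  moreover have "of_nat (n choose k) = (\<Prod>i<k. of_nat n - of_nat i :: rat) / fact k"
    by (simp add: binomial_gbinomial gbinomial_prod_rev atLeast0LessThan)
  ultimately show ?thesis by (simp add: binomial_poly_def n)
qed

lemma degree_binomial_poly: "degree (binomial_poly k) = k" and lead_coeff_binomial_poly: "lead_coeff (binomial_poly k) = 1 / fact k"
proof -
  let ?p = "\<lambda>k. \<Prod>i<k. [:- (1 + of_nat i), 1 :: rat:]"
  have *: "degree (?p k) = k \<and> lead_coeff (?p k) = 1"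
  proof (induction k)
    case (Suc k)
    then have *: "degree (?p k) = k" "coeff (?p k) k = 1" by auto
    then have "?p k \<noteq> 0" by auto
    then show ?case
      using * lead_coeff_mult[of "?p k" "[:- (1 + of_nat k), 1:]"]
      by (simp add: degree_mult_eq del: mult_pCons_right)
  qed simp
  note d = conjunct1[OF *] and l = conjunct2[OF *]
  show "degree (binomial_poly k) = k"
    by (simp only: binomial_poly_def degree_smult_eq d) simp
  show "lead_coeff (binomial_poly k) = 1 / fact k"
    by (simp only: binomial_poly_def lead_coeff_smult l mult_1_right)
qed

text \<open>The description defining the degree is unique because dimensions are unique and two
  polynomials that agree at infinitely many integers are equal.\<close>

lemma graded_degree_eqI:
  fixes p :: "rat poly" and hf :: "nat \<Rightarrow> nat"
  assumes R: "ring G" and K: "subfield (range (\<lambda>c. c \<odot>\<^bsub>G\<^esub> \<one>\<^bsub>G\<^esub>)) G"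
    and krull: "krull_dimension G = enat (r + 1)"
    and dim: "\<And>q. ring.dimension G (hf q) (range (\<lambda>c. c \<odot>\<^bsub>G\<^esub> \<one>\<^bsub>G\<^esub>)) (H q)"
    and hf: "\<And>q. q \<ge> 1 \<Longrightarrow> poly p (of_nat q) = of_nat (hf q)"
  shows "graded_degree G H = lead_coeff p * fact r"
  unfolding graded_degree_def
proof (rule the_equality)
  interpret ring G by (rule R)
  let ?K = "range (\<lambda>c. c \<odot>\<^bsub>G\<^esub> \<one>\<^bsub>G\<^esub>)"
  have "\<forall>\<^sub>F q in sequentially. \<exists>d. dimension d ?K (H q) \<and> poly p (of_nat q) = of_nat d"
    using eventually_ge_at_top[of 1] by eventually_elim (use dim hf in blast)
  then show "\<exists>r' p'. krull_dimension G = enat (r' + 1) \<and>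
      (\<forall>\<^sub>F q in sequentially. \<exists>d. dimension d ?K (H q) \<and> poly p' (of_nat q) = of_nat d) \<and>
      lead_coeff p' = lead_coeff p * fact r / fact r'"
    using krull by (intro exI[of _ r] exI[of _ p]) simp
  fix e :: rat assume "\<exists>r' p'. krull_dimension G = enat (r' + 1) \<and>
      (\<forall>\<^sub>F q in sequentially. \<exists>d. dimension d ?K (H q) \<and> poly p' (of_nat q) = of_nat d) \<and>
      lead_coeff p' = e / fact r'"
  then obtain p' where p': "\<forall>\<^sub>F q in sequentially. \<exists>d. dimension d ?K (H q) \<and> poly p' (of_nat q) = of_nat d"
    "lead_coeff p' = e / fact r" using krull by auto
  then obtain n where n: "\<And>q. q \<ge> n \<Longrightarrow> \<exists>d. dimension d ?K (H q) \<and> poly p' (of_nat q) = of_nat d"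
    by (auto simp: eventually_sequentially)
  have "p' - p = 0"
  proof (rule ccontr)
    assume "p' - p \<noteq> 0"
    then have "finite {x. poly (p' - p) x = 0}" by (rule poly_roots_finite)
    moreover have "of_nat ` {Suc n..} \<subseteq> {x. poly (p' - p) x = 0}"
    proof safe
      fix q assume q: "q \<ge> Suc n"
      obtain d where "dimension d ?K (H q)" "poly p' (of_nat q) = of_nat d" using n[of q] q by auto
      then show "poly (p' - p) (of_nat q) = 0"
        using dimension_is_inj[OF K _ dim[of q], of d] hf[of q] q by simp
    qed
    ultimately have "finite (of_nat ` {Suc n..} :: rat set)" by (rule rev_finite_subset)
    then have "finite {Suc n..}" by (rule finite_imageD) (auto simp: inj_on_def)
    then show False by (simp add: infinite_Ici)
  qed
  then show "e = lead_coeff p * fact r" using p' by simp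
qed

text \<open>The Hilbert function has the form it has for a simplicial complex with
  \<open>c k\<close> faces of \<open>k\<close> vertices. Its growth bounds the Krull dimension by d,
  the chain \<open>T\<close> of faces attains d, and the leading coefficient
  \<open>c d / (d - 1)!\<close> has the normalisation of the degree for r = d - 1.\<close>

theorem graded_degree_monoid_algebra:
  fixes deg :: "'m::{ordered_cancel_comm_monoid_add, linorder} \<Rightarrow> nat" and G :: "('k::field, 'a) module"
  assumes M: "additive_submonoid M"
    and deg: "\<And>s t. s \<in> M \<Longrightarrow> t \<in> M \<Longrightarrow> deg (s + t) = deg s + deg t"
    and fin: "\<And>q. finite {s \<in> M. deg s = q}"
    and count: "\<And>q. q \<ge> 1 \<Longrightarrow> card {s \<in> M. deg s = q} = (\<Sum>k=1..d. c k * ((q - 1) choose (k - 1)))"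
    and d: "d \<ge> 1" "c d > 0"
    and T: "\<And>i. i \<le> d \<Longrightarrow> T i \<subseteq> M" "\<And>i. i \<le> d \<Longrightarrow> 0 \<in> T i"
    and face: "\<And>i s t. i \<le> d \<Longrightarrow> s \<in> M \<Longrightarrow> t \<in> M \<Longrightarrow> s + t \<in> T i \<longleftrightarrow> s \<in> T i \<and> t \<in> T i"
    and strict: "\<And>i. i < d \<Longrightarrow> T (Suc i) \<subset> T i"
    and h: "h \<in> ring_iso (monoid_algebra M) G" "h 0 = \<zero>\<^bsub>G\<^esub>"
      "\<And>a b. b \<in> supported M \<Longrightarrow> h (a \<odot>\<^bsub>monoid_algebra M\<^esub> b) = a \<odot>\<^bsub>G\<^esub> h b"
      "\<And>q. h ` {b. Poly_Mapping.keys b \<subseteq> {s \<in> M. deg s = q}} = H q"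
  shows "graded_degree G H = of_nat (c d)"
proof -
  let ?R = "monoid_algebra M :: ('k, 'm \<Rightarrow>\<^sub>0 'k) module"
  let ?D = "\<lambda>q. {s \<in> M. deg s = q}"
  interpret R: cring ?R by (rule cring_monoid_algebra[OF M])
  have "cring (G\<lparr>zero := h \<zero>\<^bsub>?R\<^esub>\<rparr>)" by (rule R.ring_iso_imp_img_cring[OF h(1)])
  then have G: "cring G" using h(2) by simp
  interpret G: cring G by (rule G)
  have hom: "h \<in> ring_hom ?R G" and bij: "bij_betw h (supported M) (carrier G)"
    using h(1) by (auto simp: ring_iso_def)
  interpret h: ring_hom_ring ?R G h by (rule ring_hom_ringI2[OF R.ring_axioms G.ring_axioms hom])
  have one: "h 1 = \<one>\<^bsub>G\<^esub>" using h.hom_one by simp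
  have K: "h ` constants = range (\<lambda>c. c \<odot>\<^bsub>G\<^esub> \<one>\<^bsub>G\<^esub>)"
    using h(3)[of 1] M one by (simp add: constants_def image_image)
  have "\<one>\<^bsub>G\<^esub> \<noteq> \<zero>\<^bsub>G\<^esub>"
    using bij one h(2) M by (metis bij_betw_def inj_on_eq_iff supported_one supported_zero zero_neq_one)
  then have subfield: "subfield (range (\<lambda>c. c \<odot>\<^bsub>G\<^esub> \<one>\<^bsub>G\<^esub>)) G"
    using h.img_is_subfield(2)[OF subfield_constants[OF M]] K by simp
  have dim: "G.dimension (card (?D q)) (range (\<lambda>c. c \<odot>\<^bsub>G\<^esub> \<one>\<^bsub>G\<^esub>)) (H q)" for q
  proof -
    have D: "supported (?D q) \<subseteq> (supported M :: ('m \<Rightarrow>\<^sub>0 'k) set)" by (auto simp: supported_def)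
    have "inj_on h (supported (?D q))" using bij D by (auto simp: bij_betw_def intro: inj_on_subset)
    from h.inj_hom_dimension[OF subfield_constants[OF M] _ this dimension_supported[OF M fin]]
    have "G.dimension (card (?D q)) (h ` constants) (h ` supported (?D q))"
      using \<open>\<one>\<^bsub>G\<^esub> \<noteq> \<zero>\<^bsub>G\<^esub>\<close> by auto
    moreover have "h ` supported (?D q) = H q" using h(4)[of q] by (simp add: supported_def)
    ultimately show ?thesis by (simp add: K)
  qed
  define p where "p = (\<Sum>k=1..d. smult (of_nat (c k)) (binomial_poly (k - 1)))"
  have p: "poly p (of_nat q) = of_nat (card (?D q))" if "q \<ge> 1" for q
    using that by (simp add: p_def poly_sum count poly_binomial_poly)
  have split: "p = smult (of_nat (c d)) (binomial_poly (d - 1)) + (\<Sum>k=1..<d. smult (of_nat (c k)) (binomial_poly (k - 1)))"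
    using d unfolding p_def by (simp add: sum.last_plus)
  have coeff: "coeff p (d - 1) = of_nat (c d) / fact (d - 1)"
  proof -
    have "coeff (binomial_poly (k - 1)) (d - 1) = 0" if "k \<in> {1..<d}" for k
      using that by (intro coeff_eq_0) (auto simp: degree_binomial_poly)
    then show ?thesis
      using lead_coeff_binomial_poly[of "d - 1"] by (simp add: split coeff_sum degree_binomial_poly)
  qed
  have "degree p \<le> d - 1"
    unfolding p_def by (rule degree_sum_le) (auto simp: degree_binomial_poly intro: order.trans[OF degree_smult_le])
  then have "degree p = d - 1" using coeff d by (intro antisym le_degree) auto
  then have lead: "lead_coeff p = of_nat (c d) / fact (d - 1)" using coeff by simp
  have krull: "krull_dimension G = enat (d - 1 + 1)"
  proof -
    have "krull_dimension ?R \<le> enat d"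
    proof (rule krull_dimension_upper[OF M deg])
      have un: "{s \<in> M. deg s \<le> n} = (\<Union>q\<le>n. ?D q)" for n by auto
      show "finite {s \<in> M. deg s \<le> n}" for n unfolding un using fin by auto
      fix n
      \<comment> \<open>Degree 0 is added separately, since \<open>count\<close> speaks only of q
        \<ge> 1.\<close>
      define B where "B = card (?D 0) + (\<Sum>k=1..d. c k)"
      have bound: "card (?D q) \<le> B * (n + 1) ^ (d - 1)" if "q \<le> n" for q
      proof (cases "q = 0")
        case True
        have "card (?D 0) * 1 \<le> B * (n + 1) ^ (d - 1)" unfolding B_def by (intro mult_mono) auto
        then show ?thesis using True by simp
      next
        case False
        have "card (?D q) = (\<Sum>k=1..d. c k * ((q - 1) choose (k - 1)))" using False by (intro count) simp
        also have "\<dots> \<le> (\<Sum>k=1..d. c k * (n + 1) ^ (d - 1))"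
        proof (intro sum_mono mult_left_mono)
          fix k assume k: "k \<in> {1..d}"
          have "(q - 1) choose (k - 1) \<le> (n + 1) ^ (k - 1)"
          proof (cases "k - 1 \<le> q - 1")
            case True
            have "(q - 1) choose (k - 1) \<le> (q - 1) ^ (k - 1)" by (rule binomial_le_pow[OF True])
            also have "\<dots> \<le> (n + 1) ^ (k - 1)" using that by (intro power_mono) auto
            finally show ?thesis .
          qed (simp add: binomial_eq_0)
          also have "\<dots> \<le> (n + 1) ^ (d - 1)" using k by (intro power_increasing) auto
          finally show "(q - 1) choose (k - 1) \<le> (n + 1) ^ (d - 1)" .
        qed auto
        also have "\<dots> \<le> B * (n + 1) ^ (d - 1)" by (simp add: B_def sum_distrib_right add_mult_distrib)
        finally show ?thesis .
      qed
      have "card {s \<in> M. deg s \<le> n} \<le> (\<Sum>q\<le>n. card (?D q))" unfolding un by (rule card_UN_le) simp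
      also have "\<dots> \<le> (\<Sum>q\<le>n. B * (n + 1) ^ (d - 1))" by (intro sum_mono bound) simp
      also have "\<dots> = B * (n + 1) ^ (d - 1 + 1)" by (simp add: algebra_simps)
      also have "d - 1 + 1 = d" using d by simp
      finally show "card {s \<in> M. deg s \<le> n} \<le> (card (?D 0) + (\<Sum>k=1..d. c k)) * (n + 1) ^ d"
        by (simp add: B_def)
    qed
    moreover have "enat d \<le> krull_dimension ?R"
      by (rule krull_dimension_lower[of M d T]) (use M T face strict in auto)
    ultimately show ?thesis
      using krull_dimension_iso[OF R.is_cring G h(1)] d by simp
  qed
  have "graded_degree G H = lead_coeff p * fact (d - 1)"
    by (rule graded_degree_eqI[OF G.ring_axioms subfield krull dim p])
  then show ?thesis by (simp add: lead)
qed

section \<open>The monoid of a product of ladders and a torus\<close>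

definition ladder_cells :: "nat \<Rightarrow> (nat \<times> nat) set" where
  "ladder_cells k = I2 (k + 4) - {(1, 2), (k + 3, k + 4)}"

lemma ladder_cells_iff:
  "(a, b) \<in> ladder_cells k \<longleftrightarrow> 1 \<le> a \<and> a < b \<and> a \<le> k + 2 \<and> 3 \<le> b \<and> b \<le> k + 4"
  by (auto simp: ladder_cells_def I2_def)

lemma finite_ladder_cells [simp]: "finite (ladder_cells k)"
  by (rule finite_subset[of _ "{..k + 4} \<times> {..k + 4}"]) (auto simp: ladder_cells_iff)

datatype coordinate = Row nat nat | Col nat nat | Tor nat

type_synonym generator = "(nat \<times> nat \<times> nat) + nat"

text \<open>
  The generator \<open>Inl (j, a, b)\<close> is the product of a row variable and a column variable of the
  \<open>j\<close>-th ladder, with the variable of the row \<open>1\<close>, which meets all columns, set to \<open>1\<close>.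
\<close>

locale ladder_product =
  fixes g m :: nat and k :: "nat \<Rightarrow> nat"
begin

definition generators :: "generator set" where
  "generators = {Inl (j, c) | j c. j < g \<and> c \<in> ladder_cells (k j)} \<union> Inr ` {..<m}"

definition coordinates :: "coordinate set" where
  "coordinates = {Row j a | j a. j < g \<and> a \<in> {2..k j + 2}} \<union> {Col j b | j b. j < g \<and> b \<in> {3..k j + 4}} \<union> Tor ` {..<m}"

text \<open>Affine toric varieties are defined by cones in spaces indexed by an initial segment of
  the naturals, so the coordinates are numbered.\<close>

definition code :: "coordinate \<Rightarrow> nat" where
  "code = to_nat_on coordinates"

definition unit :: "coordinate \<Rightarrow> (nat \<Rightarrow>\<^sub>0 real)" where
  "unit c = Poly_Mapping.single (code c) 1"

definition val :: "(nat \<Rightarrow>\<^sub>0 real) \<Rightarrow> coordinate \<Rightarrow> real" where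
  "val s c = Poly_Mapping.lookup s (code c)"

definition \<nu> :: "generator \<Rightarrow> (nat \<Rightarrow>\<^sub>0 real)" where
  "\<nu> v = (case v of Inl (j, a, b) \<Rightarrow> (if a = 1 then 0 else unit (Row j a)) + unit (Col j b) | Inr t \<Rightarrow> unit (Tor t))"

definition \<nu>M :: "generator multiset \<Rightarrow> (nat \<Rightarrow>\<^sub>0 real)" where
  "\<nu>M M = (\<Sum>v\<in>#M. \<nu> v)"

definition S :: "(nat \<Rightarrow>\<^sub>0 real) set" where
  "S = \<nu>M ` {M. set_mset M \<subseteq> generators}"

lemma coordinates_iff [simp]:
  "Row j a \<in> coordinates \<longleftrightarrow> j < g \<and> a \<in> {2..k j + 2}"
  "Col j b \<in> coordinates \<longleftrightarrow> j < g \<and> b \<in> {3..k j + 4}"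
  "Tor t \<in> coordinates \<longleftrightarrow> t < m"
  by (auto simp: coordinates_def)

lemma generators_iff [simp]:
  "Inl (j, c) \<in> generators \<longleftrightarrow> j < g \<and> c \<in> ladder_cells (k j)"
  "Inr t \<in> generators \<longleftrightarrow> t < m"
  by (cases c; auto simp: generators_def)+

lemma coordinates_alt: "coordinates = (\<Union>j<g. Row j ` {2..k j + 2} \<union> Col j ` {3..k j + 4}) \<union> Tor ` {..<m}"
  by (auto simp: coordinates_def)

lemma finite_coordinates [simp]: "finite coordinates"
  by (simp add: coordinates_alt)

lemma finite_generators [simp]: "finite generators"
proof -
  have "generators \<subseteq> (\<Union>j<g. (\<lambda>c. Inl (j, c)) ` ladder_cells (k j)) \<union> Inr ` {..<m}"
    by (auto simp: generators_def)
  then show ?thesis by (rule finite_subset) simp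
qed

lemma code_bij: "bij_betw code coordinates {..<card coordinates}"
  unfolding code_def by (rule to_nat_on_finite) simp

lemma code_eq_iff: "c \<in> coordinates \<Longrightarrow> c' \<in> coordinates \<Longrightarrow> code c = code c' \<longleftrightarrow> c = c'"
  using code_bij by (auto simp: bij_betw_def inj_on_def)

lemma val_unit [simp]:
  "c \<in> coordinates \<Longrightarrow> c' \<in> coordinates \<Longrightarrow> val (unit c) c' = (if c = c' then 1 else 0)"
  by (simp add: val_def unit_def lookup_single code_eq_iff)

lemma val_add [simp]: "val (s + t) c = val s c + val t c" and val_0 [simp]: "val 0 c = 0"
  and val_diff [simp]: "val (s - t) c = val s c - val t c"
  by (simp_all add: val_def lookup_add lookup_minus)

lemma \<nu>M_simps [simp]: "\<nu>M {#} = 0" "\<nu>M (add_mset v M) = \<nu> v + \<nu>M M" "\<nu>M (M + N) = \<nu>M M + \<nu>M N"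
  by (simp_all add: \<nu>M_def)

lemma \<nu>_simps: "\<nu> (Inl (j, a, b)) = (if a = 1 then 0 else unit (Row j a)) + unit (Col j b)" "\<nu> (Inr t) = unit (Tor t)"
  by (simp_all add: \<nu>_def)

text \<open>The exponent of a row variable, recovered for the row \<open>1\<close> from the balance between rows and columns.\<close>

definition row_val :: "(nat \<Rightarrow>\<^sub>0 real) \<Rightarrow> nat \<Rightarrow> nat \<Rightarrow> real" where
  "row_val s j a = (if a = 1 then (\<Sum>b=3..k j + 4. val s (Col j b)) - (\<Sum>a=2..k j + 2. val s (Row j a)) else val s (Row j a))"

lemma row_val_add: "row_val (s + t) j a = row_val s j a + row_val t j a"
  by (simp add: row_val_def sum.distrib)

lemma row_val_\<nu>:
  assumes "v \<in> generators" "j < g" "a \<in> {1..k j + 2}"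
  shows "row_val (\<nu> v) j a = (if \<exists>b. v = Inl (j, a, b) then 1 else 0)"
proof (cases v)
  case (Inl x)
  obtain j' a' b' where x: "x = (j', a', b')" by (cases x)
  have v: "j' < g" "(a', b') \<in> ladder_cells (k j')" using assms Inl x by auto
  have *: "val (\<nu> v) (Row j i) = (if j' = j \<and> a' = i \<and> a' \<noteq> 1 then 1 else 0)" if "i \<in> {2..k j + 2}" for i
    using v that assms by (auto simp: Inl x \<nu>_simps ladder_cells_iff)
  have **: "val (\<nu> v) (Col j i) = (if j' = j \<and> b' = i then 1 else 0)" if "i \<in> {3..k j + 4}" for i
    using v that assms by (auto simp: Inl x \<nu>_simps ladder_cells_iff)
  have "(\<Sum>i=3..k j + 4. val (\<nu> v) (Col j i)) = (\<Sum>i=3..k j + 4. if i = b' then (if j' = j then 1 else 0) else 0)"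
    by (intro sum.cong refl) (auto simp: **)
  also have "\<dots> = (if j' = j then 1 else 0)"
    using v by (auto simp: ladder_cells_iff)
  finally have c: "(\<Sum>i=3..k j + 4. val (\<nu> v) (Col j i)) = (if j' = j then 1 else 0)" .
  have "(\<Sum>i=2..k j + 2. val (\<nu> v) (Row j i)) = (\<Sum>i=2..k j + 2. if i = a' then (if j' = j \<and> a' \<noteq> 1 then 1 else 0) else 0)"
    by (intro sum.cong refl) (auto simp: *)
  also have "\<dots> = (if j' = j \<and> a' \<noteq> 1 then 1 else 0)"
    using v by (auto simp: ladder_cells_iff)
  finally have r: "(\<Sum>i=2..k j + 2. val (\<nu> v) (Row j i)) = (if j' = j \<and> a' \<noteq> 1 then 1 else 0)" .
  show ?thesis
  proof (cases "a = 1")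
    case True
    then show ?thesis using c r by (auto simp: row_val_def Inl x)
  next
    case False
    then have "a \<in> {2..k j + 2}" using assms by auto
    then show ?thesis using * False by (auto simp: row_val_def Inl x)
  qed
next
  case (Inr t)
  then have "val (\<nu> v) (Row j i) = 0" if "i \<in> {2..k j + 2}" for i using assms that by (auto simp: \<nu>_simps)
  moreover have "val (\<nu> v) (Col j i) = 0" if "i \<in> {3..k j + 4}" for i using assms that Inr by (auto simp: \<nu>_simps)
  ultimately show ?thesis using assms by (cases "a = 1") (auto simp: row_val_def Inr)
qed

lemma row_val_\<nu>M:
  assumes "set_mset M \<subseteq> generators" "j < g" "a \<in> {1..k j + 2}"
  shows "row_val (\<nu>M M) j a = real (size {#v \<in># M. \<exists>b. v = Inl (j, a, b)#})"
  using assms(1)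
proof (induction M)
  case (add v M)
  then show ?case using row_val_\<nu>[OF _ assms(2,3), of v] by (auto simp: row_val_add)
qed (simp add: row_val_def)

lemma col_val_\<nu>M:
  assumes "set_mset M \<subseteq> generators" "j < g" "b \<in> {3..k j + 4}"
  shows "val (\<nu>M M) (Col j b) = real (size {#v \<in># M. \<exists>a. v = Inl (j, a, b)#})"
  using assms(1)
proof (induction M)
  case (add v M)
  have "val (\<nu> v) (Col j b) = (if \<exists>a. v = Inl (j, a, b) then 1 else 0)"
    using add.prems assms by (cases v) (auto simp: \<nu>_simps ladder_cells_iff)
  then show ?case using add by auto
qed simp

lemma tor_val_\<nu>M:
  assumes "set_mset M \<subseteq> generators" "t < m"
  shows "val (\<nu>M M) (Tor t) = real (count M (Inr t))"
  using assms(1)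
proof (induction M)
  case (add v M)
  have "val (\<nu> v) (Tor t) = (if v = Inr t then 1 else 0)"
    using add.prems assms by (cases v) (auto simp: \<nu>_simps ladder_cells_iff)
  then show ?case using add by auto
qed simp

lemma row_present_iff:
  assumes "set_mset M \<subseteq> generators" "j < g" "a \<in> {1..k j + 2}"
  shows "(\<exists>b. Inl (j, a, b) \<in># M) \<longleftrightarrow> row_val (\<nu>M M) j a \<noteq> 0"
  unfolding row_val_\<nu>M[OF assms] by (auto simp: filter_mset_eq_mempty_iff)

lemma col_present_iff:
  assumes "set_mset M \<subseteq> generators" "j < g" "b \<in> {3..k j + 4}"
  shows "(\<exists>a. Inl (j, a, b) \<in># M) \<longleftrightarrow> val (\<nu>M M) (Col j b) \<noteq> 0"
  unfolding col_val_\<nu>M[OF assms] by (auto simp: filter_mset_eq_mempty_iff)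

text \<open>Each ladder generator contains exactly one column variable, also in row 1 where the row
  variable is missing; so the column exponents and the torus exponents together count
  factors.\<close>

definition deg :: "(nat \<Rightarrow>\<^sub>0 real) \<Rightarrow> nat" where
  "deg s = nat \<lfloor>(\<Sum>j<g. \<Sum>b=3..k j + 4. val s (Col j b)) + (\<Sum>t<m. val s (Tor t))\<rfloor>"

lemma deg_\<nu>M:
  assumes "set_mset M \<subseteq> generators"
  shows "deg (\<nu>M M) = size M"
proof -
  have "(\<Sum>j<g. \<Sum>b=3..k j + 4. val (\<nu>M M) (Col j b)) + (\<Sum>t<m. val (\<nu>M M) (Tor t)) = real (size M)"
    using assms
  proof (induction M)
    case (add v M)
    have "(\<Sum>j<g. \<Sum>b=3..k j + 4. val (\<nu> v) (Col j b)) + (\<Sum>t<m. val (\<nu> v) (Tor t)) = 1"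
    proof (cases v)
      case (Inl x)
      obtain j a b where x: "x = (j, a, b)" by (cases x)
      have v: "j < g" "(a, b) \<in> ladder_cells (k j)" using add.prems Inl x by auto
      have "(\<Sum>j'<g. \<Sum>b'=3..k j' + 4. val (\<nu> v) (Col j' b')) =
        (\<Sum>j'<g. \<Sum>b'=3..k j' + 4. if b' = b then (if j' = j then 1 else 0) else 0)"
        using v by (intro sum.cong refl) (auto simp: Inl x \<nu>_simps ladder_cells_iff)
      also have "\<dots> = (\<Sum>j'<g. if j' = j then 1 else 0)"
        using v by (intro sum.cong refl) (auto simp: ladder_cells_iff)
      also have "\<dots> = 1" using v by simp
      finally show ?thesis using v by (auto simp: Inl x \<nu>_simps ladder_cells_iff)
    next
      case (Inr t)
      then show ?thesis using add.prems by (auto simp: \<nu>_simps)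
    qed
    then show ?case using add by (simp add: sum.distrib)
  qed simp
  then show ?thesis by (simp add: deg_def)
qed

lemma S_E:
  assumes "s \<in> S" obtains M where "set_mset M \<subseteq> generators" "s = \<nu>M M"
  using assms by (auto simp: S_def)

lemma \<nu>M_S: "set_mset M \<subseteq> generators \<Longrightarrow> \<nu>M M \<in> S"
  by (auto simp: S_def)

lemma \<nu>_S: "v \<in> generators \<Longrightarrow> \<nu> v \<in> S"
  using \<nu>M_S[of "{#v#}"] by simp

lemma additive_submonoid_S: "additive_submonoid S"
  unfolding additive_submonoid_def
proof (intro conjI ballI)
  show "0 \<in> S" using \<nu>M_S[of "{#}"] by simp
  fix s t assume "s \<in> S" "t \<in> S"
  then obtain M N where "set_mset M \<subseteq> generators" "s = \<nu>M M" "set_mset N \<subseteq> generators" "t = \<nu>M N" by (metis S_E)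
  then show "s + t \<in> S" using \<nu>M_S[of "M + N"] by simp
qed

lemma deg_add: "s \<in> S \<Longrightarrow> t \<in> S \<Longrightarrow> deg (s + t) = deg s + deg t"
proof -
  assume "s \<in> S" "t \<in> S"
  then obtain M N where "set_mset M \<subseteq> generators" "s = \<nu>M M" "set_mset N \<subseteq> generators" "t = \<nu>M N" by (metis S_E)
  then show ?thesis using deg_\<nu>M[of "M + N"] deg_\<nu>M[of M] deg_\<nu>M[of N] by simp
qed

subsection \<open>Standard monomials\<close>

text \<open>The two cells are incomparable in the componentwise order. A standard set is thus a
  chain in every ladder, together with any free generators.\<close>

definition crossing :: "generator \<Rightarrow> generator \<Rightarrow> bool" where
  "crossing u v \<longleftrightarrow> (\<exists>j a b c d. u = Inl (j, a, b) \<and> v = Inl (j, c, d) \<and> a < c \<and> d < b)"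

definition standard :: "generator set \<Rightarrow> bool" where
  "standard F \<longleftrightarrow> (\<forall>u\<in>F. \<forall>v\<in>F. \<not> crossing u v)"

lemma standard_subset: "standard F \<Longrightarrow> F' \<subseteq> F \<Longrightarrow> standard F'"
  by (auto simp: standard_def)

text \<open>A finite chain has a least element, so the least row and the least column that occur are
  attained in the same cell.\<close>

lemma standard_corner:
  assumes M: "set_mset M \<subseteq> generators" "standard (set_mset M)"
    and a: "Inl (j, a, b') \<in># M" "\<And>a' b'. Inl (j, a', b') \<in># M \<Longrightarrow> a \<le> a'"
    and b: "Inl (j, a', b) \<in># M" "\<And>a' b'. Inl (j, a', b') \<in># M \<Longrightarrow> b \<le> b'"
  shows "Inl (j, a, b) \<in># M"
proof -
  have "\<not> crossing (Inl (j, a, b')) (Inl (j, a', b))" using M a b by (auto simp: standard_def)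
  then have "a' \<le> a \<or> b' \<le> b" by (auto simp: crossing_def not_less)
  then show ?thesis using a(1) a(2)[OF b(1)] b(1) b(2)[OF a(1)] by (metis le_antisym)
qed

text \<open>It suffices to find a common generator and remove it. A free generator is read off its
  own coordinate. In a ladder the exponent vector shows which rows and which columns occur, and by
  \<open>standard_corner\<close> the least of each meet in a cell of both multisets.\<close>

lemma standard_unique:
  assumes "set_mset M \<subseteq> generators" "standard (set_mset M)" "set_mset M' \<subseteq> generators" "standard (set_mset M')"
    and "\<nu>M M = \<nu>M M'"
  shows "M = M'"
  using assms
proof (induction "size M" arbitrary: M M')
  case 0
  then show ?case using deg_\<nu>M[of M] deg_\<nu>M[of M'] by simp
next
  case (Suc n)
  have "\<exists>w. w \<in># M \<and> w \<in># M'"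
  proof -
    obtain v where v: "v \<in># M" using Suc.hyps(2) by (metis nonempty_has_size zero_less_Suc multiset_nonemptyE)
    show ?thesis
    proof (cases v)
      case (Inr t)
      then have "t < m" using v Suc.prems by auto
      then have "count M' (Inr t) = count M (Inr t)"
        using tor_val_\<nu>M[of M t] tor_val_\<nu>M[of M' t] Suc.prems by simp
      then show ?thesis using v Inr by (metis count_eq_zero_iff)
    next
      case (Inl x)
      then obtain j a0 b0 where x: "Inl (j, a0, b0) \<in># M" using v by (cases x) auto
      then have j: "j < g" using Suc.prems by auto
      have row: "(\<exists>b. Inl (j, a, b) \<in># M) \<longleftrightarrow> (\<exists>b. Inl (j, a, b) \<in># M')" for a
      proof (cases "a \<in> {1..k j + 2}")
        case True
        then show ?thesis using row_present_iff[OF _ j True] Suc.prems by metis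
      next
        case False
        then have "Inl (j, a, b) \<notin> generators" for b by (auto simp: ladder_cells_iff)
        then show ?thesis using Suc.prems by blast
      qed
      have col: "(\<exists>a. Inl (j, a, b) \<in># M) \<longleftrightarrow> (\<exists>a. Inl (j, a, b) \<in># M')" for b
      proof (cases "b \<in> {3..k j + 4}")
        case True
        then show ?thesis using col_present_iff[OF _ j True] Suc.prems by metis
      next
        case False
        then have "Inl (j, a, b) \<notin> generators" for a by (auto simp: ladder_cells_iff)
        then show ?thesis using Suc.prems by blast
      qed
      define a where "a = (LEAST a. \<exists>b. Inl (j, a, b) \<in># M)"
      define b where "b = (LEAST b. \<exists>a. Inl (j, a, b) \<in># M)"
      have a: "\<exists>b. Inl (j, a, b) \<in># M" unfolding a_def by (rule LeastI_ex) (use x in blast)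
      have b: "\<exists>a. Inl (j, a, b) \<in># M" unfolding b_def by (rule LeastI_ex) (use x in blast)
      have a_le: "a \<le> a'" if "Inl (j, a', b') \<in># M" for a' b' unfolding a_def by (rule Least_le) (use that in blast)
      have b_le: "b \<le> b'" if "Inl (j, a', b') \<in># M" for a' b' unfolding b_def by (rule Least_le) (use that in blast)
      have "Inl (j, a, b) \<in># M"
        using a b a_le b_le by (blast intro: standard_corner[OF Suc.prems(1,2)])
      moreover have "Inl (j, a, b) \<in># M'"
      proof -
        obtain b' a' where "Inl (j, a, b') \<in># M'" "Inl (j, a', b) \<in># M'" using a b row col by blast
        then show ?thesis
          using a_le b_le row col by (intro standard_corner[OF Suc.prems(3,4), of j a b' a' b]) blast+
      qed
      ultimately show ?thesis by blast
    qed
  qed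
  then obtain w where w: "w \<in># M" "w \<in># M'" by blast
  then obtain N N' where N: "M = add_mset w N" "M' = add_mset w N'" by (metis insert_DiffM)
  then have "N = N'"
    using Suc by (intro Suc.hyps(1)) (auto intro: standard_subset)
  then show ?case by (simp add: N)
qed

text \<open>Replacing the incomparable cells (a, b), (c, d) by (c, b), (a, d) raises the sum of the
  products by (c - a)(b - d), which is positive; this makes straightening terminate.\<close>

definition weight :: "generator \<Rightarrow> nat" where
  "weight v = (case v of Inl (j, a, b) \<Rightarrow> a * b | Inr t \<Rightarrow> 0)"

text \<open>The total weight rises with each swap while the number of factors, and with it the bound
  \<open>B * size M\<close>, stays the same. The relation \<open>R\<close> is left open because it
  is used for equality of exponent vectors and for congruence modulo an ideal.\<close>

lemma straightening:
  assumes refl: "\<And>M. R M M" and trans: "\<And>L M N. R L M \<Longrightarrow> R M N \<Longrightarrow> R L N"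
    and swap: "\<And>j a b c d N. j < g \<Longrightarrow> (a, b) \<in> ladder_cells (k j) \<Longrightarrow> (c, d) \<in> ladder_cells (k j) \<Longrightarrow> a < c \<Longrightarrow> d < b \<Longrightarrow>
      set_mset N \<subseteq> generators \<Longrightarrow> R (add_mset (Inl (j, a, b)) (add_mset (Inl (j, c, d)) N)) (add_mset (Inl (j, c, b)) (add_mset (Inl (j, a, d)) N))"
    and M: "set_mset M \<subseteq> generators"
  shows "\<exists>M'. set_mset M' \<subseteq> generators \<and> standard (set_mset M') \<and> R M M'"
proof -
  define B where "B = Max (insert 0 (weight ` generators))"
  have B: "weight v \<le> B" if "v \<in> generators" for v unfolding B_def using that by (intro Max_ge) auto
  have wB: "(\<Sum>v\<in>#N. weight v) \<le> B * size N" if "set_mset N \<subseteq> generators" for N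
    using that by (induction N) (auto intro!: add_mono B)
  show ?thesis using M
  proof (induction "B * size M - (\<Sum>v\<in>#M. weight v)" arbitrary: M rule: less_induct)
    case less
    show ?case
    proof (cases "standard (set_mset M)")
      case True
      then show ?thesis using less.prems refl by blast
    next
      case False
      then obtain j a b c d where uv: "Inl (j, a, b) \<in># M" "Inl (j, c, d) \<in># M" "a < c" "d < b"
        by (auto simp: standard_def crossing_def)
      then obtain N' where N': "M = add_mset (Inl (j, a, b)) N'" by (metis insert_DiffM)
      then have "Inl (j, c, d) \<in># N'" using uv by auto
      then obtain N where N: "M = add_mset (Inl (j, a, b)) (add_mset (Inl (j, c, d)) N)"
        using N' by (metis insert_DiffM)
      have mem: "j < g" "(a, b) \<in> ladder_cells (k j)" "(c, d) \<in> ladder_cells (k j)" "set_mset N \<subseteq> generators"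
        using less.prems N by auto
      let ?M = "add_mset (Inl (j, c, b)) (add_mset (Inl (j, a, d)) N)"
      \<comment> \<open>The meet and the join of two incomparable cells differ from the removed
        minimum and maximum, so they remain in the ladder.\<close>
      have W: "set_mset ?M \<subseteq> generators" using mem uv by (auto simp: ladder_cells_iff)
      have "a * b + c * d < c * b + a * d"
      proof -
        obtain x y where "c = a + Suc x" "b = d + Suc y" using uv(3,4) by (metis less_imp_Suc_add add_Suc_right)
        then show ?thesis by (simp add: algebra_simps)
      qed
      then have "(\<Sum>v\<in>#M. weight v) < (\<Sum>v\<in>#?M. weight v)" by (simp add: N weight_def)
      moreover have "size ?M = size M" by (simp add: N)
      moreover have "(\<Sum>v\<in>#?M. weight v) \<le> B * size ?M" by (rule wB[OF W])
      ultimately have "B * size ?M - (\<Sum>v\<in>#?M. weight v) < B * size M - (\<Sum>v\<in>#M. weight v)"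
        by simp
      from less.hyps[OF this W] obtain M' where "set_mset M' \<subseteq> generators" "standard (set_mset M')" "R ?M M'"
        by blast
      moreover have "R M ?M" unfolding N using mem uv by (intro swap)
      ultimately show ?thesis using trans by blast
    qed
  qed
qed

lemma \<nu>_swap: "\<nu> (Inl (j, a, b)) + \<nu> (Inl (j, c, d)) = \<nu> (Inl (j, c, b)) + \<nu> (Inl (j, a, d))"
  by (simp add: \<nu>_simps add_ac)

text \<open>
  Two monomials with the same exponent vector are connected by Hibi relations: both straighten
  to the same standard monomial.
\<close>

theorem monomials_congruent:
  assumes refl: "\<And>M. R M M" and sym: "\<And>M N. R M N \<Longrightarrow> R N M" and trans: "\<And>L M N. R L M \<Longrightarrow> R M N \<Longrightarrow> R L N"
    and swap: "\<And>j a b c d N. j < g \<Longrightarrow> (a, b) \<in> ladder_cells (k j) \<Longrightarrow> (c, d) \<in> ladder_cells (k j) \<Longrightarrow> a < c \<Longrightarrow> d < b \<Longrightarrow>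
      set_mset N \<subseteq> generators \<Longrightarrow> R (add_mset (Inl (j, a, b)) (add_mset (Inl (j, c, d)) N)) (add_mset (Inl (j, c, b)) (add_mset (Inl (j, a, d)) N))"
    and M: "set_mset M \<subseteq> generators" "set_mset M' \<subseteq> generators" "\<nu>M M = \<nu>M M'"
  shows "R M M'"
proof -
  define Q where "Q M N \<longleftrightarrow> R M N \<and> \<nu>M M = \<nu>M N" for M N
  have Q: "\<exists>M'. set_mset M' \<subseteq> generators \<and> standard (set_mset M') \<and> Q M M'" if "set_mset M \<subseteq> generators" for M
  proof (rule straightening[OF _ _ _ that])
    fix j a b c d N
    assume *: "j < g" "(a, b) \<in> ladder_cells (k j)" "(c, d) \<in> ladder_cells (k j)" "a < c" "d < b" "set_mset N \<subseteq> generators"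
    show "Q (add_mset (Inl (j, a, b)) (add_mset (Inl (j, c, d)) N)) (add_mset (Inl (j, c, b)) (add_mset (Inl (j, a, d)) N))"
      unfolding Q_def using swap[OF *] \<nu>_swap[of j a b c d] by (simp flip: add.assoc)
  qed (auto simp: Q_def refl intro: trans)
  obtain N where N: "set_mset N \<subseteq> generators" "standard (set_mset N)" "R M N" "\<nu>M M = \<nu>M N" using Q[OF M(1)] by (auto simp: Q_def)
  obtain N' where N': "set_mset N' \<subseteq> generators" "standard (set_mset N')" "R M' N'" "\<nu>M M' = \<nu>M N'" using Q[OF M(2)] by (auto simp: Q_def)
  have "N = N'" using N N' M by (intro standard_unique) auto
  then show ?thesis using N N' sym trans by blast
qed

lemma standard_representative:
  assumes "s \<in> S" shows "\<exists>M. set_mset M \<subseteq> generators \<and> standard (set_mset M) \<and> s = \<nu>M M"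
proof -
  obtain M where M: "set_mset M \<subseteq> generators" "s = \<nu>M M" using assms by (rule S_E)
  have "\<exists>M'. set_mset M' \<subseteq> generators \<and> standard (set_mset M') \<and> \<nu>M M = \<nu>M M'"
    by (rule straightening[OF _ _ _ M(1)]) (auto simp flip: add.assoc simp: \<nu>_swap)
  then show ?thesis using M by simp
qed

end

subsection \<open>Counting standard monomials\<close>

lemma finite_multisets_of_size: "finite F \<Longrightarrow> finite {M. set_mset M \<subseteq> F \<and> size M = n}"
proof (induction n)
  case 0
  have "{M. set_mset M \<subseteq> F \<and> size M = 0} \<subseteq> {{#}}" by auto
  then show ?case by (rule finite_subset) simp
next
  case (Suc n)
  let ?B = "(\<lambda>(x, M). add_mset x M) ` (F \<times> {M. set_mset M \<subseteq> F \<and> size M = n})"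
  have "M \<in> ?B" if M: "set_mset M \<subseteq> F" "size M = Suc n" for M
  proof -
    obtain x where "x \<in># M" using M(2) by (metis multiset_nonemptyE size_empty nat.distinct(1))
    then obtain N where "M = add_mset x N" by (metis insert_DiffM)
    then show ?thesis using M by (intro image_eqI[of _ _ "(x, N)"]) auto
  qed
  then have "{M. set_mset M \<subseteq> F \<and> size M = Suc n} \<subseteq> ?B" by blast
  then show ?case by (rule finite_subset) (use Suc in auto)
qed

text \<open>Removing one copy of a fixed element of the support gives the recursion of Pascal's triangle.\<close>

lemma card_multisets_with_support:
  assumes "finite F"
  shows "card {M. set_mset M = F \<and> size M = Suc n} = (if F = {} then 0 else n choose (card F - 1))"
  using assms
proof (induction n arbitrary: F)
  case 0
  show ?case
  proof (cases "card F = 1")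
    case True
    then obtain x where x: "F = {x}" by (auto simp: card_1_singleton_iff)
    have "{M. set_mset M = F \<and> size M = Suc 0} = {{#x#}}"
    proof (intro equalityI subsetI)
      fix M assume M: "M \<in> {M. set_mset M = F \<and> size M = Suc 0}"
      then obtain y where "M = {#y#}" by (metis (mono_tags) One_nat_def mem_Collect_eq size_1_singleton_mset)
      then show "M \<in> {{#x#}}" using M x by simp
    qed (simp add: x)
    then show ?thesis using x by simp
  next
    case False
    have "{M. set_mset M = F \<and> size M = Suc 0} = {}"
    proof safe
      fix M assume M: "size M = Suc 0" "F = set_mset M"
      then obtain x where "M = {#x#}" by (metis size_1_singleton_mset One_nat_def)
      then show "M \<in> {}" using False M by simp
    qed
    moreover have "0 choose (card F - 1) = 0" if "F \<noteq> {}"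
    proof -
      have "card F \<noteq> 0" using that 0 by simp
      then have "card F - 1 > 0" using False by linarith
      then show ?thesis by (rule binomial_eq_0)
    qed
    ultimately show ?thesis by (metis card.empty)
  qed
next
  case (Suc n)
  show ?case
  proof (cases "F = {}")
    case False
    then obtain x where x: "x \<in> F" by blast
    let ?A = "\<lambda>F n. {M. set_mset M = F \<and> size M = n}"
    have fin: "finite (?A F n)" if "finite F" for F :: "'a set" and n
      by (rule finite_subset[OF _ finite_multisets_of_size[OF that, of n]]) auto
    have split: "?A F (Suc (Suc n)) = add_mset x ` (?A F (Suc n) \<union> ?A (F - {x}) (Suc n))"
    proof (intro equalityI subsetI)
      fix M assume M: "M \<in> ?A F (Suc (Suc n))"
      then have "x \<in># M" using x by simp
      then obtain N where N: "M = add_mset x N" by (metis insert_DiffM)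
      then have N': "insert x (set_mset N) = F" "size N = Suc n" using M by simp_all
      have "set_mset N = F \<or> set_mset N = F - {x}"
        unfolding N'(1)[symmetric] by (metis Diff_insert_absorb insert_absorb)
      then have "N \<in> ?A F (Suc n) \<union> ?A (F - {x}) (Suc n)" using N'(2) by simp
      then show "M \<in> add_mset x ` (?A F (Suc n) \<union> ?A (F - {x}) (Suc n))" using N by blast
    next
      fix M assume "M \<in> add_mset x ` (?A F (Suc n) \<union> ?A (F - {x}) (Suc n))"
      then obtain N where N: "M = add_mset x N" "set_mset N = F \<or> set_mset N = F - {x}" "size N = Suc n"
        by blast
      then have "set_mset M = F" using x by (metis insert_Diff insert_absorb set_mset_add_mset_insert)
      then show "M \<in> ?A F (Suc (Suc n))" using N by simp
    qed
    have "card (?A F (Suc (Suc n))) = card (?A F (Suc n) \<union> ?A (F - {x}) (Suc n))"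
      unfolding split by (rule card_image) (auto simp: inj_on_def)
    also have "\<dots> = card (?A F (Suc n)) + card (?A (F - {x}) (Suc n))"
      using Suc.prems x by (intro card_Un_disjoint fin) auto
    also have "\<dots> = (n choose (card F - 1)) + (if F - {x} = {} then 0 else n choose (card (F - {x}) - 1))"
      using Suc.IH[of F] Suc.IH[of "F - {x}"] Suc.prems False by simp
    also have "\<dots> = Suc n choose (card F - 1)"
    proof (cases "F - {x} = {}")
      case True
      then have "F = {x}" using x by blast
      then show ?thesis by simp
    next
      case False
      then have "card (F - {x}) \<noteq> 0" using Suc.prems by simp
      then obtain c where c: "card F = Suc (Suc c)"
        using x Suc.prems by (metis card_Suc_Diff1 not0_implies_Suc)
      then have "card (F - {x}) = Suc c" using x Suc.prems by simp
      then show ?thesis using False c by simp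
    qed
    finally show ?thesis using False by simp
  qed simp
qed

text \<open>A chain has at most one cell for each value of a + b, and this value runs from 4 to 2k +
  6; hence 2k + 3 is the greatest possible length.\<close>

definition maximal_chains :: "nat \<Rightarrow> (nat \<times> nat) set set" where
  "maximal_chains k = {F. F \<subseteq> ladder_cells k \<and> (\<forall>a b c d. (a, b) \<in> F \<longrightarrow> (c, d) \<in> F \<longrightarrow> \<not> (a < c \<and> d < b)) \<and> card F = 2 * k + 3}"

lemma chain_card_le:
  assumes "F \<subseteq> ladder_cells k" "\<forall>a b c d. (a, b) \<in> F \<longrightarrow> (c, d) \<in> F \<longrightarrow> \<not> (a < c \<and> d < b)"
  shows "card F \<le> 2 * k + 3"
proof -
  have "inj_on (\<lambda>(a, b). a + b) F"
  proof (rule inj_onI, clarify)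
    fix a b c d assume *: "(a, b) \<in> F" "(c, d) \<in> F" "a + b = c + d"
    then have "\<not> (a < c \<and> d < b)" "\<not> (c < a \<and> b < d)" using assms(2) by blast+
    then show "a = c \<and> b = d" using *(3) by linarith
  qed
  moreover have "(\<lambda>(a, b). a + b) ` F \<subseteq> {4..2 * k + 6}" using assms(1) by (force simp: ladder_cells_iff)
  ultimately have "card F \<le> card {4..2 * k + 6}" by (metis card_image card_mono finite_atLeastAtMost)
  then show ?thesis by simp
qed

lemma card_maximal_chains_pos: "card (maximal_chains k) > 0"
proof -
  \<comment> \<open>Along the first row, then down the last column.\<close>
  let ?F = "Pair 1 ` {3..k + 4} \<union> (\<lambda>a. (a, k + 4)) ` {2..k + 2}"
  have "card ?F = card (Pair (1::nat) ` {3..k + 4}) + card ((\<lambda>a. (a, k + 4)) ` {2..k + 2})"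
    by (rule card_Un_disjoint) auto
  also have "\<dots> = 2 * k + 3" by (simp add: card_image inj_on_def)
  finally have "?F \<in> maximal_chains k" unfolding maximal_chains_def by (auto simp: ladder_cells_iff)
  moreover have "finite (maximal_chains k)"
    by (rule finite_subset[of _ "Pow (ladder_cells k)"]) (auto simp: maximal_chains_def)
  ultimately show ?thesis by (auto simp: card_gt_0_iff)
qed

section \<open>The simplicial complex of standard supports and the Hilbert function\<close>

context ladder_product
begin

text \<open>At once the number of coordinates (\<open>card_coordinates\<close>) and the greatest
  number of vertices of a face (\<open>card_face_le\<close>, \<open>card_top_faces\<close>); it will
  be the Krull dimension of K[S].\<close>

definition ldim :: nat where
  "ldim = (\<Sum>j<g. 2 * k j + 3) + m"

text \<open>This complex is the join of the order complexes of the ladders and of a simplex on the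
  free generators.\<close>

definition faces :: "generator set set" where
  "faces = {F. F \<subseteq> generators \<and> standard F}"

definition ladder_part :: "generator set \<Rightarrow> nat \<Rightarrow> (nat \<times> nat) set" where
  "ladder_part F j = {c. Inl (j, c) \<in> F}"

lemma finite_faces [simp]: "finite faces"
  by (rule finite_subset[of _ "Pow generators"]) (auto simp: faces_def)

lemma face_decomposition:
  assumes "F \<subseteq> generators"
  shows "F = (\<Union>j<g. (\<lambda>c. Inl (j, c)) ` ladder_part F j) \<union> Inr ` {t. Inr t \<in> F}"
proof (intro equalityI subsetI)
  fix v assume v: "v \<in> F"
  then have "v \<in> generators" using assms by blast
  then show "v \<in> (\<Union>j<g. (\<lambda>c. Inl (j, c)) ` ladder_part F j) \<union> Inr ` {t. Inr t \<in> F}"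
    using v by (auto simp: generators_def ladder_part_def)
qed (auto simp: ladder_part_def)

lemma card_face:
  assumes "F \<subseteq> generators"
  shows "card F = (\<Sum>j<g. card (ladder_part F j)) + card {t. Inr t \<in> F}"
proof -
  have fin: "finite F" by (rule finite_subset[OF assms finite_generators])
  have fin_part: "finite (ladder_part F j)" for j
    using finite_vimageI[OF fin, of "\<lambda>c. Inl (j, c)"] by (simp add: vimage_def ladder_part_def inj_on_def)
  have fin_tor: "finite {t. Inr t \<in> F}"
    using finite_vimageI[OF fin, of Inr] by (simp add: vimage_def)
  have "card F = card (\<Union>j<g. (\<lambda>c. Inl (j, c) :: generator) ` ladder_part F j) + card (Inr ` {t. Inr t \<in> F} :: generator set)"
  proof -
    have "card F = card ((\<Union>j<g. (\<lambda>c. Inl (j, c) :: generator) ` ladder_part F j) \<union> Inr ` {t. Inr t \<in> F})"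
      by (rule arg_cong[where f = card]) (rule face_decomposition[OF assms])
    also have "\<dots> = card (\<Union>j<g. (\<lambda>c. Inl (j, c) :: generator) ` ladder_part F j) + card (Inr ` {t. Inr t \<in> F} :: generator set)"
    proof (rule card_Un_disjoint)
      show "finite (\<Union>j<g. (\<lambda>c. Inl (j, c) :: generator) ` ladder_part F j)"
        by (intro finite_UN_I finite_lessThan finite_imageI fin_part)
    qed (use fin_tor in blast)+
    finally show ?thesis .
  qed
  also have "card (\<Union>j<g. (\<lambda>c. Inl (j, c) :: generator) ` ladder_part F j) = (\<Sum>j<g. card ((\<lambda>c. Inl (j, c) :: generator) ` ladder_part F j))"
    by (rule card_UN_disjoint) (use fin_part in auto)
  also have "\<dots> = (\<Sum>j<g. card (ladder_part F j))"
    by (intro sum.cong refl card_image) (auto simp: inj_on_def)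
  also have "card (Inr ` {t. Inr t \<in> F} :: generator set) = card {t. Inr t \<in> F}"
    by (rule card_image) (auto simp: inj_on_def)
  finally show ?thesis .
qed

lemma standard_iff:
  assumes "F \<subseteq> generators"
  shows "standard F \<longleftrightarrow> (\<forall>j<g. \<forall>a b c d. (a, b) \<in> ladder_part F j \<longrightarrow> (c, d) \<in> ladder_part F j \<longrightarrow> \<not> (a < c \<and> d < b))"
proof
  assume *: "\<forall>j<g. \<forall>a b c d. (a, b) \<in> ladder_part F j \<longrightarrow> (c, d) \<in> ladder_part F j \<longrightarrow> \<not> (a < c \<and> d < b)"
  have "\<not> (a < c \<and> d < b)" if "Inl (j, a, b) \<in> F" "Inl (j, c, d) \<in> F" for j a b c d
  proof -
    have "Inl (j, a, b) \<in> generators" using that assms by blast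
    then have "j < g" by simp
    then show ?thesis using * that unfolding ladder_part_def by blast
  qed
  then show "standard F" unfolding standard_def crossing_def by blast
next
  assume "standard F"
  then show "\<forall>j<g. \<forall>a b c d. (a, b) \<in> ladder_part F j \<longrightarrow> (c, d) \<in> ladder_part F j \<longrightarrow> \<not> (a < c \<and> d < b)"
    unfolding standard_def crossing_def ladder_part_def by blast
qed

lemma ladder_part_subset: "F \<subseteq> generators \<Longrightarrow> j < g \<Longrightarrow> ladder_part F j \<subseteq> ladder_cells (k j)"
proof -
  assume "F \<subseteq> generators"
  then have "Inl (j, c) \<in> generators" if "c \<in> ladder_part F j" for c using that by (auto simp: ladder_part_def)
  then show ?thesis by auto
qed

lemma torus_part_subset: "F \<subseteq> generators \<Longrightarrow> {t. Inr t \<in> F} \<subseteq> {..<m}"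
proof -
  assume "F \<subseteq> generators"
  then have "Inr t \<in> generators" if "Inr t \<in> F" for t using that by blast
  then show ?thesis by auto
qed

lemma card_face_le:
  assumes "F \<in> faces"
  shows "card F \<le> ldim"
proof -
  have F: "F \<subseteq> generators" "standard F" using assms by (auto simp: faces_def)
  have "card (ladder_part F j) \<le> 2 * k j + 3" if "j < g" for j
    using F(2) that unfolding standard_iff[OF F(1)]
    by (intro chain_card_le ladder_part_subset[OF F(1)]) simp_all
  then have "(\<Sum>j<g. card (ladder_part F j)) \<le> (\<Sum>j<g. 2 * k j + 3)" by (intro sum_mono) simp
  moreover have "card {t. Inr t \<in> F} \<le> m" using card_mono[OF _ torus_part_subset[OF F(1)]] by simp
  ultimately show ?thesis by (simp add: card_face[OF F(1)] ldim_def)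
qed

text \<open>The upper bounds for the ladder parts and for the free part add up to
  \<open>ldim\<close>, so a face of this size attains all of them: it is a choice of one maximal
  chain per ladder, with all free generators.\<close>

lemma card_top_faces: "card {F \<in> faces. card F = ldim} = (\<Prod>j<g. card (maximal_chains (k j)))"
proof -
  let ?h = "\<lambda>F. restrict (ladder_part F) {..<g}"
  let ?X = "PiE {..<g} (\<lambda>j. maximal_chains (k j))"
  have "bij_betw ?h {F \<in> faces. card F = ldim} ?X"
  proof (rule bij_betw_imageI)
    have top: "(\<forall>j<g. card (ladder_part F j) = 2 * k j + 3) \<and> {t. Inr t \<in> F} = {..<m}"
      if "F \<in> faces" "card F = ldim" for F
    proof -
      have F: "F \<subseteq> generators" "standard F" using that by (auto simp: faces_def)
      have le: "card (ladder_part F j) \<le> 2 * k j + 3" if "j < g" for j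
        using F(2) that unfolding standard_iff[OF F(1)]
        by (intro chain_card_le ladder_part_subset[OF F(1)]) simp_all
      have le': "card {t. Inr t \<in> F} \<le> m" using card_mono[OF _ torus_part_subset[OF F(1)]] by simp
      have "(\<Sum>j<g. card (ladder_part F j)) \<le> (\<Sum>j<g. 2 * k j + 3)" using le by (intro sum_mono) simp
      then have eq: "(\<Sum>j<g. card (ladder_part F j)) = (\<Sum>j<g. 2 * k j + 3)" "card {t. Inr t \<in> F} = m"
        using that(2) le' by (simp_all add: card_face[OF F(1)] ldim_def)
      have "\<forall>j<g. card (ladder_part F j) = 2 * k j + 3"
      proof (rule ccontr)
        assume "\<not> ?thesis"
        then obtain j where "j < g" "card (ladder_part F j) < 2 * k j + 3" using le by (metis le_neq_implies_less)
        then have "(\<Sum>j<g. card (ladder_part F j)) < (\<Sum>j<g. 2 * k j + 3)"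
          using le by (intro sum_strict_mono_ex1) auto
        then show False using eq by simp
      qed
      moreover have "{t. Inr t \<in> F} = {..<m}"
        using eq(2) torus_part_subset[OF F(1)] by (intro card_subset_eq) auto
      ultimately show ?thesis by blast
    qed
    show "inj_on ?h {F \<in> faces. card F = ldim}"
    proof (rule inj_onI)
      fix F F' assume F: "F \<in> {F \<in> faces. card F = ldim}" "F' \<in> {F \<in> faces. card F = ldim}" "?h F = ?h F'"
      have "ladder_part F j = ladder_part F' j" if "j < g" for j
        using fun_cong[OF F(3), of j] that by simp
      moreover have "{t. Inr t \<in> F} = {t. Inr t \<in> F'}" using top F by simp
      ultimately have "(\<Union>j<g. (\<lambda>c. Inl (j, c) :: generator) ` ladder_part F j) \<union> Inr ` {t. Inr t \<in> F} =
        (\<Union>j<g. (\<lambda>c. Inl (j, c)) ` ladder_part F' j) \<union> Inr ` {t. Inr t \<in> F'}" by simp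
      then show "F = F'"
        using face_decomposition[of F] face_decomposition[of F'] F by (simp add: faces_def)
    qed
    show "?h ` {F \<in> faces. card F = ldim} = ?X"
    proof (intro equalityI subsetI)
      fix y assume "y \<in> ?h ` {F \<in> faces. card F = ldim}"
      then obtain F where F: "F \<in> faces" "card F = ldim" "y = ?h F" by blast
      have sub: "F \<subseteq> generators" "standard F" using F by (auto simp: faces_def)
      have "ladder_part F j \<in> maximal_chains (k j)" if "j < g" for j
        using top[OF F(1,2)] that ladder_part_subset[OF sub(1) that] sub(2)
        unfolding maximal_chains_def standard_iff[OF sub(1)] by simp
      then show "y \<in> ?X" using F by auto
    next
      fix y assume y: "y \<in> ?X"
      define F where "F = (\<Union>j<g. (\<lambda>c. Inl (j, c) :: generator) ` y j) \<union> Inr ` {..<m}"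
      have mc: "y j \<in> maximal_chains (k j)" if "j < g" for j using y that by (auto simp: PiE_iff)
      have part: "ladder_part F j = y j" if "j < g" for j using that by (auto simp: F_def ladder_part_def)
      have tor: "{t. Inr t \<in> F} = {..<m}" by (auto simp: F_def)
      have sub: "F \<subseteq> generators" using mc by (force simp: F_def maximal_chains_def)
      have "standard F" using mc part sub by (subst standard_iff) (auto simp: maximal_chains_def)
      moreover have "card F = ldim" using mc part tor by (simp add: card_face[OF sub] ldim_def maximal_chains_def)
      moreover have "?h F = y" using part y by (auto simp: fun_eq_iff PiE_iff extensional_def)
      ultimately show "y \<in> ?h ` {F \<in> faces. card F = ldim}" using sub by (force simp: faces_def)
    qed
  qed
  then show ?thesis by (simp add: bij_betw_same_card card_PiE)
qed

lemma S_degree_image: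
  "{s \<in> S. deg s = q} = \<nu>M ` (\<Union>F\<in>faces. {M. set_mset M = F \<and> size M = q})"
proof (intro equalityI subsetI)
  fix s assume s: "s \<in> {s \<in> S. deg s = q}"
  then obtain M where "set_mset M \<subseteq> generators" "standard (set_mset M)" "s = \<nu>M M"
    using standard_representative by blast
  then show "s \<in> \<nu>M ` (\<Union>F\<in>faces. {M. set_mset M = F \<and> size M = q})"
    using s by (auto simp: faces_def deg_\<nu>M)
qed (auto simp: faces_def deg_\<nu>M \<nu>M_S)

lemma inj_\<nu>M: "inj_on \<nu>M (\<Union>F\<in>faces. {M. set_mset M = F \<and> size M = q})"
  by (rule inj_onI) (auto simp: faces_def intro: standard_unique)

lemma finite_faceD: "F \<in> faces \<Longrightarrow> finite F"
  using finite_subset[OF _ finite_generators] by (auto simp: faces_def)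

lemma finite_support_multisets: "F \<in> faces \<Longrightarrow> finite {M. set_mset M = F \<and> size M = q}"
  by (rule finite_subset[OF _ finite_multisets_of_size[OF finite_faceD, of F q]]) auto

lemma finite_S_degree: "finite {s \<in> S. deg s = q}"
  unfolding S_degree_image by (intro finite_imageI finite_UN_I finite_faces finite_support_multisets)

text \<open>Standard monomials are sorted by their support, and the number of monomials with a given
  support depends only on its size. The empty support drops out because q \<ge> 1.\<close>

lemma card_S_degree:
  assumes "q \<ge> 1"
  shows "card {s \<in> S. deg s = q} = (\<Sum>i=1..ldim. card {F \<in> faces. card F = i} * ((q - 1) choose (i - 1)))"
proof -
  obtain n where n: "q = Suc n" using assms by (cases q) auto
  have "card {s \<in> S. deg s = q} = card (\<Union>F\<in>faces. {M. set_mset M = F \<and> size M = q})"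
    unfolding S_degree_image by (rule card_image[OF inj_\<nu>M])
  also have "\<dots> = (\<Sum>F\<in>faces. card {M. set_mset M = F \<and> size M = q})"
    by (rule card_UN_disjoint) (auto intro: finite_support_multisets)
  also have "\<dots> = (\<Sum>F\<in>faces. if F = {} then 0 else n choose (card F - 1))"
    unfolding n by (intro sum.cong refl card_multisets_with_support finite_faceD)
  also have "\<dots> = (\<Sum>F\<in>faces - {{}}. n choose (card F - 1))"
    by (rule sum.mono_neutral_cong_right) auto
  also have "\<dots> = (\<Sum>i=1..ldim. \<Sum>F\<in>{F \<in> faces - {{}}. card F = i}. n choose (card F - 1))"
  proof (rule sum.group[symmetric])
    show "card ` (faces - {{}}) \<subseteq> {1..ldim}"
      using card_face_le finite_faceD by (fastforce simp: Suc_le_eq card_gt_0_iff)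
  qed auto
  also have "\<dots> = (\<Sum>i=1..ldim. card {F \<in> faces. card F = i} * ((q - 1) choose (i - 1)))"
  proof (rule sum.cong[OF refl])
    fix i assume "i \<in> {1..ldim}"
    then have "{F \<in> faces - {{}}. card F = i} = {F \<in> faces. card F = i}" by auto
    then show "(\<Sum>F\<in>{F \<in> faces - {{}}. card F = i}. n choose (card F - 1)) =
      card {F \<in> faces. card F = i} * ((q - 1) choose (i - 1))"
      by (simp add: n)
  qed
  finally show ?thesis .
qed

lemma card_coordinates: "card coordinates = ldim"
proof -
  have "card coordinates = card (\<Union>j<g. Row j ` {2..k j + 2} \<union> Col j ` {3..k j + 4}) + card (Tor ` {..<m})"
    unfolding coordinates_alt by (rule card_Un_disjoint) auto
  also have "card (\<Union>j<g. Row j ` {2..k j + 2} \<union> Col j ` {3..k j + 4}) = (\<Sum>j<g. card (Row j ` {2..k j + 2} \<union> Col j ` {3..k j + 4}))"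
    by (rule card_UN_disjoint) auto
  also have "\<dots> = (\<Sum>j<g. 2 * k j + 3)"
  proof (rule sum.cong[OF refl])
    fix j
    have "card (Row j ` {2..k j + 2} \<union> Col j ` {3..k j + 4}) = card (Row j ` {2..k j + 2}) + card (Col j ` {3..k j + 4})"
      by (rule card_Un_disjoint) auto
    then show "card (Row j ` {2..k j + 2} \<union> Col j ` {3..k j + 4}) = 2 * k j + 3"
      by (simp add: card_image inj_on_def)
  qed
  also have "card (Tor ` {..<m}) = m" by (simp add: card_image inj_on_def)
  finally show ?thesis by (simp add: ldim_def)
qed

lemma val_nonneg: "s \<in> S \<Longrightarrow> c \<in> coordinates \<Longrightarrow> val s c \<ge> 0"
proof (erule S_E)
  fix M assume "set_mset M \<subseteq> generators" "s = \<nu>M M" "c \<in> coordinates"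
  then show ?thesis
  proof (induction M arbitrary: s)
    case (add v M)
    then have "val (\<nu> v) c \<ge> 0"
      by (cases v) (auto simp: \<nu>_simps ladder_cells_iff)
    then show ?case using add by simp
  qed simp
qed

text \<open>
  Killing the coordinates one after the other, the row variables first, gives a strictly
  decreasing chain of faces.
\<close>

lemma face_chain_exists:
  "\<exists>T. (\<forall>i\<le>ldim. T i \<subseteq> S \<and> 0 \<in> T i) \<and>
     (\<forall>i\<le>ldim. \<forall>s\<in>S. \<forall>t\<in>S. s + t \<in> T i \<longleftrightarrow> s \<in> T i \<and> t \<in> T i) \<and> (\<forall>i<ldim. T (Suc i) \<subset> T i)"
proof -
  let ?rows = "(\<Union>j<g. Row j ` {2..k j + 2})"
  obtain rs where rs: "set rs = ?rows" "distinct rs" using finite_distinct_list[of ?rows] by auto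
  obtain cs where cs: "set cs = coordinates - ?rows" "distinct cs" using finite_distinct_list[of "coordinates - ?rows"] by auto
  define xs where "xs = rs @ cs"
  have rows: "?rows \<subseteq> coordinates" by auto
  have xs: "set xs = coordinates" "distinct xs" using rs cs rows by (auto simp: xs_def)
  have len: "length xs = ldim" using distinct_card[OF xs(2)] xs(1) card_coordinates by simp
  define T where "T i = {s \<in> S. \<forall>c\<in>set (take i xs). val s c = 0}" for i
  have sub: "set (take i xs) \<subseteq> coordinates" for i unfolding xs(1)[symmetric] by (rule set_take_subset)
  have T: "T i \<subseteq> S" "0 \<in> T i" for i
    using additive_submonoid_S by (auto simp: T_def additive_submonoid_def)
  have face: "s + t \<in> T i \<longleftrightarrow> s \<in> T i \<and> t \<in> T i" if st: "s \<in> S" "t \<in> S" for s t i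
  proof -
    have "val s c + val t c = 0 \<longleftrightarrow> val s c = 0 \<and> val t c = 0" if "c \<in> set (take i xs)" for c
      using val_nonneg[OF st(1), of c] val_nonneg[OF st(2), of c] that sub by (simp add: add_nonneg_eq_0_iff subset_iff)
    then show ?thesis using st additive_submonoid_S by (auto simp: T_def additive_submonoid_def)
  qed
  have strict: "T (Suc i) \<subset> T i" if i: "i < ldim" for i
  proof -
    define c where "c = xs ! i"
    have take: "take (Suc i) xs = take i xs @ [c]" using i len by (simp add: c_def take_Suc_conv_app_nth)
    then have c: "c \<notin> set (take i xs)" "c \<in> coordinates"
      using xs distinct_take[OF xs(2), of "Suc i"] i len nth_mem[of i xs] by (auto simp: c_def)
    \<comment> \<open>While rows are being killed all columns are alive, so a cell of row
      \<open>a\<close> in the last column survives. Once columns are reached, a cell of row 1 is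
      still available, because it involves no row variable.\<close>
    have "\<exists>v\<in>generators. val (\<nu> v) c \<noteq> 0 \<and> (\<forall>c'\<in>set (take i xs). val (\<nu> v) c' = 0)"
    proof (cases c)
      case (Row j a)
      have "i < length rs"
      proof (rule ccontr)
        assume "\<not> i < length rs"
        then have "c \<in> set cs" using i len by (auto simp: c_def xs_def nth_append)
        moreover have "j < g" "a \<in> {2..k j + 2}" using c(2) by (auto simp: Row)
        then have "c \<in> ?rows" unfolding Row by blast
        ultimately show False using cs by blast
      qed
      then have "take i xs = take i rs" by (simp add: xs_def)
      then have "set (take i xs) \<subseteq> ?rows" unfolding rs(1)[symmetric] by (simp only: set_take_subset)
      then have "val (\<nu> (Inl (j, a, k j + 4))) c' = 0" if "c' \<in> set (take i xs)" for c'
        using that c sub[of i] Row by (auto simp: \<nu>_simps)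
      moreover have "Inl (j, a, k j + 4) \<in> generators" "val (\<nu> (Inl (j, a, k j + 4))) c \<noteq> 0"
        using c(2) by (auto simp: Row \<nu>_simps ladder_cells_iff)
      ultimately show ?thesis by blast
    next
      case (Col j b)
      then have "Inl (j, 1, b) \<in> generators" "val (\<nu> (Inl (j, 1, b))) c \<noteq> 0"
        "\<forall>c'\<in>set (take i xs). val (\<nu> (Inl (j, 1, b))) c' = 0"
        using c sub[of i] by (auto simp: \<nu>_simps ladder_cells_iff)
      then show ?thesis by blast
    next
      case (Tor t)
      then have "Inr t \<in> generators" "val (\<nu> (Inr t)) c \<noteq> 0"
        "\<forall>c'\<in>set (take i xs). val (\<nu> (Inr t)) c' = 0"
        using c sub[of i] by (auto simp: \<nu>_simps)
      then show ?thesis by blast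
    qed
    then obtain v where "v \<in> generators" "val (\<nu> v) c \<noteq> 0" "\<forall>c'\<in>set (take i xs). val (\<nu> v) c' = 0" by blast
    then have "\<nu> v \<in> T i" "\<nu> v \<notin> T (Suc i)" using \<nu>_S[of v] by (simp_all add: T_def take)
    moreover have "T (Suc i) \<subseteq> T i" by (auto simp: T_def take)
    ultimately show ?thesis by blast
  qed
  show ?thesis
    by (intro exI[of _ T] conjI allI impI ballI; (rule T strict face; assumption)?)
qed

theorem graded_degree_S:
  fixes G :: "('k::field, 'a) module"
  assumes "ldim \<ge> 1"
    and h: "h \<in> ring_iso (monoid_algebra S) G" "h 0 = \<zero>\<^bsub>G\<^esub>"
      "\<And>a b. b \<in> supported S \<Longrightarrow> h (a \<odot>\<^bsub>monoid_algebra S\<^esub> b) = a \<odot>\<^bsub>G\<^esub> h b"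
      "\<And>q. h ` {b. Poly_Mapping.keys b \<subseteq> {s \<in> S. deg s = q}} = H q"
  shows "graded_degree G H = of_nat (\<Prod>j<g. card (maximal_chains (k j)))"
proof -
  obtain T where T: "\<forall>i\<le>ldim. T i \<subseteq> S \<and> 0 \<in> T i"
    "\<forall>i\<le>ldim. \<forall>s\<in>S. \<forall>t\<in>S. s + t \<in> T i \<longleftrightarrow> s \<in> T i \<and> t \<in> T i" "\<forall>i<ldim. T (Suc i) \<subset> T i"
    using face_chain_exists by (elim exE conjE) (rule that)
  have "graded_degree G H = of_nat (card {F \<in> faces. card F = ldim})"
  proof (rule graded_degree_monoid_algebra[where T = T, OF additive_submonoid_S deg_add finite_S_degree card_S_degree assms(1) _ _ _ _ _ h])
    show "T i \<subseteq> S" "0 \<in> T i" if "i \<le> ldim" for i using T(1) that by simp_all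
    show "s + t \<in> T i \<longleftrightarrow> s \<in> T i \<and> t \<in> T i" if "i \<le> ldim" "s \<in> S" "t \<in> S" for i s t
      by (rule T(2)[rule_format, OF that])
    show "T (Suc i) \<subset> T i" if "i < ldim" for i
      by (rule T(3)[rule_format, OF that])
    have "(\<Prod>j<g. card (maximal_chains (k j))) \<noteq> 0"
      using card_maximal_chains_pos by (metis finite_lessThan less_numeral_extra(3) prod_zero_iff)
    then show "0 < card {F \<in> faces. card F = ldim}" by (simp add: card_top_faces)
  qed
  then show ?thesis by (simp add: card_top_faces)
qed

end

subsection \<open>Elements satisfying the Hibi relations\<close>

text \<open>Used twice: for the coordinates of a product of ladders, and for the polynomials
  \<open>elem\<close> whose classes generate the tangent cone, with \<open>I\<close> the ideal of
  \<open>X2 n\<close>.\<close>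

locale ladder_elements = ladder_product g m k + monoid_algebra_ideal M I
  for g m :: nat and k :: "nat \<Rightarrow> nat" and M :: "'m::comm_monoid_add set" and I :: "('m \<Rightarrow>\<^sub>0 'k::field) set" +
  fixes el :: "generator \<Rightarrow> 'm \<Rightarrow>\<^sub>0 'k"
  assumes el_closed: "\<And>v. v \<in> generators \<Longrightarrow> el v \<in> supported M"
    and hibi: "\<And>j a b c d. j < g \<Longrightarrow> (a, b) \<in> ladder_cells (k j) \<Longrightarrow> (c, d) \<in> ladder_cells (k j) \<Longrightarrow> a < c \<Longrightarrow> d < b \<Longrightarrow>
      el (Inl (j, a, b)) * el (Inl (j, c, d)) - el (Inl (j, c, b)) * el (Inl (j, a, d)) \<in> I"
begin

text \<open>An arbitrary factorisation is chosen; by \<open>prod_el_congruent\<close> the choice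
  does not matter modulo \<open>I\<close>, which is why products are respected only modulo
  \<open>I\<close>.\<close>

definition monomial_element :: "(nat \<Rightarrow>\<^sub>0 real) \<Rightarrow> 'm \<Rightarrow>\<^sub>0 'k" where
  "monomial_element s = (\<Prod>v\<in>#(SOME N. set_mset N \<subseteq> generators \<and> \<nu>M N = s). el v)"

lemma prod_el_closed: "set_mset N \<subseteq> generators \<Longrightarrow> (\<Prod>v\<in>#N. el v) \<in> supported M"
  using M el_closed by (intro supported_prod_mset) auto

lemma prod_el_congruent:
  assumes "set_mset N \<subseteq> generators" "set_mset N' \<subseteq> generators" "\<nu>M N = \<nu>M N'"
  shows "(\<Prod>v\<in>#N. el v) - (\<Prod>v\<in>#N'. el v) \<in> I"
proof (rule monomials_congruent[where R = "\<lambda>N N'. (\<Prod>v\<in>#N. el v) - (\<Prod>v\<in>#N'. el v) \<in> I", OF _ _ _ _ assms])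
  fix j a b c d N
  assume *: "j < g" "(a, b) \<in> ladder_cells (k j)" "(c, d) \<in> ladder_cells (k j)" "a < c" "d < b" "set_mset N \<subseteq> generators"
  have "(\<Prod>v\<in>#N. el v) * (el (Inl (j, a, b)) * el (Inl (j, c, d)) - el (Inl (j, c, b)) * el (Inl (j, a, d))) \<in> I"
    by (rule I_mult_left[OF hibi[OF *(1-5)] prod_el_closed[OF *(6)]])
  then show "(\<Prod>v\<in>#add_mset (Inl (j, a, b)) (add_mset (Inl (j, c, d)) N). el v) -
      (\<Prod>v\<in>#add_mset (Inl (j, c, b)) (add_mset (Inl (j, a, d)) N). el v) \<in> I"
    by (simp add: algebra_simps)
next
  show "\<And>M N. (\<Prod>v\<in>#M. el v) - (\<Prod>v\<in>#N. el v) \<in> I \<Longrightarrow> (\<Prod>v\<in>#N. el v) - (\<Prod>v\<in>#M. el v) \<in> I"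
    by (rule I_sym)
  show "\<And>L M N. (\<Prod>v\<in>#L. el v) - (\<Prod>v\<in>#M. el v) \<in> I \<Longrightarrow> (\<Prod>v\<in>#M. el v) - (\<Prod>v\<in>#N. el v) \<in> I \<Longrightarrow> (\<Prod>v\<in>#L. el v) - (\<Prod>v\<in>#N. el v) \<in> I"
    by (rule I_trans)
qed simp

lemma monomial_element_E:
  assumes "s \<in> S" obtains N where "set_mset N \<subseteq> generators" "\<nu>M N = s" "monomial_element s = (\<Prod>v\<in>#N. el v)"
proof -
  have "\<exists>N. set_mset N \<subseteq> generators \<and> \<nu>M N = s" using assms by (auto simp: S_def)
  from someI_ex[OF this] show thesis using that unfolding monomial_element_def by blast
qed

lemma monomial_element_closed: "s \<in> S \<Longrightarrow> monomial_element s \<in> supported M"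
  by (metis monomial_element_E prod_el_closed)

lemma prod_el_monomial_element:
  assumes "set_mset N \<subseteq> generators"
  shows "(\<Prod>v\<in>#N. el v) - monomial_element (\<nu>M N) \<in> I"
  using monomial_element_E[OF \<nu>M_S[OF assms]] prod_el_congruent[OF assms] by metis

lemma monomial_element_0: "monomial_element 0 = 1"
proof -
  have "0 \<in> S" using \<nu>M_S[of "{#}"] by simp
  then obtain N where N: "set_mset N \<subseteq> generators" "\<nu>M N = 0" "monomial_element 0 = (\<Prod>v\<in>#N. el v)"
    by (rule monomial_element_E)
  then have "size N = 0" using deg_\<nu>M[of N] deg_\<nu>M[of "{#}"] by simp
  then show ?thesis using N by simp
qed

lemma monomial_element_add:
  assumes "s \<in> S" "t \<in> S"
  shows "monomial_element (s + t) - monomial_element s * monomial_element t \<in> I"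
proof -
  obtain N where N: "set_mset N \<subseteq> generators" "\<nu>M N = s" "monomial_element s = (\<Prod>v\<in>#N. el v)"
    using monomial_element_E[OF assms(1)] by blast
  obtain N' where N': "set_mset N' \<subseteq> generators" "\<nu>M N' = t" "monomial_element t = (\<Prod>v\<in>#N'. el v)"
    using monomial_element_E[OF assms(2)] by blast
  have "(\<Prod>v\<in>#N + N'. el v) - monomial_element (\<nu>M (N + N')) \<in> I"
    by (rule prod_el_monomial_element) (use N N' in simp)
  then show ?thesis using N N' I_sym by simp
qed

end

subsection \<open>The toric presentation\<close>

text \<open>\<open>relations\<close> puts the Hibi relations into \<open>I\<close>, and
  \<open>toric\<close> puts \<open>I\<close> into the kernel of the parametrisation by exponent
  vectors. Straightening shows that the two bounds meet. The bijection \<open>\<beta>\<close> leaves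
  the type of the coordinates free, since products of schemes have nested sums as
  coordinates.\<close>

locale ladder_presentation = ladder_product g m k
  for g m :: nat and k :: "nat \<Rightarrow> nat" +
  fixes V :: "'w set" and I :: "('w, 'k::field) mpolynomial set" and \<beta> :: "'w \<Rightarrow> generator"
  assumes bij: "bij_betw \<beta> V generators" and ideal_V: "ideal I (polynomial_algebra V)"
    and relations: "\<And>j a b c d. j < g \<Longrightarrow> (a, b) \<in> ladder_cells (k j) \<Longrightarrow> (c, d) \<in> ladder_cells (k j) \<Longrightarrow> a < c \<Longrightarrow> d < b \<Longrightarrow>
      variable (inv_into V \<beta> (Inl (j, a, b))) * variable (inv_into V \<beta> (Inl (j, c, d))) -
      variable (inv_into V \<beta> (Inl (j, c, b))) * variable (inv_into V \<beta> (Inl (j, a, d))) \<in> I"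
    and toric: "\<And>p. p \<in> I \<Longrightarrow> substitute (Poly_Mapping.single 0) (\<lambda>w. Poly_Mapping.single (\<nu> (\<beta> w)) (1::'k)) p = 0"
begin

abbreviation "\<beta>' \<equiv> inv_into V \<beta>"

sublocale ladder_elements g m k "monomials V" I "\<lambda>v. variable (\<beta>' v)"
proof (intro ladder_elements.intro monoid_algebra_ideal.intro ladder_elements_axioms.intro)
  show "additive_submonoid (monomials V)" by simp
  show "ideal I (monoid_algebra (monomials V))" using ideal_V by (simp add: polynomial_algebra_eq)
  fix v assume "v \<in> generators"
  then show "variable (\<beta>' v) \<in> supported (monomials V)"
    using bij by (intro supported_variable) (auto simp: bij_betw_def inv_into_into)
qed (rule relations)

definition tor :: "('w, 'k) mpolynomial \<Rightarrow> (nat \<Rightarrow>\<^sub>0 real) \<Rightarrow>\<^sub>0 'k" where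
  "tor = substitute (Poly_Mapping.single 0) (\<lambda>w. Poly_Mapping.single (\<nu> (\<beta> w)) 1)"

definition Z :: "((nat \<Rightarrow>\<^sub>0 real) \<Rightarrow>\<^sub>0 'k) \<Rightarrow> ('w, 'k) mpolynomial" where
  "Z = lift (Poly_Mapping.single 0) monomial_element"

lemma tor_hom: "coefficient_hom tor"
  unfolding tor_def by (rule substitute_hom) simp

lemma prod_single: "(\<Prod>v\<in>#N. Poly_Mapping.single (f v) (1::'k)) = Poly_Mapping.single (\<Sum>v\<in>#N. f v) 1"
  for f :: "'i \<Rightarrow> 'n::comm_monoid_add"
  by (induction N) (auto simp: mult_single)

lemma tor_prod:
  assumes "set_mset N \<subseteq> generators"
  shows "tor (\<Prod>v\<in>#N. variable (\<beta>' v)) = Poly_Mapping.single (\<nu>M N) 1"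
  using assms
proof (induction N)
  case empty
  then show ?case using coefficient_homD(3)[OF tor_hom] by simp
next
  case (add v N)
  have "\<beta> (\<beta>' v) = v" using bij add.prems by (intro bij_betw_inv_into_right) auto
  then show ?case using add
    by (simp add: coefficient_homD[OF tor_hom] mult_single) (simp add: tor_def substitute_variable mult_single)
qed

lemma tor_monomial_element: "s \<in> S \<Longrightarrow> tor (monomial_element s) = Poly_Mapping.single s 1"
  by (metis monomial_element_E tor_prod)

lemma tor_Z: "b \<in> supported S \<Longrightarrow> tor (Z b) = b"
proof -
  assume b: "b \<in> supported S"
  have "tor (Z b) = (\<Sum>s\<in>Poly_Mapping.keys b. Poly_Mapping.single 0 (Poly_Mapping.lookup b s) * tor (monomial_element s))"
    unfolding Z_def lift_def
    by (simp add: coefficient_hom_sum[OF tor_hom] coefficient_homD[OF tor_hom]) (simp add: tor_def substitute_const)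
  also have "\<dots> = (\<Sum>s\<in>Poly_Mapping.keys b. Poly_Mapping.single s (Poly_Mapping.lookup b s))"
    using b by (intro sum.cong refl) (auto simp: tor_monomial_element supported_def mult_single subset_iff)
  also have "\<dots> = b" by (rule poly_mapping_sum_single[symmetric])
  finally show ?thesis .
qed

lemma Z_closed: "b \<in> supported S \<Longrightarrow> Z b \<in> supported (monomials V)"
  unfolding Z_def lift_def by (rule supported_sum) (auto simp: supported_def[of S] monomial_element_closed)

lemma exponent_monomial:
  assumes "set_mset N \<subseteq> V"
  shows "Poly_Mapping.single (exponent N) (1::'k) = (\<Prod>v\<in>#image_mset \<beta> N. variable (\<beta>' v))"
proof -
  have "(\<Prod>v\<in>#image_mset \<beta> N. variable (\<beta>' v)) = (\<Prod>w\<in>#N. variable w :: ('w, 'k) mpolynomial)"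
    using bij assms by (simp add: image_mset.compositionality o_def)
      (intro arg_cong[where f = prod_mset] image_mset_cong, auto simp: bij_betw_inv_into_left subset_iff)
  also have "\<dots> = Poly_Mapping.single (exponent N) 1"
    by (simp add: variable_def prod_single exponent_def)
  finally show ?thesis by simp
qed

lemma single_congruent:
  assumes "mm \<in> monomials V"
  shows "\<exists>s\<in>S. tor (Poly_Mapping.single mm 1) = Poly_Mapping.single s 1 \<and> Poly_Mapping.single mm 1 - monomial_element s \<in> I"
proof -
  obtain N where N: "mm = exponent N" using ex_exponent by blast
  then have V: "set_mset N \<subseteq> V" using assms keys_exponent[of N] by (simp add: monomials_def)
  let ?N = "image_mset \<beta> N"
  have gen: "set_mset ?N \<subseteq> generators" using V bij by (auto simp: bij_betw_def)
  show ?thesis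
    using \<nu>M_S[OF gen] tor_prod[OF gen] prod_el_monomial_element[OF gen] exponent_monomial[OF V] N by metis
qed

lemma tor_const_mult: "tor (Poly_Mapping.single 0 c * p) = Poly_Mapping.single 0 c * tor p"
  by (simp add: coefficient_homD[OF tor_hom]) (simp add: tor_def substitute_const)

text \<open>Straightening one monomial at a time shows that a polynomial is determined modulo
  \<open>I\<close> by its toric image; in particular the kernel of \<open>tor\<close> lies in
  \<open>I\<close>.\<close>

lemma Z_tor:
  assumes "p \<in> supported (monomials V)"
  shows "tor p \<in> supported S \<and> p - Z (tor p) \<in> I"
proof -
  have single: "tor (Poly_Mapping.single mm c) \<in> supported S \<and> Poly_Mapping.single mm c - Z (tor (Poly_Mapping.single mm c)) \<in> I"
    if mm: "mm \<in> monomials V" for mm and c :: 'k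
  proof -
    obtain s where s: "s \<in> S" "tor (Poly_Mapping.single mm 1) = Poly_Mapping.single s 1"
      "Poly_Mapping.single mm 1 - monomial_element s \<in> I"
      using single_congruent[OF mm] by blast
    have eq: "Poly_Mapping.single mm c = Poly_Mapping.single 0 c * Poly_Mapping.single mm (1::'k)" by (simp add: mult_single)
    have P: "tor (Poly_Mapping.single mm c) = Poly_Mapping.single s c"
      unfolding eq tor_const_mult s(2) by (simp add: mult_single)
    have "Poly_Mapping.single 0 c * (Poly_Mapping.single mm 1 - monomial_element s) \<in> I"
      using s(3) by (rule I_mult_left) simp
    then show ?thesis using s(1) unfolding P by (simp add: Z_def lift_single right_diff_distrib mult_single)
  qed
  let ?f = "\<lambda>mm. Poly_Mapping.single mm (Poly_Mapping.lookup p mm)"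
  have keys: "Poly_Mapping.keys p \<subseteq> monomials V" using assms by (simp add: supported_def)
  have P: "tor p = (\<Sum>mm\<in>Poly_Mapping.keys p. tor (?f mm))"
    by (subst poly_mapping_sum_single[of p]) (rule coefficient_hom_sum[OF tor_hom])
  have "p - Z (tor p) = (\<Sum>mm\<in>Poly_Mapping.keys p. ?f mm - Z (tor (?f mm)))"
    unfolding P Z_def by (simp add: lift_sum sum_subtractf flip: poly_mapping_sum_single)
  also have "\<dots> \<in> I" using single keys by (intro I_sum) auto
  moreover have "tor p \<in> supported S" unfolding P using single keys by (intro supported_sum) auto
  ultimately show ?thesis by simp
qed

lemma Z_mult:
  assumes "a \<in> supported S" "b \<in> supported S"
  shows "Z (a * b) - Z a * Z b \<in> I"
proof -
  have C: "Z (a * b) - Z a * Z b \<in> supported (monomials V)"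
    using assms by (intro supported_diff supported_mult Z_closed) (auto simp: additive_submonoid_S)
  have "tor (Z (a * b) - Z a * Z b) = 0"
    using assms additive_submonoid_S by (simp add: coefficient_homD[OF tor_hom] tor_Z)
  then show ?thesis using Z_tor[OF C] by (simp add: Z_def)
qed

theorem algebra_isomorphic_S: "algebra_isomorphic (monoid_algebra S) (coordinate_algebra (V, I))"
proof -
  have Q: "coordinate_algebra (V, I) = Q" by (simp add: coordinate_algebra_def Q_def polynomial_algebra_eq)
  let ?h = "\<lambda>b. cos (Z b)"
  have "?h \<in> ring_iso (monoid_algebra S) Q"
  proof (rule ring_iso_memI)
    fix a b assume "a \<in> carrier (monoid_algebra S :: ('k, _) module)" "b \<in> carrier (monoid_algebra S :: ('k, _) module)"
    then have ab: "a \<in> supported S" "b \<in> supported S" by simp_all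
    show "?h (a \<oplus>\<^bsub>monoid_algebra S\<^esub> b) = ?h a \<oplus>\<^bsub>Q\<^esub> ?h b"
      using ab by (simp add: add_Q Z_closed) (simp add: Z_def lift_add)
    show "?h (a \<otimes>\<^bsub>monoid_algebra S\<^esub> b) = ?h a \<otimes>\<^bsub>Q\<^esub> ?h b"
      using ab Z_mult by (simp add: mult_Q Z_closed cos_eq_iff)
  next
    show "?h \<one>\<^bsub>monoid_algebra S\<^esub> = \<one>\<^bsub>Q\<^esub>"
      using lift_single[OF coefficient_hom_single, of monomial_element 0 1] by (simp add: one_Q Z_def monomial_element_0)
    have "inj_on ?h (supported S)"
    proof (rule inj_onI)
      fix a b assume ab: "a \<in> supported S" "b \<in> supported S" "?h a = ?h b"
      then have "tor (Z a - Z b) = 0" using toric by (simp add: cos_eq_iff tor_def)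
      then show "a = b" using ab by (simp add: coefficient_homD[OF tor_hom] tor_Z)
    qed
    moreover have "?h ` supported S = carrier Q"
    proof (intro equalityI subsetI)
      fix x assume "x \<in> carrier Q"
      then obtain p where p: "p \<in> supported (monomials V)" "x = cos p" by (rule carrier_QE)
      then show "x \<in> ?h ` supported S" using Z_tor[OF p(1)] by (intro image_eqI[of _ _ "tor p"]) (simp_all add: cos_eq_iff)
    qed (auto simp: Z_closed)
    ultimately show "bij_betw ?h (carrier (monoid_algebra S)) (carrier Q)" by (simp add: bij_betw_def)
  qed (simp add: Z_closed)
  moreover have "?h (c \<odot>\<^bsub>monoid_algebra S\<^esub> b) = c \<odot>\<^bsub>Q\<^esub> ?h b" for c b
    by (simp add: smult_Q Z_def lift_scale)
  ultimately show ?thesis unfolding algebra_isomorphic_def Q by (intro bexI[of _ ?h] allI ballI)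
qed

end

subsection \<open>Saturation\<close>

lemma lookup_scaleR_poly_mapping: "Poly_Mapping.lookup (r *\<^sub>R x) i = r * Poly_Mapping.lookup x i" for x :: "'b \<Rightarrow>\<^sub>0 real"
proof -
  have "finite {i. r * Poly_Mapping.lookup x i \<noteq> 0}"
    by (rule finite_subset[OF _ finite_keys[of x]]) (auto simp: in_keys_iff)
  then show ?thesis by (simp add: scaleR_poly_mapping_def)
qed

lemma pairing_superset:
  assumes "finite A" "Poly_Mapping.keys u \<subseteq> A"
  shows "pairing u v = (\<Sum>z\<in>A. Poly_Mapping.lookup u z * Poly_Mapping.lookup v z)"
  unfolding pairing_def using assms by (intro sum.mono_neutral_left) (auto simp: in_keys_iff)

lemma pairing_add_right: "pairing u (v + w) = pairing u v + pairing u w"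
  and pairing_scaleR_right: "pairing u (r *\<^sub>R v) = r * pairing u v"
  and pairing_diff_right: "pairing u (v - w) = pairing u v - pairing u w"
  and pairing_0_right [simp]: "pairing u 0 = 0"
  by (simp_all add: pairing_def lookup_add lookup_minus lookup_scaleR_poly_mapping algebra_simps
      sum.distrib sum_subtractf sum_distrib_left)

lemma pairing_sum_right: "pairing u (sum f A) = (\<Sum>a\<in>A. pairing u (f a))"
  by (induction A rule: infinite_finite_induct) (auto simp: pairing_add_right)

lemma pairing_single_right: "pairing u (Poly_Mapping.single z 1) = Poly_Mapping.lookup u z"
proof -
  have "pairing u (Poly_Mapping.single z 1) = (\<Sum>y\<in>Poly_Mapping.keys u. if y = z then Poly_Mapping.lookup u z else 0)"
    unfolding pairing_def by (intro sum.cong) (auto simp: lookup_single)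
  also have "\<dots> = Poly_Mapping.lookup u z" by (subst sum.delta) (auto simp: in_keys_iff)
  finally show ?thesis .
qed

lemma convex_cone_pairing: "convex_cone {v. pairing u v \<ge> 0}"
  by (simp add: convex_cone_iff pairing_add_right pairing_scaleR_right)

lemma dual_cone_hull: "dual_cone B (convex_cone hull G) = {u \<in> vectors B. \<forall>v\<in>G. pairing u v \<ge> 0}"
proof -
  have "pairing u v \<ge> 0" if "\<forall>v\<in>G. pairing u v \<ge> 0" "v \<in> convex_cone hull G" for u v
    using hull_minimal[of G "{v. pairing u v \<ge> 0}" convex_cone] that convex_cone_pairing by blast
  then show ?thesis using hull_subset[of G convex_cone] unfolding dual_cone_def by blast
qed

context ladder_product
begin

text \<open>A cell in a row \<ge> i lies in a column > i, so on S the columns beyond i weigh at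
  least as much as the rows from i on; this is the linear form of that inequality. For i = 2 it is
  nonnegativity of the exponent of row 1, which has no coordinate of its own.\<close>

definition step_form :: "nat \<Rightarrow> nat \<Rightarrow> (nat \<Rightarrow>\<^sub>0 real)" where
  "step_form j i = (\<Sum>b=i+1..k j + 4. unit (Col j b)) - (\<Sum>a=i..k j + 2. unit (Row j a))"

definition cone_generators :: "(nat \<Rightarrow>\<^sub>0 real) set" where
  "cone_generators = unit ` coordinates \<union> {step_form j i | j i. j < g \<and> i \<in> {2..k j + 2}}"

lemma pairing_unit: "pairing u (unit c) = val u c"
  by (simp add: unit_def val_def pairing_single_right)

definition row_tail :: "(nat \<Rightarrow>\<^sub>0 real) \<Rightarrow> nat \<Rightarrow> nat \<Rightarrow> real" where
  "row_tail s j i = (\<Sum>a=i..k j + 2. val s (Row j a))"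

definition col_tail :: "(nat \<Rightarrow>\<^sub>0 real) \<Rightarrow> nat \<Rightarrow> nat \<Rightarrow> real" where
  "col_tail s j i = (\<Sum>b=i+1..k j + 4. val s (Col j b))"

lemma tail_simps [simp]:
  "row_tail (s + t) j i = row_tail s j i + row_tail t j i" "col_tail (s + t) j i = col_tail s j i + col_tail t j i"
  "row_tail (s - t) j i = row_tail s j i - row_tail t j i" "col_tail (s - t) j i = col_tail s j i - col_tail t j i"
  "row_tail 0 j i = 0" "col_tail 0 j i = 0"
  by (simp_all only: row_tail_def col_tail_def val_add val_diff val_0 sum.distrib sum_subtractf sum.neutral_const)

lemma pairing_step_form: "pairing u (step_form j i) = col_tail u j i - row_tail u j i"
  unfolding step_form_def pairing_diff_right pairing_sum_right pairing_unit row_tail_def col_tail_def ..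

definition saturation :: "(nat \<Rightarrow>\<^sub>0 real) set" where
  "saturation = {s \<in> lattice_points {..<ldim}. (\<forall>c\<in>coordinates. val s c \<ge> 0) \<and>
     (\<forall>j<g. \<forall>i\<in>{2..k j + 2}. row_tail s j i \<le> col_tail s j i)}"

lemma saturation_eq: "dual_cone {..<ldim} (convex_cone hull cone_generators) \<inter> lattice_points {..<ldim} = saturation"
proof -
  have "s \<in> vectors {..<ldim}" if "s \<in> lattice_points {..<ldim}" for s using that by (simp add: lattice_points_def)
  moreover have "(\<forall>v\<in>cone_generators. pairing s v \<ge> 0) \<longleftrightarrow> (\<forall>c\<in>coordinates. val s c \<ge> 0) \<and>
     (\<forall>j<g. \<forall>i\<in>{2..k j + 2}. row_tail s j i \<le> col_tail s j i)" for s
  proof -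
    have "(\<forall>v\<in>cone_generators. pairing s v \<ge> 0) \<longleftrightarrow> (\<forall>c\<in>coordinates. pairing s (unit c) \<ge> 0) \<and>
      (\<forall>j<g. \<forall>i\<in>{2..k j + 2}. pairing s (step_form j i) \<ge> 0)"
      unfolding cone_generators_def by blast
    then show ?thesis by (simp only: pairing_unit pairing_step_form le_diff_eq add_0)
  qed
  ultimately show ?thesis unfolding dual_cone_hull saturation_def by blast
qed

lemma code_less: "c \<in> coordinates \<Longrightarrow> code c < ldim"
  using code_bij by (auto simp: bij_betw_def card_coordinates)

lemma unit_lattice: "c \<in> coordinates \<Longrightarrow> unit c \<in> lattice_points {..<ldim}"
  by (auto simp: lattice_points_def vectors_def unit_def code_less lookup_single when_def)

lemma lattice_0 [simp]: "0 \<in> lattice_points B"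
  by (simp add: lattice_points_def vectors_def)

lemma lattice_add: "s \<in> lattice_points B \<Longrightarrow> t \<in> lattice_points B \<Longrightarrow> s + t \<in> lattice_points B"
  using Poly_Mapping.keys_add[of s t] by (auto simp: lattice_points_def vectors_def lookup_add)

lemma lattice_diff: "s \<in> lattice_points B \<Longrightarrow> t \<in> lattice_points B \<Longrightarrow> s - t \<in> lattice_points B"
  by (auto simp: lattice_points_def vectors_def lookup_minus in_keys_iff subset_iff) (metis diff_zero)

lemma lattice_sum: "(\<And>a. a \<in> A \<Longrightarrow> f a \<in> lattice_points B) \<Longrightarrow> sum f A \<in> lattice_points B"
  by (induction A rule: infinite_finite_induct) (auto intro: lattice_add)

lemma \<nu>_lattice: "v \<in> generators \<Longrightarrow> \<nu> v \<in> lattice_points {..<ldim}"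
  by (cases v) (auto simp: \<nu>_simps ladder_cells_iff intro!: lattice_add unit_lattice)

lemma tail_\<nu>:
  assumes "v \<in> generators" "j < g" "i \<in> {2..k j + 2}"
  shows "row_tail (\<nu> v) j i = (if \<exists>a b. v = Inl (j, a, b) \<and> i \<le> a then 1 else 0)"
    "col_tail (\<nu> v) j i = (if \<exists>a b. v = Inl (j, a, b) \<and> i < b then 1 else 0)"
proof -
  have "row_tail (\<nu> v) j i = (if \<exists>a b. v = Inl (j, a, b) \<and> i \<le> a then 1 else 0) \<and>
    col_tail (\<nu> v) j i = (if \<exists>a b. v = Inl (j, a, b) \<and> i < b then 1 else 0)"
  proof (cases v)
    case (Inl x)
    obtain j' a' b' where x: "x = (j', a', b')" by (cases x)
    have v: "j' < g" "(a', b') \<in> ladder_cells (k j')" using assms Inl x by auto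
    have "row_tail (\<nu> v) j i = (\<Sum>a=i..k j + 2. if a = a' then (if j' = j then 1 else 0) else 0)"
      unfolding row_tail_def using v assms by (intro sum.cong refl) (auto simp: Inl x \<nu>_simps ladder_cells_iff)
    moreover have "col_tail (\<nu> v) j i = (\<Sum>b=i+1..k j + 4. if b = b' then (if j' = j then 1 else 0) else 0)"
      unfolding col_tail_def using v assms by (intro sum.cong refl) (auto simp: Inl x \<nu>_simps ladder_cells_iff)
    ultimately show ?thesis using v assms unfolding sum.delta[OF finite_atLeastAtMost] by (auto simp: Inl x ladder_cells_iff)
  next
    case (Inr t)
    then have "val (\<nu> v) (Row j a) = 0" if "a \<in> {i..k j + 2}" for a using that assms by (auto simp: \<nu>_simps)
    moreover have "val (\<nu> v) (Col j b) = 0" if "b \<in> {i+1..k j + 4}" for b using that assms Inr by (auto simp: \<nu>_simps)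
    ultimately show ?thesis unfolding row_tail_def col_tail_def by (simp add: Inr del: sum.cl_ivl_Suc)
  qed
  then show "row_tail (\<nu> v) j i = (if \<exists>a b. v = Inl (j, a, b) \<and> i \<le> a then 1 else 0)"
    "col_tail (\<nu> v) j i = (if \<exists>a b. v = Inl (j, a, b) \<and> i < b then 1 else 0)" by auto
qed

lemma \<nu>_saturation: "v \<in> generators \<Longrightarrow> \<nu> v \<in> saturation"
proof -
  assume v: "v \<in> generators"
  have "row_tail (\<nu> v) j i \<le> col_tail (\<nu> v) j i" if "j < g" "i \<in> {2..k j + 2}" for i j
    unfolding tail_\<nu>[OF v that] using v by (auto simp: ladder_cells_iff)
  then show ?thesis using \<nu>_lattice[OF v] val_nonneg[OF \<nu>_S[OF v]] by (simp add: saturation_def)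
qed

lemma S_saturation: "s \<in> S \<Longrightarrow> s \<in> saturation"
proof (erule S_E)
  fix N assume "set_mset N \<subseteq> generators" "s = \<nu>M N"
  then show "s \<in> saturation"
  proof (induction N arbitrary: s)
    case (add v N)
    then have "\<nu> v \<in> saturation" "\<nu>M N \<in> saturation" by (simp_all add: \<nu>_saturation)
    then show ?case
      using add.prems by (auto simp: saturation_def intro!: lattice_add add_mono add_nonneg_nonneg)
  qed (simp add: saturation_def)
qed

lemma val_Ints: "s \<in> lattice_points B \<Longrightarrow> val s c \<in> \<int>"
  by (simp add: lattice_points_def val_def)

lemma val_ge_1: "s \<in> lattice_points B \<Longrightarrow> val s c > 0 \<Longrightarrow> val s c \<ge> 1"
  using val_Ints[of s B c] by (auto elim!: Ints_cases)

lemma zero_if_no_values: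
  assumes "s \<in> lattice_points {..<ldim}" "\<forall>c\<in>coordinates. val s c = 0"
  shows "s = 0"
proof (rule poly_mapping_eqI)
  fix z
  show "Poly_Mapping.lookup s z = Poly_Mapping.lookup 0 z"
  proof (cases "z < ldim")
    case True
    then obtain c where "c \<in> coordinates" "z = code c"
      using code_bij by (auto simp: bij_betw_def card_coordinates)
    then show ?thesis using assms(2) by (simp add: val_def)
  next
    case False
    then show ?thesis using assms(1) by (auto simp: lattice_points_def vectors_def in_keys_iff subset_iff)
  qed
qed

text \<open>Removing the cell (a, b) lowers both tails at i when i \<le> a and neither when b \<le>
  i. Only for a < i < b does the inequality lose room, and there the row tail is zero, so
  nonnegativity of the columns is enough.\<close>

lemma saturation_subtract:
  assumes s: "s \<in> saturation" and v: "v \<in> generators"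
    and pos: "\<And>c. c \<in> coordinates \<Longrightarrow> val (\<nu> v) c \<noteq> 0 \<Longrightarrow> val s c > 0"
    and tail: "\<And>j a b i. v = Inl (j, a, b) \<Longrightarrow> i \<in> {2..k j + 2} \<Longrightarrow> a < i \<Longrightarrow> i < b \<Longrightarrow> row_tail s j i = 0"
  shows "s - \<nu> v \<in> saturation"
proof -
  have lat: "s \<in> lattice_points {..<ldim}" using s by (simp add: saturation_def)
  have nn: "val (s - \<nu> v) c \<ge> 0" if c: "c \<in> coordinates" for c
  proof (cases "val (\<nu> v) c = 0")
    case True
    then show ?thesis using s c by (simp add: saturation_def)
  next
    case False
    have "val (\<nu> v) c \<le> 1" using v c by (cases v) (auto simp: \<nu>_simps ladder_cells_iff)
    then show ?thesis using val_ge_1[OF lat pos[OF c False]] by simp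
  qed
  have "row_tail (s - \<nu> v) j i \<le> col_tail (s - \<nu> v) j i" if ji: "j < g" "i \<in> {2..k j + 2}" for i j
  proof (cases "\<exists>a b. v = Inl (j, a, b) \<and> a < i \<and> i < b")
    case True
    then have "row_tail s j i = 0" using tail ji by blast
    moreover have "row_tail (\<nu> v) j i = 0" unfolding tail_\<nu>[OF v ji] using True by auto
    moreover have "col_tail (s - \<nu> v) j i \<ge> 0"
      unfolding col_tail_def using nn ji by (intro sum_nonneg) auto
    ultimately show ?thesis by simp
  next
    case False
    have "row_tail (\<nu> v) j i = col_tail (\<nu> v) j i"
      unfolding tail_\<nu>[OF v ji] using False v by (auto simp: ladder_cells_iff not_less)
    moreover have "row_tail s j i \<le> col_tail s j i"
      using s ji by (simp add: saturation_def)
    ultimately show ?thesis by simp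
  qed
  then show ?thesis using nn lattice_diff[OF lat \<nu>_lattice[OF v]] by (simp add: saturation_def)
qed

text \<open>Greedy choice: take the last row \<open>a\<close> with positive exponent. The inequality
  at \<open>a\<close> provides a column beyond \<open>a\<close> with positive exponent, and all row
  tails beyond \<open>a\<close> vanish, as \<open>saturation_subtract\<close> requires. If no row
  variable occurs, a cell of row 1 or a free generator is removed.\<close>

lemma saturation_step:
  assumes s: "s \<in> saturation" "s \<noteq> 0"
  shows "\<exists>v\<in>generators. s - \<nu> v \<in> saturation"
proof -
  have lat: "s \<in> lattice_points {..<ldim}" and nn: "\<And>c. c \<in> coordinates \<Longrightarrow> val s c \<ge> 0"
    using s by (auto simp: saturation_def)
  show ?thesis
  proof (cases "\<exists>j a. Row j a \<in> coordinates \<and> val s (Row j a) > 0")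
    case True
    then obtain j a0 where j: "Row j a0 \<in> coordinates" "val s (Row j a0) > 0" by blast
    define A where "A = {a \<in> {2..k j + 2}. val s (Row j a) > 0}"
    have A: "finite A" "a0 \<in> A" using j by (auto simp: A_def)
    define a where "a = Max A"
    have a: "a \<in> A" unfolding a_def using A by (intro Max_in) auto
    have max: "val s (Row j i) = 0" if "i \<in> {2..k j + 2}" "a < i" for i
    proof -
      have "i \<notin> A" using that Max_ge[OF A(1), of i] by (auto simp: a_def)
      then show ?thesis using nn[of "Row j i"] j that by (auto simp: A_def)
    qed
    have jg: "j < g" "a \<in> {2..k j + 2}" "val s (Row j a) > 0" using a j by (auto simp: A_def)
    have "val s (Row j a) \<le> row_tail s j a"
      unfolding row_tail_def using jg nn by (intro member_le_sum) auto
    also have "\<dots> \<le> col_tail s j a" using s jg by (simp add: saturation_def)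
    finally have "\<not> col_tail s j a \<le> 0" using jg by simp
    then obtain b where b: "b \<in> {a+1..k j + 4}" "val s (Col j b) > 0"
      unfolding col_tail_def using sum_nonpos[of "{a+1..k j + 4}" "\<lambda>b. val s (Col j b)"] not_less by blast
    have v: "Inl (j, a, b) \<in> generators" using jg b by (auto simp: ladder_cells_iff)
    have "s - \<nu> (Inl (j, a, b)) \<in> saturation"
    proof (rule saturation_subtract[OF s(1) v])
      show "val s c > 0" if "c \<in> coordinates" "val (\<nu> (Inl (j, a, b))) c \<noteq> 0" for c
        using that jg b by (auto simp: \<nu>_simps split: if_splits)
      show "row_tail s j' i = 0" if "Inl (j, a, b) = Inl (j', a', b')" "i \<in> {2..k j' + 2}" "a' < i" for i j' a' b'
        unfolding row_tail_def using that max by (intro sum.neutral) auto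
    qed
    then show ?thesis using v by blast
  next
    case False
    have rows: "val s (Row j a) = 0" if "Row j a \<in> coordinates" for j a
    proof -
      have "\<not> val s (Row j a) > 0" using False that by blast
      then show ?thesis using nn[OF that] by linarith
    qed
    obtain c where c: "c \<in> coordinates" "val s c \<noteq> 0" using zero_if_no_values[OF lat] s(2) by blast
    then have pos: "val s c > 0" using nn[OF c(1)] by simp
    obtain v where v: "v \<in> generators" "\<nu> v = unit c" "\<And>j a b. v = Inl (j, a, b) \<Longrightarrow> j < g"
    proof (cases c)
      case (Col j b)
      then show thesis using that[of "Inl (j, 1, b)"] c by (auto simp: \<nu>_simps ladder_cells_iff)
    next
      case (Tor t)
      then show thesis using that[of "Inr t"] c by (auto simp: \<nu>_simps)
    qed (use rows c in auto)
    have "s - \<nu> v \<in> saturation"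
    proof (rule saturation_subtract[OF s(1) v(1)])
      show "val s c' > 0" if "c' \<in> coordinates" "val (\<nu> v) c' \<noteq> 0" for c'
        using that pos c v(2) by (auto split: if_splits)
      show "row_tail s j i = 0" if "v = Inl (j, a, b)" "i \<in> {2..k j + 2}" for i j a b
        unfolding row_tail_def using that rows v(3) by (intro sum.neutral) auto
    qed
    then show ?thesis using v by blast
  qed
qed

lemma saturation_S: "s \<in> saturation \<Longrightarrow> s \<in> S"
proof (induction "nat \<lfloor>\<Sum>c\<in>coordinates. val s c\<rfloor>" arbitrary: s rule: less_induct)
  case less
  show ?case
  proof (cases "s = 0")
    case True
    then show ?thesis using \<nu>M_S[of "{#}"] by simp
  next
    case False
    obtain v where v: "v \<in> generators" "s - \<nu> v \<in> saturation" using saturation_step[OF less.prems False] by blast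
    have nn: "(\<Sum>c\<in>coordinates. val (s - \<nu> v) c) \<ge> 0" using v by (intro sum_nonneg) (simp add: saturation_def)
    have "\<exists>c\<in>coordinates. val (\<nu> v) c \<ge> 1"
      using v(1)
    proof (cases v)
      case (Inl x)
      obtain j a b where "x = (j, a, b)" by (cases x)
      then show ?thesis using v(1) Inl by (intro bexI[of _ "Col j b"]) (auto simp: \<nu>_simps ladder_cells_iff)
    next
      case (Inr t)
      then show ?thesis using v(1) by (intro bexI[of _ "Tor t"]) (auto simp: \<nu>_simps)
    qed
    then obtain c where c: "c \<in> coordinates" "val (\<nu> v) c \<ge> 1" by blast
    have "val (\<nu> v) c \<le> (\<Sum>c\<in>coordinates. val (\<nu> v) c)"
      using c val_nonneg[OF \<nu>_S[OF v(1)]] by (intro member_le_sum) auto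
    then have "(\<Sum>c\<in>coordinates. val (s - \<nu> v) c) + 1 \<le> (\<Sum>c\<in>coordinates. val s c)"
      using c by (simp add: sum_subtractf)
    then have "nat \<lfloor>\<Sum>c\<in>coordinates. val (s - \<nu> v) c\<rfloor> < nat \<lfloor>\<Sum>c\<in>coordinates. val s c\<rfloor>"
      using nn by linarith
    then have "s - \<nu> v \<in> S" using v(2) by (rule less.hyps)
    then have "(s - \<nu> v) + \<nu> v \<in> S"
      using \<nu>_S[OF v(1)] additive_submonoid_S unfolding additive_submonoid_def by blast
    then show ?thesis by simp
  qed
qed

lemma strongly_convex:
  "(convex_cone hull cone_generators) \<inter> uminus ` (convex_cone hull cone_generators) = {0}"
proof -
  \<comment> \<open>A linear form positive on all generators of the cone; a step form has one column
    more than it has rows, so its value is positive as well.\<close>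
  define L where "L v = (\<Sum>c\<in>coordinates. (case c of Row _ _ \<Rightarrow> 1 | Col _ _ \<Rightarrow> 2 | Tor _ \<Rightarrow> 1) * val v c)" for v
  have L_add: "L (v + w) = L v + L w" and L_diff: "L (v - w) = L v - L w" for v w
    by (simp_all add: L_def algebra_simps sum.distrib sum_subtractf)
  have L_scale: "L (r *\<^sub>R v) = r * L v" for r v
    by (simp add: L_def val_def lookup_scaleR_poly_mapping sum_distrib_left mult_ac)
  have L_0: "L 0 = 0" by (simp add: L_def)
  have L_sum: "L (sum f A) = (\<Sum>a\<in>A. L (f a))" for f :: "nat \<Rightarrow> nat \<Rightarrow>\<^sub>0 real" and A
    by (induction A rule: infinite_finite_induct) (auto simp: L_add L_0)
  have L_unit: "L (unit c) = (case c of Row _ _ \<Rightarrow> 1 | Col _ _ \<Rightarrow> 2 | Tor _ \<Rightarrow> 1)" if c: "c \<in> coordinates" for c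
  proof -
    have "L (unit c) = (\<Sum>c'\<in>coordinates. if c' = c then (case c of Row _ _ \<Rightarrow> 1 | Col _ _ \<Rightarrow> 2 | Tor _ \<Rightarrow> 1) else 0)"
      unfolding L_def using c by (intro sum.cong refl) auto
    then show ?thesis using c by simp
  qed
  have "L (step_form j i) > 0" if "j < g" "i \<in> {2..k j + 2}" for i j
  proof -
    have "L (step_form j i) = (\<Sum>b=i+1..k j + 4. 2) - (\<Sum>a=i..k j + 2. 1)"
      unfolding step_form_def L_diff L_sum using that by (intro arg_cong2[where f = minus] sum.cong refl) (auto simp: L_unit)
    then show ?thesis using that by auto
  qed
  then have gens: "cone_generators \<subseteq> {v. v = 0 \<or> L v > 0}"
    unfolding cone_generators_def by (auto simp: L_unit split: coordinate.splits)
  have "convex_cone {v. v = 0 \<or> L v > 0}"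
    unfolding convex_cone_iff by (auto simp: L_add L_scale L_0 zero_less_mult_iff intro: add_pos_pos)
  with gens have hull: "convex_cone hull cone_generators \<subseteq> {v. v = 0 \<or> L v > 0}" by (rule hull_minimal)
  have "v = 0" if "v \<in> convex_cone hull cone_generators" "- v \<in> convex_cone hull cone_generators" for v
  proof (rule ccontr)
    assume "v \<noteq> 0"
    then have "L v > 0" "L (- v) > 0" using that hull by auto
    then show False using L_diff[of 0 v] L_0 by simp
  qed
  moreover have "0 \<in> convex_cone hull cone_generators" by (rule convex_cone_hull_contains_0)
  ultimately show ?thesis by (force simp: image_iff)
qed

theorem affine_toric_S:
  assumes "algebra_isomorphic A (monoid_algebra S :: ('k::field, (nat \<Rightarrow>\<^sub>0 real) \<Rightarrow>\<^sub>0 'k) module)"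
  shows "affine_toric A"
proof -
  have "finite cone_generators"
  proof -
    have "{step_form j i | j i. j < g \<and> i \<in> {2..k j + 2}} = (\<Union>j<g. step_form j ` {2..k j + 2})" by blast
    moreover have "finite (\<Union>j<g. step_form j ` {2..k j + 2})"
      by (intro finite_UN_I finite_lessThan finite_imageI finite_atLeastAtMost)
    ultimately show ?thesis unfolding cone_generators_def by (simp only: finite_Un finite_imageI finite_coordinates simp_thms)
  qed
  moreover have "cone_generators \<subseteq> lattice_points {..<ldim}"
  proof -
    have "step_form j i \<in> lattice_points {..<ldim}" if "j < g" "i \<in> {2..k j + 2}" for i j
      unfolding step_form_def by (intro lattice_diff lattice_sum unit_lattice) (use that in auto)
    then show ?thesis unfolding cone_generators_def using unit_lattice by blast
  qed
  moreover have "dual_cone {..<ldim} (convex_cone hull cone_generators) \<inter> lattice_points {..<ldim} = S"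
    unfolding saturation_eq using S_saturation saturation_S by blast
  ultimately show ?thesis
    unfolding affine_toric_def semigroup_algebra_eq
    using assms strongly_convex by (intro exI[of _ ldim] exI[of _ cone_generators]) simp
qed

end

section \<open>The tangent cone at a point supported on blocks\<close>

lemma ideal_kernel:
  fixes \<psi> :: "('m::comm_monoid_add \<Rightarrow>\<^sub>0 'k::field) \<Rightarrow> 'r::comm_ring_1"
  assumes M: "additive_submonoid M" and \<psi>: "coefficient_hom \<psi>"
  shows "ideal {x \<in> supported M. \<psi> x = 0} (monoid_algebra M)"
proof -
  interpret R: cring "monoid_algebra M :: ('k, _) module" by (rule cring_monoid_algebra[OF M])
  show ?thesis
  proof (rule idealI[OF R.ring_axioms R.add.subgroupI])
    have "(0 :: 'm \<Rightarrow>\<^sub>0 'k) \<in> {x \<in> supported M. \<psi> x = 0}" by (simp add: coefficient_homD[OF \<psi>])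
    then show "{x \<in> supported M. \<psi> x = 0} \<noteq> {}" by blast
    show "\<ominus>\<^bsub>monoid_algebra M\<^esub> x \<in> {x \<in> supported M. \<psi> x = 0}" if "x \<in> {x \<in> supported M. \<psi> x = 0}" for x
      using that by (simp add: monoid_algebra_a_inv M coefficient_homD[OF \<psi>])
  qed (simp_all add: coefficient_homD[OF \<psi>] M subset_iff)
qed

lemma genideal_kernel:
  fixes \<psi> :: "('v, 'k::field) mpolynomial \<Rightarrow> 'r::comm_ring_1"
  assumes \<psi>: "coefficient_hom \<psi>" and G: "G \<subseteq> supported (monomials V)" "\<And>x. x \<in> G \<Longrightarrow> \<psi> x = 0"
    and x: "x \<in> genideal (polynomial_algebra V) G"
  shows "\<psi> x = 0"
proof -
  interpret R: cring "monoid_algebra (monomials V) :: ('k, _) module" by (rule cring_monoid_algebra) simp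
  have "genideal (polynomial_algebra V) G \<subseteq> {x \<in> supported (monomials V). \<psi> x = 0}"
    unfolding polynomial_algebra_eq by (rule R.genideal_minimal[OF ideal_kernel[OF _ \<psi>]]) (use G in auto)
  then show ?thesis using x by auto
qed

lemma ideal_genideal:
  "G \<subseteq> supported (monomials V) \<Longrightarrow> ideal (genideal (polynomial_algebra V) G) (polynomial_algebra V)"
  unfolding polynomial_algebra_eq
  by (intro ring.genideal_ideal cring.axioms(1) cring_monoid_algebra) auto

lemma genideal_mem:
  fixes x :: "('a, 'b::field) mpolynomial"
  shows "G \<subseteq> supported (monomials V) \<Longrightarrow> x \<in> G \<Longrightarrow> x \<in> genideal (polynomial_algebra V) G"
proof -
  assume "G \<subseteq> supported (monomials V)" "x \<in> G"
  interpret R: cring "monoid_algebra (monomials V) :: ('b, _) module" by (rule cring_monoid_algebra) simp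
  have "G \<subseteq> genideal (monoid_algebra (monomials V)) G"
    by (rule R.genideal_self) (simp add: \<open>G \<subseteq> supported (monomials V)\<close>)
  then show ?thesis unfolding polynomial_algebra_eq using \<open>x \<in> G\<close> by (rule subsetD)
qed

text \<open>Block \<open>j\<close> of the support consists of the cells with
  \<open>p j \<le> a < b \<le> l j\<close>. There are g + 1 blocks, numbered from 0, and g gaps, gap
  \<open>j\<close> following block \<open>j\<close>. The value \<open>p (Suc g)\<close> beyond
  \<open>n\<close> is a sentinel that places every row. The map \<open>tor\<close> enumerates the
  first rows and last columns of the blocks.\<close>

locale block_point = ladder_product g m k
  for g m :: nat and k :: "nat \<Rightarrow> nat" +
  fixes n :: nat and p l :: "nat \<Rightarrow> nat" and tor :: "nat \<Rightarrow> nat \<times> nat" and P :: "nat \<times> nat \<Rightarrow> 'k::field"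
  assumes p_0: "p 0 = 1" and l_g: "l g = n" and block: "\<And>j. j \<le> g \<Longrightarrow> p j < l j"
    and gap: "\<And>j. j < g \<Longrightarrow> p (Suc j) = l j + k j + 1" and end_gap: "n < p (Suc g)"
    and tor: "bij_betw tor {..<m} {(a, b). \<exists>j\<le>g. p j \<le> a \<and> a < b \<and> b \<le> l j \<and> (a = p j \<or> b = l j)}"
    and P: "\<And>a b. (a, b) \<in> I2 n \<Longrightarrow> P (a, b) = (if \<exists>j\<le>g. p j \<le> a \<and> b \<le> l j then 1 else 0)"
begin

section \<open>The position of rows and columns relative to the blocks\<close>

lemma gap_less: "i < j \<Longrightarrow> j \<le> Suc g \<Longrightarrow> l i < p j"
proof (induction j)
  case (Suc j)
  have *: "l j < p (Suc j)" using gap[of j] end_gap l_g Suc.prems by (cases "j = g") auto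
  show ?case
  proof (cases "i = j")
    case False
    then have "l i < p j" using Suc by simp
    also have "p j < l j" using Suc by (intro block) simp
    finally show ?thesis using * by simp
  qed (use * in simp)
qed simp

lemma p_mono: "i \<le> j \<Longrightarrow> j \<le> Suc g \<Longrightarrow> p i \<le> p j"
proof (cases "i = j")
  case False
  assume "i \<le> j" "j \<le> Suc g"
  then show ?thesis using False gap_less[of i j] block[of i] by simp
qed simp

lemma l_mono: "i \<le> j \<Longrightarrow> j \<le> g \<Longrightarrow> l i \<le> l j"
proof (cases "i = j")
  case False
  assume "i \<le> j" "j \<le> g"
  then show ?thesis using False gap_less[of i j] block[of j] by simp
qed simp

lemma p_pos: "j \<le> g \<Longrightarrow> 1 \<le> p j"
  using p_mono[of 0 j] p_0 by simp

lemma l_le: "j \<le> g \<Longrightarrow> l j \<le> n"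
  using l_mono[of j g] l_g by simp

text \<open>Gaps are assigned in two ways: a gap row belongs to the block before it, a gap column
  (see \<open>col_block\<close>) to the block after it. A cell then leads from the block of its row
  to the block of its column.\<close>

definition row_block :: "nat \<Rightarrow> nat" where
  "row_block a = (LEAST j. a < p (Suc j))"

definition col_block :: "nat \<Rightarrow> nat" where
  "col_block b = (LEAST j. b \<le> l j)"

lemma row_block_eq: "j \<le> g \<Longrightarrow> p j \<le> a \<Longrightarrow> a < p (Suc j) \<Longrightarrow> row_block a = j"
  unfolding row_block_def
proof (rule Least_equality)
  fix y assume *: "j \<le> g" "p j \<le> a" "a < p (Suc y)"
  show "j \<le> y"
  proof (rule ccontr)
    assume "\<not> j \<le> y"
    then have "p (Suc y) \<le> p j" using * by (intro p_mono) auto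
    then show False using * by simp
  qed
qed

lemma col_block_eq: "j \<le> g \<Longrightarrow> b \<le> l j \<Longrightarrow> (\<And>i. i < j \<Longrightarrow> l i < b) \<Longrightarrow> col_block b = j"
  unfolding col_block_def by (rule Least_equality) (auto simp: not_less[symmetric])

lemma row_block_E:
  assumes "1 \<le> a" "a < n" obtains j where "j \<le> g" "p j \<le> a" "a < p (Suc j)"
proof -
  have ex: "a < p (Suc g)" using assms end_gap by simp
  let ?j = "row_block a"
  have 1: "a < p (Suc ?j)" unfolding row_block_def using ex by (rule LeastI)
  have 2: "?j \<le> g" unfolding row_block_def using ex by (rule Least_le)
  have "p ?j \<le> a"
  proof (cases ?j)
    case 0
    then show ?thesis using assms p_0 by simp
  next
    case (Suc i)
    then have "\<not> a < p (Suc i)" using not_less_Least[of i "\<lambda>j. a < p (Suc j)"] unfolding row_block_def by simp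
    then show ?thesis using Suc by simp
  qed
  with 1 2 show thesis by (intro that)
qed

lemma col_block_E:
  assumes "b \<le> n" obtains j where "j \<le> g" "b \<le> l j" "\<And>i. i < j \<Longrightarrow> l i < b"
proof -
  have ex: "b \<le> l g" using assms l_g by simp
  let ?j = "col_block b"
  have 1: "b \<le> l ?j" unfolding col_block_def using ex by (rule LeastI)
  have 2: "?j \<le> g" unfolding col_block_def using ex by (rule Least_le)
  have 3: "l i < b" if "i < ?j" for i using not_less_Least[of i "\<lambda>j. b \<le> l j"] that unfolding col_block_def by simp
  from 1 2 3 show thesis by (intro that)
qed

abbreviation "D \<equiv> {(a, b). \<exists>j\<le>g. p j \<le> a \<and> a < b \<and> b \<le> l j}"

subsection \<open>The ideal\<close>

abbreviation "V \<equiv> I2 n"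
abbreviation "Y a b \<equiv> variable (a, b) :: (nat \<times> nat, 'k) mpolynomial"

definition hibi_binomials :: "(nat \<times> nat, 'k) mpolynomial set" where
  "hibi_binomials = {variable \<alpha> * variable \<beta> - variable (sup \<alpha> \<beta>) * variable (inf \<alpha> \<beta>) | \<alpha> \<beta>. \<alpha> \<in> V \<and> \<beta> \<in> V}"

definition I :: "(nat \<times> nat, 'k) mpolynomial set" where
  "I = genideal (polynomial_algebra V) hibi_binomials"

lemma X2_eq: "X2 n = (V, I)"
  by (simp add: X2_def hibi_variety_def I_def hibi_binomials_def)

lemma hibi_binomials_closed: "hibi_binomials \<subseteq> supported (monomials V)"
  unfolding hibi_binomials_def
  by (auto simp: I2_def sup_prod_def inf_prod_def sup_nat_def inf_nat_def intro!: supported_diff supported_mult supported_variable)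

lemma hibi_relation:
  assumes "1 \<le> a" "a < c" "c < d" "d < b" "b \<le> n"
  shows "Y a b * Y c d - Y c b * Y a d \<in> I"
proof -
  have "sup (a, b) (c, d) = (c, b)" "inf (a, b) (c, d) = (a, d)"
    using assms by (simp_all add: sup_prod_def inf_prod_def sup_nat_def inf_nat_def)
  moreover have "(a, b) \<in> V" "(c, d) \<in> V" using assms by (auto simp: I2_def)
  ultimately have "Y a b * Y c d - Y c b * Y a d \<in> hibi_binomials"
    unfolding hibi_binomials_def by (intro CollectI exI[of _ "(a, b)"] exI[of _ "(c, d)"]) simp
  then show ?thesis unfolding I_def by (rule genideal_mem[OF hibi_binomials_closed])
qed

subsection \<open>The order function\<close>

abbreviation u :: "coordinate \<Rightarrow> (nat \<Rightarrow>\<^sub>0 real) \<Rightarrow>\<^sub>0 'k" where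
  "u c \<equiv> Poly_Mapping.single (unit c) 1"

abbreviation "index \<equiv> inv_into {..<m} tor"

text \<open>The first row of a block is normalised to 1, its other rows before \<open>l j\<close>
  have constant coefficient 1, and a gap row is a ladder variable of order 0. The shift makes row
  \<open>l j\<close> the row 2 of the ladder, row 1 standing for the block itself.\<close>

definition row_factor :: "nat \<Rightarrow> ((nat \<Rightarrow>\<^sub>0 real) \<Rightarrow>\<^sub>0 'k) poly" where
  "row_factor a = (let j = row_block a in if a = p j then 1 else if a < l j then [:1, u (Tor (index (a, l j))):]
     else [:u (Row j (a - l j + 2)):])"

text \<open>The weight t of a gap sits on its columns, of which \<open>p j\<close> is the last; a
  column beyond \<open>p j\<close> has constant coefficient 1. The shift makes
  \<open>l (j - 1) + 1\<close> the column 3 of the ladder.\<close>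

definition col_factor :: "nat \<Rightarrow> ((nat \<Rightarrow>\<^sub>0 real) \<Rightarrow>\<^sub>0 'k) poly" where
  "col_factor b = (let j = col_block b in if p j < b then [:1, u (Tor (index (p j, b))):]
     else [:0, u (Col (j - 1) (b - l (j - 1) + 2)):])"

text \<open>A gap is named by the block after it. A gap column already carries its own factor t, so
  a gap counts as crossed only if b lies beyond \<open>p j\<close>, the last gap column.\<close>

definition crossed :: "nat \<Rightarrow> nat \<Rightarrow> nat set" where
  "crossed a b = {j. 1 \<le> j \<and> j \<le> g \<and> a < p j \<and> p j < b}"

text \<open>
  The product over the crossed gaps keeps the substitution compatible with the Hibi relations
  without inverting any variable.
\<close>

definition \<Phi> :: "nat \<times> nat \<Rightarrow> ((nat \<Rightarrow>\<^sub>0 real) \<Rightarrow>\<^sub>0 'k) poly" where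
  "\<Phi> c = (case c of (a, b) \<Rightarrow> row_factor a * col_factor b * (\<Prod>j\<in>crossed a b. [:0, u (Col (j - 1) (k (j - 1) + 4)):]))"

definition \<phi> :: "(nat \<times> nat, 'k) mpolynomial \<Rightarrow> ((nat \<Rightarrow>\<^sub>0 real) \<Rightarrow>\<^sub>0 'k) poly" where
  "\<phi> = substitute (\<lambda>c. [:Poly_Mapping.single 0 c:]) \<Phi>"

lemma const_hom: "coefficient_hom (\<lambda>c. [:Poly_Mapping.single 0 c:] :: ((nat \<Rightarrow>\<^sub>0 real) \<Rightarrow>\<^sub>0 'k) poly)"
  by (rule coefficient_hom_comp[OF coefficient_hom_pCons coefficient_hom_single])

lemma \<phi>_hom: "coefficient_hom \<phi>"
  unfolding \<phi>_def by (rule substitute_hom[OF const_hom])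

lemmas \<phi>_simps = coefficient_homD[OF \<phi>_hom]

lemma \<phi>_X: "\<phi> (Y a b) = \<Phi> (a, b)"
  unfolding \<phi>_def by (rule substitute_variable[OF const_hom])

lemma \<phi>_const: "\<phi> (Poly_Mapping.single 0 c) = [:Poly_Mapping.single 0 c:]"
  unfolding \<phi>_def by (rule substitute_const[OF const_hom])

lemma finite_crossed [simp]: "finite (crossed a b)"
  by (rule finite_subset[of _ "{..g}"]) (auto simp: crossed_def)

text \<open>Row and column factors are merely permuted. The gap factors agree because, as c < d, a
  gap crossed by (a, b) is crossed by (a, d) or by (c, b), and one crossed by both is crossed by (c,
  d).\<close>

lemma \<Phi>_relation:
  assumes "a \<le> c" "c < d" "d \<le> b"
  shows "\<Phi> (a, b) * \<Phi> (c, d) = \<Phi> (c, b) * \<Phi> (a, d)"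
proof -
  let ?f = "\<lambda>j. [:0, u (Col (j - 1) (k (j - 1) + 4)):]"
  have "crossed a d \<union> crossed c b = crossed a b" "crossed a d \<inter> crossed c b = crossed c d"
    using assms by (auto simp: crossed_def)
  then have *: "prod ?f (crossed a b) * prod ?f (crossed c d) = prod ?f (crossed a d) * prod ?f (crossed c b)"
    using prod.union_inter[of "crossed a d" "crossed c b" ?f] by simp
  have "\<Phi> (a, b) * \<Phi> (c, d) = (row_factor a * col_factor b * row_factor c * col_factor d) * (prod ?f (crossed a b) * prod ?f (crossed c d))"
    by (simp only: \<Phi>_def prod.case mult_ac)
  also have "\<dots> = \<Phi> (c, b) * \<Phi> (a, d)"
    unfolding * by (simp only: \<Phi>_def prod.case mult_ac)
  finally show ?thesis .
qed

lemma \<phi>_binomial: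
  assumes "\<alpha> \<in> V" "\<beta> \<in> V"
  shows "\<phi> (variable \<alpha> * variable \<beta> - variable (sup \<alpha> \<beta>) * variable (inf \<alpha> \<beta>)) = 0"
proof -
  obtain a b c d where ab: "\<alpha> = (a, b)" "\<beta> = (c, d)" by (metis surj_pair)
  have *: "a < b" "c < d" using assms ab by (auto simp: I2_def)
  have si: "sup \<alpha> \<beta> = (max a c, max b d)" "inf \<alpha> \<beta> = (min a c, min b d)"
    by (simp_all add: ab sup_prod_def inf_prod_def sup_nat_def inf_nat_def)
  have "\<Phi> (a, b) * \<Phi> (c, d) = \<Phi> (max a c, max b d) * \<Phi> (min a c, min b d)"
  proof (cases "a \<le> c")
    case True
    then show ?thesis using \<Phi>_relation[of a c d b] * by (cases "b \<le> d") (simp_all add: max_def min_def mult.commute)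
  next
    case False
    then show ?thesis using \<Phi>_relation[of c a b d] * by (cases "d \<le> b") (simp_all add: max_def min_def mult.commute)
  qed
  then show ?thesis unfolding si by (simp add: \<phi>_simps \<phi>_X ab)
qed

lemma \<phi>_I: "x \<in> I \<Longrightarrow> \<phi> x = 0"
  unfolding I_def
proof (rule genideal_kernel[OF \<phi>_hom hibi_binomials_closed])
  fix x assume "x \<in> hibi_binomials"
  then show "\<phi> x = 0" unfolding hibi_binomials_def using \<phi>_binomial by blast
qed

lemma coeff_0_mult: "coeff (f * h) 0 = coeff f 0 * coeff h (0::nat)" for f h :: "'r::comm_ring_1 poly"
  by (simp add: coeff_mult)

lemma coeff_1_mult: "coeff (f * h) 1 = coeff f 0 * coeff h 1 + coeff f 1 * coeff h (0::nat)" for f h :: "'r::comm_ring_1 poly"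
  by (simp add: coeff_mult)

lemma coeff_0_prod: "coeff (\<Prod>j\<in>A. [:0, f j:]) 0 = (if A = {} then 1 else 0)" if "finite A" for f :: "nat \<Rightarrow> 'r::comm_ring_1"
  using that by (induction A rule: finite_induct) (auto simp: coeff_0_mult)

lemma block_cell:
  assumes "j \<le> g" "p j \<le> a" "a < b" "b \<le> l j"
  shows "row_block a = j" "col_block b = j" "crossed a b = {}"
proof -
  show "row_block a = j" using assms gap_less[of j "Suc j"] by (intro row_block_eq) auto
  have "l i < b" if "i < j" for i using gap_less[of i j] that assms by simp
  then show "col_block b = j" using assms by (intro col_block_eq) auto
  have False if "i \<le> g" "a < p i" "p i < b" for i
    using that assms p_mono[of i j] gap_less[of j i] by (cases "i \<le> j") auto
  then show "crossed a b = {}" by (auto simp: crossed_def)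
qed

lemma coeff_\<Phi>:
  assumes "(a, b) \<in> V"
  shows "coeff (\<Phi> (a, b)) 0 = Poly_Mapping.single 0 (P (a, b))"
proof (cases "\<exists>j\<le>g. p j \<le> a \<and> b \<le> l j")
  case True
  then obtain j where j: "j \<le> g" "p j \<le> a" "b \<le> l j" by blast
  have ab: "a < b" using assms by (simp add: I2_def)
  have "coeff (\<Phi> (a, b)) 0 = 1"
    using block_cell[OF j(1,2) ab j(3)] j ab
    by (simp add: \<Phi>_def row_factor_def col_factor_def Let_def coeff_0_mult)
  then show ?thesis using P[OF assms] True by simp
next
  case False
  have ab: "1 \<le> a" "a < b" "b \<le> n" using assms by (auto simp: I2_def)
  obtain j where j: "j \<le> g" "p j \<le> a" "a < p (Suc j)" using row_block_E[of a] ab by auto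
  obtain i where i: "i \<le> g" "b \<le> l i" "\<And>i'. i' < i \<Longrightarrow> l i' < b" using col_block_E[OF ab(3)] by blast
  have cb: "col_block b = i" by (rule col_block_eq[OF i])
  have "coeff (\<Phi> (a, b)) 0 = 0"
  \<comment> \<open>Outside the blocks a factor t always appears: either b lies in a block that
    begins beyond row a, whose gap is crossed, or b is itself a gap column.\<close>
  proof (cases "p i < b")
    case True
    have "\<not> p i \<le> a" using False i by blast
    moreover have "i \<noteq> 0" using calculation p_0 ab by (cases "i = 0") auto
    ultimately have "i \<in> crossed a b" using True i by (auto simp: crossed_def)
    then have "coeff (\<Prod>j\<in>crossed a b. [:0, u (Col (j - 1) (k (j - 1) + 4)):]) 0 = 0"
      by (subst coeff_0_prod) auto
    then show ?thesis by (simp only: \<Phi>_def prod.case coeff_0_mult mult_zero_right)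
  next
    case False
    then have "coeff (col_factor b) 0 = 0" using cb by (simp add: col_factor_def)
    then show ?thesis by (simp only: \<Phi>_def prod.case coeff_0_mult mult_zero_right mult_zero_left)
  qed
  then show ?thesis using P[OF assms] False by simp
qed

lemma \<phi>_0:
  assumes "x \<in> supported (monomials V)"
  shows "coeff (\<phi> x) 0 = Poly_Mapping.single 0 (mpolynomial_eval P x)"
proof -
  let ?s = "Poly_Mapping.single 0 :: 'k \<Rightarrow> (nat \<Rightarrow>\<^sub>0 real) \<Rightarrow>\<^sub>0 'k"
  have hom: "coefficient_hom (\<lambda>x. coeff (\<phi> x) 0)"
    unfolding coefficient_hom_def by (simp add: \<phi>_simps coeff_0_mult)
  have ev: "coefficient_hom (mpolynomial_eval P)"
    by (simp add: mpolynomial_eval_substitute substitute_hom)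
  have keys: "v \<in> V" if "mm \<in> Poly_Mapping.keys x" "v \<in> Poly_Mapping.keys mm" for mm v
    using assms that unfolding supported_def monomials_def by blast
  have "coeff (\<phi> x) 0 = substitute ?s (\<lambda>v. ?s (P v)) x"
  proof (rule substitute_eqI[OF coefficient_hom_single hom])
    fix mm v assume "mm \<in> Poly_Mapping.keys x" "v \<in> Poly_Mapping.keys mm"
    then have "v \<in> V" by (rule keys)
    then show "coeff (\<phi> (variable v)) 0 = ?s (P v)" using coeff_\<Phi> by (cases v) (simp add: \<phi>_X)
  qed (simp add: \<phi>_const)
  moreover have "?s (mpolynomial_eval P x) = substitute ?s (\<lambda>v. ?s (P v)) x"
    by (rule substitute_eqI[OF coefficient_hom_single coefficient_hom_comp[OF coefficient_hom_single ev]])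
       (simp_all add: mpolynomial_eval_substitute substitute_const substitute_variable)
  ultimately show ?thesis by simp
qed

sublocale affine_point V I P
proof (rule affine_point.intro)
  show "ideal I (polynomial_algebra V)" unfolding I_def by (rule ideal_genideal[OF hibi_binomials_closed])
  fix x assume x: "x \<in> I"
  interpret ideal I "polynomial_algebra V :: ('k, _) module"
    unfolding I_def by (rule ideal_genideal[OF hibi_binomials_closed])
  have "x \<in> supported (monomials V)" using Icarr[OF x] by (simp add: polynomial_algebra_eq)
  \<comment> \<open>That the point lies on the variety is read off \<open>\<phi>\<close>: it kills
    the ideal, and its constant coefficient is evaluation at the point.\<close>
  then have "Poly_Mapping.single 0 (mpolynomial_eval P x) = (0 :: (nat \<Rightarrow>\<^sub>0 real) \<Rightarrow>\<^sub>0 'k)"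
    using \<phi>_0[of x] \<phi>_I[OF x] by simp
  then show "mpolynomial_eval P x = 0" by (metis lookup_single_eq lookup_zero)
qed

subsection \<open>Generators of the tangent cone\<close>

text \<open>Places ladder \<open>j\<close> in the lattice. Index 1 stands for the whole block before
  the gap and is represented by its first row; index \<open>k j + 4\<close> stands for the whole
  block after it and is represented by its last column.\<close>

definition \<gamma> :: "nat \<Rightarrow> nat \<Rightarrow> nat" where
  "\<gamma> j i = (if i = 1 then p j else if i = k j + 4 then l (Suc j) else l j + i - 2)"

text \<open>In the last column of a block the linear coefficient of X - 1 would be the sum of a row
  and a column variable; subtracting the cell of the first row instead leaves the row variable
  alone.\<close>

definition elem :: "generator \<Rightarrow> (nat \<times> nat, 'k) mpolynomial" where
  "elem v = (case v of Inl (j, a, b) \<Rightarrow> Y (\<gamma> j a) (\<gamma> j b)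
     | Inr t \<Rightarrow> (case tor t of (a, b) \<Rightarrow> if a = p (row_block a) then Y a b - 1 else Y a b - Y (p (row_block a)) b))"

lemma \<gamma>_mono: "j < g \<Longrightarrow> 1 \<le> i \<Longrightarrow> i < i' \<Longrightarrow> i' \<le> k j + 4 \<Longrightarrow> \<gamma> j i < \<gamma> j i'"
  using block[of j] block[of "Suc j"] gap[of j] by (auto simp: \<gamma>_def)

lemma \<gamma>_bounds: "j < g \<Longrightarrow> 1 \<le> i \<Longrightarrow> i \<le> k j + 4 \<Longrightarrow> 1 \<le> \<gamma> j i \<and> \<gamma> j i \<le> n"
  using block[of j] block[of "Suc j"] gap[of j] p_pos[of j] l_le[of "Suc j"] by (auto simp: \<gamma>_def)

lemma tor_E:
  assumes "t < m" obtains j a b where "tor t = (a, b)" "j \<le> g" "p j \<le> a" "a < b" "b \<le> l j" "a = p j \<or> b = l j"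
    "index (a, b) = t"
proof -
  have "tor t \<in> {(a, b). \<exists>j\<le>g. p j \<le> a \<and> a < b \<and> b \<le> l j \<and> (a = p j \<or> b = l j)}"
    by (rule bij_betwE[OF tor, THEN bspec]) (simp add: assms)
  moreover have "index (tor t) = t" using tor assms by (intro bij_betw_inv_into_left) auto
  ultimately show thesis using that by (cases "tor t") auto
qed

lemma block_V: "j \<le> g \<Longrightarrow> p j \<le> a \<Longrightarrow> a < b \<Longrightarrow> b \<le> l j \<Longrightarrow> (a, b) \<in> V"
  using p_pos[of j] l_le[of j] by (auto simp: I2_def)

lemma elem_closed:
  assumes "v \<in> generators" shows "elem v \<in> C"
proof (cases v)
  case (Inl x)
  obtain j a b where x: "x = (j, a, b)" by (cases x)
  have "j < g" "1 \<le> a" "a < b" "b \<le> k j + 4" using assms by (auto simp: Inl x ladder_cells_iff)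
  then have "(\<gamma> j a, \<gamma> j b) \<in> V" using \<gamma>_mono[of j a b] \<gamma>_bounds[of j a] \<gamma>_bounds[of j b] by (auto simp: I2_def)
  then show ?thesis by (simp add: Inl x elem_def)
next
  case (Inr t)
  then have "t < m" using assms by simp
  then obtain j a b where t: "tor t = (a, b)" "j \<le> g" "p j \<le> a" "a < b" "b \<le> l j" by (rule tor_E)
  have rb: "row_block a = j" by (rule block_cell(1)[OF t(2-5)])
  have "(a, b) \<in> V" "(p j, b) \<in> V" using t by (auto intro: block_V)
  then show ?thesis by (simp add: Inr elem_def t(1) rb)
qed

sublocale ladder_elements g m k "monomials V" I elem
proof
  fix j a b c d assume *: "j < g" "(a, b) \<in> ladder_cells (k j)" "(c, d) \<in> ladder_cells (k j)" "a < c" "d < b"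
  then have "\<gamma> j a < \<gamma> j c" "\<gamma> j c < \<gamma> j d" "\<gamma> j d < \<gamma> j b" "1 \<le> \<gamma> j a" "\<gamma> j b \<le> n"
    using \<gamma>_bounds[of j a] \<gamma>_bounds[of j b] by (auto simp: ladder_cells_iff intro!: \<gamma>_mono)
  then show "elem (Inl (j, a, b)) * elem (Inl (j, c, d)) - elem (Inl (j, c, b)) * elem (Inl (j, a, d)) \<in> I"
    unfolding elem_def by (simp add: hibi_relation)
qed (rule elem_closed)

lemma row_factor_\<gamma>:
  assumes "j < g" "1 \<le> a" "a \<le> k j + 2"
  shows "row_factor (\<gamma> j a) = (if a = 1 then 1 else [:u (Row j a):])"
proof -
  have "\<gamma> j a < p (Suc j)" "p j \<le> \<gamma> j a" using assms block[of j] gap[of j] by (auto simp: \<gamma>_def)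
  then have rb: "row_block (\<gamma> j a) = j" using assms by (intro row_block_eq) auto
  show ?thesis
  proof (cases "a = 1")
    case True
    then show ?thesis using rb by (simp add: row_factor_def \<gamma>_def)
  next
    case False
    then have "2 \<le> a" using assms by simp
    then obtain a' where a': "a = 2 + a'" using le_Suc_ex by blast
    then have "\<gamma> j a = l j + a'" using assms by (simp add: \<gamma>_def)
    then show ?thesis using rb a' block[of j] assms by (simp add: row_factor_def)
  qed
qed

text \<open>Exactly one factor t occurs. For the last ladder column, which lies in the next block,
  it comes from the crossed gap; for every other column it comes from the column factor, and nothing
  is crossed.\<close>

lemma coeff_gap_cell:
  assumes "j < g" "(a, b) \<in> ladder_cells (k j)"
  shows "coeff (\<Phi> (\<gamma> j a, \<gamma> j b)) 0 = 0" "coeff (\<Phi> (\<gamma> j a, \<gamma> j b)) 1 = Poly_Mapping.single (\<nu> (Inl (j, a, b))) 1"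
proof -
  have ab: "1 \<le> a" "a < b" "a \<le> k j + 2" "3 \<le> b" "b \<le> k j + 4" using assms by (auto simp: ladder_cells_iff)
  have row: "row_factor (\<gamma> j a) = [:if a = 1 then 1 else u (Row j a):]"
    using row_factor_\<gamma>[of j a] assms ab by (simp add: pCons_one)
  have ge: "p j \<le> \<gamma> j a" "\<gamma> j a < p (Suc j)" using assms ab block[of j] gap[of j] by (auto simp: \<gamma>_def)
  have low: "l i < \<gamma> j b" if "i < Suc j" for i
  proof -
    have "l i \<le> l j" using that assms by (intro l_mono) auto
    moreover have "l j < \<gamma> j b" using assms ab gap[of j] block[of "Suc j"] by (auto simp: \<gamma>_def)
    ultimately show ?thesis by simp
  qed
  have cb: "col_block (\<gamma> j b) = Suc j"
    using assms ab gap[of j] block[of "Suc j"] low by (intro col_block_eq) (auto simp: \<gamma>_def)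
  have "\<exists>c. coeff (col_factor (\<gamma> j b) * (\<Prod>j\<in>crossed (\<gamma> j a) (\<gamma> j b). [:0, u (Col (j - 1) (k (j - 1) + 4)):])) 0 = 0 \<and>
    coeff (col_factor (\<gamma> j b) * (\<Prod>j\<in>crossed (\<gamma> j a) (\<gamma> j b). [:0, u (Col (j - 1) (k (j - 1) + 4)):])) 1 = u (Col j b)"
  proof (cases "b = k j + 4")
    case True
    have \<gamma>b: "\<gamma> j b = l (Suc j)" using True by (simp add: \<gamma>_def)
    have "crossed (\<gamma> j a) (\<gamma> j b) = {Suc j}"
    proof (intro equalityI subsetI)
      fix i assume i: "i \<in> crossed (\<gamma> j a) (\<gamma> j b)"
      then have "\<not> i \<le> j" using ge p_mono[of i j] assms by (auto simp: crossed_def)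
      moreover have "\<not> Suc j < i" using gap_less[of "Suc j" i] i \<gamma>b by (auto simp: crossed_def)
      ultimately show "i \<in> {Suc j}" by auto
    qed (use ge \<gamma>b block[of "Suc j"] assms in \<open>auto simp: crossed_def\<close>)
    moreover have "col_factor (\<gamma> j b) = [:1, u (Tor (index (p (Suc j), \<gamma> j b))):]"
      using cb \<gamma>b block[of "Suc j"] assms by (simp add: col_factor_def)
    ultimately show ?thesis using True by simp
  next
    case False
    then have \<gamma>b: "\<gamma> j b = l j + b - 2" "\<gamma> j b \<le> p (Suc j)" using ab assms gap[of j] by (auto simp: \<gamma>_def)
    have "crossed (\<gamma> j a) (\<gamma> j b) = {}"
    proof (rule equals0I)
      fix i assume i: "i \<in> crossed (\<gamma> j a) (\<gamma> j b)"
      then have "\<not> i \<le> j" using ge p_mono[of i j] assms by (auto simp: crossed_def)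
      then have "p (Suc j) \<le> p i" using i by (intro p_mono) (auto simp: crossed_def)
      then show False using i \<gamma>b by (auto simp: crossed_def)
    qed
    moreover have "col_factor (\<gamma> j b) = [:0, u (Col j b):]"
    proof -
      obtain b'' where b'': "b = 2 + b''" using le_Suc_ex[of 2 b] ab by auto
      then have "\<gamma> j b = l j + b''" using \<gamma>b(1) by simp
      then show ?thesis using cb \<gamma>b(2) b'' by (simp add: col_factor_def)
    qed
    ultimately show ?thesis by simp
  qed
  then have c: "coeff (col_factor (\<gamma> j b) * (\<Prod>j\<in>crossed (\<gamma> j a) (\<gamma> j b). [:0, u (Col (j - 1) (k (j - 1) + 4)):])) 0 = 0"
    "coeff (col_factor (\<gamma> j b) * (\<Prod>j\<in>crossed (\<gamma> j a) (\<gamma> j b). [:0, u (Col (j - 1) (k (j - 1) + 4)):])) 1 = u (Col j b)" by auto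
  show "coeff (\<Phi> (\<gamma> j a, \<gamma> j b)) 0 = 0"
    unfolding \<Phi>_def prod.case mult.assoc coeff_0_mult[of "row_factor _"] c by simp
  show "coeff (\<Phi> (\<gamma> j a, \<gamma> j b)) 1 = Poly_Mapping.single (\<nu> (Inl (j, a, b))) 1"
    unfolding \<Phi>_def prod.case mult.assoc coeff_1_mult[of "row_factor _"] c
    by (simp add: row \<nu>_simps mult_single)
qed

lemma coeff_elem:
  assumes "v \<in> generators"
  shows "coeff (\<phi> (elem v)) 0 = 0" "coeff (\<phi> (elem v)) 1 = Poly_Mapping.single (\<nu> v) 1"
proof -
  have "coeff (\<phi> (elem v)) 0 = 0 \<and> coeff (\<phi> (elem v)) 1 = Poly_Mapping.single (\<nu> v) 1"
  proof (cases v)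
    case (Inl x)
    obtain j a b where x: "x = (j, a, b)" by (cases x)
    then show ?thesis
      using coeff_gap_cell[of j a b] assms by (simp add: Inl x elem_def \<phi>_X)
  next
    case (Inr t)
    then have "t < m" using assms by simp
    then obtain j a b where t: "tor t = (a, b)" "j \<le> g" "p j \<le> a" "a < b" "b \<le> l j" "a = p j \<or> b = l j" "index (a, b) = t"
      by (rule tor_E)
    have bc: "row_block a = j" "col_block b = j" "crossed a b = {}" by (rule block_cell[OF t(2-5)])+
    show ?thesis
    proof (cases "a = p j")
      case True
      have "\<Phi> (a, b) = [:1, u (Tor t):]"
        using bc t True by (simp add: \<Phi>_def row_factor_def col_factor_def)
      then show ?thesis using True bc t by (simp add: Inr elem_def \<phi>_simps \<phi>_X \<nu>_simps)
    next
      case False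
      then have b: "b = l j" using t by simp
      have bc': "row_block (p j) = j" "crossed (p j) b = {}" using block_cell[of j "p j" b] t by auto
      have "\<Phi> (a, b) = [:1, u (Tor t):] * col_factor b" "\<Phi> (p j, b) = col_factor b"
        using bc bc' t b False by (simp_all add: \<Phi>_def row_factor_def)
      moreover have "coeff (col_factor b) 0 = 1"
        using bc block[OF t(2)] b by (simp add: col_factor_def)
      ultimately show ?thesis
        using False bc t by (simp add: Inr elem_def \<phi>_simps \<phi>_X \<nu>_simps coeff_0_mult coeff_1_mult[unfolded One_nat_def] del: mult_pCons_left)
    qed
  qed
  then show "coeff (\<phi> (elem v)) 0 = 0" "coeff (\<phi> (elem v)) 1 = Poly_Mapping.single (\<nu> v) 1" by auto
qed

lemma coeff_prod_elem:
  assumes "set_mset N \<subseteq> generators"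
  shows "(\<forall>i<size N. coeff (\<phi> (\<Prod>v\<in>#N. elem v)) i = 0) \<and> coeff (\<phi> (\<Prod>v\<in>#N. elem v)) (size N) = Poly_Mapping.single (\<nu>M N) 1"
  using assms
proof (induction N)
  case empty
  then show ?case by (simp add: \<phi>_simps)
next
  case (add v N)
  have v: "coeff (\<phi> (elem v)) 0 = 0" "coeff (\<phi> (elem v)) 1 = Poly_Mapping.single (\<nu> v) 1"
    using coeff_elem[of v] add.prems by auto
  obtain f where f: "\<phi> (elem v) = pCons 0 f" using v(1) by (metis coeff_pCons_0 pCons_cases)
  then have "coeff f 0 = Poly_Mapping.single (\<nu> v) 1" using v(2) by simp
  let ?q = "\<phi> (\<Prod>v\<in>#N. elem v)"
  have IH: "\<forall>i<size N. coeff ?q i = 0" "coeff ?q (size N) = Poly_Mapping.single (\<nu>M N) 1" using add by auto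
  have prod: "\<phi> (\<Prod>v\<in>#add_mset v N. elem v) = pCons 0 (f * ?q)"
    by (simp add: \<phi>_simps f)
  have low: "coeff (f * ?q) i = 0" if "i < size N" for i
    unfolding coeff_mult using IH(1) that by (intro sum.neutral) auto
  have "coeff (f * ?q) (size N) = (\<Sum>i\<le>size N. if i = 0 then coeff f 0 * coeff ?q (size N) else 0)"
    unfolding coeff_mult using IH(1) by (intro sum.cong refl) auto
  also have "\<dots> = coeff f 0 * coeff ?q (size N)" by simp
  finally have lead: "coeff (f * ?q) (size N) = Poly_Mapping.single (\<nu> v + \<nu>M N) 1"
    using IH(2) \<open>coeff f 0 = _\<close> by (simp add: mult_single)
  show ?case unfolding prod using low lead by (auto simp: coeff_pCons split: nat.split)
qed

subsection \<open>The cotangent space\<close>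

abbreviation "Xi0 \<equiv> lift (Poly_Mapping.single 0) monomial_element :: ((nat \<Rightarrow>\<^sub>0 real) \<Rightarrow>\<^sub>0 'k) \<Rightarrow> _"

text \<open>The class of \<open>x\<close> in the cotangent space lies in the span of the chosen
  elements.\<close>

definition lin :: "(nat \<times> nat, 'k) mpolynomial \<Rightarrow> bool" where
  "lin x \<longleftrightarrow> (\<exists>b. Poly_Mapping.keys b \<subseteq> {s \<in> S. deg s = 1} \<and> ideal_pow 2 (x - Xi0 b))"

lemma lin_add:
  assumes "lin x" "lin y" shows "lin (x + y)"
proof -
  obtain a where a: "Poly_Mapping.keys a \<subseteq> {s \<in> S. deg s = 1}" "ideal_pow 2 (x - Xi0 a)"
    using assms(1) unfolding lin_def by (elim exE conjE)
  obtain b where b: "Poly_Mapping.keys b \<subseteq> {s \<in> S. deg s = 1}" "ideal_pow 2 (y - Xi0 b)"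
    using assms(2) unfolding lin_def by (elim exE conjE)
  have eq: "x + y - Xi0 (a + b) = (x - Xi0 a) + (y - Xi0 b)" by (simp add: lift_add)
  have "ideal_pow 2 (x + y - Xi0 (a + b))" unfolding eq by (rule ideal_pow_add[OF a(2) b(2)])
  moreover have "Poly_Mapping.keys (a + b) \<subseteq> {s \<in> S. deg s = 1}"
    using Poly_Mapping.keys_add[of a b] a(1) b(1) by (meson Un_least order.trans)
  ultimately show ?thesis unfolding lin_def by (intro exI[of _ "a + b"] conjI)
qed

lemma lin_uminus:
  assumes "lin x" shows "lin (- x)"
proof -
  obtain a where a: "Poly_Mapping.keys a \<subseteq> {s \<in> S. deg s = 1}" "ideal_pow 2 (x - Xi0 a)"
    using assms unfolding lin_def by (elim exE conjE)
  have eq: "- x - Xi0 (- a) = - (x - Xi0 a)" by (simp add: lift_uminus)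
  have "ideal_pow 2 (- x - Xi0 (- a))" unfolding eq by (rule ideal_pow_uminus[OF a(2)])
  moreover have "Poly_Mapping.keys (- a) = Poly_Mapping.keys a" by (auto simp: in_keys_iff)
  ultimately show ?thesis using a(1) unfolding lin_def by (intro exI[of _ "- a"] conjI) simp_all
qed

lemma lin_diff: "lin x \<Longrightarrow> lin y \<Longrightarrow> lin (x - y)"
  using lin_add[of x "- y"] lin_uminus by simp

lemma lin_square: "ideal_pow 2 x \<Longrightarrow> lin x"
  unfolding lin_def by (intro exI[of _ 0]) simp

lemma lin_cong: "ideal_pow 2 (x - y) \<Longrightarrow> lin y \<Longrightarrow> lin x"
  using lin_add[OF lin_square, of "x - y" y] by simp

lemma lin_elem:
  assumes "v \<in> generators" shows "lin (elem v)"
proof -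
  have "elem v - monomial_element (\<nu> v) \<in> I" using prod_el_monomial_element[of "{#v#}"] assms by simp
  moreover have "deg (\<nu> v) = 1" using deg_\<nu>M[of "{#v#}"] assms by simp
  moreover have "Xi0 (Poly_Mapping.single (\<nu> v) 1) = monomial_element (\<nu> v)"
    by (simp add: lift_single)
  ultimately show ?thesis
    unfolding lin_def using \<nu>_S[OF assms] ideal_powI[of "elem v - monomial_element (\<nu> v)" 2]
    by (intro exI[of _ "Poly_Mapping.single (\<nu> v) 1"] conjI) (simp, simp only:)
qed

abbreviation "dY a b \<equiv> Y a b - Poly_Mapping.single 0 (P (a, b))"

lemma x_pow: "(a, b) \<in> V \<Longrightarrow> ideal_pow 1 (dY a b)"
  using ideal_pow_1[of "dY a b"] by (simp add: ev_simps)

lemma x_mult: "(a, b) \<in> V \<Longrightarrow> (c, d) \<in> V \<Longrightarrow> ideal_pow 2 (dY a b * dY c d)"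
  using ideal_pow_mult[OF x_pow x_pow] by (simp add: numeral_2_eq_2)

lemma pow_comb: "z \<in> I \<Longrightarrow> ideal_pow 2 y \<Longrightarrow> ideal_pow 2 y' \<Longrightarrow> ideal_pow 2 (z - y + y')"
  and pow_comb': "z \<in> I \<Longrightarrow> ideal_pow 2 y \<Longrightarrow> ideal_pow 2 y' \<Longrightarrow> ideal_pow 2 (y - y' - z)"
  by (rule ideal_pow_add[OF ideal_pow_diff[OF ideal_powI]]; assumption)
     (rule ideal_pow_diff[OF ideal_pow_diff ideal_powI]; assumption)

lemma x_block: "j \<le> g \<Longrightarrow> p j \<le> a \<Longrightarrow> a < b \<Longrightarrow> b \<le> l j \<Longrightarrow> dY a b = Y a b - 1"
  using P[OF block_V] by (auto simp: intro!: exI[of _ j])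

lemma x_outside: "(a, b) \<in> V \<Longrightarrow> \<not> (\<exists>j\<le>g. p j \<le> a \<and> b \<le> l j) \<Longrightarrow> dY a b = Y a b"
  using P[of a b] by simp

lemma lin_torus:
  assumes "j \<le> g" "p j \<le> a" "a < b" "b \<le> l j" "a = p j \<or> b = l j"
  shows "lin (dY a b)"
proof -
  have first: "lin (dY (p j) b)" if "p j < b" "b \<le> l j" for b
  proof -
    have "(p j, b) \<in> tor ` {..<m}" using tor that assms(1) by (auto simp: bij_betw_def)
    then obtain t where t: "t < m" "tor t = (p j, b)" by auto
    have "elem (Inr t) = dY (p j) b"
      using t block_cell(1)[OF assms(1) order.refl that] x_block[OF assms(1) order.refl that] by (simp add: elem_def)
    then show ?thesis using lin_elem[of "Inr t"] t by simp
  qed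
  show ?thesis
  proof (cases "a = p j")
    case False
    have "(a, b) \<in> tor ` {..<m}" using tor assms by (auto simp: bij_betw_def)
    then obtain t where t: "t < m" "tor t = (a, b)" by auto
    have "elem (Inr t) + dY (p j) b = dY a b"
      using t False block_cell(1)[OF assms(1-4)] x_block[OF assms(1-4)] x_block[OF assms(1) order.refl _ assms(4)] assms
      by (simp add: elem_def)
    then show ?thesis using lin_add[OF lin_elem[of "Inr t"] first[of b]] t assms by simp
  qed (use first assms in simp)
qed

text \<open>All four coordinates of the Hibi relation at the corners of the block are 1 at the
  point, so to first order the relation is additive: an interior increment is the sum of two border
  increments minus the one at the corner.\<close>

lemma lin_block:
  assumes "j \<le> g" "p j \<le> a" "a < b" "b \<le> l j"
  shows "lin (dY a b)"
proof (cases "a = p j \<or> b = l j")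
  case False
  then have ab: "p j < a" "b < l j" using assms by auto
  let ?p = "p j" and ?l = "l j"
  have V: "(?p, ?l) \<in> V" "(a, b) \<in> V" "(a, ?l) \<in> V" "(?p, b) \<in> V" using assms ab by (auto intro!: block_V[OF assms(1)])
  have "Y ?p ?l * Y a b - Y a ?l * Y ?p b \<in> I"
    using ab assms p_pos[of j] l_le[of j] by (intro hibi_relation) auto
  then have "ideal_pow 2 ((Y ?p ?l * Y a b - Y a ?l * Y ?p b) - dY ?p ?l * dY a b + dY a ?l * dY ?p b)"
    by (rule pow_comb) (rule x_mult; fact V)+
  moreover have "(Y ?p ?l * Y a b - Y a ?l * Y ?p b) - dY ?p ?l * dY a b + dY a ?l * dY ?p b = dY a b - (dY a ?l + dY ?p b - dY ?p ?l)"
    using assms ab by (simp add: x_block[OF assms(1)] algebra_simps)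
  ultimately have "ideal_pow 2 (dY a b - (dY a ?l + dY ?p b - dY ?p ?l))" by (simp only:)
  moreover have "lin (dY a ?l + dY ?p b - dY ?p ?l)"
    by (rule lin_diff[OF lin_add]; rule lin_torus[OF assms(1)]; use assms ab in linarith)
  ultimately show ?thesis by (rule lin_cong)
qed (use lin_torus assms in blast)

text \<open>Relations with coordinates that are 1 at the point move a to the first row of its block
  and b to the last column of its block, without change modulo \<mm>^2. The resulting corner spans
  one gap and is a ladder generator, or it spans several gaps and lies in \<mm>^2.\<close>

lemma lin_outside:
  assumes "(a, b) \<in> V" "\<not> (\<exists>j\<le>g. p j \<le> a \<and> b \<le> l j)"
  shows "lin (dY a b)"
proof -
  have ab: "1 \<le> a" "a < b" "b \<le> n" using assms by (auto simp: I2_def)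
  have out: "\<And>j. j \<le> g \<Longrightarrow> p j \<le> a \<Longrightarrow> l j < b" using assms(2) not_less by blast
  obtain j where j: "j \<le> g" "p j \<le> a" "a < p (Suc j)" using row_block_E[of a] ab by auto
  obtain i where i: "i \<le> g" "b \<le> l i" "\<And>i'. i' < i \<Longrightarrow> l i' < b" using col_block_E[OF ab(3)] by blast
  have ji: "j < i"
  proof (rule ccontr)
    assume "\<not> j < i"
    then have "l i \<le> l j" using j by (intro l_mono) auto
    then show False using out[OF j(1,2)] i by simp
  qed
  define a' where "a' = (if a < l j then p j else a)"
  define b' where "b' = (if p i < b then l i else b)"
  have a': "p j \<le> a'" "a' \<le> a" "a' = p j \<or> l j \<le> a'" using j by (auto simp: a'_def)
  have b': "b \<le> b'" "b' \<le> l i" using i by (auto simp: b'_def)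
  have bn: "b' \<le> n" using b' l_le[OF i(1)] by simp
  have a1: "1 \<le> a'" using a' p_pos[OF j(1)] by simp
  have V: "(c, d) \<in> V" if "1 \<le> c" "c < d" "d \<le> n" for c d using that by (simp add: I2_def)
  have out': "\<not> (\<exists>i'\<le>g. p i' \<le> c \<and> d \<le> l i')" if "c \<le> a" "b \<le> d" for c d
    using out that by (meson le_trans not_less)
  have row: "ideal_pow 2 (dY a b - dY a' b)"
  proof (cases "a < l j \<and> a \<noteq> p j")
    case True
    let ?p = "p j" and ?l = "l j"
    have lt: "?p < a" "a < ?l" "?l < b" using True j out[OF j(1,2)] by auto
    \<comment> \<open>The coordinates in column \<open>l j\<close> are 1 at the point, so to first
      order this relation equates the two outside coordinates.\<close>
    have "Y ?p b * Y a ?l - Y a b * Y ?p ?l \<in> I"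
      using lt ab p_pos[OF j(1)] by (intro hibi_relation) auto
    then have "ideal_pow 2 (dY ?p b * dY a ?l - dY a b * dY ?p ?l - (Y ?p b * Y a ?l - Y a b * Y ?p ?l))"
      by (rule pow_comb') (rule x_mult; rule V; use lt ab p_pos[OF j(1)] in linarith)+
    moreover have "dY ?p b * dY a ?l - dY a b * dY ?p ?l - (Y ?p b * Y a ?l - Y a b * Y ?p ?l) = dY a b - dY ?p b"
      using lt j ab p_pos[OF j(1)] out'[of a b] out'[of ?p b]
      by (simp add: x_block[OF j(1)] x_outside[OF V] algebra_simps)
    moreover have "a' = ?p" using True by (simp add: a'_def)
    ultimately show ?thesis by (simp only:)
  next
    case False
    then have "a' = a" by (auto simp: a'_def)
    then show ?thesis by (simp add: ideal_powI)
  qed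
  have col: "ideal_pow 2 (dY a' b - dY a' b')"
  proof (cases "p i < b \<and> b \<noteq> l i")
    case True
    let ?p = "p i" and ?l = "l i"
    have "a < ?p"
    proof -
      have "p (Suc j) \<le> p i" using ji i by (intro p_mono) auto
      then show ?thesis using j by simp
    qed
    then have lt: "a' < ?p" "?p < b" "b < ?l" using True i a' by auto
    have "Y a' ?l * Y ?p b - Y ?p ?l * Y a' b \<in> I"
      using lt a1 l_le[OF i(1)] by (intro hibi_relation) auto
    then have "ideal_pow 2 ((Y a' ?l * Y ?p b - Y ?p ?l * Y a' b) - dY a' ?l * dY ?p b + dY ?p ?l * dY a' b)"
      by (rule pow_comb) (rule x_mult; rule V; use lt a1 l_le[OF i(1)] in linarith)+
    moreover have "(Y a' ?l * Y ?p b - Y ?p ?l * Y a' b) - dY a' ?l * dY ?p b + dY ?p ?l * dY a' b = - (dY a' b - dY a' ?l)"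
      using lt a1 a' l_le[OF i(1)] out'[of a' b] out'[of a' ?l]
      by (simp add: x_block[OF i(1)] x_outside[OF V] algebra_simps)
    ultimately have "ideal_pow 2 (- (dY a' b - dY a' ?l))" by (simp only:)
    from ideal_pow_uminus[OF this] have "ideal_pow 2 (dY a' b - dY a' ?l)" by (simp only: group_add_class.minus_minus)
    moreover have "b' = ?l" using True by (simp add: b'_def)
    ultimately show ?thesis by (simp only:)
  next
    case False
    then have "b' = b" by (auto simp: b'_def)
    then show ?thesis by (simp add: ideal_powI)
  qed
  have corner: "lin (dY a' b')"
  proof (cases "i = Suc j")
    case True
    then have jg: "j < g" using i by simp
    have xX: "dY a' b' = Y a' b'" using a' b' a1 bn ab out'[of a' b'] by (intro x_outside V) auto
    \<comment> \<open>The inverse of \<open>\<gamma>\<close>: a row at the start of its block gets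
      index 1, and below the last column of the next block gets index
      \<open>k j + 4\<close>.\<close>
    define \<alpha> where "\<alpha> = (if a' = p j then 1 else a' - l j + 2)"
    define \<beta> where "\<beta> = (if b' = l i then k j + 4 else b' - l j + 2)"
    have pS: "p (Suc j) = l j + k j + 1" by (rule gap[OF jg])
    have lb: "l j < b" using i(3)[of j] True by simp
    have bl: "b' = l i \<or> (l j < b' \<and> b' \<le> p i)" using lb by (auto simp: b'_def)
    have pl: "p j < l j" "p i < l i" using block j i by auto
    have lt: "a' < b'" using a' b' ab by simp
    have 1: "\<gamma> j \<alpha> = a'" using a' pl pS j by (auto simp: \<gamma>_def \<alpha>_def)
    have 2: "\<gamma> j \<beta> = b'" using bl pl pS True by (auto simp: \<gamma>_def \<beta>_def)
    have "(\<alpha>, \<beta>) \<in> ladder_cells (k j)"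
      using a' bl pl pS True j lt by (auto simp: ladder_cells_iff \<alpha>_def \<beta>_def)
    then have "lin (elem (Inl (j, \<alpha>, \<beta>)))" using jg by (intro lin_elem) simp
    then show ?thesis by (simp add: elem_def 1 2 xX)
  next
    case False
    let ?p = "p (Suc j)" and ?l = "l (Suc j)"
    have Sj: "Suc j \<le> g" "Suc j < i" using ji i False by auto
    have lt: "a' < ?p" "?p < ?l" "?l < b'" using a' j block[OF Sj(1)] i(3)[OF Sj(2)] b' by auto
    have o1: "\<not> (\<exists>i'\<le>g. p i' \<le> a' \<and> ?l \<le> l i')"
    proof
      assume "\<exists>i'\<le>g. p i' \<le> a' \<and> ?l \<le> l i'"
      then obtain i' where i': "i' \<le> g" "p i' \<le> a'" "?l \<le> l i'" by blast
      have "i' \<le> j" using i' lt p_mono[of "Suc j" i'] by (metis le_trans not_less not_less_eq_eq le_SucI)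
      then have "l i' < ?p" using Sj by (intro gap_less) auto
      then show False using i' lt by simp
    qed
    have o2: "\<not> (\<exists>i'\<le>g. p i' \<le> ?p \<and> b' \<le> l i')"
    proof
      assume "\<exists>i'\<le>g. p i' \<le> ?p \<and> b' \<le> l i'"
      then obtain i' where i': "i' \<le> g" "p i' \<le> ?p" "b' \<le> l i'" by blast
      have "\<not> Suc j < i'" using gap_less[of "Suc j" i'] i' lt by auto
      then have "l i' \<le> ?l" using Sj by (intro l_mono) auto
      then show False using i' lt by simp
    qed
    \<comment> \<open>Block \<open>Suc j\<close> lies strictly between the two blocks. Its corner
      coordinate is 1 at the point, whereas both factors of the other product vanish there.\<close>
    have "Y a' b' * Y ?p ?l - Y ?p b' * Y a' ?l \<in> I"
      using lt a1 bn by (intro hibi_relation) auto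
    then have "ideal_pow 2 ((Y a' b' * Y ?p ?l - Y ?p b' * Y a' ?l) - dY a' b' * dY ?p ?l + dY ?p b' * dY a' ?l)"
      by (rule pow_comb) (rule x_mult; rule V; use lt a1 bn in linarith)+
    moreover have "(Y a' b' * Y ?p ?l - Y ?p b' * Y a' ?l) - dY a' b' * dY ?p ?l + dY ?p b' * dY a' ?l = dY a' b'"
      using lt a1 bn a' b' out'[of a' b'] o1 o2
      by (simp add: x_block[OF Sj(1)] x_outside[OF V] algebra_simps)
    ultimately show ?thesis by (intro lin_square) (simp only:)
  qed
  show ?thesis by (rule lin_cong[OF row lin_cong[OF col corner]])
qed

sublocale graded_model V I P \<phi> S deg monomial_element
proof
  show "\<phi> y = 0" if "y \<in> I" for y using that by (rule \<phi>_I)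
  fix s i assume s: "s \<in> S"
  then obtain N where N: "set_mset N \<subseteq> generators" "\<nu>M N = s" "monomial_element s = (\<Prod>v\<in>#N. elem v)"
    by (rule monomial_element_E)
  then have "deg s = size N" using deg_\<nu>M by blast
  then show "coeff (\<phi> (monomial_element s)) (deg s) = Poly_Mapping.single s 1"
    "i < deg s \<Longrightarrow> coeff (\<phi> (monomial_element s)) i = 0"
    using coeff_prod_elem[OF N(1)] N by auto
next
  show "\<exists>b. Poly_Mapping.keys b \<subseteq> {s \<in> S. deg s = 1} \<and>
      ideal_pow 2 (variable v - Poly_Mapping.single 0 (P v) - Xi0 b)" if v: "v \<in> V" for v
  proof -
    obtain a b where ab: "v = (a, b)" by (cases v)
    have "lin (dY a b)"
    proof (cases "\<exists>j\<le>g. p j \<le> a \<and> b \<le> l j")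
      case True
      then show ?thesis using lin_block v ab by (auto simp: I2_def)
    next
      case False
      then show ?thesis using lin_outside v ab by blast
    qed
    then show ?thesis unfolding lin_def ab by simp
  qed
qed (auto simp: \<phi>_hom \<phi>_0 additive_submonoid_S deg_add \<phi>_const monomial_element_closed monomial_element_0 monomial_element_add)

theorem algebra_isomorphic_tangent_cone: "algebra_isomorphic (tangent_cone (X2 n) P) (monoid_algebra S)"
proof (rule algebra_isomorphic_sym)
  show "algebra_isomorphic (monoid_algebra S) (tangent_cone (X2 n) P)"
    unfolding algebra_isomorphic_def X2_eq
    using graded_map_iso graded_map_smult by (intro bexI[of _ graded_map]) auto
  show "ring (monoid_algebra S :: ('k, _) module)"
    by (rule cring.axioms(1)[OF cring_monoid_algebra[OF additive_submonoid_S]])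
qed (simp add: additive_submonoid_S)

theorem multiplicity_at_block_point:
  assumes "g \<ge> 1"
  shows "multiplicity_at (X2 n) P = of_nat (\<Prod>j<g. card (maximal_chains (k j)))"
  unfolding multiplicity_at_def X2_eq
proof (rule graded_degree_S[where h = graded_map])
  have "3 \<le> (2 * k 0 + 3)" by simp
  also have "\<dots> \<le> (\<Sum>j<g. 2 * k j + 3)" using assms by (intro member_le_sum) auto
  finally show "1 \<le> ldim" by (simp add: ldim_def)
qed (use graded_map_iso graded_map_zero graded_map_smult graded_map_homogeneous in \<open>simp_all add: Sd_def\<close>)

end

section \<open>The codimension of the face\<close>

abbreviation basis :: "'b \<Rightarrow> ('b \<Rightarrow>\<^sub>0 real)" where
  "basis z \<equiv> Poly_Mapping.single z 1"

lemma independent_dual: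
  fixes b :: "'i \<Rightarrow> ('i \<Rightarrow>\<^sub>0 real)"
  assumes N: "finite N" and b: "\<And>x y. x \<in> N \<Longrightarrow> y \<in> N \<Longrightarrow> Poly_Mapping.lookup (b x) y = (if x = y then 1 else 0)"
  shows "\<not> real_vector.dependent (b ` N)" "card (b ` N) = card N"
proof -
  have inj: "inj_on b N"
  proof (rule inj_onI)
    fix x y assume "x \<in> N" "y \<in> N" "b x = b y"
    then have "Poly_Mapping.lookup (b y) x = 1" using b[of x x] by simp
    then show "x = y" using b[of y x] \<open>x \<in> N\<close> \<open>y \<in> N\<close> by (auto split: if_splits)
  qed
  then show "card (b ` N) = card N" by (rule card_image)
  show "\<not> real_vector.dependent (b ` N)"
  proof (rule real_vector.independent_if_scalars_zero)
    fix f w assume f: "(\<Sum>w\<in>b ` N. f w *\<^sub>R w) = 0" "w \<in> b ` N"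
    then obtain y where y: "y \<in> N" "w = b y" by blast
    have "0 = Poly_Mapping.lookup (\<Sum>x\<in>N. f (b x) *\<^sub>R b x) y"
      using f(1) by (simp add: sum.reindex[OF inj])
    also have "\<dots> = (\<Sum>x\<in>N. if x = y then f (b y) else 0)"
      unfolding lookup_sum lookup_scaleR_poly_mapping using y b by (intro sum.cong refl) auto
    also have "\<dots> = f w" using N y by simp
    finally show "f w = 0" by simp
  qed (use N in simp)
qed

lemma vectors_iff: "v \<in> vectors B \<longleftrightarrow> (\<forall>z. z \<notin> B \<longrightarrow> Poly_Mapping.lookup v z = 0)"
  unfolding vectors_def mem_Collect_eq subset_iff in_keys_iff by blast

lemma pairing_vectors:
  assumes "finite B" "u \<in> vectors B"
  shows "pairing u v = (\<Sum>z\<in>B. Poly_Mapping.lookup u z * Poly_Mapping.lookup v z)"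
  using assms by (intro pairing_superset) (auto simp: vectors_def)

text \<open>A pair (a, b) is the join of (1, b) and (a, a + 1), which leaves the first row and the
  diagonal.\<close>

lemma join_irreducibles_I2:
  "join_irreducibles (I2 n) = {(a, b). 1 \<le> a \<and> a < b \<and> b \<le> n \<and> (a = 1 \<or> b = a + 1)}"
proof (intro equalityI subsetI)
  fix z assume z: "z \<in> join_irreducibles (I2 n)"
  obtain a b where ab: "z = (a, b)" by (cases z)
  then have I: "1 \<le> a" "a < b" "b \<le> n" using z by (auto simp: join_irreducibles_def I2_def)
  then have "(1, b) \<in> I2 n" "(a, a + 1) \<in> I2 n" "z = sup (1, b) (a, a + 1)"
    by (auto simp: I2_def ab sup_prod_def sup_nat_def)
  then have "z = (1, b) \<or> z = (a, a + 1)" using z unfolding join_irreducibles_def by blast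
  then show "z \<in> {(a, b). 1 \<le> a \<and> a < b \<and> b \<le> n \<and> (a = 1 \<or> b = a + 1)}" using I ab by auto
next
  fix z assume "z \<in> {(a, b). 1 \<le> a \<and> a < b \<and> b \<le> n \<and> (a = 1 \<or> b = a + 1)}"
  then obtain a b where ab: "z = (a, b)" "1 \<le> a" "a < b" "b \<le> n" "a = 1 \<or> b = a + 1" by auto
  have "z = x \<or> z = y" if x: "x \<in> I2 n" and y: "y \<in> I2 n" and s: "z = sup x y" for x y
  proof -
    obtain x1 x2 y1 y2 where xy: "x = (x1, x2)" "y = (y1, y2)" by (metis surj_pair)
    have "1 \<le> x1" "x1 < x2" "1 \<le> y1" "y1 < y2" using x y by (auto simp: I2_def xy)
    moreover have "a = max x1 y1" "b = max x2 y2" using s by (simp_all add: ab xy sup_prod_def sup_nat_def)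
    ultimately show ?thesis using ab(5) unfolding ab xy by (auto simp: max_def split: if_splits)
  qed
  moreover have "z \<in> I2 n" using ab by (simp add: I2_def)
  ultimately show "z \<in> join_irreducibles (I2 n)" by (simp add: join_irreducibles_def)
qed

section \<open>The join-irreducibles of the lattice and the cone \<sigma>\<close>

context block_point
begin

abbreviation "J \<equiv> join_irreducibles (I2 n)"
abbreviation "F \<equiv> ideal_vector (I2 n)"

lemma J_iff: "(a, b) \<in> J \<longleftrightarrow> 1 \<le> a \<and> a < b \<and> b \<le> n \<and> (a = 1 \<or> b = a + 1)"
  by (auto simp: join_irreducibles_I2)

lemma finite_J [simp]: "finite J"
  by (rule finite_subset[of _ "{..n} \<times> {..n}"]) (auto simp: join_irreducibles_I2)

lemma n_ge: "2 \<le> n"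
  using block[of 0] p_0 l_le[of 0] by simp

lemma card_J: "card J + 3 = 2 * n"
proof -
  have J: "J = Pair 1 ` {2..n} \<union> (\<lambda>a. (a, a + 1)) ` {2..<n}"
    by (auto simp: join_irreducibles_I2 image_iff)
  have "card J = card (Pair (1::nat) ` {2..n}) + card ((\<lambda>a. (a, a + 1)) ` {2..<n})"
    unfolding J by (rule card_Un_disjoint) auto
  then show ?thesis using n_ge by (simp add: card_image inj_on_def)
qed

lemma lookup_F: "Poly_Mapping.lookup (F \<alpha>) z = (if z \<in> J \<and> z \<le> \<alpha> then 1 else 0)"
proof -
  have "Poly_Mapping.lookup (F \<alpha>) z = (\<Sum>y\<in>{z \<in> J. z \<le> \<alpha>}. if y = z then 1 else 0)"
    unfolding ideal_vector_def lookup_sum by (intro sum.cong refl) (simp add: lookup_single when_def)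
  then show ?thesis by simp
qed

lemma F_vectors: "F \<alpha> \<in> vectors J"
  by (simp add: vectors_iff lookup_F)

lemma pairing_diff_left:
  assumes "w1 \<in> vectors J" "w2 \<in> vectors J"
  shows "pairing (w1 - c *\<^sub>R w2) v = pairing w1 v - c * pairing w2 v" "w1 - c *\<^sub>R w2 \<in> vectors J"
proof -
  show *: "w1 - c *\<^sub>R w2 \<in> vectors J"
    using assms by (simp add: vectors_iff lookup_minus lookup_scaleR_poly_mapping)
  show "pairing (w1 - c *\<^sub>R w2) v = pairing w1 v - c * pairing w2 v"
    unfolding pairing_vectors[OF finite_J *] pairing_vectors[OF finite_J assms(1)] pairing_vectors[OF finite_J assms(2)]
    by (simp add: lookup_minus lookup_scaleR_poly_mapping algebra_simps sum_subtractf sum_distrib_left)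
qed

definition gens :: "((nat \<times> nat) \<Rightarrow>\<^sub>0 real) set" where
  "gens = {basis z | z. z \<in> J \<and> \<not> (\<exists>w\<in>J. z < w)} \<union> {basis y' - basis y | y y'. covers J y y'}"

lemma hibi_cone_eq: "hibi_cone (I2 n) = convex_cone hull gens"
  by (simp add: hibi_cone_def gens_def)

lemma dual_iff:
  "w \<in> dual_cone J (hibi_cone (I2 n)) \<longleftrightarrow> w \<in> vectors J \<and> (\<forall>z\<in>J. \<not> (\<exists>y\<in>J. z < y) \<longrightarrow> Poly_Mapping.lookup w z \<ge> 0) \<and>
    (\<forall>y y'. covers J y y' \<longrightarrow> Poly_Mapping.lookup w y \<le> Poly_Mapping.lookup w y')"
proof -
  have "(\<forall>v\<in>gens. pairing w v \<ge> 0) \<longleftrightarrow> (\<forall>z\<in>J. \<not> (\<exists>y\<in>J. z < y) \<longrightarrow> pairing w (basis z) \<ge> 0) \<and>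
    (\<forall>y y'. covers J y y' \<longrightarrow> pairing w (basis y' - basis y) \<ge> 0)"
    unfolding gens_def by fast
  then show ?thesis
    unfolding hibi_cone_eq dual_cone_hull mem_Collect_eq by (simp only: pairing_diff_right pairing_single_right le_diff_eq add_0)
qed

lemma cover_row: "1 \<le> b' \<Longrightarrow> Suc b' < n \<Longrightarrow> covers J (1, Suc (Suc b')) (1, Suc b')"
  unfolding covers_def less_le_not_le by (auto simp: J_iff)

lemma cover_diag: "2 \<le> a \<Longrightarrow> a + 2 \<le> n \<Longrightarrow> covers J (a + 1, a + 2) (a, a + 1)"
  unfolding covers_def less_le_not_le by (auto simp: J_iff)

lemma cover_rung: "2 \<le> a \<Longrightarrow> a + 1 \<le> n \<Longrightarrow> covers J (a, a + 1) (1, a + 1)"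
  unfolding covers_def less_le_not_le by (auto simp: J_iff)

lemma ne_emptyI: "x \<in> A \<Longrightarrow> A \<noteq> {}"
  by blast

text \<open>
  Subtracting a small multiple of the indicator of an upper level set of a functional on the cone
  gives another functional on the cone; hence faces are cut out by such indicators.
\<close>

lemma level_set:
  assumes w: "w \<in> dual_cone J (hibi_cone (I2 n))" and y: "y' \<in> J"
  shows "\<exists>\<alpha>\<in>I2 n. \<forall>z\<in>J. z \<le> \<alpha> \<longleftrightarrow> Poly_Mapping.lookup w z \<ge> Poly_Mapping.lookup w y'"
proof -
  let ?w = "Poly_Mapping.lookup w" and ?t = "Poly_Mapping.lookup w y'"
  have cov: "?w y \<le> ?w y'" if "covers J y y'" for y y' using w that unfolding dual_iff by blast
  have row: "?w (1, b + d) \<le> ?w (1, b)" if "2 \<le> b" "b + d \<le> n" for b d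
    using that
  proof (induction d)
    case (Suc d)
    have "?w (1, Suc (Suc (b + d - 1))) \<le> ?w (1, Suc (b + d - 1))"
      using Suc.prems by (intro cov cover_row) auto
    then show ?case using Suc by simp
  qed simp
  have diag: "?w (a + d, a + d + 1) \<le> ?w (a, a + 1)" if "2 \<le> a" "a + d + 1 \<le> n" for a d
    using that
  proof (induction d)
    case (Suc d)
    have "?w (a + d + 1, a + d + 2) \<le> ?w (a + d, a + d + 1)" using Suc.prems by (intro cov cover_diag) auto
    then show ?case using Suc by simp
  qed simp
  have rung: "?w (a, a + 1) \<le> ?w (1, a + 1)" if "2 \<le> a" "a + 1 \<le> n" for a
    using that by (intro cov cover_rung)
  let ?A = "{a. 2 \<le> a \<and> a < n \<and> ?w (a, a + 1) \<ge> ?t}" and ?B = "{b. 2 \<le> b \<and> b \<le> n \<and> ?w (1, b) \<ge> ?t}"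
  have finA: "finite (insert 1 ?A)" by (rule finite_subset[of _ "{..n}"]) (use n_ge in auto)
  have finB: "finite ?B" by (rule finite_subset[of _ "{..n}"]) auto
  have "2 \<in> ?B"
  proof -
    obtain a b where ab: "y' = (a, b)" "(a, b) \<in> J" using y by (cases y') auto
    have "?t \<le> ?w (1, b)" using ab rung[of a] by (cases "a = 1") (auto simp: J_iff)
    also have "\<dots> \<le> ?w (1, 2)"
    proof -
      have b: "2 + (b - 2) = b" "b \<le> n" using ab by (auto simp: J_iff)
      show ?thesis using row[of 2 "b - 2"] unfolding b(1) using b(2) by simp
    qed
    finally show ?thesis using n_ge by simp
  qed
  \<comment> \<open>The inserted 1 is the row to use when no diagonal element from (2, 3) on reaches
    the level.\<close>
  define a0 where "a0 = Max (insert 1 ?A)"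
  define b0 where "b0 = Max ?B"
  have a0: "a0 \<in> insert 1 ?A" unfolding a0_def by (rule Max_in[OF finA]) simp
  have b0: "b0 \<in> ?B" unfolding b0_def by (rule Max_in[OF finB]) (use \<open>2 \<in> ?B\<close> in blast)
  have B_iff: "?w (1, b) \<ge> ?t \<longleftrightarrow> b \<le> b0" if "2 \<le> b" "b \<le> n" for b
  proof
    assume "?w (1, b) \<ge> ?t"
    then show "b \<le> b0" unfolding b0_def using that by (intro Max_ge[OF finB]) simp
  next
    assume "b \<le> b0"
    then have "?w (1, b0) \<le> ?w (1, b)" using row[of b "b0 - b"] that b0 by simp
    then show "?w (1, b) \<ge> ?t" using b0 by simp
  qed
  have A_iff: "?w (a, a + 1) \<ge> ?t \<longleftrightarrow> a \<le> a0" if "2 \<le> a" "a < n" for a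
  proof
    assume "?w (a, a + 1) \<ge> ?t"
    then show "a \<le> a0" unfolding a0_def using that by (intro Max_ge[OF finA]) simp
  next
    assume a: "a \<le> a0"
    then have "?w (a0, a0 + 1) \<le> ?w (a, a + 1)" "?w (a0, a0 + 1) \<ge> ?t" using diag[of a "a0 - a"] that a0 by auto
    then show "?w (a, a + 1) \<ge> ?t" by simp
  qed
  have "a0 < b0"
  proof (cases "a0 = 1")
    case True
    then show ?thesis using b0 by simp
  next
    case False
    then have "2 \<le> a0" "a0 < n" "?w (a0, a0 + 1) \<ge> ?t" using a0 by auto
    then have "?w (1, a0 + 1) \<ge> ?t" using rung[of a0] by simp
    then show ?thesis using B_iff[of "a0 + 1"] \<open>2 \<le> a0\<close> \<open>a0 < n\<close> by simp
  qed
  then have "(a0, b0) \<in> I2 n" using a0 b0 by (auto simp: I2_def)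
  moreover have "z \<le> (a0, b0) \<longleftrightarrow> ?w z \<ge> ?t" if z: "z \<in> J" for z
  proof -
    obtain a b where ab: "z = (a, b)" by (cases z)
    have "1 \<le> a0" using a0 by auto
    show ?thesis
    proof (cases "a = 1")
      case True
      then show ?thesis using z B_iff[of b] \<open>1 \<le> a0\<close> by (auto simp: ab J_iff)
    next
      case False
      then have "b = a + 1" "2 \<le> a" "a < n" using z by (auto simp: ab J_iff)
      then show ?thesis using A_iff[of a] \<open>a0 < b0\<close> by (auto simp: ab)
    qed
  qed
  ultimately show ?thesis by blast
qed

lemma maximal_J:
  assumes "z \<in> J" "\<not> (\<exists>y\<in>J. z < y)" "n \<ge> 3" shows "z = (n - 1, n)"
proof -
  obtain a b where z: "z = (a, b)" by (cases z)
  have "(n - 1, n) \<in> J" using assms(3) by (auto simp: J_iff)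
  moreover have "z \<le> (n - 1, n)" using assms(1) by (auto simp: z J_iff)
  ultimately show ?thesis using assms(2) by (metis order_le_imp_less_or_eq)
qed

context
  fixes \<tau> :: "((nat \<times> nat) \<Rightarrow>\<^sub>0 real) set"
  assumes face: "hibi_face (I2 n) \<tau>" and P_eq: "P = face_point (I2 n) \<tau>"
begin

lemma tau_sub: "\<tau> \<subseteq> hibi_cone (I2 n)"
  using face by (auto simp: hibi_face_def cone_face_def)

lemma perp_iff:
  assumes "(a, b) \<in> I2 n"
  shows "(\<forall>v\<in>\<tau>. pairing (F (a, b)) v = 0) \<longleftrightarrow> (\<exists>j\<le>g. p j \<le> a \<and> b \<le> l j)"
proof -
  have "P (a, b) = (if F (a, b) \<in> perp J \<tau> then 1 else 0)" by (simp add: P_eq face_point_def)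
  moreover have "F (a, b) \<in> perp J \<tau> \<longleftrightarrow> (\<forall>v\<in>\<tau>. pairing (F (a, b)) v = 0)" using F_vectors by (simp add: perp_def)
  ultimately show ?thesis using P[OF assms] by (auto split: if_splits)
qed

text \<open>Suppose a functional w that cuts out the face drops from y' to y. Its upper level set at
  y' consists of the elements below some \<alpha>, and w minus a positive multiple of
  \<open>F \<alpha>\<close> is still nonnegative on the cone. So \<open>F \<alpha>\<close> vanishes
  on the face and \<alpha> lies in the support, yet it separates y' from y, against
  \<open>sep\<close>.\<close>

lemma edge_in_face:
  assumes cov: "covers J y y'"
    and sep: "\<And>a b. (a, b) \<in> I2 n \<Longrightarrow> \<exists>j\<le>g. p j \<le> a \<and> b \<le> l j \<Longrightarrow> y' \<le> (a, b) \<Longrightarrow> y \<le> (a, b)"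
  shows "basis y' - basis y \<in> \<tau>"
proof -
  obtain w where w: "w \<in> dual_cone J (hibi_cone (I2 n))" "\<tau> = {v \<in> hibi_cone (I2 n). pairing w v = 0}"
    using face unfolding hibi_face_def cone_face_def by blast
  let ?w = "Poly_Mapping.lookup w"
  have wv: "w \<in> vectors J" using w(1) by (simp add: dual_cone_def)
  have J: "y \<in> J" "y' \<in> J" "y' < y" using cov by (auto simp: covers_def)
  have le: "?w y \<le> ?w y'" using w(1) cov unfolding dual_iff by blast
  have "?w y = ?w y'"
  proof (rule ccontr)
    assume "?w y \<noteq> ?w y'"
    then have less: "?w y < ?w y'" using le by simp
    obtain \<alpha> where \<alpha>: "\<alpha> \<in> I2 n" "\<forall>z\<in>J. z \<le> \<alpha> \<longleftrightarrow> ?w z \<ge> ?w y'" using level_set[OF w(1) J(2)] by blast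
    obtain a b where ab: "\<alpha> = (a, b)" by (cases \<alpha>)
    have y\<alpha>: "y' \<le> \<alpha>" "\<not> y \<le> \<alpha>" using \<alpha>(2) J less by auto
    define s where "s = Max (?w ` {z \<in> J. \<not> z \<le> \<alpha>})"
    have fin: "finite (?w ` {z \<in> J. \<not> z \<le> \<alpha>})" by simp
    have s_ge: "?w z \<le> s" if "z \<in> J" "\<not> z \<le> \<alpha>" for z 
      unfolding s_def by (rule Max_ge[OF fin], rule imageI) (simp only: mem_Collect_eq that simp_thms)
    have "y \<in> {z \<in> J. \<not> z \<le> \<alpha>}" by (simp only: mem_Collect_eq J(1) y\<alpha>(2) simp_thms)
    then have "?w y \<in> ?w ` {z \<in> J. \<not> z \<le> \<alpha>}" by (rule imageI)
    then have "?w ` {z \<in> J. \<not> z \<le> \<alpha>} \<noteq> {}" by (rule ne_emptyI)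
    then have "s \<in> ?w ` {z \<in> J. \<not> z \<le> \<alpha>}" unfolding s_def by (rule Max_in[OF fin])
    then obtain z where "z \<in> J" "\<not> z \<le> \<alpha>" "s = ?w z" by (elim imageE CollectE conjE)
    moreover have "z \<le> \<alpha> \<longleftrightarrow> ?w y' \<le> ?w z" using \<alpha>(2) \<open>z \<in> J\<close> by (rule bspec)
    ultimately have s_less: "s < ?w y'" by simp
    \<comment> \<open>The drop of w from the level set to the largest value outside it: an amount
      that can be taken off the level set without breaking the order.\<close>
    define c where "c = ?w y' - s"
    have c: "c > 0" using s_less by (simp add: c_def)
    have n3: "n \<ge> 3"
    proof -
      obtain a1 b1 a2 b2 where "y = (a1, b1)" "y' = (a2, b2)" by (metis surj_pair)
      then show ?thesis using J by (auto simp: J_iff less_le_not_le)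
    qed
    have top: "\<not> z \<le> \<alpha>" if "z \<in> J" "\<not> (\<exists>x\<in>J. z < x)" for z
    proof
      assume "z \<le> \<alpha>"
      moreover have "y \<le> z" using maximal_J[OF that n3] J(1) by (cases y) (auto simp: J_iff)
      ultimately show False using y\<alpha> by (meson order.trans)
    qed
    have F_dual: "F \<alpha> \<in> dual_cone J (hibi_cone (I2 n))"
      unfolding dual_iff using F_vectors by (auto simp: lookup_F covers_def)
    have "w - c *\<^sub>R F \<alpha> \<in> dual_cone J (hibi_cone (I2 n))"
      unfolding dual_iff
    proof (intro conjI ballI allI impI)
      show "w - c *\<^sub>R F \<alpha> \<in> vectors J" by (rule pairing_diff_left(2)[OF wv F_vectors])
      fix z assume "z \<in> J" "\<not> (\<exists>x\<in>J. z < x)"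
      then show "0 \<le> Poly_Mapping.lookup (w - c *\<^sub>R F \<alpha>) z"
        using w(1) top[of z] unfolding dual_iff by (simp add: lookup_minus lookup_scaleR_poly_mapping lookup_F)
    next
      fix x x' assume x: "covers J x x'"
      have xJ: "x \<in> J" "x' \<in> J" "x' \<le> x" using x by (auto simp: covers_def)
      have xw: "?w x \<le> ?w x'" using w(1) x unfolding dual_iff by blast
      show "Poly_Mapping.lookup (w - c *\<^sub>R F \<alpha>) x \<le> Poly_Mapping.lookup (w - c *\<^sub>R F \<alpha>) x'"
      proof (cases "x' \<le> \<alpha> \<and> \<not> x \<le> \<alpha>")
        case True
        then have "?w x \<le> s" "?w x' \<ge> ?w y'" using s_ge \<alpha>(2) xJ by auto
        then show ?thesis using True xJ by (simp add: lookup_minus lookup_scaleR_poly_mapping lookup_F c_def)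
      next
        case False
        then have "x \<le> \<alpha> \<longleftrightarrow> x' \<le> \<alpha>" using xJ by (meson order.trans)
        then show ?thesis using xw xJ by (simp add: lookup_minus lookup_scaleR_poly_mapping lookup_F)
      qed
    qed
    then have "pairing (F \<alpha>) v = 0" if "v \<in> \<tau>" for v
    proof -
      have v: "v \<in> hibi_cone (I2 n)" "pairing w v = 0" using that w(2) by auto
      have "pairing (w - c *\<^sub>R F \<alpha>) v \<ge> 0" "pairing (F \<alpha>) v \<ge> 0"
        using \<open>w - c *\<^sub>R F \<alpha> \<in> _\<close> F_dual v by (auto simp: dual_cone_def)
      then have "c * pairing (F \<alpha>) v \<le> 0" using v pairing_diff_left(1)[OF wv F_vectors] by simp
      then show ?thesis using c \<open>pairing (F \<alpha>) v \<ge> 0\<close> by (simp add: mult_le_0_iff)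
    qed
    then have "\<exists>j\<le>g. p j \<le> a \<and> b \<le> l j" using perp_iff[of a b] \<alpha>(1) ab by blast
    then show False using sep[of a b] \<alpha>(1) y\<alpha> ab by blast
  qed
  then have "pairing w (basis y' - basis y) = 0" by (simp add: pairing_diff_right pairing_single_right)
  moreover have "basis y' - basis y \<in> hibi_cone (I2 n)"
    unfolding hibi_cone_eq gens_def using cov by (intro hull_inc) blast
  ultimately show ?thesis using w(2) by simp
qed

text \<open>The \<open>2 * k j + 4\<close> join-irreducibles that the edges of the face link
  together at gap \<open>j\<close>. Being connected, they contribute one dimension less than their
  number.\<close>

definition gap_part :: "nat \<Rightarrow> (nat \<times> nat) set" where
  "gap_part j = Pair 1 ` {l j + 1..p (Suc j) + 1} \<union> (\<lambda>a. (a, a + 1)) ` {l j..p (Suc j)}"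

abbreviation root :: "nat \<Rightarrow> nat \<times> nat" where
  "root j \<equiv> (1, l j + 1)"

lemma gap_facts:
  assumes "j < g"
  shows "2 \<le> l j" "p (Suc j) = l j + k j + 1" "p (Suc j) + 1 \<le> n"
  using block[of j] p_pos[of j] gap[OF assms] block[of "Suc j"] l_le[of "Suc j"] assms by auto

text \<open>No cell of the support has its column in a gap: such a column is too large for the
  blocks up to \<open>j\<close> and does not exceed the first row of any later block.\<close>

lemma gap_row_edge:
  assumes "j < g" "l j + 1 \<le> b" "b \<le> p (Suc j)"
  shows "basis (1, b) - basis (1, b + 1) \<in> \<tau>"
proof (rule edge_in_face)
  show "covers J (1, b + 1) (1, b)"
    using cover_row[of "b - 1"] assms gap_facts[OF assms(1)] by simp
  fix c d assume *: "(c, d) \<in> I2 n" "\<exists>i\<le>g. p i \<le> c \<and> d \<le> l i" "(1, b) \<le> (c, d)"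
  then obtain i where i: "i \<le> g" "p i \<le> c" "d \<le> l i" by blast
  have cd: "1 \<le> c" "c < d" "b \<le> d" using * by (auto simp: I2_def)
  have "d \<noteq> b"
  proof
    assume "d = b"
    have "\<not> i \<le> j" using l_mono[of i j] assms i \<open>d = b\<close> by auto
    then have "p (Suc j) \<le> p i" using i by (intro p_mono) auto
    then show False using i cd assms \<open>d = b\<close> by simp
  qed
  then show "(1, b + 1) \<le> (c, d)" using cd by simp
qed

text \<open>A cell of the support with column beyond \<open>l j\<close> belongs to a later block, so
  its row is at least \<open>p (Suc j)\<close>.\<close>

lemma gap_rung:
  assumes "j < g" "l j \<le> a" "a \<le> p (Suc j)"
  shows "basis (1, a + 1) - basis (a, a + 1) \<in> \<tau>"
proof (rule edge_in_face)
  show "covers J (a, a + 1) (1, a + 1)"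
    using cover_rung[of a] assms gap_facts[OF assms(1)] by simp
  fix c d assume *: "(c, d) \<in> I2 n" "\<exists>i\<le>g. p i \<le> c \<and> d \<le> l i" "(1, a + 1) \<le> (c, d)"
  then obtain i where i: "i \<le> g" "p i \<le> c" "d \<le> l i" by blast
  have cd: "1 \<le> c" "c < d" "a + 1 \<le> d" using * by (auto simp: I2_def)
  have "a \<le> c"
  proof (rule ccontr)
    assume "\<not> a \<le> c"
    then have "p i < p (Suc j)" using i assms by simp
    then have "i \<le> j" using p_mono[of "Suc j" i] i by (metis le_SucI not_less not_less_eq_eq)
    then have "l i \<le> l j" using assms by (intro l_mono) auto
    then show False using i cd assms by simp
  qed
  then show "(a, a + 1) \<le> (c, d)" using cd by simp
qed

lemma gap_part_span:
  assumes "j < g" "x \<in> gap_part j"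
  shows "basis x - basis (root j) \<in> real_vector.span \<tau>"
proof -
  have row: "basis (1, l j + 1 + d) - basis (root j) \<in> real_vector.span \<tau>" if "l j + 1 + d \<le> p (Suc j) + 1" for d
    using that
  proof (induction d)
    case 0
    show ?case using real_vector.span_zero by simp
  next
    case (Suc d)
    have "basis (1, l j + 1 + d) - basis (1, l j + 1 + d + 1) \<in> real_vector.span \<tau>"
      using Suc.prems by (intro real_vector.span_base gap_row_edge[OF assms(1)]) auto
    from real_vector.span_diff[OF Suc.IH this] Suc.prems show ?case by simp
  qed
  have row': "basis (1, b) - basis (root j) \<in> real_vector.span \<tau>" if "l j + 1 \<le> b" "b \<le> p (Suc j) + 1" for b
    using row[of "b - (l j + 1)"] that by simp
  have "basis (a, a + 1) - basis (root j) \<in> real_vector.span \<tau>" if "l j \<le> a" "a \<le> p (Suc j)" for a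
  proof -
    have "basis (1, a + 1) - basis (a, a + 1) \<in> real_vector.span \<tau>"
      using that by (intro real_vector.span_base gap_rung[OF assms(1)])
    from real_vector.span_diff[OF row'[of "a + 1"] this] that show ?thesis by simp
  qed
  then show ?thesis using assms(2) row' by (auto simp: gap_part_def)
qed

text \<open>
  The equations for the span of the face come from partial sums along the two chains of \<open>J\<close>: on the
  support they cancel, so a vector of the face lives on the gaps, with total weight zero on each gap.
\<close>

definition row_sum :: "((nat \<times> nat) \<Rightarrow>\<^sub>0 real) \<Rightarrow> nat \<Rightarrow> real" where
  "row_sum v b = (\<Sum>b'=2..b. Poly_Mapping.lookup v (1, b'))"

definition diag_sum :: "((nat \<times> nat) \<Rightarrow>\<^sub>0 real) \<Rightarrow> nat \<Rightarrow> real" where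
  "diag_sum v a = (\<Sum>a'=2..a. Poly_Mapping.lookup v (a', a' + 1))"

lemma pairing_F:
  assumes "(a, b) \<in> I2 n"
  shows "pairing (F (a, b)) v = row_sum v b + diag_sum v a"
proof -
  have ab: "1 \<le> a" "a < b" "b \<le> n" using assms by (auto simp: I2_def)
  have set: "{z \<in> J. z \<le> (a, b)} = Pair 1 ` {2..b} \<union> (\<lambda>a. (a, a + 1)) ` {2..a}"
    using ab by (auto simp: join_irreducibles_I2 image_iff)
  have "pairing (F (a, b)) v = (\<Sum>z\<in>J. if z \<le> (a, b) then Poly_Mapping.lookup v z else 0)"
    unfolding pairing_vectors[OF finite_J F_vectors] by (intro sum.cong refl) (simp add: lookup_F)
  also have "\<dots> = (\<Sum>z\<in>{z \<in> J. z \<le> (a, b)}. Poly_Mapping.lookup v z)"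
    by (rule sum.inter_filter[symmetric]) simp
  also have "\<dots> = (\<Sum>z\<in>Pair 1 ` {2..b}. Poly_Mapping.lookup v z) + (\<Sum>z\<in>(\<lambda>a. (a, a + 1)) ` {2..a}. Poly_Mapping.lookup v z)"
    unfolding set by (rule sum.union_disjoint) auto
  also have "\<dots> = row_sum v b + diag_sum v a"
    by (simp add: row_sum_def diag_sum_def sum.reindex inj_on_def)
  finally show ?thesis .
qed

context
  fixes v assumes v: "v \<in> \<tau>"
begin

lemma block_zero:
  assumes "j \<le> g" "p j \<le> a" "a < b" "b \<le> l j"
  shows "row_sum v b + diag_sum v a = 0"
  using perp_iff[OF block_V[OF assms]] pairing_F[OF block_V[OF assms]] assms v by metis

lemma row_step: "2 \<le> b \<Longrightarrow> Poly_Mapping.lookup v (1, b) = row_sum v b - row_sum v (b - 1)"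
  by (cases b) (simp_all add: row_sum_def)

lemma diag_step: "2 \<le> a \<Longrightarrow> Poly_Mapping.lookup v (a, a + 1) = diag_sum v a - diag_sum v (a - 1)"
  by (cases a) (simp_all add: diag_sum_def)

lemma tau_vectors: "v \<in> vectors J"
proof -
  have "real_vector.subspace (vectors J)"
    unfolding real_vector.subspace_def
    by (simp add: vectors_iff lookup_add lookup_scaleR_poly_mapping)
  then have "convex_cone (vectors J)"
    unfolding convex_cone_iff real_vector.subspace_def by blast
  moreover have "gens \<subseteq> vectors J"
    by (auto simp: gens_def vectors_def covers_def in_keys_iff lookup_minus lookup_single when_def split: if_splits)
  ultimately have "hibi_cone (I2 n) \<subseteq> vectors J" unfolding hibi_cone_eq by (intro hull_minimal)
  then show ?thesis using v tau_sub by blast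
qed

text \<open>Away from the gaps, two block equations that differ by one step of the row sum or of the
  diagonal sum force the corresponding coordinate to vanish. The coordinate (1, 2) vanishes by a
  single equation, as there is no smaller cell.\<close>

lemma support:
  assumes z: "Poly_Mapping.lookup v z \<noteq> 0"
  shows "\<exists>j<g. z \<in> gap_part j"
proof -
  have "z \<in> J" using tau_vectors z unfolding vectors_iff by blast
  then obtain a b where ab: "z = (a, b)" "1 \<le> a" "a < b" "b \<le> n" "a = 1 \<or> b = a + 1" by (cases z) (auto simp: J_iff)
  show ?thesis
  proof (cases "a = 1")
    case True
    obtain i where i: "i \<le> g" "b \<le> l i" "\<And>i'. i' < i \<Longrightarrow> l i' < b" using col_block_E[OF ab(4)] by blast
    have "b \<le> p i + 1 \<and> i \<noteq> 0"
    proof (rule ccontr)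
      assume *: "\<not> (b \<le> p i + 1 \<and> i \<noteq> 0)"
      have "row_sum v b = row_sum v (b - 1)"
      proof (cases "b \<le> p i + 1")
        case False
        have "row_sum v b + diag_sum v (p i) = 0" using False i by (intro block_zero[OF i(1)]) auto
        moreover have "row_sum v (b - 1) + diag_sum v (p i) = 0" using False i by (intro block_zero[OF i(1)]) auto
        ultimately show ?thesis by simp
      next
        case True
        then have "i = 0" using * by simp
        then have "b = 2" using True ab p_0 by simp
        moreover have "row_sum v 2 + diag_sum v 1 = 0"
          using i \<open>i = 0\<close> \<open>b = 2\<close> p_0 by (intro block_zero[of 0]) auto
        ultimately show ?thesis by (simp add: row_sum_def diag_sum_def)
      qed
      then show False using row_step[of b] z ab True by simp
    qed
    then obtain j where j: "i = Suc j" by (cases i) auto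
    then have "z \<in> gap_part j" using True ab(1) i(3)[of j] \<open>b \<le> p i + 1 \<and> i \<noteq> 0\<close> by (auto simp: gap_part_def)
    then show ?thesis using i(1) j by (intro exI[of _ j]) simp
  next
    case False
    then have b: "b = a + 1" "2 \<le> a" using ab by auto
    obtain j where j: "j \<le> g" "p j \<le> a" "a < p (Suc j)" using row_block_E[of a] ab by auto
    have "a = p j \<or> l j \<le> a"
    proof (rule ccontr)
      assume *: "\<not> (a = p j \<or> l j \<le> a)"
      have "row_sum v (l j) + diag_sum v a = 0" using * j by (intro block_zero[OF j(1)]) auto
      moreover have "row_sum v (l j) + diag_sum v (a - 1) = 0" using * j by (intro block_zero[OF j(1)]) auto
      ultimately show False using diag_step[OF b(2)] z ab(1) b(1) by simp
    qed
    then show ?thesis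
    proof
      assume a: "a = p j"
      then have "j \<noteq> 0" using b p_0 by (cases "j = 0") auto
      then obtain j' where j': "j = Suc j'" by (cases j) auto
      then have "z \<in> gap_part j'" using ab(1) b(1) a gap_less[of j' j] j(1) by (auto simp: gap_part_def)
      then show ?thesis using j(1) j' by (intro exI[of _ j']) simp
    next
      assume a: "l j \<le> a"
      have "j \<noteq> g" using a ab b l_g by auto
      moreover have "z \<in> gap_part j" using a j ab(1) b(1) by (auto simp: gap_part_def)
      ultimately show ?thesis using j(1) by (intro exI[of _ j]) simp
    qed
  qed
qed

text \<open>The sum telescopes to the difference of two block equations, those of the last diagonal
  cell of block \<open>j\<close> and of the first diagonal cell of the next block.\<close>

lemma gap_part_sum:
  assumes "j < g" shows "(\<Sum>x\<in>gap_part j. Poly_Mapping.lookup v x) = 0"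
proof -
  note gf = gap_facts[OF assms]
  have tele: "(\<Sum>b=Suc s..s + d. f b - f (b - 1)) = f (s + d) - f s" for f :: "nat \<Rightarrow> real" and s d
    by (induction d) auto
  have "(\<Sum>x\<in>gap_part j. Poly_Mapping.lookup v x) =
    (\<Sum>x\<in>Pair 1 ` {l j + 1..p (Suc j) + 1}. Poly_Mapping.lookup v x) + (\<Sum>x\<in>(\<lambda>a. (a, a + 1)) ` {l j..p (Suc j)}. Poly_Mapping.lookup v x)"
    unfolding gap_part_def using gf by (intro sum.union_disjoint) auto
  also have "\<dots> = (\<Sum>b=l j + 1..p (Suc j) + 1. Poly_Mapping.lookup v (1, b)) + (\<Sum>a=l j..p (Suc j). Poly_Mapping.lookup v (a, a + 1))"
    by (subst (1 2) sum.reindex) (simp_all add: inj_on_def)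
  also have "(\<Sum>b=l j + 1..p (Suc j) + 1. Poly_Mapping.lookup v (1, b)) = (\<Sum>b=Suc (l j)..l j + (k j + 2). row_sum v b - row_sum v (b - 1))"
    using gf by (intro sum.cong row_step) auto
  also have "\<dots> = row_sum v (p (Suc j) + 1) - row_sum v (l j)"
    unfolding tele using gf by (simp add: add.assoc)
  also have "(\<Sum>a=l j..p (Suc j). Poly_Mapping.lookup v (a, a + 1)) = (\<Sum>a=Suc (l j - 1)..(l j - 1) + (k j + 2). diag_sum v a - diag_sum v (a - 1))"
    using gf by (intro sum.cong diag_step) auto
  also have "\<dots> = diag_sum v (p (Suc j)) - diag_sum v (l j - 1)"
    unfolding tele using gf by simp
  also have "row_sum v (p (Suc j) + 1) - row_sum v (l j) + (diag_sum v (p (Suc j)) - diag_sum v (l j - 1)) = 0"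
  proof -
    have "row_sum v (p (Suc j) + 1) + diag_sum v (p (Suc j)) = 0"
      using assms block[of "Suc j"] by (intro block_zero[of "Suc j"]) auto
    moreover have "row_sum v (l j) + diag_sum v (l j - 1) = 0"
      using assms block[of j] by (intro block_zero[of j]) auto
    ultimately show ?thesis by simp
  qed
  finally show ?thesis .
qed

end

definition nonroots :: "(nat \<times> nat) set" where
  "nonroots = (\<Union>j<g. gap_part j - {root j})"

lemma finite_gap_part [simp]: "finite (gap_part j)"
  by (simp add: gap_part_def)

lemma gap_part_disjoint:
  assumes "i < g" "j < g" "x \<in> gap_part i" "x \<in> gap_part j" shows "i = j"
proof -
  have "i < g \<Longrightarrow> j < g \<Longrightarrow> i < j \<Longrightarrow> x \<in> gap_part i \<Longrightarrow> x \<in> gap_part j \<Longrightarrow> False" for i j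
  proof -
    assume *: "i < g" "j < g" "i < j" "x \<in> gap_part i" "x \<in> gap_part j"
    have "p (Suc i) < l (Suc i)" "l (Suc i) \<le> l j" using * by (auto intro!: block l_mono)
    then have "p (Suc i) < l j" by simp
    then show False using * gap_facts[OF *(1)] gap_facts[OF *(2)] by (auto simp: gap_part_def)
  qed
  then show ?thesis using assms by (metis linorder_neqE_nat)
qed

lemma root_mem: "j < g \<Longrightarrow> root j \<in> gap_part j"
  using gap_facts[of j] by (auto simp: gap_part_def)

lemma card_gap_part: "j < g \<Longrightarrow> card (gap_part j - {root j}) = 2 * k j + 3"
proof -
  assume j: "j < g"
  note gf = gap_facts[OF j]
  have "card (gap_part j) = card (Pair (1::nat) ` {l j + 1..p (Suc j) + 1}) + card ((\<lambda>a. (a, a + 1)) ` {l j..p (Suc j)})"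
    unfolding gap_part_def using gf by (intro card_Un_disjoint) auto
  also have "\<dots> = 2 * k j + 4" using gf by (simp add: card_image inj_on_def)
  finally show ?thesis using root_mem[OF j] by simp
qed

lemma card_nonroots: "card nonroots = (\<Sum>j<g. 2 * k j + 3)"
proof -
  have "card nonroots = (\<Sum>j<g. card (gap_part j - {root j}))"
    unfolding nonroots_def using gap_part_disjoint by (intro card_UN_disjoint) auto
  also have "\<dots> = (\<Sum>j<g. 2 * k j + 3)" by (intro sum.cong refl card_gap_part) simp
  finally show ?thesis .
qed

definition gap_index :: "nat \<times> nat \<Rightarrow> nat" where
  "gap_index x = (THE j. j < g \<and> x \<in> gap_part j)"

lemma gap_index_eq: "j < g \<Longrightarrow> x \<in> gap_part j \<Longrightarrow> gap_index x = j"
  unfolding gap_index_def using gap_part_disjoint by blast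

lemma nonroots_E:
  assumes "x \<in> nonroots" obtains j where "j < g" "x \<in> gap_part j" "x \<noteq> root j" "gap_index x = j"
  using assms gap_index_eq that by (auto simp: nonroots_def)

lemma root_not_nonroot: "j < g \<Longrightarrow> root j \<notin> nonroots"
proof
  assume j: "j < g" and "root j \<in> nonroots"
  then obtain i where i: "i < g" "root j \<in> gap_part i" "root j \<noteq> root i" by (auto simp: nonroots_def)
  then have "i = j" using gap_part_disjoint root_mem j by blast
  then show False using i by simp
qed

lemma finite_nonroots: "finite nonroots"
  by (simp add: nonroots_def)

definition edge :: "nat \<times> nat \<Rightarrow> ((nat \<times> nat) \<Rightarrow>\<^sub>0 real)" where
  "edge x = basis x - basis (root (gap_index x))"

lemma lookup_edge:
  assumes "x \<in> nonroots" "y \<in> nonroots"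
  shows "Poly_Mapping.lookup (edge x) y = (if x = y then 1 else 0)"
proof -
  obtain j where "j < g" "gap_index x = j" using assms(1) by (rule nonroots_E)
  then have "root (gap_index x) \<noteq> y" using root_not_nonroot assms(2) by blast
  then show ?thesis by (auto simp: edge_def lookup_minus lookup_single when_def)
qed

text \<open>A vector of the face lives on the gaps, and total weight zero on each gap fixes its
  coordinate at the root; so the remaining coordinates are its coefficients with respect to the
  edges.\<close>

lemma tau_in_span: "v \<in> \<tau> \<Longrightarrow> v = (\<Sum>x\<in>nonroots. Poly_Mapping.lookup v x *\<^sub>R edge x)"
proof (rule poly_mapping_eqI)
  fix y assume v: "v \<in> \<tau>"
  have rhs: "Poly_Mapping.lookup (\<Sum>x\<in>nonroots. Poly_Mapping.lookup v x *\<^sub>R edge x) y =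
    (\<Sum>x\<in>nonroots. Poly_Mapping.lookup v x * Poly_Mapping.lookup (edge x) y)"
    by (simp add: lookup_sum lookup_scaleR_poly_mapping)
  show "Poly_Mapping.lookup v y = Poly_Mapping.lookup (\<Sum>x\<in>nonroots. Poly_Mapping.lookup v x *\<^sub>R edge x) y"
  proof (cases "y \<in> nonroots")
    case True
    have "(\<Sum>x\<in>nonroots. Poly_Mapping.lookup v x * Poly_Mapping.lookup (edge x) y) =
      (\<Sum>x\<in>nonroots. if x = y then Poly_Mapping.lookup v y else 0)"
      using True by (intro sum.cong refl) (auto simp: lookup_edge)
    then show ?thesis unfolding rhs using True finite_nonroots by simp
  next
    case False
    have le: "Poly_Mapping.lookup (edge x) y = (if root (gap_index x) = y then - 1 else 0)" if "x \<in> nonroots" for x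
      using that False by (auto simp: edge_def lookup_minus lookup_single when_def)
    show ?thesis
    proof (cases "\<exists>j<g. y = root j")
      case True
      then obtain j where j: "j < g" "y = root j" by blast
      have root: "root (gap_index x) = y \<longleftrightarrow> x \<in> gap_part j" if x: "x \<in> nonroots" for x
      proof -
        obtain i where i: "i < g" "x \<in> gap_part i" "gap_index x = i" using x by (rule nonroots_E)
        have "root i = root j \<longleftrightarrow> i = j"
          using root_mem[OF i(1)] root_mem[OF j(1)] gap_part_disjoint[OF i(1) j(1)] by metis
        moreover have "x \<in> gap_part j \<longleftrightarrow> i = j" using gap_part_disjoint[OF i(1) j(1)] i by blast
        ultimately show ?thesis using i j by simp
      qed
      have "(\<Sum>x\<in>nonroots. Poly_Mapping.lookup v x * Poly_Mapping.lookup (edge x) y) =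
        (\<Sum>x\<in>nonroots. if x \<in> gap_part j then - Poly_Mapping.lookup v x else 0)"
        using le root by (intro sum.cong refl) auto
      also have "\<dots> = (\<Sum>x\<in>{x \<in> nonroots. x \<in> gap_part j}. - Poly_Mapping.lookup v x)"
        by (rule sum.inter_filter[symmetric]) (rule finite_nonroots)
      also have "{x \<in> nonroots. x \<in> gap_part j} = gap_part j - {root j}"
      proof (intro equalityI subsetI)
        fix x assume "x \<in> {x \<in> nonroots. x \<in> gap_part j}"
        then have x: "x \<in> nonroots" "x \<in> gap_part j" by simp_all
        then have "x \<noteq> root j" using root_not_nonroot[OF j(1)] by metis
        then show "x \<in> gap_part j - {root j}" using x(2) by simp
      next
        fix x assume x: "x \<in> gap_part j - {root j}"
        then have "x \<in> nonroots" unfolding nonroots_def using j(1) by (intro UN_I[of j]) simp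
        then show "x \<in> {x \<in> nonroots. x \<in> gap_part j}" using x by simp
      qed
      also have "(\<Sum>x\<in>gap_part j - {root j}. - Poly_Mapping.lookup v x) = Poly_Mapping.lookup v (root j)"
        using gap_part_sum[OF v j(1)] sum.remove[OF finite_gap_part root_mem[OF j(1)], of "Poly_Mapping.lookup v"]
        by (simp add: sum_negf)
      finally show ?thesis unfolding rhs using j by simp
    next
      case no_root: False
      have "Poly_Mapping.lookup v y = 0"
      proof (rule ccontr)
        assume "Poly_Mapping.lookup v y \<noteq> 0"
        then obtain j where "j < g" "y \<in> gap_part j" using support[OF v] by blast
        then show False using False no_root by (auto simp: nonroots_def)
      qed
      moreover have "Poly_Mapping.lookup (edge x) y = 0" if x: "x \<in> nonroots" for x
      proof -
        obtain j where "j < g" "gap_index x = j" using x by (rule nonroots_E)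
        then have "root (gap_index x) \<noteq> y" using no_root by auto
        then show ?thesis unfolding le[OF x] by (rule if_not_P)
      qed
      ultimately show ?thesis unfolding rhs by (simp add: sum.neutral)
    qed
  qed
qed

lemma dim_tau: "real_vector.dim \<tau> = (\<Sum>j<g. 2 * k j + 3)"
proof -
  have "real_vector.dim (real_vector.span \<tau>) = card nonroots"
  proof (rule real_vector.dim_unique)
    show "edge ` nonroots \<subseteq> real_vector.span \<tau>"
      using gap_part_span by (auto simp: edge_def elim!: nonroots_E)
    have "\<tau> \<subseteq> real_vector.span (edge ` nonroots)"
    proof
      fix v assume "v \<in> \<tau>"
      then show "v \<in> real_vector.span (edge ` nonroots)"
        by (subst tau_in_span) (assumption, intro real_vector.span_sum real_vector.span_scale real_vector.span_base imageI)
    qed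
    then show "real_vector.span \<tau> \<subseteq> real_vector.span (edge ` nonroots)"
      by (rule real_vector.span_minimal) (rule real_vector.subspace_span)
    show "\<not> real_vector.dependent (edge ` nonroots)" "card (edge ` nonroots) = card nonroots"
      by (rule independent_dual[OF finite_nonroots]; rule lookup_edge; assumption)+
  qed
  then show ?thesis by (simp add: real_vector.dim_span card_nonroots)
qed

end

text \<open>The maximal element gives one basis vector; adding the generators of the covers carries
  it down the diagonal, from there to the first row, and finally to (1, 2).\<close>

lemma dim_sigma:
  assumes n3: "n \<ge> 3"
  shows "real_vector.dim (hibi_cone (I2 n)) = card J"
proof -
  let ?\<sigma> = "hibi_cone (I2 n)"
  have gens: "gens \<subseteq> ?\<sigma>" unfolding hibi_cone_eq by (rule hull_subset)
  have cov: "basis y' - basis y \<in> real_vector.span ?\<sigma>" if "covers J y y'" for y y'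
    by (rule real_vector.span_base, rule subsetD[OF gens]) (use that in \<open>unfold gens_def, blast\<close>)
  have "(n - 1, n) \<in> J" using n3 by (auto simp: J_iff)
  moreover have "\<not> (\<exists>w\<in>J. (n - 1, n) < w)" by (auto simp: J_iff less_le_not_le)
  ultimately have "basis (n - 1, n) \<in> ?\<sigma>" using gens unfolding gens_def by blast
  then have top: "basis (n - 1, n) \<in> real_vector.span ?\<sigma>" by (rule real_vector.span_base)
  have diag: "basis (n - 1 - d, n - d) \<in> real_vector.span ?\<sigma>" if "d + 3 \<le> n" for d
    using that
  proof (induction d)
    case (Suc d)
    have "basis (n - 1 - Suc d, n - Suc d) - basis (n - 1 - d, n - d) \<in> real_vector.span ?\<sigma>"
    proof -
      have "covers J (n - 1 - Suc d + 1, n - 1 - Suc d + 2) (n - 1 - Suc d, n - 1 - Suc d + 1)"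
        using Suc.prems by (intro cover_diag) auto
      moreover have "n - 1 - Suc d + 1 = n - 1 - d" "n - 1 - Suc d + 2 = n - d" "n - 1 - Suc d + 1 = n - Suc d" using Suc.prems by auto
      ultimately show ?thesis by (intro cov) simp
    qed
    from real_vector.span_add[OF this Suc.IH] Suc.prems show ?case by simp
  qed (use top in simp)
  have diag': "basis (a, a + 1) \<in> real_vector.span ?\<sigma>" if "2 \<le> a" "a + 1 \<le> n" for a
  proof -
    have "n - 1 - (n - 1 - a) = a" "n - (n - 1 - a) = a + 1" using that by auto
    then show ?thesis using diag[of "n - 1 - a"] that by simp
  qed
  have row: "basis (1, a + 1) \<in> real_vector.span ?\<sigma>" if "2 \<le> a" "a + 1 \<le> n" for a
    using real_vector.span_add[OF cov[OF cover_rung[OF that]] diag'[OF that]] by simp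
  have "basis (1, 2) \<in> real_vector.span ?\<sigma>"
    using real_vector.span_add[OF cov[OF cover_row[of 1]] row[of 2]] n3 by (simp add: numeral_2_eq_2 numeral_3_eq_3)
  then have all: "basis z \<in> real_vector.span ?\<sigma>" if "z \<in> J" for z
  proof -
    obtain a b where z: "z = (a, b)" by (cases z)
    show ?thesis
    proof (cases "a = 1")
      case True
      show ?thesis
      proof (cases "b = 2")
        case False
        then show ?thesis using row[of "b - 1"] that True by (auto simp: z J_iff)
      qed (use \<open>basis (1, 2) \<in> _\<close> True z in simp)
    next
      case False
      then show ?thesis using diag'[of a] that by (auto simp: z J_iff)
    qed
  qed
  have "real_vector.dim (real_vector.span ?\<sigma>) = card J"
  proof (rule real_vector.dim_unique)
    show "basis ` J \<subseteq> real_vector.span ?\<sigma>" using all by blast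
    have base: "basis z \<in> real_vector.span (basis ` J)" if "z \<in> J" for z
      using that by (intro real_vector.span_base) simp
    have "gens \<subseteq> real_vector.span (basis ` J)"
      using base by (auto simp: gens_def covers_def intro!: real_vector.span_diff)
    moreover have "convex_cone (real_vector.span (basis ` J))"
      unfolding convex_cone_iff by (auto intro: real_vector.span_add real_vector.span_scale real_vector.span_zero)
    ultimately have "?\<sigma> \<subseteq> real_vector.span (basis ` J)" unfolding hibi_cone_eq by (rule hull_minimal)
    then show "real_vector.span ?\<sigma> \<subseteq> real_vector.span (basis ` J)"
      by (rule real_vector.span_minimal) (rule real_vector.subspace_span)
    show "\<not> real_vector.dependent (basis ` J)" "card (basis ` J) = card J"
      by (rule independent_dual[OF finite_J]; simp add: lookup_single when_def)+
  qed
  then show ?thesis by (simp add: real_vector.dim_span)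
qed

theorem cone_codim_eq:
  assumes "hibi_face (I2 n) \<tau>" "P = face_point (I2 n) \<tau>" "n \<ge> 3"
  shows "cone_codim (hibi_cone (I2 n)) \<tau> = 2 * n - 3 - (\<Sum>j<g. 2 * k j + 3)"
  using dim_tau[OF assms(1,2)] dim_sigma[OF assms(3)] card_J by (simp add: cone_codim_def)

end

section \<open>Products of affine schemes\<close>

lemma substitute_rename:
  fixes p :: "('v, 'k::field) mpolynomial"
  assumes "coefficient_hom h"
  shows "substitute h f (mpolynomial_rename g p) = substitute h (\<lambda>v. f (g v)) p"
proof (rule substitute_eqI[where \<psi> = "\<lambda>p. substitute h f (mpolynomial_rename g p)"])
  show "coefficient_hom (\<lambda>p. substitute h f (mpolynomial_rename g p))"
    unfolding mpolynomial_rename_substitute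
    by (rule coefficient_hom_comp[OF substitute_hom[OF assms] substitute_hom[OF coefficient_hom_single]])
qed (simp_all add: mpolynomial_rename_substitute substitute_const substitute_variable assms)

lemma rename_supported:
  assumes "p \<in> supported (monomials V)" "\<And>v. v \<in> V \<Longrightarrow> f v \<in> W"
  shows "mpolynomial_rename f p \<in> supported (monomials W)"
  unfolding mpolynomial_rename_def
proof (rule supported_sum)
  fix m assume "m \<in> Poly_Mapping.keys p"
  then have m: "Poly_Mapping.keys m \<subseteq> V" using assms(1) by (auto simp: supported_def monomials_def)
  have "Poly_Mapping.keys (\<Sum>v\<in>Poly_Mapping.keys m. Poly_Mapping.single (f v) (Poly_Mapping.lookup m v)) \<subseteq> W"
    by (rule order.trans[OF keys_sum]) (use m assms(2) in auto)
  then show "Poly_Mapping.single (\<Sum>v\<in>Poly_Mapping.keys m. Poly_Mapping.single (f v) (Poly_Mapping.lookup m v))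
      (Poly_Mapping.lookup p m) \<in> supported (monomials W)"
    by (intro supported_single) (simp add: monomials_def)
qed

definition subscheme :: "('v, 'k::field) affine_subscheme \<Rightarrow> bool" where
  "subscheme X \<longleftrightarrow> ideal (snd X) (polynomial_algebra (fst X))"

lemma subscheme_supported:
  assumes "subscheme X" shows "snd X \<subseteq> supported (monomials (fst X))"
proof -
  have "ideal (snd X) (monoid_algebra (monomials (fst X)))"
    using assms by (simp only: subscheme_def polynomial_algebra_eq)
  from additive_subgroup.a_subset[OF ideal.axioms(1)[OF this]] show ?thesis by simp
qed

lemma product_generators:
  fixes X :: "('v, 'k::field) affine_subscheme" and Y :: "('w, 'k) affine_subscheme"
  assumes "subscheme X" "subscheme Y"
  shows "mpolynomial_rename Inl ` snd X \<union> mpolynomial_rename Inr ` snd Y \<subseteq> supported (monomials (fst X <+> fst Y))"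
proof -
  have "mpolynomial_rename Inl p \<in> supported (monomials (fst X <+> fst Y))" if "p \<in> snd X" for p
    using subscheme_supported[OF assms(1)] that by (intro rename_supported[of p "fst X"]) auto
  moreover have "mpolynomial_rename Inr p \<in> supported (monomials (fst X <+> fst Y))" if "p \<in> snd Y" for p
    using subscheme_supported[OF assms(2)] that by (intro rename_supported[of p "fst Y"]) auto
  ultimately show ?thesis by (simp add: image_subset_iff)
qed

lemma fst_product [simp]: "fst (affine_product X Y) = fst X <+> fst Y"
  by (simp add: affine_product_def)

lemma subscheme_product:
  assumes "subscheme X" "subscheme Y" shows "subscheme (affine_product X Y)"
  using ideal_genideal[OF product_generators[OF assms]] by (simp add: subscheme_def affine_product_def)

lemma product_mem:
  assumes "subscheme X" "subscheme Y"
  shows "p \<in> snd X \<Longrightarrow> mpolynomial_rename Inl p \<in> snd (affine_product X Y)"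
    and "q \<in> snd Y \<Longrightarrow> mpolynomial_rename Inr q \<in> snd (affine_product X Y)"
  using product_generators[OF assms] by (simp_all add: affine_product_def genideal_mem)

lemma product_vanish:
  fixes h :: "'k::field \<Rightarrow> 'r::comm_ring_1"
  assumes X: "subscheme X" "subscheme Y" and h: "coefficient_hom h"
    and "\<And>p. p \<in> snd X \<Longrightarrow> substitute h (\<lambda>v. f (Inl v)) p = 0" "\<And>q. q \<in> snd Y \<Longrightarrow> substitute h (\<lambda>v. f (Inr v)) q = 0"
    and p: "p \<in> snd (affine_product X Y)"
  shows "substitute h f p = 0"
proof (rule genideal_kernel[OF substitute_hom[OF h] product_generators[OF X]])
  show "p \<in> genideal (polynomial_algebra (fst X <+> fst Y)) (mpolynomial_rename Inl ` snd X \<union> mpolynomial_rename Inr ` snd Y)"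
    using p by (simp add: affine_product_def)
  fix x assume "x \<in> mpolynomial_rename Inl ` snd X \<union> mpolynomial_rename Inr ` snd Y"
  then show "substitute h f x = 0" using assms(4,5) by (auto simp: substitute_rename[OF h])
qed

lemma subscheme_affine_space: "subscheme (affine_space m :: (nat, 'k::field) affine_subscheme)"
proof -
  interpret R: cring "monoid_algebra (monomials {..<m}) :: ('k, _) module" by (rule cring_monoid_algebra) simp
  show ?thesis using R.zeroideal by (simp add: subscheme_def affine_space_def polynomial_algebra_eq)
qed

section \<open>The ladder varieties as factors\<close>

lemma fst_Z2: "fst (Z2 (k + 4)) = ladder_cells k"
  by (simp add: Z2_def hibi_variety_def ladder_cells_def add.commute)

lemma Z2_generators:
  "{variable \<alpha> * variable \<beta> - variable (sup \<alpha> \<beta>) * variable (inf \<alpha> \<beta>) | \<alpha> \<beta>. \<alpha> \<in> ladder_cells k \<and> \<beta> \<in> ladder_cells k}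
    \<subseteq> supported (monomials (ladder_cells k))" (is "?G \<subseteq> _")
proof
  fix x assume "x \<in> ?G"
  then obtain \<alpha> \<beta> where x: "x = variable \<alpha> * variable \<beta> - variable (sup \<alpha> \<beta>) * variable (inf \<alpha> \<beta>)"
    and \<alpha>\<beta>: "\<alpha> \<in> ladder_cells k" "\<beta> \<in> ladder_cells k" by auto
  obtain a b c d where ab: "\<alpha> = (a, b)" "\<beta> = (c, d)" by (metis surj_pair)
  have "sup \<alpha> \<beta> \<in> ladder_cells k" "inf \<alpha> \<beta> \<in> ladder_cells k"
    using \<alpha>\<beta> unfolding ab by (auto simp: ladder_cells_iff sup_prod_def inf_prod_def sup_nat_def inf_nat_def)
  then show "x \<in> supported (monomials (ladder_cells k))" unfolding x using \<alpha>\<beta> by simp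
qed

lemma snd_Z2:
  "snd (Z2 (k + 4)) = genideal (polynomial_algebra (ladder_cells k))
    {variable \<alpha> * variable \<beta> - variable (sup \<alpha> \<beta>) * variable (inf \<alpha> \<beta>) | \<alpha> \<beta>. \<alpha> \<in> ladder_cells k \<and> \<beta> \<in> ladder_cells k}"
proof -
  have "I2 (k + 4) - {(1, 2), (k + 4 - 1, k + 4)} = ladder_cells k"
  proof -
    have "k + 4 - 1 = k + 3" by simp
    then show ?thesis by (simp only: ladder_cells_def)
  qed
  then show ?thesis unfolding Z2_def hibi_variety_def by simp
qed

lemma subscheme_Z2: "subscheme (Z2 (k + 4))"
  unfolding subscheme_def fst_Z2 snd_Z2 by (rule ideal_genideal[OF Z2_generators])

lemma Z2_relation:
  assumes "(a, b) \<in> ladder_cells k" "(c, d) \<in> ladder_cells k" "a < c" "d < b"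
  shows "variable (a, b) * variable (c, d) - variable (c, b) * variable (a, d) \<in> snd (Z2 (k + 4))"
proof -
  have "sup (a, b) (c, d) = (c, b)" "inf (a, b) (c, d) = (a, d)"
    using assms by (auto simp: sup_prod_def inf_prod_def sup_nat_def inf_nat_def)
  then show ?thesis unfolding snd_Z2 using assms(1,2)
    by (intro genideal_mem[OF Z2_generators] CollectI exI[of _ "(a, b)"] exI[of _ "(c, d)"]) simp
qed

lemma Z2_vanish:
  fixes h :: "'k::field \<Rightarrow> 'r::comm_ring_1"
  assumes h: "coefficient_hom h" and f: "\<And>a b c d. f (a, b) * f (c, d) = f (c, b) * f (a, d)"
    and p: "p \<in> snd (Z2 (k + 4))"
  shows "substitute h f p = 0"
proof (rule genideal_kernel[OF substitute_hom[OF h] Z2_generators _ p[unfolded snd_Z2]])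
  fix x :: "(nat \<times> nat, 'k) mpolynomial"
  assume "x \<in> {variable \<alpha> * variable \<beta> - variable (sup \<alpha> \<beta>) * variable (inf \<alpha> \<beta>) | \<alpha> \<beta>. \<alpha> \<in> ladder_cells k \<and> \<beta> \<in> ladder_cells k}"
  then obtain \<alpha> \<beta> where x: "x = variable \<alpha> * variable \<beta> - variable (sup \<alpha> \<beta>) * variable (inf \<alpha> \<beta>)" by auto
  obtain a b c d where ab: "\<alpha> = (a, b)" "\<beta> = (c, d)" by (metis surj_pair)
  have "f \<alpha> * f \<beta> = f (sup \<alpha> \<beta>) * f (inf \<alpha> \<beta>)"
  proof -
    have s: "sup (a, b) (c, d) = (max a c, max b d)" "inf (a, b) (c, d) = (min a c, min b d)"
      by (simp_all add: sup_prod_def inf_prod_def sup_nat_def inf_nat_def)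
    consider "a \<le> c" "b \<le> d" | "c \<le> a" "d \<le> b" | "a \<le> c" "d \<le> b" | "c \<le> a" "b \<le> d" by linarith
    then show ?thesis
    proof cases
      case 1
      then show ?thesis unfolding ab s by (simp only: max_absorb2 min_absorb1 mult.commute)
    next
      case 2
      then show ?thesis unfolding ab s by (simp only: max_absorb1 min_absorb2)
    next
      case 3
      then show ?thesis unfolding ab s by (simp only: max_absorb1 max_absorb2 min_absorb1 min_absorb2 f[of a b c d])
    next
      case 4
      then show ?thesis unfolding ab s by (simp only: max_absorb1 max_absorb2 min_absorb1 min_absorb2 f[of a b c d] mult.commute)
    qed
  qed
  then show "substitute h f x = 0"
    by (simp add: x coefficient_homD[OF substitute_hom[OF h]] substitute_variable[OF h])
qed

lemma rename_binomial:
  "mpolynomial_rename f (variable x * variable y - variable z * variable t) =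
    variable (f x) * variable (f y) - variable (f z) * variable (f t)"
  by (simp add: mpolynomial_rename_substitute coefficient_homD[OF substitute_hom] substitute_variable)

text \<open>Relations of a factor become relations of the product by renaming, and vanishing under
  the toric substitution can be tested on the factors. The affine space supplies the free
  generators.\<close>

theorem ladder_presentation_product:
  fixes m k1 k2 :: nat
  defines "X \<equiv> affine_product (Z2 (k1 + 4)) (affine_product (Z2 (k2 + 4)) (affine_space m)) :: (_, 'k::field) affine_subscheme"
  shows "ladder_presentation 2 m (\<lambda>j. if j = 0 then k1 else k2) (fst X) (snd X)
    (case_sum (\<lambda>c. Inl (0, c)) (case_sum (\<lambda>c. Inl (1, c)) Inr))"
    (is "ladder_presentation 2 m ?k _ _ ?\<beta>")
proof -
  interpret ladder_product 2 m ?k .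
  let ?W = "affine_product (Z2 (k2 + 4)) (affine_space m) :: (_, 'k) affine_subscheme"
  have W: "subscheme ?W" by (intro subscheme_product subscheme_Z2 subscheme_affine_space)
  have X: "subscheme X" unfolding X_def by (intro subscheme_product subscheme_Z2 W)
  have fst_X: "fst X = ladder_cells k1 <+> (ladder_cells k2 <+> {..<m})"
    by (simp add: X_def fst_Z2 affine_space_def)
  have inj: "inj_on ?\<beta> A" for A by (auto simp: inj_on_def split: sum.splits)
  have less2: "j < 2 \<longleftrightarrow> j = 0 \<or> j = 1" for j :: nat by linarith
  have "?\<beta> ` fst X = generators"
  proof (intro equalityI subsetI)
    fix v assume "v \<in> ?\<beta> ` fst X"
    then obtain w where "w \<in> fst X" "v = ?\<beta> w" by blast
    then show "v \<in> generators" by (auto simp: fst_X)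
  next
    fix v assume v: "v \<in> generators"
    show "v \<in> ?\<beta> ` fst X"
    proof (cases v)
      case (Inl jc)
      obtain j c where jc: "jc = (j, c)" by (cases jc)
      have j: "j = 0 \<and> c \<in> ladder_cells k1 \<or> j = 1 \<and> c \<in> ladder_cells k2"
        using v unfolding Inl jc generators_iff less2 by auto
      have "\<exists>w\<in>fst X. v = ?\<beta> w"
        using j
      proof
        assume "j = 0 \<and> c \<in> ladder_cells k1"
        then show ?thesis by (intro bexI[of _ "Inl c"]) (simp_all add: Inl jc fst_X InlI InrI)
      next
        assume "j = 1 \<and> c \<in> ladder_cells k2"
        then show ?thesis by (intro bexI[of _ "Inr (Inl c)"]) (simp_all add: Inl jc fst_X InlI InrI)
      qed
      then show ?thesis by (simp only: image_iff)
    next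
      case (Inr t)
      then have "\<exists>w\<in>fst X. v = ?\<beta> w" using v by (intro bexI[of _ "Inr (Inr t)"]) (simp_all add: Inr fst_X InrI)
      then show ?thesis by (simp only: image_iff)
    qed
  qed
  with inj have bij: "bij_betw ?\<beta> (fst X) generators" by (rule bij_betw_imageI)
  have inv0: "inv_into (fst X) ?\<beta> (Inl (0, c)) = Inl c" if "c \<in> ladder_cells k1" for c
    using that by (intro inv_into_f_eq inj) (simp_all add: fst_X InlI InrI)
  have inv1: "inv_into (fst X) ?\<beta> (Inl (1, c)) = Inr (Inl c)" if "c \<in> ladder_cells k2" for c
    using that by (intro inv_into_f_eq inj) (simp_all add: fst_X InlI InrI)
  show ?thesis
  proof (rule ladder_presentation.intro[OF bij])
    show "ideal (snd X) (polynomial_algebra (fst X))" using X by (simp only: subscheme_def)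
  next
    fix j a b c d
    assume j: "j < (2::nat)" and cells: "(a, b) \<in> ladder_cells (?k j)" "(c, d) \<in> ladder_cells (?k j)" and ac: "a < c" "d < b"
    have corners: "(c, b) \<in> ladder_cells (?k j)" "(a, d) \<in> ladder_cells (?k j)"
      using cells ac unfolding ladder_cells_iff by linarith+
    from j consider "j = 0" | "j = 1" by linarith
    then show "variable (inv_into (fst X) ?\<beta> (Inl (j, a, b))) * variable (inv_into (fst X) ?\<beta> (Inl (j, c, d))) -
      variable (inv_into (fst X) ?\<beta> (Inl (j, c, b))) * variable (inv_into (fst X) ?\<beta> (Inl (j, a, d))) \<in> snd X"
    proof cases
      case 1
      have cells0: "(a, b) \<in> ladder_cells k1" "(c, d) \<in> ladder_cells k1" "(c, b) \<in> ladder_cells k1" "(a, d) \<in> ladder_cells k1"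
        using cells corners 1 by simp_all
      show ?thesis
        using product_mem(1)[OF subscheme_Z2 W Z2_relation[OF cells0(1,2) ac], folded X_def]
        unfolding 1 inv0[OF cells0(1)] inv0[OF cells0(2)] inv0[OF cells0(3)] inv0[OF cells0(4)] rename_binomial .
    next
      case 2
      have cells1: "(a, b) \<in> ladder_cells k2" "(c, d) \<in> ladder_cells k2" "(c, b) \<in> ladder_cells k2" "(a, d) \<in> ladder_cells k2"
        using cells corners 2 by simp_all
      show ?thesis
        using product_mem(2)[OF subscheme_Z2[of k1] W product_mem(1)[OF subscheme_Z2 subscheme_affine_space Z2_relation[OF cells1(1,2) ac]], folded X_def]
        unfolding 2 inv1[OF cells1(1)] inv1[OF cells1(2)] inv1[OF cells1(3)] inv1[OF cells1(4)] rename_binomial .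
    qed
  next
    fix p assume p: "p \<in> snd X"
    have swap: "Poly_Mapping.single (\<nu> (Inl (j, a, b))) (1::'k) * Poly_Mapping.single (\<nu> (Inl (j, c, d))) 1 =
      Poly_Mapping.single (\<nu> (Inl (j, c, b))) 1 * Poly_Mapping.single (\<nu> (Inl (j, a, d))) 1" for j a b c d
      by (simp only: mult_single \<nu>_swap)
    show "substitute (Poly_Mapping.single 0) (\<lambda>w. Poly_Mapping.single (\<nu> (?\<beta> w)) (1::'k)) p = 0"
    proof (rule product_vanish[OF subscheme_Z2 W coefficient_hom_single _ _ p[unfolded X_def]])
      fix q :: "(nat \<times> nat, 'k) mpolynomial"
      assume "q \<in> snd (Z2 (k1 + 4))"
      then show "substitute (Poly_Mapping.single 0) (\<lambda>v. Poly_Mapping.single (\<nu> (?\<beta> (Inl v))) 1) q = 0"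
        by (intro Z2_vanish[OF coefficient_hom_single]) (simp_all only: sum.case swap)
    next
      fix q assume q: "q \<in> snd ?W"
      show "substitute (Poly_Mapping.single 0) (\<lambda>v. Poly_Mapping.single (\<nu> (?\<beta> (Inr v))) (1::'k)) q = 0"
      proof (rule product_vanish[OF subscheme_Z2 subscheme_affine_space coefficient_hom_single _ _ q])
        fix r :: "(nat \<times> nat, 'k) mpolynomial"
        assume "r \<in> snd (Z2 (k2 + 4))"
        then show "substitute (Poly_Mapping.single 0) (\<lambda>v. Poly_Mapping.single (\<nu> (?\<beta> (Inr (Inl v)))) 1) r = 0"
          by (intro Z2_vanish[OF coefficient_hom_single]) (simp_all only: sum.case swap)
      next
        fix r :: "(nat, 'k) mpolynomial"
        assume "r \<in> snd (affine_space m)"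
        then have "r = 0" by (simp add: affine_space_def)
        then show "substitute (Poly_Mapping.single 0) (\<lambda>v. Poly_Mapping.single (\<nu> (?\<beta> (Inr (Inr v)))) 1) r = 0"
          by (simp only: coefficient_homD[OF substitute_hom[OF coefficient_hom_single]])
      qed
    qed
  qed
qed

section \<open>The three points\<close>

abbreviation torus_cells :: "nat \<Rightarrow> (nat \<Rightarrow> nat) \<Rightarrow> (nat \<Rightarrow> nat) \<Rightarrow> (nat \<times> nat) set" where
  "torus_cells g p l \<equiv> {(a, b). \<exists>j\<le>g. p j \<le> a \<and> a < b \<and> b \<le> l j \<and> (a = p j \<or> b = l j)}"

lemma ex_block_point:
  assumes "p 0 = 1" "l g = n" "\<And>j. j \<le> g \<Longrightarrow> p j < l j" "\<And>j. j < g \<Longrightarrow> p (Suc j) = l j + k j + 1" "n < p (Suc g)"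
    and "\<And>a b. (a, b) \<in> I2 n \<Longrightarrow> P (a, b) = (if \<exists>j\<le>g. p j \<le> a \<and> b \<le> l j then 1 else 0)"
  shows "\<exists>tor. block_point g (card (torus_cells g p l)) k n p l tor P"
proof -
  have "torus_cells g p l \<subseteq> (\<Union>j\<le>g. {..l j} \<times> {..l j})"
  proof
    fix x assume x: "x \<in> torus_cells g p l"
    obtain a b where ab: "x = (a, b)" by (cases x)
    obtain j where "j \<le> g" "a < b" "b \<le> l j" using x unfolding ab by blast
    then show "x \<in> (\<Union>j\<le>g. {..l j} \<times> {..l j})" unfolding ab by (intro UN_I[of j]) simp_all
  qed
  then have "finite (torus_cells g p l)" by (rule finite_subset) auto
  then obtain tor where tor: "bij_betw tor {..<card (torus_cells g p l)} (torus_cells g p l)"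
    using ex_bij_betw_nat_finite unfolding atLeast0LessThan by blast
  have "block_point g (card (torus_cells g p l)) k n p l tor P"
    by (rule block_point.intro) (fact assms tor)+
  then show ?thesis by (rule exI[of _ tor])
qed

text \<open>The first row and the last column have y - x cells each and share the corner (x, y); the
  summand 1 avoids truncated subtraction.\<close>

lemma card_border:
  assumes "x < y"
  shows "card {(a, b). x \<le> a \<and> a < b \<and> b \<le> y \<and> (a = x \<or> b = y)} + 1 = 2 * (y - x)"
    "finite {(a, b). x \<le> a \<and> a < b \<and> b \<le> y \<and> (a = x \<or> b = y)}"
proof -
  have *: "{(a, b). x \<le> a \<and> a < b \<and> b \<le> y \<and> (a = x \<or> b = y)} = Pair x ` {x<..y} \<union> (\<lambda>a. (a, y)) ` {x<..<y}"
    using assms by (auto simp: image_iff)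
  have "card (Pair x ` {x<..y} \<union> (\<lambda>a. (a, y)) ` {x<..<y}) = card (Pair x ` {x<..y}) + card ((\<lambda>a. (a, y)) ` {x<..<y})"
    by (rule card_Un_disjoint) auto
  then show "card {(a, b). x \<le> a \<and> a < b \<and> b \<le> y \<and> (a = x \<or> b = y)} + 1 = 2 * (y - x)"
    unfolding * using assms by (simp add: card_image inj_on_def)
  show "finite {(a, b). x \<le> a \<and> a < b \<and> b \<le> y \<and> (a = x \<or> b = y)}" unfolding * by simp
qed

lemma ex_le_1: "(\<exists>j\<le>1. Q j) \<longleftrightarrow> Q 0 \<or> Q (1::nat)"
  by (metis One_nat_def le_0_eq le_SucE le_refl zero_le_one)

lemma ex_le_2: "(\<exists>j\<le>2. Q j) \<longleftrightarrow> Q 0 \<or> Q 1 \<or> Q (2::nat)"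
proof
  assume "\<exists>j\<le>2. Q j"
  then obtain j where j: "j \<le> 2" "Q j" by blast
  from j(1) have "j = 0 \<or> j = 1 \<or> j = 2" by linarith
  with j(2) show "Q 0 \<or> Q 1 \<or> Q 2" by blast
next
  assume "Q 0 \<or> Q 1 \<or> Q 2"
  then show "\<exists>j\<le>2. Q j" by (elim disjE) (rule exI, rule conjI[rotated], assumption, simp)+
qed

lemma face_point_value:
  "P = face_point L \<tau> \<Longrightarrow> \<alpha> \<in> L \<Longrightarrow> P \<alpha> = (if \<alpha> \<in> point_support L P then 1 else 0)"
  by (simp add: point_support_def face_point_def)

lemma I2_interval_iff:
  assumes "(a, b) \<in> I2 n" "y = x + 1" "w = z + 1"
  shows "(a, b) \<in> I2_interval n (x, y) (z, w) \<longleftrightarrow> x \<le> a \<and> b \<le> w"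
  using assms by (auto simp: I2_interval_def I2_def)

lemma one_gap_point:
  fixes P :: "nat \<times> nat \<Rightarrow> 'k::field"
  assumes "1 \<le> i" "i + k + 3 \<le> n" "P = face_point (I2 n) \<tau>"
    and supp: "point_support (I2 n) P = I2_interval n (1, 2) (i, i + 1) \<union> I2_interval n (i + k + 2, i + k + 3) (n - 1, n)"
  shows "multiplicity_at (X2 n) P = of_nat (card (maximal_chains k))"
proof -
  \<comment> \<open>The entry \<open>n + 1\<close> is the sentinel after the last block.\<close>
  let ?p = "nth [1, i + k + 2, n + 1]" and ?l = "nth [i + 1, n]"
  have "\<exists>tor. block_point 1 (card (torus_cells 1 ?p ?l)) (\<lambda>_. k) n ?p ?l tor P"
  proof (rule ex_block_point)
    fix a b assume ab: "(a, b) \<in> I2 n"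
    show "P (a, b) = (if \<exists>j\<le>1. ?p j \<le> a \<and> b \<le> ?l j then 1 else 0)"
    proof -
      have 1: "(a, b) \<in> I2_interval n (1, 2) (i, i + 1) \<longleftrightarrow> 1 \<le> a \<and> b \<le> i + 1"
        by (rule I2_interval_iff[OF ab]) simp_all
      have 2: "(a, b) \<in> I2_interval n (i + k + 2, i + k + 3) (n - 1, n) \<longleftrightarrow> i + k + 2 \<le> a \<and> b \<le> n"
        by (rule I2_interval_iff[OF ab]) (use assms(2) in simp_all)
      have nth: "?p 0 = 1" "?p 1 = i + k + 2" "?l 0 = i + 1" "?l 1 = n" by simp_all
      show ?thesis by (simp only: face_point_value[OF assms(3) ab] supp ex_le_1 Un_iff 1 2 nth)
    qed
  next
    fix j :: nat assume "j \<le> 1"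
    then have "j = 0 \<or> j = 1" by linarith
    then show "?p j < ?l j" using assms(1,2) by auto
  qed (use assms(1,2) in auto)
  then obtain tor where "block_point 1 (card (torus_cells 1 ?p ?l)) (\<lambda>_. k) n ?p ?l tor P" by blast
  from block_point.multiplicity_at_block_point[OF this] show ?thesis by simp
qed

theorem theorem7p17:
  fixes n i1 i2 k1 k2 :: nat
    and \<tau> \<tau>1 \<tau>2 :: "((nat \<times> nat) \<Rightarrow>\<^sub>0 real) set"
    and P P1 P2 :: "nat \<times> nat \<Rightarrow> 'k::alg_closed_field"
  assumes "i1 \<ge> 1" and "i1 + k1 + 1 < i2" and "i2 + k2 + 3 \<le> n"
    and "hibi_face (I2 n) \<tau>" and "hibi_face (I2 n) \<tau>1" and "hibi_face (I2 n) \<tau>2"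
    and "P = face_point (I2 n) \<tau>" and "P1 = face_point (I2 n) \<tau>1" and "P2 = face_point (I2 n) \<tau>2"
    and "point_support (I2 n) P =
           I2_interval n (1, 2) (i1, i1 + 1) \<union>
           I2_interval n (i1 + k1 + 2, i1 + k1 + 3) (i2, i2 + 1) \<union>
           I2_interval n (i2 + k2 + 2, i2 + k2 + 3) (n - 1, n)"
    and "point_support (I2 n) P1 =
           I2_interval n (1, 2) (i1, i1 + 1) \<union>
           I2_interval n (i1 + k1 + 2, i1 + k1 + 3) (n - 1, n)"
    and "point_support (I2 n) P2 =
           I2_interval n (1, 2) (i2, i2 + 1) \<union>
           I2_interval n (i2 + k2 + 2, i2 + k2 + 3) (n - 1, n)"
  shows "algebra_isomorphic
           (tangent_cone (X2 n) P)
           (coordinate_algebra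
             (affine_product (Z2 (k1 + 4))
               (affine_product (Z2 (k2 + 4))
                 (affine_space (cone_codim (hibi_cone (I2 n)) \<tau>))))) \<and>
         int (cone_codim (hibi_cone (I2 n)) \<tau>) = 2 * (int n - int k1 - int k2) - 9 \<and>
         affine_toric (tangent_cone (X2 n) P) \<and>
         multiplicity_at (X2 n) P = multiplicity_at (X2 n) P1 * multiplicity_at (X2 n) P2"
proof -
  \<comment> \<open>Three blocks and two gaps; the entry \<open>n + 1\<close> is again the
    sentinel.\<close>
  let ?p = "nth [1, i1 + k1 + 2, i2 + k2 + 2, n + 1]" and ?l = "nth [i1 + 1, i2 + 1, n]"
  let ?k = "\<lambda>j::nat. if j = 0 then k1 else k2"
  let ?codim = "cone_codim (hibi_cone (I2 n)) \<tau>"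
  define m where "m = card (torus_cells 2 ?p ?l)"
  have "\<exists>tor. block_point 2 m ?k n ?p ?l tor P"
    unfolding m_def
  proof (rule ex_block_point)
    fix a b assume ab: "(a, b) \<in> I2 n"
    show "P (a, b) = (if \<exists>j\<le>2. ?p j \<le> a \<and> b \<le> ?l j then 1 else 0)"
    proof -
      have 1: "(a, b) \<in> I2_interval n (1, 2) (i1, i1 + 1) \<longleftrightarrow> 1 \<le> a \<and> b \<le> i1 + 1"
        by (rule I2_interval_iff[OF ab]) simp_all
      have 2: "(a, b) \<in> I2_interval n (i1 + k1 + 2, i1 + k1 + 3) (i2, i2 + 1) \<longleftrightarrow> i1 + k1 + 2 \<le> a \<and> b \<le> i2 + 1"
        by (rule I2_interval_iff[OF ab]) simp_all
      have 3: "(a, b) \<in> I2_interval n (i2 + k2 + 2, i2 + k2 + 3) (n - 1, n) \<longleftrightarrow> i2 + k2 + 2 \<le> a \<and> b \<le> n"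
        by (rule I2_interval_iff[OF ab]) (use assms(3) in simp_all)
      have nth: "?p 0 = 1" "?p 1 = i1 + k1 + 2" "?p 2 = i2 + k2 + 2" "?l 0 = i1 + 1" "?l 1 = i2 + 1" "?l 2 = n" by simp_all
      show ?thesis by (simp only: face_point_value[OF assms(7) ab] assms(10) ex_le_2 Un_iff disj_assoc 1 2 3 nth)
    qed
  next
    fix j :: nat assume "j \<le> 2"
    then have "j = 0 \<or> j = 1 \<or> j = 2" by linarith
    then show "?p j < ?l j" using assms(1-3) by auto
  next
    fix j :: nat assume "j < 2"
    then have "j = 0 \<or> j = 1" by linarith
    then show "?p (Suc j) = ?l j + ?k j + 1" by auto
  qed (use assms(1-3) in auto)
  then obtain tor where bp: "block_point 2 m ?k n ?p ?l tor P" by blast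
  have two: "{..<2} = {0, 1::nat}" by auto
  have "?codim = 2 * n - 3 - (\<Sum>j<2. 2 * ?k j + 3)"
    using block_point.cone_codim_eq[OF bp assms(4,7)] assms(1-3) by simp
  then have codim: "?codim + (9 + 2 * k1 + 2 * k2) = 2 * n" unfolding two using assms(1-3) by simp
  \<comment> \<open>The three borders have 2 i1 - 1, 2 (i2 - i1 - k1 - 1) - 1 and 2 (n - i2 - k2 -
    2) - 1 cells, in total 2 (n - k1 - k2) - 9.\<close>
  have "m = ?codim"
  proof -
    let ?B = "\<lambda>x y. {(a, b). x \<le> a \<and> a < b \<and> b \<le> y \<and> (a = x \<or> b = y)} :: (nat \<times> nat) set"
    have less: "1 < i1 + 1" "i1 + k1 + 2 < i2 + 1" "i2 + k2 + 2 < n" using assms(1-3) by linarith+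
    have "torus_cells 2 ?p ?l = ?B 1 (i1 + 1) \<union> (?B (i1 + k1 + 2) (i2 + 1) \<union> ?B (i2 + k2 + 2) n)"
    proof (rule Set.set_eqI)
      fix x :: "nat \<times> nat"
      obtain a b where x: "x = (a, b)" by (cases x)
      have nth: "?p 0 = 1" "?p 1 = i1 + k1 + 2" "?p 2 = i2 + k2 + 2" "?l 0 = i1 + 1" "?l 1 = i2 + 1" "?l 2 = n" by simp_all
      show "x \<in> torus_cells 2 ?p ?l \<longleftrightarrow> x \<in> ?B 1 (i1 + 1) \<union> (?B (i1 + k1 + 2) (i2 + 1) \<union> ?B (i2 + k2 + 2) n)"
        unfolding x by (simp only: mem_Collect_eq case_prod_conv Un_iff ex_le_2 nth)
    qed
    moreover have "card (?B 1 (i1 + 1) \<union> (?B (i1 + k1 + 2) (i2 + 1) \<union> ?B (i2 + k2 + 2) n)) =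
      card (?B 1 (i1 + 1)) + card (?B (i1 + k1 + 2) (i2 + 1) \<union> ?B (i2 + k2 + 2) n)"
      using less by (intro card_Un_disjoint finite_UnI card_border) auto
    moreover have "card (?B (i1 + k1 + 2) (i2 + 1) \<union> ?B (i2 + k2 + 2) n) = card (?B (i1 + k1 + 2) (i2 + 1)) + card (?B (i2 + k2 + 2) n)"
      using less by (intro card_Un_disjoint finite_UnI card_border) auto
    ultimately have "m = card (?B 1 (i1 + 1)) + (card (?B (i1 + k1 + 2) (i2 + 1)) + card (?B (i2 + k2 + 2) n))"
      unfolding m_def by (simp only:)
    then show ?thesis
      using card_border(1)[OF less(1)] card_border(1)[OF less(2)] card_border(1)[OF less(3)] codim less by linarith
  qed
  let ?X = "affine_product (Z2 (k1 + 4)) (affine_product (Z2 (k2 + 4)) (affine_space m)) :: (_, 'k) affine_subscheme"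
  note cone_iso = block_point.algebra_isomorphic_tangent_cone[OF bp]
  have "algebra_isomorphic (tangent_cone (X2 n) P) (coordinate_algebra (fst ?X, snd ?X))"
    by (rule algebra_isomorphic_trans[OF cone_iso ladder_presentation.algebra_isomorphic_S[OF ladder_presentation_product]])
  moreover have "affine_toric (tangent_cone (X2 n) P)"
    by (rule ladder_product.affine_toric_S[OF cone_iso])
  moreover have "int ?codim = 2 * (int n - int k1 - int k2) - 9"
    using arg_cong[OF codim, of int] by simp
  moreover have "multiplicity_at (X2 n) P = multiplicity_at (X2 n) P1 * multiplicity_at (X2 n) P2"
  proof -
    have "multiplicity_at (X2 n) P1 = of_nat (card (maximal_chains k1))"
      using assms(1-3) by (intro one_gap_point[OF assms(1) _ assms(8,11)]) linarith
    moreover have "multiplicity_at (X2 n) P2 = of_nat (card (maximal_chains k2))"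
      using assms(1-3) by (intro one_gap_point[OF _ _ assms(9,12)]) linarith+
    moreover have "multiplicity_at (X2 n) P = of_nat (\<Prod>j<2. card (maximal_chains (?k j)))"
      by (rule block_point.multiplicity_at_block_point[OF bp]) simp
    ultimately show ?thesis unfolding two by simp
  qed
  ultimately show ?thesis unfolding \<open>m = ?codim\<close> prod.collapse by blast
qed

end
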